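(* For $m\ge0$ let $\phi_m(r)=(r^2+m^2)^{1/2}$. Let $d\ge3$, $m\ge0$, and for real $s$ put $$w(r)=(1+r^2)^{-s/2},\qquad \psi(r)=\phi_m(r)^{-1/2}(1+r^2)^{1/4}.$$ If $s\ge2$, then the smoothing estimate for the Dirac equation holds, i.e. $\widetilde C_d(w,\psi,m)<\infty$. The range $s\ge2$ is sharp, i.e. the estimate fails ($\widetilde C_d(w,\psi,m)=\infty$) when $s<2$. Furthermore, for $s=2$: when $d=3$, $$\pi\le\widetilde C_3\big((1+r^2)^{-1},\,\phi_m(r)^{-1/2}(1+r^2)^{1/4},\,m\big)\le2\pi,$$ and when $d\ge5$, $$\widetilde C_d\big((1+r^2)^{-1},\,\phi_m(r)^{-1/2}(1+r^2)^{1/4},\,m\big)\le\pi .$$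
   Context: Fourier transform: $\hat f(\xi)=\int_{\mathbb R^d}f(x)e^{-ix\cdot\xi}\,dx$; for a function $\psi$ on $(0,\infty)$, $\psi(|D|)$ is the Fourier multiplier with symbol $\psi(|\xi|)$; $D_j$ is the Fourier multiplier with symbol $\xi_j$. Let $N=2^{\lfloor(d+1)/2\rfloor}$ and $H_m=\sum_{j=1}^d\alpha_jD_j+m\beta$, acting on $\mathbb C^N$-valued functions, where $\alpha_1,\dots,\alpha_d,\alpha_{d+1}=\beta$ are $N\times N$ Hermitian matrices with $\alpha_j\alpha_k+\alpha_k\alpha_j=2\delta_{jk}I_N$. The smoothing estimate for the Dirac equation with spatial weight $w:(0,\infty)\to[0,\infty)$ and smoothing function $\psi:(0,\infty)\to[0,\infty)$ is $$\int_{\mathbb R}\int_{\mathbb R^d}|\psi(|D|)e^{-itH_m}f(x)|^2w(|x|)\,dx\,dt\le C\|f\|_{L^2(\mathbb R^d,\mathbb C^N)}^2$$ for all $f\in L^2(\mathbb R^d,\mathbb C^N)$, with a finite constant $C$ independent of $f$; $\widetilde C_d(w,\psi,m)\in[0,\infty]$ denotes the optimal constant (supremum of the left-hand side over $\|f\|_2=1$). Convention: the left-hand side is defined directly when $\hat f$ has compact support in $\mathbb R^d\setminus\{0\}$, and, when the estimate holds with finite $C$, for all $f\in L^2$ by continuous extension. *)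

theory Defs
  imports "HOL-Analysis.Analysis"
begin

definition hermitian_matrix :: "complex^'n^'n \<Rightarrow> bool" where
  "hermitian_matrix A \<longleftrightarrow> (\<forall>i j. A $ i $ j = cnj (A $ j $ i))"

definition dirac_matrices :: "('d::finite \<Rightarrow> complex^'n^'n) \<Rightarrow> complex^'n^'n \<Rightarrow> bool" where
  "dirac_matrices \<alpha> \<beta> \<longleftrightarrow>
     (\<forall>j. hermitian_matrix (\<alpha> j)) \<and> hermitian_matrix \<beta> \<and>
     (\<forall>j k. \<alpha> j ** \<alpha> k + \<alpha> k ** \<alpha> j = (if j = k then mat 2 else 0)) \<and>
     (\<forall>j. \<alpha> j ** \<beta> + \<beta> ** \<alpha> j = 0) \<and>
     \<beta> ** \<beta> + \<beta> ** \<beta> = mat 2"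

text \<open>Square matrices are not an instance of the type class on which \<open>exp\<close> is defined.\<close>

definition matrix_exp :: "complex^'n^'n \<Rightarrow> complex^'n^'n" where
  "matrix_exp A = (\<Sum>k. (1 / fact k) *\<^sub>R (((**) A) ^^ k) (mat 1))"

definition L2_sqnorm :: "(real^'d \<Rightarrow> complex^'n) \<Rightarrow> ennreal" where
  "L2_sqnorm f = (\<integral>\<^sup>+x. ennreal ((norm (f x))\<^sup>2) \<partial>lborel)"

definition L2_space :: "(real^'d \<Rightarrow> complex^'n) set" where
  "L2_space = {f. f \<in> borel_measurable lborel \<and> L2_sqnorm f < \<infinity>}"

definition fourier :: "(real^'d \<Rightarrow> complex^'n) \<Rightarrow> real^'d \<Rightarrow> complex^'n" where
  "fourier f \<xi> = (\<integral>x. exp (- \<i> * of_real (x \<bullet> \<xi>)) *s f x \<partial>lborel)"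

definition inverse_fourier :: "(real^'d \<Rightarrow> complex^'n) \<Rightarrow> real^'d \<Rightarrow> complex^'n" where
  "inverse_fourier g x =
     (1 / (2 * pi) ^ CARD('d)) *\<^sub>R (\<integral>\<xi>. exp (\<i> * of_real (x \<bullet> \<xi>)) *s g \<xi> \<partial>lborel)"

text \<open>The Fourier transform on \<open>L\<^sup>2\<close> (Plancherel): the \<open>L\<^sup>2\<close>-limit of the transforms of the
  integrable truncations of \<open>f\<close> to balls. It is determined up to a null set.\<close>

definition L2_fourier :: "(real^'d \<Rightarrow> complex^'n) \<Rightarrow> real^'d \<Rightarrow> complex^'n" where
  "L2_fourier f = (SOME g. g \<in> L2_space \<and>
     ((\<lambda>R::real. L2_sqnorm (\<lambda>\<xi>. fourier (\<lambda>x. indicator (ball 0 R) x *\<^sub>R f x) \<xi> - g \<xi>))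
        \<longlongrightarrow> 0) at_top)"

text \<open>The functions for which the left-hand side of the smoothing estimate is defined directly:
  those whose Fourier transform has compact support away from the origin.\<close>

definition L2_annular :: "(real^'d \<Rightarrow> complex^'n) set" where
  "L2_annular = {f \<in> L2_space. \<exists>K. compact K \<and> 0 \<notin> K \<and>
     (AE \<xi> in lborel. \<xi> \<notin> K \<longrightarrow> L2_fourier f \<xi> = 0)}"

text \<open>The multiplier with matrix-valued symbol \<open>\<sigma>\<close>. It is applied only to functions in
  \<open>L2_annular\<close>; for them the inverse transform is an absolutely convergent integral whenever
  \<open>\<sigma>\<close> is measurable and bounded on compact subsets of the complement of the origin.\<close>

definition fourier_multiplier ::
  "(real^'d \<Rightarrow> complex^'n^'n) \<Rightarrow> (real^'d \<Rightarrow> complex^'n) \<Rightarrow> real^'d \<Rightarrow> complex^'n" where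
  "fourier_multiplier \<sigma> f = inverse_fourier (\<lambda>\<xi>. \<sigma> \<xi> *v L2_fourier f \<xi>)"

definition dirac_symbol ::
  "('d::finite \<Rightarrow> complex^'n^'n) \<Rightarrow> complex^'n^'n \<Rightarrow> real \<Rightarrow> real^'d \<Rightarrow> complex^'n^'n" where
  "dirac_symbol \<alpha> \<beta> m \<xi> = (\<Sum>j\<in>UNIV. (\<xi> $ j) *\<^sub>R \<alpha> j) + m *\<^sub>R \<beta>"

text \<open>\<open>\<psi>(|D|) e\<^sup>-\<^sup>i\<^sup>t\<^sup>H f\<close> for the Dirac operator \<open>H\<close> of mass \<open>m\<close>; the matrix
  \<open>mat (- \<i> t)\<close> is the scalar multiple of the identity.\<close>

definition smoothed_dirac_flow ::
  "('d::finite \<Rightarrow> complex^'n^'n) \<Rightarrow> complex^'n^'n \<Rightarrow> (real \<Rightarrow> real) \<Rightarrow> real \<Rightarrow> real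
     \<Rightarrow> (real^'d \<Rightarrow> complex^'n) \<Rightarrow> real^'d \<Rightarrow> complex^'n" where
  "smoothed_dirac_flow \<alpha> \<beta> \<psi> m t = fourier_multiplier
     (\<lambda>\<xi>. \<psi> (norm \<xi>) *\<^sub>R matrix_exp (mat (- \<i> * of_real t) ** dirac_symbol \<alpha> \<beta> m \<xi>))"

definition smoothing_lhs_direct ::
  "('d::finite \<Rightarrow> complex^'n^'n) \<Rightarrow> complex^'n^'n \<Rightarrow> (real \<Rightarrow> real) \<Rightarrow> (real \<Rightarrow> real) \<Rightarrow> real
     \<Rightarrow> (real^'d \<Rightarrow> complex^'n) \<Rightarrow> ennreal" where
  "smoothing_lhs_direct \<alpha> \<beta> w \<psi> m f =
     (\<integral>\<^sup>+t. (\<integral>\<^sup>+x. ennreal ((norm (smoothed_dirac_flow \<alpha> \<beta> \<psi> m t f x))\<^sup>2 * w (norm x)) \<partial>lborel)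
        \<partial>(lborel :: real measure))"

text \<open>Extension by continuity to \<open>L\<^sup>2\<close>: outside \<open>L2_annular\<close> the value is the limit of the direct
  values at \<open>g\<close>, as \<open>g\<close> in \<open>L2_annular\<close> tends to \<open>f\<close> in \<open>L\<^sup>2\<close>. The limit exists if the estimate
  holds with a finite constant on the dense subspace \<open>L2_annular\<close>. Otherwise its
  value is irrelevant, as the estimate fails and the supremum below is infinite already because
  of \<open>L2_annular\<close>.\<close>

definition smoothing_lhs ::
  "('d::finite \<Rightarrow> complex^'n^'n) \<Rightarrow> complex^'n^'n \<Rightarrow> (real \<Rightarrow> real) \<Rightarrow> (real \<Rightarrow> real) \<Rightarrow> real
     \<Rightarrow> (real^'d \<Rightarrow> complex^'n) \<Rightarrow> ennreal" where
  "smoothing_lhs \<alpha> \<beta> w \<psi> m f =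
     (if f \<in> L2_annular then smoothing_lhs_direct \<alpha> \<beta> w \<psi> m f
      else Lim (inf (filtercomap (\<lambda>g. L2_sqnorm (\<lambda>x. g x - f x)) (nhds 0)) (principal L2_annular))
             (smoothing_lhs_direct \<alpha> \<beta> w \<psi> m))"

definition smoothing_estimate ::
  "('d::finite \<Rightarrow> complex^'n^'n) \<Rightarrow> complex^'n^'n \<Rightarrow> (real \<Rightarrow> real) \<Rightarrow> (real \<Rightarrow> real) \<Rightarrow> real \<Rightarrow> bool" where
  "smoothing_estimate \<alpha> \<beta> w \<psi> m \<longleftrightarrow>
     (\<exists>C::real. \<forall>f\<in>L2_space. smoothing_lhs \<alpha> \<beta> w \<psi> m f \<le> ennreal C * L2_sqnorm f)"

definition smoothing_const ::
  "('d::finite \<Rightarrow> complex^'n^'n) \<Rightarrow> complex^'n^'n \<Rightarrow> (real \<Rightarrow> real) \<Rightarrow> (real \<Rightarrow> real) \<Rightarrow> real \<Rightarrow> ennreal" where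
  "smoothing_const \<alpha> \<beta> w \<psi> m =
     (SUP f\<in>{f \<in> L2_space. L2_sqnorm f = 1}. smoothing_lhs \<alpha> \<beta> w \<psi> m f)"

definition dirac_dispersion :: "real \<Rightarrow> real \<Rightarrow> real" where
  "dirac_dispersion m r = (r\<^sup>2 + m\<^sup>2) powr (1/2)"

definition bracket_weight :: "real \<Rightarrow> real \<Rightarrow> real" where
  "bracket_weight s r = (1 + r\<^sup>2) powr (- s / 2)"

definition bracket_smoothing :: "real \<Rightarrow> real \<Rightarrow> real" where
  "bracket_smoothing m r = dirac_dispersion m r powr (- 1/2) * (1 + r\<^sup>2) powr (1/4)"

end

theory Submission
  imports Defs "HOL-Probability.Probability"
begin

text \<open>The operator \<open>J(\<xi>) = i H(\<xi>) / \<phi>\<^sub>m(|\<xi>|)\<close> is a real-orthogonal complex structure, so the flow acts on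
  the Fourier side by \<open>cos (t \<phi>) - sin (t \<phi>) J\<close>.

  Upper bounds: by duality it is enough to bound, for space-time functions \<open>F\<close>, the integral of
  \<open>\<psi>\<^sup>2 |F^(\<plusminus>\<phi>(|\<xi>|), \<xi>)|\<^sup>2\<close> by the \<open>L\<^sup>2\<close> norm of \<open>F\<close> with weight \<open>1 + |x|\<^sup>2\<close>, that is, by
  \<open>|F^|\<^sup>2 + |\<nabla>\<^sub>\<xi> F^|\<^sup>2\<close>. At a fixed time frequency the restriction to the sphere of radius \<open>r\<close> is
  estimated ray by ray: if \<open>b' + (d - 1) b / \<rho> + b\<^sup>2 \<le> 1\<close>, then the derivative of
  \<open>b \<rho>\<^sup>d\<^sup>-\<^sup>1 |v|\<^sup>2\<close> is at most \<open>\<rho>\<^sup>d\<^sup>-\<^sup>1 (|v|\<^sup>2 + |v'|\<^sup>2)\<close>. Using such a \<open>b\<close> inside the sphere and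
  another one outside, the jump at \<open>r\<close> controls the trace; for \<open>d \<ge> 5\<close> the choice
  \<open>b = -(d - 1) / (2 \<rho>) \<plusminus> (1 + \<rho>\<^sup>-\<^sup>2)\<^sup>1\<^sup>/\<^sup>2\<close> has twice the jump needed, which gives \<open>\<pi>\<close> instead
  of \<open>2 \<pi>\<close>. The substitutions \<open>\<eta> = \<mu> \<xi>\<close> and
  \<open>\<tau> = \<phi>(|\<eta>| / \<mu>)\<close> then turn the integral over \<open>\<xi>\<close> and the rays into one over space-time, without
  polar coordinates.

  Lower bounds: for \<open>s < 2\<close>, data with Fourier transform concentrated at frequencies \<open>\<delta> \<rightarrow> 0\<close> stay
  concentrated in \<open>|x| \<le> c / \<delta>\<close> for times of order \<open>\<phi>(\<delta>) / \<delta>\<^sup>2\<close>. For \<open>s = 2\<close>, wave packets of high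
  frequency and small width travel through the origin at speed one, and their left-hand side tends
  to at least the integral of \<open>1 / (1 + t\<^sup>2)\<close>.\<close>

section \<open>Translations in \<open>L\<^sup>2\<close>\<close>

text \<open>The two factors of \<psi>^2 = (1 + r^2)^(1/2) / \<phi> have separate origins: the first
  is what the jump of b across the sphere pays for, and 1 / \<phi> belongs to the Jacobian of \<tau>
  = \<phi>(|\<eta>| / \<mu>). On the ray through \<xi> the sphere sits at parameter 1, so the radius
  r = |\<xi>| survives only as the constant r^2 in the Riccati inequality. The dimension enters
  through the inverse-square term (d - 1)(d - 3) / (4 \<rho>^2), which is nonnegative for d = 3, 4
  and reaches 2 / \<rho>^2 at d = 5; this is why the better choice of b starts there. The constant 2
  pi is the quotient of the Plancherel factors (2 pi)^(d + 1) of space-time and (2 pi)^d of space.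
  Treating both signs of the energy costs nothing: J is isometric, and the branches \<tau> = \<phi>
  and \<tau> = -\<phi> lie in disjoint half-spaces. Since \<open>L2_fourier\<close> is an L^2-limit
  fixed by a choice, all identities for it hold only almost everywhere; inverse Fourier integrals,
  which ignore null sets, bring them back to pointwise statements about the flow.\<close>

lemma lborel_nn_integral_translate:
  fixes f :: "'a::euclidean_space \<Rightarrow> ennreal"
  assumes [measurable]: "f \<in> borel_measurable borel"
  shows "(\<integral>\<^sup>+x. f (x + c) \<partial>lborel) = (\<integral>\<^sup>+x. f x \<partial>lborel)"
proof -
  have "(\<integral>\<^sup>+x. f x \<partial>lborel) = (\<integral>\<^sup>+x. f x \<partial>distr lborel borel ((+) c))"
    by (simp add: lborel_distr_plus)
  also have "\<dots> = (\<integral>\<^sup>+x. f (x + c) \<partial>lborel)"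
    by (subst nn_integral_distr) (simp_all add: add.commute)
  finally show ?thesis by simp
qed

text \<open>The difference of the indicators splits into the points that leave U and those that
  enter it; translating the second part turns it into the first with the opposite shift. Openness of
  U makes the first part vanish pointwise in the limit, and the indicator of U dominates it.\<close>

lemma indicator_translation_open:
  fixes U :: "'a::euclidean_space set"
  assumes U: "open U" and fin: "emeasure lborel U < \<infinity>" and X: "X \<longlonglongrightarrow> (0::'a)"
  shows "(\<lambda>n. \<integral>\<^sup>+x. ennreal \<bar>indicator U (x + X n) - indicator U x\<bar> \<partial>lborel) \<longlonglongrightarrow> 0"
proof -
  have [measurable]: "U \<in> sets borel" using U by auto
  have half: "(\<lambda>n. \<integral>\<^sup>+x. ennreal (indicator U x * (1 - indicator U (x + Y n))) \<partial>lborel) \<longlonglongrightarrow> (\<integral>\<^sup>+x. 0 \<partial>(lborel::'a measure))"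
    if Y: "Y \<longlonglongrightarrow> 0" for Y
  proof (rule nn_integral_dominated_convergence[where w="indicator U"])
    show "(\<integral>\<^sup>+ x. indicator U x \<partial>lborel) < \<infinity>" using fin by simp
    show "AE x in lborel. ennreal (indicator U x * (1 - indicator U (x + Y j))) \<le> indicator U x" for j
      by (auto split: split_indicator)
    show "AE x in lborel. (\<lambda>n. ennreal (indicator U x * (1 - indicator U (x + Y n)))) \<longlonglongrightarrow> 0"
    proof (intro AE_I2)
      fix x :: 'a
      show "(\<lambda>n. ennreal (indicator U x * (1 - indicator U (x + Y n)))) \<longlonglongrightarrow> 0"
      proof (cases "x \<in> U")
        case True
        have "(\<lambda>n. x + Y n) \<longlonglongrightarrow> x + 0" using Y by (intro tendsto_intros)
        then have "\<forall>\<^sub>F n in sequentially. x + Y n \<in> U"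
          using U True by (auto dest: topological_tendstoD)
        then show ?thesis
          by (intro tendsto_eventually) (auto elim!: eventually_mono simp: True)
      qed simp
    qed
  qed auto
  have "(\<integral>\<^sup>+x. ennreal \<bar>indicator U (x + X n) - indicator U x\<bar> \<partial>lborel) =
     (\<integral>\<^sup>+x. ennreal (indicator U x * (1 - indicator U (x + X n))) \<partial>lborel)
     + (\<integral>\<^sup>+x. ennreal (indicator U x * (1 - indicator U (x + - X n))) \<partial>lborel)" for n
  proof -
    have "(\<integral>\<^sup>+x. ennreal (indicator U x * (1 - indicator U (x + - X n))) \<partial>lborel)
      = (\<integral>\<^sup>+x. ennreal (indicator U (x + X n) * (1 - indicator U x)) \<partial>lborel)"
      by (subst lborel_nn_integral_translate[of _ "X n", symmetric]) (simp_all add: algebra_simps)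
    then show ?thesis
      by (simp only:) (subst nn_integral_add[symmetric], auto intro!: nn_integral_cong split: split_indicator)
  qed
  moreover have "(\<lambda>n. (\<integral>\<^sup>+x. ennreal (indicator U x * (1 - indicator U (x + X n))) \<partial>lborel)
     + (\<integral>\<^sup>+x. ennreal (indicator U x * (1 - indicator U (x + - X n))) \<partial>lborel)) \<longlonglongrightarrow> 0 + 0"
    using half[OF X] half[of "\<lambda>n. - X n"] tendsto_minus[OF X] by (intro tendsto_add) auto
  ultimately show ?thesis by simp
qed

text \<open>An approximation argument in terms of limsup: besides a null sequence b, a small error c
  independent of n is allowed. This is how density of simpler functions enters below.\<close>

lemma ennreal_tendsto_0_approx:
  fixes a :: "nat \<Rightarrow> ennreal"
  assumes "\<And>e. e > 0 \<Longrightarrow> \<exists>b c. (\<forall>n. a n \<le> b n + c) \<and> b \<longlonglongrightarrow> 0 \<and> c \<le> ennreal e"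
  shows "a \<longlonglongrightarrow> 0"
proof -
  have "limsup a \<le> ennreal e" if pos: "e > 0" for e
  proof -
    obtain b c where *: "\<forall>n. a n \<le> b n + c" "b \<longlonglongrightarrow> 0" "c \<le> ennreal e"
      using assms[OF pos] by blast
    have "limsup a \<le> limsup (\<lambda>n. b n + c)" using * by (intro Limsup_mono) auto
    also have "\<dots> = 0 + c"
      using * by (intro lim_imp_Limsup tendsto_add) auto
    finally show ?thesis using * by simp
  qed
  then have "limsup a \<le> 0"
    by (metis ennreal_le_epsilon add_0)
  then have "limsup a = 0" by simp
  then show ?thesis by (simp add: tendsto_0_if_Limsup_eq_0_ennreal)
qed

text \<open>Induction over integrable functions reduces the claim to the indicator of a Borel set A
  of finite measure, which outer regularity replaces by an open superset U. The error set U - A is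
  counted once at x and once at the translated point, hence the factor 2.\<close>

lemma translation_continuous_L1:
  fixes f :: "'a::euclidean_space \<Rightarrow> 'b::euclidean_space"
  assumes "integrable lborel f" and X: "X \<longlonglongrightarrow> (0::'a)"
  shows "(\<lambda>n. \<integral>\<^sup>+x. ennreal (norm (f (x + X n) - f x)) \<partial>lborel) \<longlonglongrightarrow> 0"
  using assms(1)
proof (induction rule: integrable_induct)
  case (base A c)
  then have A[measurable]: "A \<in> sets borel" and Afin: "emeasure lborel A < \<infinity>" by auto
  show ?case
  proof (rule ennreal_tendsto_0_approx)
    fix e :: real assume "e > 0"
    \<comment> \<open>Twice d times \<open>norm c\<close> has to stay below e; the added 1 keeps d
      positive also when c = 0.\<close>
    define d where "d = e / (2 * (norm c + 1))"
    have "d > 0" using \<open>e > 0\<close> by (simp add: d_def add_nonneg_pos)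
    have "A \<in> sets lebesgue" by simp
    then obtain U where U: "open U" "A \<subseteq> U" "U - A \<in> lmeasurable" "emeasure lebesgue (U - A) < ennreal d"
      using sets_lebesgue_outer_open[OF _ \<open>d > 0\<close>] by blast
    have [measurable]: "U \<in> sets borel" using U by auto
    have UA: "emeasure lborel (U - A) < ennreal d" using U by simp
    have Ufin: "emeasure lborel U < \<infinity>"
    proof -
      have "emeasure lborel U = emeasure lborel (U - A) + emeasure lborel A"
        using U(2) by (subst plus_emeasure) (auto simp: Un_absorb2)
      then show ?thesis using UA Afin by (metis ennreal_add_eq_top ennreal_less_top infinity_ennreal_def less_top top.not_eq_extremum order_less_trans)
    qed
    let ?b = "\<lambda>n. ennreal (norm c) * (\<integral>\<^sup>+x. ennreal \<bar>indicator U (x + X n) - indicator U x\<bar> \<partial>lborel)"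
    let ?c = "ennreal (norm c) * (2 * emeasure lborel (U - A))"
    have "?b \<longlonglongrightarrow> ennreal (norm c) * 0"
      using indicator_translation_open[OF U(1) Ufin X] by (intro ennreal_tendsto_cmult) auto
    moreover have "?c \<le> ennreal e"
    proof -
      have "?c \<le> ennreal (norm c) * (2 * ennreal d)" using UA by (intro mult_left_mono) auto
      also have "\<dots> = ennreal (norm c * (2 * d))" using \<open>d > 0\<close> by (simp add: ennreal_mult)
      also have "\<dots> \<le> ennreal e" using \<open>e > 0\<close> by (intro ennreal_leI) (simp add: d_def divide_le_eq add_nonneg_pos algebra_simps not_less)
      finally show ?thesis .
    qed
    moreover have "(\<integral>\<^sup>+x. ennreal (norm (indicat_real A (x + X n) *\<^sub>R c - indicat_real A x *\<^sub>R c)) \<partial>lborel) \<le> ?b n + ?c" for n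
    proof -
      have "(\<integral>\<^sup>+x. ennreal (norm (indicat_real A (x + X n) *\<^sub>R c - indicat_real A x *\<^sub>R c)) \<partial>lborel)
        \<le> (\<integral>\<^sup>+x. ennreal (norm c) * ennreal \<bar>indicator U (x + X n) - indicator U x\<bar>
             + ennreal (norm c) * (indicator (U - A) (x + X n) + indicator (U - A) x) \<partial>lborel)"
      proof (rule nn_integral_mono)
        fix x
        have "norm (indicat_real A (x + X n) *\<^sub>R c - indicat_real A x *\<^sub>R c) \<le>
          norm c * \<bar>indicator U (x + X n) - indicator U x\<bar> + norm c * (indicator (U - A) (x + X n) + indicator (U - A) x)"
          using U(2) by (auto split: split_indicator)
        then have "ennreal (norm (indicat_real A (x + X n) *\<^sub>R c - indicat_real A x *\<^sub>R c)) \<le> ennreal (norm c * \<bar>indicator U (x + X n) - indicator U x\<bar> + norm c * (indicator (U - A) (x + X n) + indicator (U - A) x))"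
          by (rule ennreal_leI)
        also have "\<dots> = ennreal (norm c) * ennreal \<bar>indicator U (x + X n) - indicator U x\<bar>
             + ennreal (norm c) * (indicator (U - A) (x + X n) + indicator (U - A) x)"
          by (simp add: ennreal_plus ennreal_mult ennreal_indicator)
        finally show "ennreal (norm (indicat_real A (x + X n) *\<^sub>R c - indicat_real A x *\<^sub>R c)) \<le> \<dots>" .
      qed
      also have "\<dots> = ?b n + ennreal (norm c) * ((\<integral>\<^sup>+x. indicator (U - A) (x + X n) \<partial>lborel) + emeasure lborel (U - A))"
        by (simp add: nn_integral_add nn_integral_cmult)
      also have "(\<integral>\<^sup>+x. indicator (U - A) (x + X n) \<partial>lborel) = (\<integral>\<^sup>+x. indicator (U - A) x \<partial>lborel)"
        by (rule lborel_nn_integral_translate) auto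
      finally show ?thesis by (simp add: mult_2)
    qed
    ultimately show "\<exists>b c'. (\<forall>n. (\<integral>\<^sup>+x. ennreal (norm (indicat_real A (x + X n) *\<^sub>R c - indicat_real A x *\<^sub>R c)) \<partial>lborel) \<le> b n + c') \<and> b \<longlonglongrightarrow> 0 \<and> c' \<le> ennreal e"
      by (intro exI[of _ ?b] exI[of _ ?c]) auto
  qed
next
  case (add f g)
  have [measurable]: "f \<in> borel_measurable borel" "g \<in> borel_measurable borel"
    using add by auto
  have "(\<lambda>n. (\<integral>\<^sup>+x. ennreal (norm (f (x + X n) - f x)) \<partial>lborel) + (\<integral>\<^sup>+x. ennreal (norm (g (x + X n) - g x)) \<partial>lborel)) \<longlonglongrightarrow> 0 + 0"
    using add by (intro tendsto_add)
  then have lim: "(\<lambda>n. (\<integral>\<^sup>+x. ennreal (norm (f (x + X n) - f x)) \<partial>lborel) + (\<integral>\<^sup>+x. ennreal (norm (g (x + X n) - g x)) \<partial>lborel)) \<longlonglongrightarrow> 0"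
    by simp
  show ?case
  proof (rule tendsto_sandwich[OF _ _ tendsto_const lim])
    show "\<forall>\<^sub>F n in sequentially. (\<integral>\<^sup>+x. ennreal (norm (f (x + X n) + g (x + X n) - (f x + g x))) \<partial>lborel) \<le>
      (\<integral>\<^sup>+x. ennreal (norm (f (x + X n) - f x)) \<partial>lborel) + (\<integral>\<^sup>+x. ennreal (norm (g (x + X n) - g x)) \<partial>lborel)"
    proof (intro always_eventually allI)
      fix n
      have "(\<integral>\<^sup>+x. ennreal (norm (f (x + X n) + g (x + X n) - (f x + g x))) \<partial>lborel) \<le>
        (\<integral>\<^sup>+x. ennreal (norm (f (x + X n) - f x)) + ennreal (norm (g (x + X n) - g x)) \<partial>lborel)"
        by (intro nn_integral_mono)
           (simp add: ennreal_plus[symmetric] norm_diff_triangle_ineq del: ennreal_plus)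
      then show "(\<integral>\<^sup>+x. ennreal (norm (f (x + X n) + g (x + X n) - (f x + g x))) \<partial>lborel) \<le>
      (\<integral>\<^sup>+x. ennreal (norm (f (x + X n) - f x)) \<partial>lborel) + (\<integral>\<^sup>+x. ennreal (norm (g (x + X n) - g x)) \<partial>lborel)"
        by (simp add: nn_integral_add)
    qed
  qed auto
next
  case (lim f s)
  have [measurable]: "f \<in> borel_measurable borel" "s i \<in> borel_measurable borel" for i
    using lim by auto
  have "(\<lambda>i. \<integral>\<^sup>+x. ennreal (norm (f x - s i x)) \<partial>lborel) \<longlonglongrightarrow> 0"
  proof (rule nn_integral_dominated_convergence_norm[where w="\<lambda>x. 2 * norm (f x)"])
    show "(\<integral>\<^sup>+ x. ennreal (2 * norm (f x)) \<partial>lborel) < \<infinity>"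
      using \<open>integrable lborel f\<close> by (auto simp: integrable_iff_bounded ennreal_mult nn_integral_cmult ennreal_mult_less_top)
  qed (use lim in auto)
  show ?case
  proof (rule ennreal_tendsto_0_approx)
    fix e :: real assume "e > 0"
    then have "\<forall>\<^sub>F i in sequentially. (\<integral>\<^sup>+x. ennreal (norm (f x - s i x)) \<partial>lborel) < ennreal (e / 2)"
      using \<open>(\<lambda>i. \<integral>\<^sup>+x. ennreal (norm (f x - s i x)) \<partial>lborel) \<longlonglongrightarrow> 0\<close> by (auto intro: order_tendstoD)
    then obtain i where i: "(\<integral>\<^sup>+x. ennreal (norm (f x - s i x)) \<partial>lborel) < ennreal (e / 2)"
      by (auto simp: eventually_sequentially)
    let ?b = "\<lambda>n. \<integral>\<^sup>+x. ennreal (norm (s i (x + X n) - s i x)) \<partial>lborel"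
    let ?c = "2 * (\<integral>\<^sup>+x. ennreal (norm (f x - s i x)) \<partial>lborel)"
    have "?c \<le> 2 * ennreal (e / 2)" using i by (intro mult_left_mono) auto
    also have "\<dots> = ennreal e" using \<open>e > 0\<close> by (simp add: ennreal_mult[symmetric] flip: ennreal_numeral)
    finally have "?c \<le> ennreal e" .
    moreover have "(\<integral>\<^sup>+x. ennreal (norm (f (x + X n) - f x)) \<partial>lborel) \<le> ?b n + ?c" for n
    proof -
      have "(\<integral>\<^sup>+x. ennreal (norm (f (x + X n) - f x)) \<partial>lborel) \<le>
        (\<integral>\<^sup>+x. ennreal (norm (s i (x + X n) - s i x)) + (ennreal (norm (f (x + X n) - s i (x + X n))) + ennreal (norm (f x - s i x))) \<partial>lborel)"
      proof (intro nn_integral_mono)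
        fix x
        have "norm (f (x + X n) - f x) = norm ((s i (x + X n) - s i x) + ((f (x + X n) - s i (x + X n)) - (f x - s i x)))"
          by (simp add: algebra_simps)
        also have "\<dots> \<le> norm (s i (x + X n) - s i x) + (norm (f (x + X n) - s i (x + X n)) + norm (f x - s i x))"
          by (intro norm_triangle_le add_left_mono norm_triangle_ineq4)
        finally show "ennreal (norm (f (x + X n) - f x)) \<le> ennreal (norm (s i (x + X n) - s i x)) + (ennreal (norm (f (x + X n) - s i (x + X n))) + ennreal (norm (f x - s i x)))"
          by (simp add: ennreal_plus[symmetric] del: ennreal_plus)
      qed
      also have "\<dots> = ?b n + ((\<integral>\<^sup>+x. ennreal (norm (f (x + X n) - s i (x + X n))) \<partial>lborel) + (\<integral>\<^sup>+x. ennreal (norm (f x - s i x)) \<partial>lborel))"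
        by (simp add: nn_integral_add)
      also have "(\<integral>\<^sup>+x. ennreal (norm (f (x + X n) - s i (x + X n))) \<partial>lborel) = (\<integral>\<^sup>+x. ennreal (norm (f x - s i x)) \<partial>lborel)"
        by (rule lborel_nn_integral_translate[where f="\<lambda>x. ennreal (norm (f x - s i x))"]) auto
      finally show ?thesis by (simp add: mult_2)
    qed
    ultimately show "\<exists>b c. (\<forall>n. (\<integral>\<^sup>+x. ennreal (norm (f (x + X n) - f x)) \<partial>lborel) \<le> b n + c) \<and> b \<longlonglongrightarrow> 0 \<and> c \<le> ennreal e"
      using lim(5)[of i] by (intro exI[of _ ?b] exI[of _ ?c]) auto
  qed
qed

text \<open>\<open>L2_sqnorm\<close> over an arbitrary Euclidean domain, so that the same lemmas
  serve functions on space and on space-time. Values in \<open>ennreal\<close> postpone all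
  integrability questions.\<close>

definition sqn :: "('a::euclidean_space \<Rightarrow> 'b::euclidean_space) \<Rightarrow> ennreal" where
  "sqn f = (\<integral>\<^sup>+x. ennreal ((norm (f x))\<^sup>2) \<partial>lborel)"

text \<open>Young's inequality with a free parameter: e = 1 is enough for limit arguments, whereas
  optimising over e recovers the triangle inequality for \<open>nrm\<close>.\<close>

lemma norm_add_sq_le:
  fixes a b :: "'b::real_normed_vector"
  assumes "e > 0"
  shows "(norm (a + b))\<^sup>2 \<le> (1 + e) * (norm a)\<^sup>2 + (1 + 1 / e) * (norm b)\<^sup>2"
proof -
  have "(norm (a + b))\<^sup>2 \<le> (norm a + norm b)\<^sup>2"
    by (intro power_mono norm_triangle_ineq) auto
  also have "\<dots> = (norm a)\<^sup>2 + 2 * norm a * norm b + (norm b)\<^sup>2"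
    by (simp add: power2_sum)
  also have "2 * norm a * norm b \<le> e * (norm a)\<^sup>2 + 1 / e * (norm b)\<^sup>2"
  proof -
    have "0 \<le> (e * norm a - norm b)\<^sup>2 / e" using assms by simp
    also have "\<dots> = e * (norm a)\<^sup>2 + 1 / e * (norm b)\<^sup>2 - 2 * norm a * norm b"
      using assms by (simp add: power2_eq_square field_simps)
    finally show ?thesis by simp
  qed
  finally show ?thesis by (simp add: algebra_simps)
qed

lemma sqn_add_le:
  assumes [measurable]: "f \<in> borel_measurable borel" "g \<in> borel_measurable borel" and e: "e > 0"
  shows "sqn (\<lambda>x. f x + g x) \<le> ennreal (1 + e) * sqn f + ennreal (1 + 1 / e) * sqn g"
proof -
  have "sqn (\<lambda>x. f x + g x) \<le> (\<integral>\<^sup>+x. ennreal (1 + e) * ennreal ((norm (f x))\<^sup>2) + ennreal (1 + 1 / e) * ennreal ((norm (g x))\<^sup>2) \<partial>lborel)"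
    unfolding sqn_def using e
    by (intro nn_integral_mono)
       (simp add: ennreal_mult[symmetric] ennreal_plus[symmetric] norm_add_sq_le del: ennreal_plus)
  also have "\<dots> = ennreal (1 + e) * sqn f + ennreal (1 + 1 / e) * sqn g"
    by (simp add: nn_integral_add nn_integral_cmult sqn_def)
  finally show ?thesis .
qed

lemma sqn_minus: "sqn (\<lambda>x. - f x) = sqn f"
  by (simp add: sqn_def)

lemma sqn_commute: "sqn (\<lambda>x. f x - g x) = sqn (\<lambda>x. g x - f x)"
  by (simp add: sqn_def norm_minus_commute)

lemma sqn_add_le2:
  assumes "f \<in> borel_measurable borel" "g \<in> borel_measurable borel"
  shows "sqn (\<lambda>x. f x + g x) \<le> 2 * sqn f + 2 * sqn g"
  using sqn_add_le[OF assms, of 1] by simp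

lemma sqn_diff_le2:
  assumes "f \<in> borel_measurable borel" "g \<in> borel_measurable borel"
  shows "sqn (\<lambda>x. f x - g x) \<le> 2 * sqn f + 2 * sqn g"
  using sqn_add_le2[of f "\<lambda>x. - g x"] assms by (simp add: sqn_minus)

lemma sqn_translate:
  assumes [measurable]: "f \<in> borel_measurable borel"
  shows "sqn (\<lambda>x. f (x + h)) = sqn f"
  unfolding sqn_def by (rule lborel_nn_integral_translate[where f="\<lambda>x. ennreal ((norm (f x))\<^sup>2)"]) simp

lemma sqn_cmult: "sqn (\<lambda>x. c *\<^sub>R f x) = ennreal (c\<^sup>2) * sqn f" if [measurable]: "f \<in> borel_measurable borel"
  by (simp add: sqn_def power_mult_distrib ennreal_mult nn_integral_cmult)

text \<open>A square-integrable function need not be integrable, so f is approximated by simple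
  functions dominated by 2 |f|. Each of these is bounded and integrable, and for bounded functions
  the L^1 statement implies the L^2 one.\<close>

lemma translation_continuous_L2:
  fixes f :: "'a::euclidean_space \<Rightarrow> 'b::euclidean_space"
  assumes f[measurable]: "f \<in> borel_measurable borel" and fin: "sqn f < \<infinity>" and X: "X \<longlonglongrightarrow> (0::'a)"
  shows "(\<lambda>n. sqn (\<lambda>x. f (x + X n) - f x)) \<longlonglongrightarrow> 0"
proof -
  obtain s where s: "\<And>i. simple_function borel (s i)" "\<And>x. (\<lambda>i. s i x) \<longlonglongrightarrow> f x"
    "\<And>i x. norm (s i x) \<le> 2 * norm (f x)"
    using borel_measurable_implies_sequence_metric[OF f, of 0] by (auto simp: dist_norm)
  have [measurable]: "s i \<in> borel_measurable borel" for i
    using s(1) by (rule borel_measurable_simple_function)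
  have lim: "(\<lambda>i. sqn (\<lambda>x. f x - s i x)) \<longlonglongrightarrow> (\<integral>\<^sup>+x. 0 \<partial>(lborel::'a measure))"
    unfolding sqn_def
  proof (rule nn_integral_dominated_convergence[where w="\<lambda>x. 9 * ennreal ((norm (f x))\<^sup>2)"])
    show "(\<integral>\<^sup>+ x. 9 * ennreal ((norm (f x))\<^sup>2) \<partial>lborel) < \<infinity>"
      using fin by (simp add: sqn_def nn_integral_cmult ennreal_mult_less_top)
    show "AE x in lborel. ennreal ((norm (f x - s j x))\<^sup>2) \<le> 9 * ennreal ((norm (f x))\<^sup>2)" for j
    proof (intro AE_I2)
      fix x
      have "norm (f x - s j x) \<le> 3 * norm (f x)"
        using norm_triangle_ineq4[of "f x" "s j x"] s(3)[of j x] by simp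
      then have "(norm (f x - s j x))\<^sup>2 \<le> (3 * norm (f x))\<^sup>2" by (intro power_mono) auto
      then have "ennreal ((norm (f x - s j x))\<^sup>2) \<le> ennreal (9 * (norm (f x))\<^sup>2)"
        by (intro ennreal_leI) (simp add: power_mult_distrib)
      then show "ennreal ((norm (f x - s j x))\<^sup>2) \<le> 9 * ennreal ((norm (f x))\<^sup>2)"
        by (simp add: ennreal_mult)
    qed
    show "AE x in lborel. (\<lambda>i. ennreal ((norm (f x - s i x))\<^sup>2)) \<longlonglongrightarrow> 0"
    proof (intro AE_I2)
      fix x
      have "(\<lambda>i. ennreal ((norm (f x - s i x))\<^sup>2)) \<longlonglongrightarrow> ennreal ((norm (f x - f x))\<^sup>2)"
        using s(2) by (intro tendsto_ennrealI tendsto_intros)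
      then show "(\<lambda>i. ennreal ((norm (f x - s i x))\<^sup>2)) \<longlonglongrightarrow> 0" by simp
    qed
  qed auto
  have s_cont: "(\<lambda>n. sqn (\<lambda>x. s i (x + X n) - s i x)) \<longlonglongrightarrow> 0" for i
  proof -
    have finr: "finite (range (s i))" using s(1)[of i] by (simp add: simple_function_def)
    \<comment> \<open>On the finite range of \<open>s i\<close>, K bounds 1 / |v| for every nonzero
      value v, while \<open>inverse 0 = 0\<close> adds nothing. Hence |s| \<le> K |s|^2, and square
      integrability yields integrability.\<close>
    define K where "K = (\<Sum>v\<in>range (s i). inverse (norm v))"
    define M where "M = (\<Sum>v\<in>range (s i). norm v)"
    have M: "norm (s i x) \<le> M" for x
      unfolding M_def using finr by (intro member_le_sum) auto
    have "M \<ge> 0" unfolding M_def by (intro sum_nonneg) auto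
    have "norm (s i x) \<le> K * (norm (s i x))\<^sup>2" for x
    proof (cases "s i x = 0")
      case False
      have "inverse (norm (s i x)) \<le> K"
        unfolding K_def using finr by (intro member_le_sum) auto
      then have "inverse (norm (s i x)) * (norm (s i x))\<^sup>2 \<le> K * (norm (s i x))\<^sup>2"
        by (intro mult_right_mono) auto
      then show ?thesis using False by (simp add: power2_eq_square)
    qed simp
    moreover have "K \<ge> 0" unfolding K_def by (intro sum_nonneg) auto
    ultimately have "ennreal (norm (s i x)) \<le> ennreal K * (4 * ennreal ((norm (f x))\<^sup>2))" for x
    proof -
      have "(norm (s i x))\<^sup>2 \<le> (2 * norm (f x))\<^sup>2" using s(3) by (intro power_mono) auto
      then have "K * (norm (s i x))\<^sup>2 \<le> K * (4 * (norm (f x))\<^sup>2)"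
        using \<open>K \<ge> 0\<close> by (intro mult_left_mono) (auto simp: power_mult_distrib)
      then have "ennreal (norm (s i x)) \<le> ennreal (K * (4 * (norm (f x))\<^sup>2))"
        using \<open>norm (s i x) \<le> K * (norm (s i x))\<^sup>2\<close> by (intro ennreal_leI) simp
      then show ?thesis using \<open>K \<ge> 0\<close> by (simp add: ennreal_mult)
    qed
    then have "(\<integral>\<^sup>+x. ennreal (norm (s i x)) \<partial>lborel) \<le> (\<integral>\<^sup>+x. ennreal K * (4 * ennreal ((norm (f x))\<^sup>2)) \<partial>lborel)"
      by (intro nn_integral_mono)
    also have "\<dots> < \<infinity>"
      using fin by (simp add: sqn_def nn_integral_cmult ennreal_mult_less_top)
    finally have int: "integrable lborel (s i)" by (simp add: integrable_iff_bounded)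
    have "(\<lambda>n. ennreal (2 * M) * (\<integral>\<^sup>+x. ennreal (norm (s i (x + X n) - s i x)) \<partial>lborel)) \<longlonglongrightarrow> ennreal (2 * M) * 0"
      using translation_continuous_L1[OF int X] by (intro ennreal_tendsto_cmult) auto
    then have lim: "(\<lambda>n. ennreal (2 * M) * (\<integral>\<^sup>+x. ennreal (norm (s i (x + X n) - s i x)) \<partial>lborel)) \<longlonglongrightarrow> 0"
      by simp
    show ?thesis
    proof (rule tendsto_sandwich[OF _ _ tendsto_const lim])
      show "\<forall>\<^sub>F n in sequentially. sqn (\<lambda>x. s i (x + X n) - s i x) \<le> ennreal (2 * M) * (\<integral>\<^sup>+x. ennreal (norm (s i (x + X n) - s i x)) \<partial>lborel)"
      proof (intro always_eventually allI)
        fix n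
        have "sqn (\<lambda>x. s i (x + X n) - s i x) \<le> (\<integral>\<^sup>+x. ennreal (2 * M) * ennreal (norm (s i (x + X n) - s i x)) \<partial>lborel)"
          unfolding sqn_def
        proof (intro nn_integral_mono)
          fix x
          have "norm (s i (x + X n) - s i x) \<le> 2 * M"
            using norm_triangle_ineq4[of "s i (x + X n)" "s i x"] M[of x] M[of "x + X n"] by simp
          then have "(norm (s i (x + X n) - s i x))\<^sup>2 \<le> 2 * M * norm (s i (x + X n) - s i x)"
            by (simp add: power2_eq_square mult_right_mono)
          then show "ennreal ((norm (s i (x + X n) - s i x))\<^sup>2) \<le> ennreal (2 * M) * ennreal (norm (s i (x + X n) - s i x))"
            using \<open>M \<ge> 0\<close> by (simp add: ennreal_mult[symmetric] del: ennreal_mult')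
        qed
        then show "sqn (\<lambda>x. s i (x + X n) - s i x) \<le> ennreal (2 * M) * (\<integral>\<^sup>+x. ennreal (norm (s i (x + X n) - s i x)) \<partial>lborel)"
          by (simp add: nn_integral_cmult)
      qed
    qed auto
  qed
  show ?thesis
  proof (rule ennreal_tendsto_0_approx)
    fix e :: real assume "e > 0"
    have "\<forall>\<^sub>F i in sequentially. sqn (\<lambda>x. f x - s i x) < ennreal (e / 8)"
      using lim \<open>e > 0\<close> by (intro order_tendstoD) auto
    then obtain i where i: "sqn (\<lambda>x. f x - s i x) < ennreal (e / 8)"
      by (auto simp: eventually_sequentially)
    let ?r = "\<lambda>x. f x - s i x"
    let ?b = "\<lambda>n. 2 * sqn (\<lambda>x. s i (x + X n) - s i x)" and ?c = "8 * sqn ?r"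
    have "?c \<le> 8 * ennreal (e / 8)" using i by (intro mult_left_mono) auto
    also have "\<dots> = ennreal e" using \<open>e > 0\<close> by (simp add: ennreal_mult[symmetric] flip: ennreal_numeral)
    finally have "?c \<le> ennreal e" .
    moreover have "?b \<longlonglongrightarrow> 2 * 0" by (intro ennreal_tendsto_cmult s_cont) auto
    moreover have "sqn (\<lambda>x. f (x + X n) - f x) \<le> ?b n + ?c" for n
    proof -
      have "sqn (\<lambda>x. f (x + X n) - f x) = sqn (\<lambda>x. (s i (x + X n) - s i x) + (?r (x + X n) - ?r x))"
        by (simp add: algebra_simps)
      also have "\<dots> \<le> 2 * sqn (\<lambda>x. s i (x + X n) - s i x) + 2 * sqn (\<lambda>x. ?r (x + X n) - ?r x)"
        by (intro sqn_add_le2) auto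
      also have "sqn (\<lambda>x. ?r (x + X n) - ?r x) \<le> 2 * sqn (\<lambda>x. ?r (x + X n)) + 2 * sqn ?r"
        by (intro sqn_diff_le2) auto
      also have "sqn (\<lambda>x. ?r (x + X n)) = sqn ?r"
        by (intro sqn_translate) auto
      also have "2 * (2 * sqn ?r + 2 * sqn ?r) = 8 * sqn ?r"
        by (simp add: distrib_left mult.assoc[symmetric] flip: mult_2 distrib_right)
      finally show ?thesis by (simp add: add_left_mono mult_left_mono)
    qed
    ultimately show "\<exists>b c. (\<forall>n. sqn (\<lambda>x. f (x + X n) - f x) \<le> b n + c) \<and> b \<longlonglongrightarrow> 0 \<and> c \<le> ennreal e"
      by (intro exI[of _ ?b] exI[of _ ?c]) auto
  qed
qed

section \<open>The Plancherel identity\<close>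

text \<open>The density of the standard normal distribution on the whole Euclidean space; its
  characteristic function drives the proof of the Plancherel identity.\<close>

definition gaussian :: "'a::euclidean_space \<Rightarrow> real" where
  "gaussian z = (1 / sqrt (2 * pi)) ^ DIM('a) * exp (- (norm z)\<^sup>2 / 2)"

lemma gaussian_eq_prod: "gaussian z = (\<Prod>b\<in>Basis. std_normal_density (z \<bullet> b))"
proof -
  have "(norm z)\<^sup>2 = (\<Sum>b\<in>Basis. (z \<bullet> b)\<^sup>2)"
    by (subst power2_norm_eq_inner, subst euclidean_inner) (simp add: power2_eq_square)
  then have "- (norm z)\<^sup>2 / 2 = (\<Sum>b\<in>Basis. - (z \<bullet> b)\<^sup>2 / 2)"
    by (simp add: sum_negf sum_divide_distrib)
  then show ?thesis
    by (simp add: gaussian_def std_normal_density_def prod_dividef exp_sum power_divide)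
qed

lemma gaussian_pos: "gaussian z > 0"
  by (simp add: gaussian_def)

lemma gaussian_measurable [measurable]: "gaussian \<in> borel_measurable borel"
  unfolding gaussian_def by measurable

text \<open>Lebesgue measure is the image of the product measure over the basis, so the integral
  factors into one-dimensional characteristic functions of the standard normal distribution.\<close>

lemma gaussian_char_aux:
  fixes y :: "'a::euclidean_space"
  shows "integrable lborel (\<lambda>z::'a. exp (\<i> * of_real (z \<bullet> y)) * of_real (gaussian z))"
    and "(\<integral>z. exp (\<i> * of_real (z \<bullet> y)) * of_real (gaussian z) \<partial>(lborel::'a measure)) = of_real (exp (- (norm y)\<^sup>2 / 2))"
proof -
  interpret product_sigma_finite "\<lambda>b::'a. lborel :: real measure" ..
  let ?g = "\<lambda>b t. exp (\<i> * of_real (t * (y \<bullet> b))) * complex_of_real (std_normal_density t)"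
  have eq: "exp (\<i> * of_real (z \<bullet> y)) * of_real (gaussian z) = (\<Prod>b\<in>Basis. ?g b (z \<bullet> b))" for z
  proof -
    have "exp (\<i> * of_real (z \<bullet> y)) = (\<Prod>b\<in>Basis. exp (\<i> * of_real ((z \<bullet> b) * (y \<bullet> b))))"
      by (subst euclidean_inner) (simp add: exp_sum sum_distrib_left)
    then show ?thesis by (simp add: gaussian_eq_prod prod.distrib)
  qed
  have g1: "integrable lborel (?g b)" for b
  proof (rule Bochner_Integration.integrable_bound)
    show "integrable lborel std_normal_density" by simp
  qed (auto simp: norm_mult)
  have g2: "(\<integral>t. ?g b t \<partial>lborel) = of_real (exp (- (y \<bullet> b)\<^sup>2 / 2))" for b
  proof -
    have "of_real (exp (- (y \<bullet> b)\<^sup>2 / 2)) = char std_normal_distribution (y \<bullet> b)"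
      by (simp add: char_std_normal_distribution)
    also have "\<dots> = (\<integral>t. std_normal_density t *\<^sub>R iexp ((y \<bullet> b) * t) \<partial>lborel)"
      unfolding char_def by (subst integral_density) auto
    finally show ?thesis by (simp add: scaleR_conv_of_real mult_ac)
  qed
  have comp: "(\<Sum>b\<in>Basis. x b *\<^sub>R b) \<bullet> c = x c" if "c \<in> Basis" for x and c :: 'a
    using that by (simp add: inner_sum_left inner_Basis if_distrib sum.delta cong: if_cong)
  have [measurable]: "(\<lambda>f. \<Sum>b\<in>Basis. f b *\<^sub>R (b::'a)) \<in> measurable (\<Pi>\<^sub>M b\<in>Basis. lborel) borel"
    by measurable
  have pi: "integrable (\<Pi>\<^sub>M b\<in>Basis. lborel) (\<lambda>x. \<Prod>b\<in>Basis. ?g b (x b))"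
    using g1 by (intro product_integrable_prod) auto
  have "integrable lborel (\<lambda>z::'a. \<Prod>b\<in>Basis. ?g b (z \<bullet> b))"
    using pi by (subst lborel_eq, subst integrable_distr_eq) (simp_all add: comp cong: prod.cong)
  then show "integrable lborel (\<lambda>z::'a. exp (\<i> * of_real (z \<bullet> y)) * of_real (gaussian z))"
    by (simp add: eq)
  have "(\<integral>z. exp (\<i> * of_real (z \<bullet> y)) * of_real (gaussian z) \<partial>(lborel::'a measure))
     = (\<integral>z. (\<Prod>b\<in>Basis. ?g b (z \<bullet> b)) \<partial>(lborel::'a measure))" by (simp add: eq)
  also have "\<dots> = (\<integral>x. (\<Prod>b\<in>Basis. ?g b (x b)) \<partial>(\<Pi>\<^sub>M b\<in>(Basis::'a set). lborel))"
    by (subst lborel_eq, subst integral_distr) (simp_all add: comp cong: prod.cong)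
  also have "\<dots> = (\<Prod>b\<in>Basis. \<integral>t. ?g b t \<partial>lborel)"
    using g1 by (intro product_integral_prod) auto
  also have "\<dots> = of_real (\<Prod>b\<in>Basis. exp (- (y \<bullet> b)\<^sup>2 / 2))" by (simp only: g2 of_real_prod)
  also have "(\<Prod>b\<in>Basis. exp (- (y \<bullet> b)\<^sup>2 / 2)) = exp (\<Sum>b\<in>Basis. - (y \<bullet> b)\<^sup>2 / 2)"
    by (simp add: exp_sum)
  also have "(\<Sum>b\<in>Basis. - (y \<bullet> b)\<^sup>2 / 2) = - (norm y)\<^sup>2 / 2"
    by (subst power2_norm_eq_inner, subst euclidean_inner)
       (simp add: power2_eq_square sum_negf sum_divide_distrib)
  finally show "(\<integral>z. exp (\<i> * of_real (z \<bullet> y)) * of_real (gaussian z) \<partial>(lborel::'a measure)) = of_real (exp (- (norm y)\<^sup>2 / 2))" .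
qed

lemma gaussian_integrable: "integrable lborel (gaussian :: 'a::euclidean_space \<Rightarrow> real)"
proof -
  have "integrable lborel (\<lambda>z::'a. complex_of_real (gaussian z))"
    using gaussian_char_aux(1)[of "0::'a"] by simp
  then show ?thesis using complex_of_real_integrable_eq by blast
qed

lemma gaussian_integral: "(\<integral>z. gaussian z \<partial>(lborel::'a::euclidean_space measure)) = 1"
proof -
  have "complex_of_real (\<integral>z. gaussian z \<partial>(lborel::'a::euclidean_space measure)) = 1"
    using gaussian_char_aux(2)[of "0::'a"] by simp
  then show ?thesis using of_real_eq_1_iff by blast
qed

section \<open>Affine changes of variables and the scaled Gaussian\<close>

lemma lborel_affine_integral:
  fixes f :: "'a::euclidean_space \<Rightarrow> 'b::{banach, second_countable_topology}"
  assumes [measurable]: "f \<in> borel_measurable borel" and c: "c \<noteq> 0"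
  shows "(\<integral>x. f x \<partial>lborel) = \<bar>c\<bar> ^ DIM('a) *\<^sub>R (\<integral>x. f (t + c *\<^sub>R x) \<partial>lborel)"
  by (subst lborel_affine[OF c, of t]) (simp add: integral_density integral_distr)

lemma lborel_affine_nn_integral:
  fixes f :: "'a::euclidean_space \<Rightarrow> ennreal"
  assumes [measurable]: "f \<in> borel_measurable borel" and c: "c \<noteq> 0"
  shows "(\<integral>\<^sup>+x. f x \<partial>lborel) = ennreal (\<bar>c\<bar> ^ DIM('a)) * (\<integral>\<^sup>+x. f (t + c *\<^sub>R x) \<partial>lborel)"
  by (subst lborel_affine[OF c, of t])
     (simp add: nn_integral_density nn_integral_distr nn_integral_cmult ennreal_power)

lemma gaussian_scaled_fourier:
  fixes u :: "'a::euclidean_space"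
  assumes s: "s > 0"
  shows "integrable lborel (\<lambda>\<xi>::'a. exp (- \<i> * of_real (u \<bullet> \<xi>)) * of_real (gaussian (s *\<^sub>R \<xi>)))"
    and "(\<integral>\<xi>. exp (- \<i> * of_real (u \<bullet> \<xi>)) * of_real (gaussian (s *\<^sub>R \<xi>)) \<partial>(lborel::'a measure))
      = of_real (exp (- (norm (u /\<^sub>R s))\<^sup>2 / 2) / s ^ DIM('a))"
proof -
  let ?h = "\<lambda>z::'a. exp (\<i> * of_real (z \<bullet> (- u /\<^sub>R s))) * complex_of_real (gaussian z)"
  have eq: "exp (- \<i> * of_real (u \<bullet> \<xi>)) * of_real (gaussian (s *\<^sub>R \<xi>)) = ?h (0 + s *\<^sub>R \<xi>)" for \<xi>
  proof -
    have "(0 + s *\<^sub>R \<xi>) \<bullet> (- u /\<^sub>R s) = - (u \<bullet> \<xi>)"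
      using s by (simp add: inner_commute)
    then show ?thesis by (simp only:) simp
  qed
  have int: "integrable lborel ?h" by (rule gaussian_char_aux)
  then have "(\<integral>\<^sup>+z. norm (?h z) \<partial>lborel) < \<infinity>" by (simp add: integrable_iff_bounded)
  then have "(\<integral>\<^sup>+\<xi>. norm (?h (0 + s *\<^sub>R \<xi>)) \<partial>lborel) < \<infinity>"
    using s by (subst (asm) lborel_affine_nn_integral[of _ s 0]) (auto simp: ennreal_mult_less_top)
  moreover have "(\<lambda>\<xi>. ?h (0 + s *\<^sub>R \<xi>)) \<in> borel_measurable lborel" by measurable
  ultimately have "integrable lborel (\<lambda>\<xi>. ?h (0 + s *\<^sub>R \<xi>))"
    unfolding integrable_iff_bounded by blast
  then show "integrable lborel (\<lambda>\<xi>::'a. exp (- \<i> * of_real (u \<bullet> \<xi>)) * of_real (gaussian (s *\<^sub>R \<xi>)))"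
    by (simp only: eq)
  have "(\<integral>z. ?h z \<partial>lborel) = \<bar>s\<bar> ^ DIM('a) *\<^sub>R (\<integral>\<xi>. ?h (0 + s *\<^sub>R \<xi>) \<partial>lborel)"
    using s by (intro lborel_affine_integral) auto
  moreover have "(\<integral>z. ?h z \<partial>lborel) = of_real (exp (- (norm (u /\<^sub>R s))\<^sup>2 / 2))"
    by (subst gaussian_char_aux(2)) simp
  ultimately have "(\<integral>\<xi>. ?h (0 + s *\<^sub>R \<xi>) \<partial>lborel) = of_real (exp (- (norm (u /\<^sub>R s))\<^sup>2 / 2) / s ^ DIM('a))"
    using s by (simp add: scaleR_conv_of_real field_simps)
  then show "(\<integral>\<xi>. exp (- \<i> * of_real (u \<bullet> \<xi>)) * of_real (gaussian (s *\<^sub>R \<xi>)) \<partial>(lborel::'a measure))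
      = of_real (exp (- (norm (u /\<^sub>R s))\<^sup>2 / 2) / s ^ DIM('a))"
    by (simp only: eq)
qed

lemma borel_measurable_cnj [measurable]: "cnj \<in> borel_measurable borel"
  by (intro borel_measurable_continuous_onI continuous_intros)

text \<open>The scalar transform on any Euclidean space: it is used componentwise for vector-valued
  functions on R^d and again for functions on space-time R x R^d.\<close>

definition ft :: "('a::euclidean_space \<Rightarrow> complex) \<Rightarrow> 'a \<Rightarrow> complex" where
  "ft f \<xi> = (\<integral>x. exp (- \<i> * of_real (x \<bullet> \<xi>)) * f x \<partial>lborel)"

lemma ft_integrable:
  assumes "integrable lborel f"
  shows "integrable lborel (\<lambda>x. exp (- \<i> * of_real (x \<bullet> \<xi>)) * f x)"
  using assms by (rule Bochner_Integration.integrable_bound) (use assms in \<open>auto simp: norm_mult\<close>)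

lemma ft_measurable [measurable]:
  assumes [measurable]: "f \<in> borel_measurable borel"
  shows "ft f \<in> borel_measurable borel"
  unfolding ft_def by measurable

lemma lborel_pair_integrable_mult:
  fixes f :: "'a::euclidean_space \<Rightarrow> 'c::{real_normed_field, banach, second_countable_topology}"
    and g :: "'b::euclidean_space \<Rightarrow> 'c"
  assumes f: "integrable lborel f" and g: "integrable lborel g"
  shows "integrable (lborel \<Otimes>\<^sub>M lborel) (\<lambda>p. f (fst p) * g (snd p))"
proof (rule lborel_pair.Fubini_integrable)
  have [measurable]: "f \<in> borel_measurable borel" "g \<in> borel_measurable borel" using f g by auto
  show "(\<lambda>p. f (fst p) * g (snd p)) \<in> borel_measurable (lborel \<Otimes>\<^sub>M lborel)" by measurable
qed (use f g in \<open>auto simp: norm_mult\<close>)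

text \<open>The Gaussian factor makes the triple integral over x, y and \<xi> absolutely convergent.
  By Fubini the \<xi>-integral leaves a Gaussian of width s in x - y, that is, an average over z of
  the autocorrelation of f at shift s z.\<close>

lemma ft_gaussian_weighted:
  fixes f :: "'a::euclidean_space \<Rightarrow> complex"
  assumes f: "integrable lborel f" and fin: "sqn f < \<infinity>" and s: "s > 0"
  shows "(\<integral>\<xi>. of_real ((norm (ft f \<xi>))\<^sup>2 * gaussian (s *\<^sub>R \<xi>)) \<partial>lborel)
    = of_real (sqrt (2 * pi) ^ DIM('a)) * (\<integral>z. of_real (gaussian z) * (\<integral>x. f x * cnj (f (x + s *\<^sub>R z)) \<partial>lborel) \<partial>lborel)"
    and "integrable lborel (\<lambda>\<xi>. (norm (ft f \<xi>))\<^sup>2 * gaussian (s *\<^sub>R \<xi>))"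
    and "integrable lborel (\<lambda>z. of_real (gaussian z) * (\<integral>x. f x * cnj (f (x + s *\<^sub>R z)) \<partial>lborel))"
proof -
  have [measurable]: "f \<in> borel_measurable borel" using f by auto
  let ?H = "\<lambda>p. f (fst p) * cnj (f (snd p))"
  let ?E = "\<lambda>p \<xi>. exp (- \<i> * of_real ((fst p - snd p) \<bullet> \<xi>))"
  have H: "integrable (lborel \<Otimes>\<^sub>M lborel) ?H"
    using f by (intro lborel_pair_integrable_mult) auto
  have sq: "complex_of_real ((norm (ft f \<xi>))\<^sup>2) = (\<integral>p. ?E p \<xi> * ?H p \<partial>(lborel \<Otimes>\<^sub>M lborel))" for \<xi>
  proof -
    define F where "F = (\<lambda>x. exp (- \<i> * of_real (x \<bullet> \<xi>)) * f x)"
    have F1: "integrable lborel F"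
      using ft_integrable[OF f, of \<xi>] by (simp only: F_def)
    have F: "integrable lborel F" "integrable lborel (\<lambda>y. cnj (F y))"
      using F1 by simp_all
    have "complex_of_real ((norm (ft f \<xi>))\<^sup>2) = (\<integral>x. F x \<partial>lborel) * cnj (\<integral>x. F x \<partial>lborel)"
      unfolding ft_def F_def[symmetric] by (rule complex_norm_square)
    also have "\<dots> = (\<integral>x. (\<integral>y. F x * cnj (F y) \<partial>lborel) \<partial>lborel)"
      using F by simp
    also have "\<dots> = (\<integral>p. F (fst p) * cnj (F (snd p)) \<partial>(lborel \<Otimes>\<^sub>M lborel))"
      using lborel_pair.integral_fst'[OF lborel_pair_integrable_mult[OF F]] by simp
    also have "\<dots> = (\<integral>p. ?E p \<xi> * ?H p \<partial>(lborel \<Otimes>\<^sub>M lborel))"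
    proof (intro Bochner_Integration.integral_cong refl)
      fix p :: "'a \<times> 'a"
      have *: "exp (- \<i> * of_real (fst p \<bullet> \<xi>)) * cnj (exp (- \<i> * of_real (snd p \<bullet> \<xi>))) = ?E p \<xi>"
        by (simp add: exp_cnj inner_diff_left exp_add[symmetric] algebra_simps)
      show "F (fst p) * cnj (F (snd p)) = ?E p \<xi> * ?H p"
        unfolding *[symmetric] F_def by (simp only: complex_cnj_mult mult_ac)
    qed
    finally show ?thesis .
  qed
  have g: "integrable lborel (\<lambda>\<xi>::'a. gaussian (s *\<^sub>R \<xi>))"
    using gaussian_scaled_fourier(1)[OF s, of 0] by (simp only: inner_zero_left) (simp add: complex_of_real_integrable_eq)
  have trip: "integrable (lborel \<Otimes>\<^sub>M lborel) (\<lambda>(p, \<xi>). ?E p \<xi> * ?H p * of_real (gaussian (s *\<^sub>R \<xi>)))"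
  proof (rule Bochner_Integration.integrable_bound)
    show "integrable (lborel \<Otimes>\<^sub>M lborel) (\<lambda>q. ?H (fst q) * complex_of_real (gaussian (s *\<^sub>R (snd q :: 'a))))"
      using H g by (intro lborel_pair_integrable_mult) (auto simp: lborel_prod)
    show "(\<lambda>(p, \<xi>). ?E p \<xi> * ?H p * of_real (gaussian (s *\<^sub>R \<xi>))) \<in> borel_measurable (lborel \<Otimes>\<^sub>M lborel)"
      unfolding split_beta' lborel_prod measurable_lborel2 borel_prod[symmetric] by measurable
  qed (auto simp: norm_mult split_beta simp del: of_real_mult)
  have "integrable lborel (\<lambda>\<xi>. \<integral>p. ?E p \<xi> * ?H p * of_real (gaussian (s *\<^sub>R \<xi>)) \<partial>lborel)"
    using lborel_pair.integrable_snd[OF trip] .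
  moreover have gsq: "(\<integral>p. ?E p \<xi> * ?H p * of_real (gaussian (s *\<^sub>R \<xi>)) \<partial>lborel) = complex_of_real ((norm (ft f \<xi>))\<^sup>2 * gaussian (s *\<^sub>R \<xi>))" for \<xi>
    using sq[of \<xi>] by (simp add: lborel_prod)
  ultimately show "integrable lborel (\<lambda>\<xi>. (norm (ft f \<xi>))\<^sup>2 * gaussian (s *\<^sub>R \<xi>))"
    by (simp only: complex_of_real_integrable_eq)
  \<comment> \<open>Integrability in (x, z) comes from the L^2 bound: |f(x) f(x + s z)| \<le>
    |f(x)|^2 + |f(x + s z)|^2, and translations preserve the L^2 norm.\<close>
  have xz: "integrable (lborel \<Otimes>\<^sub>M lborel) (\<lambda>(x, z). f x * cnj (f (x + s *\<^sub>R z)) * complex_of_real (gaussian z))"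
  proof (rule integrableI_bounded)
    let ?G = "\<lambda>x z. ennreal (norm (f x * cnj (f (x + s *\<^sub>R z)) * complex_of_real (gaussian z)))"
    have meas: "(\<lambda>(x, z). f x * cnj (f (x + s *\<^sub>R z)) * complex_of_real (gaussian z)) \<in> borel_measurable (lborel \<Otimes>\<^sub>M lborel)"
      unfolding split_beta' lborel_prod measurable_lborel2 borel_prod[symmetric] by measurable
    then show "(\<lambda>(x, z). f x * cnj (f (x + s *\<^sub>R z)) * complex_of_real (gaussian z)) \<in> borel_measurable (lborel \<Otimes>\<^sub>M lborel)" .
    have "(\<lambda>p. ennreal (norm ((\<lambda>(x, z). f x * cnj (f (x + s *\<^sub>R z)) * complex_of_real (gaussian z)) p))) \<in> borel_measurable (lborel \<Otimes>\<^sub>M lborel)"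
      using meas by measurable
    then have G: "case_prod ?G \<in> borel_measurable (lborel \<Otimes>\<^sub>M lborel)"
      by (simp only: split_beta')
    have "(\<integral>\<^sup>+p. ennreal (norm ((\<lambda>(x, z). f x * cnj (f (x + s *\<^sub>R z)) * complex_of_real (gaussian z)) p)) \<partial>(lborel \<Otimes>\<^sub>M lborel))
       = (\<integral>\<^sup>+z. \<integral>\<^sup>+x. ennreal (norm (f x * cnj (f (x + s *\<^sub>R z)) * complex_of_real (gaussian z))) \<partial>lborel \<partial>lborel)"
      using lborel_pair.nn_integral_snd[OF G, symmetric] by (simp only: split_beta' fst_conv snd_conv)
    also have "\<dots> \<le> (\<integral>\<^sup>+z. ennreal (gaussian (z::'a)) * (sqn f + sqn f) \<partial>lborel)"
    proof (intro nn_integral_mono)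
      fix z
      have "(\<integral>\<^sup>+x. ennreal (norm (f x * cnj (f (x + s *\<^sub>R z)) * complex_of_real (gaussian z))) \<partial>lborel)
        \<le> (\<integral>\<^sup>+x. ennreal (gaussian z) * (ennreal ((norm (f x))\<^sup>2) + ennreal ((norm (f (x + s *\<^sub>R z)))\<^sup>2)) \<partial>lborel)"
      proof (intro nn_integral_mono)
        fix x
        have "norm (f x) * norm (f (x + s *\<^sub>R z)) \<le> (norm (f x))\<^sup>2 + (norm (f (x + s *\<^sub>R z)))\<^sup>2"
          using sum_squares_bound[of "norm (f x)" "norm (f (x + s *\<^sub>R z))"]
            mult_nonneg_nonneg[OF norm_ge_zero[of "f x"] norm_ge_zero[of "f (x + s *\<^sub>R z)"]] by linarith
        then have "norm (f x * cnj (f (x + s *\<^sub>R z)) * complex_of_real (gaussian z)) \<le> gaussian z * ((norm (f x))\<^sup>2 + (norm (f (x + s *\<^sub>R z)))\<^sup>2)"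
          using gaussian_pos[of z] by (simp add: norm_mult mult.commute mult_right_mono)
        then show "ennreal (norm (f x * cnj (f (x + s *\<^sub>R z)) * complex_of_real (gaussian z))) \<le> ennreal (gaussian z) * (ennreal ((norm (f x))\<^sup>2) + ennreal ((norm (f (x + s *\<^sub>R z)))\<^sup>2))"
          using gaussian_pos[of z] by (simp add: ennreal_mult[symmetric] ennreal_plus[symmetric] ennreal_leI del: ennreal_plus)
      qed
      also have "\<dots> = ennreal (gaussian z) * (sqn f + sqn (\<lambda>x. f (x + s *\<^sub>R z)))"
        by (simp add: nn_integral_cmult nn_integral_add sqn_def)
      finally show "(\<integral>\<^sup>+x. ennreal (norm (f x * cnj (f (x + s *\<^sub>R z)) * complex_of_real (gaussian z))) \<partial>lborel) \<le> ennreal (gaussian z) * (sqn f + sqn f)"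
        by (simp add: sqn_translate)
    qed
    also have "\<dots> = (\<integral>\<^sup>+z. ennreal (gaussian (z::'a)) \<partial>lborel) * (sqn f + sqn f)"
      by (simp add: nn_integral_multc)
    also have "\<dots> < \<infinity>"
      using fin gaussian_integrable[where 'a='a] gaussian_pos[where 'a='a]
      by (auto simp: ennreal_mult_less_top integrable_iff_bounded abs_of_pos)
    finally show "(\<integral>\<^sup>+p. ennreal (norm ((\<lambda>(x, z). f x * cnj (f (x + s *\<^sub>R z)) * complex_of_real (gaussian z)) p)) \<partial>(lborel \<Otimes>\<^sub>M lborel)) < \<infinity>" .
  qed
  from lborel_pair.integrable_snd[OF xz]
  show "integrable lborel (\<lambda>z. of_real (gaussian z) * (\<integral>x. f x * cnj (f (x + s *\<^sub>R z)) \<partial>lborel))"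
    by (simp add: mult.commute[of "complex_of_real (gaussian _)"])
  let ?K = "\<lambda>u::'a. complex_of_real (exp (- (norm (u /\<^sub>R s))\<^sup>2 / 2) / s ^ DIM('a))"
  have "(\<integral>\<xi>. complex_of_real ((norm (ft f \<xi>))\<^sup>2 * gaussian (s *\<^sub>R \<xi>)) \<partial>lborel)
    = (\<integral>p. (\<integral>\<xi>. ?E p \<xi> * ?H p * of_real (gaussian (s *\<^sub>R \<xi>)) \<partial>lborel) \<partial>lborel)"
    by (simp only: gsq[symmetric] lborel_pair.Fubini_integral[OF trip])
  also have "\<dots> = (\<integral>p. ?H p * ?K (fst p - snd p) \<partial>lborel)"
  proof (rule Bochner_Integration.integral_cong[OF refl])
    fix p
    have "(\<integral>\<xi>. ?E p \<xi> * ?H p * of_real (gaussian (s *\<^sub>R \<xi>)) \<partial>lborel) = (\<integral>\<xi>. ?H p * (?E p \<xi> * of_real (gaussian (s *\<^sub>R \<xi>))) \<partial>lborel)"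
      by (simp add: mult_ac)
    also have "\<dots> = ?H p * (\<integral>\<xi>. ?E p \<xi> * of_real (gaussian (s *\<^sub>R \<xi>)) \<partial>lborel)"
      by (rule integral_mult_right_zero)
    finally show "(\<integral>\<xi>. ?E p \<xi> * ?H p * of_real (gaussian (s *\<^sub>R \<xi>)) \<partial>lborel) = ?H p * ?K (fst p - snd p)"
      by (simp only: gaussian_scaled_fourier(2)[OF s])
  qed
  also have "\<dots> = (\<integral>x. (\<integral>y. ?H (x, y) * ?K (x - y) \<partial>lborel) \<partial>lborel)"
  proof -
    have "integrable (lborel \<Otimes>\<^sub>M lborel) (\<lambda>p. ?H p * ?K (fst p - snd p))"
    proof (rule Bochner_Integration.integrable_bound)
      show "integrable (lborel \<Otimes>\<^sub>M lborel) (\<lambda>p. (1 / s ^ DIM('a)) *\<^sub>R ?H p)" using H by simp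
    qed (use s in \<open>auto simp: norm_mult norm_divide norm_power divide_right_mono mult_left_le\<close>)
    from lborel_pair.integral_fst'[OF this, symmetric] show ?thesis by (simp only: lborel_prod fst_conv snd_conv)
  qed
  also have "\<dots> = (\<integral>x. (\<integral>z. of_real (sqrt (2 * pi) ^ DIM('a)) * (f x * cnj (f (x + s *\<^sub>R z)) * of_real (gaussian z)) \<partial>lborel) \<partial>lborel)"
  proof (rule Bochner_Integration.integral_cong[OF refl])
    fix x
    have "(\<integral>y. ?H (x, y) * ?K (x - y) \<partial>lborel) = \<bar>s\<bar> ^ DIM('a) *\<^sub>R (\<integral>z. ?H (x, x + s *\<^sub>R z) * ?K (x - (x + s *\<^sub>R z)) \<partial>lborel)"
      using s by (intro lborel_affine_integral) auto
    also have "\<dots> = (\<integral>z. \<bar>s\<bar> ^ DIM('a) *\<^sub>R (?H (x, x + s *\<^sub>R z) * ?K (x - (x + s *\<^sub>R z))) \<partial>lborel)"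
      by (rule integral_scaleR_right[symmetric])
    also have "\<dots> = (\<integral>z. of_real (sqrt (2 * pi) ^ DIM('a)) * (f x * cnj (f (x + s *\<^sub>R z)) * of_real (gaussian z)) \<partial>lborel)"
    proof (rule Bochner_Integration.integral_cong[OF refl])
      fix z
      have "exp (- (norm ((x - (x + s *\<^sub>R z)) /\<^sub>R s))\<^sup>2 / 2) = sqrt (2 * pi) ^ DIM('a) * gaussian z"
        using s by (simp add: gaussian_def power_divide)
      then show "\<bar>s\<bar> ^ DIM('a) *\<^sub>R (?H (x, x + s *\<^sub>R z) * ?K (x - (x + s *\<^sub>R z))) =
        of_real (sqrt (2 * pi) ^ DIM('a)) * (f x * cnj (f (x + s *\<^sub>R z)) * of_real (gaussian z))"
        using s by (simp only:) (simp add: scaleR_conv_of_real)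
    qed
    finally show "(\<integral>y. ?H (x, y) * ?K (x - y) \<partial>lborel) = \<dots>" .
  qed
  also have "\<dots> = of_real (sqrt (2 * pi) ^ DIM('a)) * (\<integral>x. (\<integral>z. f x * cnj (f (x + s *\<^sub>R z)) * of_real (gaussian z) \<partial>lborel) \<partial>lborel)"
    by simp
  also have "(\<integral>x. (\<integral>z. f x * cnj (f (x + s *\<^sub>R z)) * of_real (gaussian z) \<partial>lborel) \<partial>lborel) =
    (\<integral>z. (\<integral>x. f x * cnj (f (x + s *\<^sub>R z)) * of_real (gaussian z) \<partial>lborel) \<partial>lborel)"
    by (rule lborel_pair.Fubini_integral[OF xz, symmetric])
  finally show "(\<integral>\<xi>. of_real ((norm (ft f \<xi>))\<^sup>2 * gaussian (s *\<^sub>R \<xi>)) \<partial>lborel)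
    = of_real (sqrt (2 * pi) ^ DIM('a)) * (\<integral>z. of_real (gaussian z) * (\<integral>x. f x * cnj (f (x + s *\<^sub>R z)) \<partial>lborel) \<partial>lborel)"
    by (simp add: mult.commute)
qed

lemma sqn_finite:
  fixes f :: "'a::euclidean_space \<Rightarrow> 'b::euclidean_space"
  assumes [measurable]: "f \<in> borel_measurable borel" and fin: "sqn f < \<infinity>"
  shows "integrable lborel (\<lambda>x. (norm (f x))\<^sup>2)" and "sqn f = ennreal (\<integral>x. (norm (f x))\<^sup>2 \<partial>lborel)"
proof -
  show *: "integrable lborel (\<lambda>x. (norm (f x))\<^sup>2)"
    using fin by (simp add: integrable_iff_bounded sqn_def)
  show "sqn f = ennreal (\<integral>x. (norm (f x))\<^sup>2 \<partial>lborel)"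
    unfolding sqn_def using * by (intro nn_integral_eq_integral) auto
qed

text \<open>Polarisation: 2 Re (a cnj b) = |a|^2 + |b|^2 - |b - a|^2. Continuity of translations
  thus becomes continuity of the autocorrelation at shift 0.\<close>

lemma autocorrelation:
  fixes f :: "'a::euclidean_space \<Rightarrow> complex"
  assumes [measurable]: "f \<in> borel_measurable borel" and fin: "sqn f < \<infinity>"
  shows "Re (\<integral>x. f x * cnj (f (x + h)) \<partial>lborel) = enn2real (sqn f) - enn2real (sqn (\<lambda>x. f (x + h) - f x)) / 2"
proof -
  have fin2: "sqn (\<lambda>x. f (x + h)) < \<infinity>" using fin by (simp add: sqn_translate)
  have "sqn (\<lambda>x. f (x + h) - f x) \<le> 2 * sqn (\<lambda>x. f (x + h)) + 2 * sqn f"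
    by (intro sqn_diff_le2) auto
  also have "\<dots> < \<infinity>" using fin fin2 by (simp add: ennreal_mult_less_top)
  finally have fin3: "sqn (\<lambda>x. f (x + h) - f x) < \<infinity>" .
  note i = sqn_finite[OF _ fin] sqn_finite[OF _ fin2] sqn_finite[OF _ fin3]
  have ptw: "Re (f x * cnj (f (x + h))) = ((norm (f x))\<^sup>2 + (norm (f (x + h)))\<^sup>2 - (norm (f (x + h) - f x))\<^sup>2) / 2" for x
    unfolding cmod_power2 by (simp add: power2_eq_square algebra_simps)
  have int: "integrable lborel (\<lambda>x. f x * cnj (f (x + h)))"
  proof (rule Bochner_Integration.integrable_bound)
    show "integrable lborel (\<lambda>x. (norm (f x))\<^sup>2 + (norm (f (x + h)))\<^sup>2)" using i by simp
    show "AE x in lborel. norm (f x * cnj (f (x + h))) \<le> norm ((norm (f x))\<^sup>2 + (norm (f (x + h)))\<^sup>2)"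
    proof (rule AE_I2)
      fix x
      show "norm (f x * cnj (f (x + h))) \<le> norm ((norm (f x))\<^sup>2 + (norm (f (x + h)))\<^sup>2)"
        unfolding norm_mult complex_mod_cnj real_norm_def
        using sum_squares_bound[of "norm (f x)" "norm (f (x + h))"]
          mult_nonneg_nonneg[OF norm_ge_zero[of "f x"] norm_ge_zero[of "f (x + h)"]]
        by linarith
    qed
  qed measurable
  have "Re (\<integral>x. f x * cnj (f (x + h)) \<partial>lborel) = (\<integral>x. Re (f x * cnj (f (x + h))) \<partial>lborel)"
    using int by (rule integral_Re[symmetric])
  also have "\<dots> = ((\<integral>x. (norm (f x))\<^sup>2 \<partial>lborel) + (\<integral>x. (norm (f (x + h)))\<^sup>2 \<partial>lborel) - (\<integral>x. (norm (f (x + h) - f x))\<^sup>2 \<partial>lborel)) / 2"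
    unfolding ptw using i by simp
  also have "(\<integral>x. (norm (f x))\<^sup>2 \<partial>lborel) = enn2real (sqn f)"
    using i(2) by simp
  also have "(\<integral>x. (norm (f (x + h)))\<^sup>2 \<partial>lborel) = enn2real (sqn f)"
    using i(4) sqn_translate[of f h] by simp
  also have "(\<integral>x. (norm (f (x + h) - f x))\<^sup>2 \<partial>lborel) = enn2real (sqn (\<lambda>x. f (x + h) - f x))"
    using i(6) by simp
  finally show ?thesis by (simp add: field_simps)
qed

text \<open>The Gaussian-weighted identity is passed to the limit s -> 0. The right-hand side
  converges by dominated convergence, as the autocorrelation is bounded by \<open>N\<close> and
  continuous at 0. The left-hand side increases as s decreases, so monotone convergence gives
  finiteness and value at once.\<close>

theorem plancherel_complex:
  fixes f :: "'a::euclidean_space \<Rightarrow> complex"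
  assumes f: "integrable lborel f" and fin: "sqn f < \<infinity>"
  shows "sqn (ft f) = ennreal ((2 * pi) ^ DIM('a)) * sqn f"
proof -
  have [measurable]: "f \<in> borel_measurable borel" using f by auto
  define N where "N = enn2real (sqn f)"
  have sqnN: "sqn f = ennreal N" using fin by (simp add: N_def)
  have N0: "N \<ge> 0" by (simp add: N_def)
  define A where "A h = Re (\<integral>x. f x * cnj (f (x + h)) \<partial>lborel)" for h
  have [measurable]: "A \<in> borel_measurable borel" unfolding A_def by measurable
  have A_bound: "\<bar>A h\<bar> \<le> N" for h
  proof -
    have "sqn (\<lambda>x. f (x + h) - f x) \<le> 2 * sqn (\<lambda>x. f (x + h)) + 2 * sqn f"
      by (intro sqn_diff_le2) auto
    also have "\<dots> = ennreal (4 * N)" using N0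
      by (simp add: sqn_translate sqnN flip: ennreal_numeral ennreal_mult ennreal_plus)
    finally have "enn2real (sqn (\<lambda>x. f (x + h) - f x)) \<le> 4 * N"
      using N0 by (intro enn2real_leI) auto
    then show ?thesis
      unfolding A_def by (subst autocorrelation) (use fin in \<open>auto simp: N_def abs_le_iff\<close>)
  qed
  have A_lim: "(\<lambda>n. A (X n)) \<longlonglongrightarrow> N" if "X \<longlonglongrightarrow> 0" for X
  proof -
    have "(\<lambda>n. sqn (\<lambda>x. f (x + X n) - f x)) \<longlonglongrightarrow> ennreal 0"
      using translation_continuous_L2[OF _ fin that] by simp
    then have "(\<lambda>n. enn2real (sqn (\<lambda>x. f (x + X n) - f x))) \<longlonglongrightarrow> 0"
      by (rule tendsto_enn2real) simp
    then have "(\<lambda>n. N - enn2real (sqn (\<lambda>x. f (x + X n) - f x)) / 2) \<longlonglongrightarrow> N - 0 / 2"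
      by (intro tendsto_diff tendsto_divide tendsto_const) auto
    then show ?thesis
      unfolding A_def by (subst autocorrelation) (use fin in \<open>auto simp: N_def\<close>)
  qed
  define s where "s n = 1 / real (Suc n)" for n
  have s0: "s n > 0" for n by (simp add: s_def)
  have slim: "s \<longlonglongrightarrow> 0" unfolding s_def using LIMSEQ_Suc[OF lim_1_over_n] by simp
  let ?c = "sqrt (2 * pi) ^ DIM('a)"
  have int: "(\<integral>\<xi>. (norm (ft f \<xi>))\<^sup>2 * gaussian (s n *\<^sub>R \<xi>) \<partial>lborel) = ?c * (\<integral>z. gaussian z * A (s n *\<^sub>R z) \<partial>lborel)" for n
  proof -
    note I = ft_gaussian_weighted(3)[OF f fin s0[of n]]
    have "complex_of_real (\<integral>\<xi>. (norm (ft f \<xi>))\<^sup>2 * gaussian (s n *\<^sub>R \<xi>) \<partial>lborel)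
      = of_real ?c * (\<integral>z. of_real (gaussian z) * (\<integral>x. f x * cnj (f (x + s n *\<^sub>R z)) \<partial>lborel) \<partial>lborel)"
      unfolding ft_gaussian_weighted(1)[OF f fin s0, symmetric] by (rule integral_complex_of_real[symmetric])
    then have "(\<integral>\<xi>. (norm (ft f \<xi>))\<^sup>2 * gaussian (s n *\<^sub>R \<xi>) \<partial>lborel)
      = Re (of_real ?c * (\<integral>z. of_real (gaussian z) * (\<integral>x. f x * cnj (f (x + s n *\<^sub>R z)) \<partial>lborel) \<partial>lborel))"
      by (metis Re_complex_of_real)
    also have "\<dots> = ?c * Re (\<integral>z. of_real (gaussian z) * (\<integral>x. f x * cnj (f (x + s n *\<^sub>R z)) \<partial>lborel) \<partial>lborel)"
      by (simp only: times_complex.sel Re_complex_of_real Im_complex_of_real mult_zero_left diff_zero)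
    also have "Re (\<integral>z. of_real (gaussian z) * (\<integral>x. f x * cnj (f (x + s n *\<^sub>R z)) \<partial>lborel) \<partial>lborel)
       = (\<integral>z. gaussian z * A (s n *\<^sub>R z) \<partial>lborel)"
      unfolding integral_Re[OF I, symmetric] A_def
      by (simp only: times_complex.sel Re_complex_of_real Im_complex_of_real mult_zero_left diff_zero)
    finally show ?thesis .
  qed
  have "(\<lambda>n. ?c * (\<integral>z. gaussian z * A (s n *\<^sub>R z) \<partial>lborel)) \<longlonglongrightarrow> ?c * (\<integral>z. gaussian (z::'a) * N \<partial>lborel)"
  proof (intro tendsto_mult tendsto_const integral_dominated_convergence[where w="\<lambda>z::'a. gaussian z * N"])
    show "integrable lborel (\<lambda>z::'a. gaussian z * N)" using gaussian_integrable[where 'a='a] by simp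
    show "AE z::'a in lborel. (\<lambda>n. gaussian z * A (s n *\<^sub>R z)) \<longlonglongrightarrow> gaussian z * N"
    proof (rule AE_I2)
      fix z :: 'a
      have "(\<lambda>n. s n *\<^sub>R z) \<longlonglongrightarrow> 0 *\<^sub>R z" by (intro tendsto_intros slim)
      then show "(\<lambda>n. gaussian z * A (s n *\<^sub>R z)) \<longlonglongrightarrow> gaussian z * N"
        by (intro tendsto_intros A_lim) simp
    qed
    show "AE z::'a in lborel. norm (gaussian z * A (s n *\<^sub>R z)) \<le> gaussian z * N" for n
      using A_bound gaussian_pos[where 'a='a] by (intro AE_I2) (simp add: abs_mult abs_of_pos mult_left_mono less_imp_le)
  qed auto
  then have R: "(\<lambda>n. ?c * (\<integral>z. gaussian z * A (s n *\<^sub>R z) \<partial>lborel)) \<longlonglongrightarrow> ?c * N"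
    by (simp add: gaussian_integral)
  have nn: "(\<integral>\<^sup>+\<xi>. ennreal ((norm (ft f \<xi>))\<^sup>2 * gaussian (s n *\<^sub>R \<xi>)) \<partial>lborel) = ennreal (?c * (\<integral>z. gaussian z * A (s n *\<^sub>R z) \<partial>lborel))" for n
    unfolding int[symmetric] using ft_gaussian_weighted(2)[OF f fin s0, of n] gaussian_pos[where 'a='a]
    by (intro nn_integral_eq_integral) (auto simp: less_imp_le)
  have "(\<lambda>n. \<integral>\<^sup>+\<xi>. ennreal ((norm (ft f \<xi>))\<^sup>2 * gaussian (s n *\<^sub>R \<xi>)) \<partial>lborel) \<longlonglongrightarrow>
    (\<integral>\<^sup>+\<xi>. ennreal ((norm (ft f \<xi>))\<^sup>2 * gaussian (0::'a)) \<partial>lborel)"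
  proof (rule nn_integral_LIMSEQ)
    show "incseq (\<lambda>n \<xi>. ennreal ((norm (ft f \<xi>))\<^sup>2 * gaussian (s n *\<^sub>R \<xi>)))"
    proof (intro incseq_SucI le_funI ennreal_leI mult_left_mono)
      fix n and \<xi> :: 'a
      have "norm (s (Suc n) *\<^sub>R \<xi>) \<le> norm (s n *\<^sub>R \<xi>)"
        by (simp add: s_def field_simps mult_right_mono frac_le)
      then show "gaussian (s n *\<^sub>R \<xi>) \<le> gaussian (s (Suc n) *\<^sub>R \<xi>)"
        unfolding gaussian_def by (intro mult_left_mono) (auto simp: power_mono divide_right_mono)
    qed auto
    show "(\<lambda>n. ennreal ((norm (ft f \<xi>))\<^sup>2 * gaussian (s n *\<^sub>R \<xi>))) \<longlonglongrightarrow> ennreal ((norm (ft f \<xi>))\<^sup>2 * gaussian (0::'a))" for \<xi>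
    proof -
      have "(\<lambda>n. s n *\<^sub>R \<xi>) \<longlonglongrightarrow> 0 *\<^sub>R \<xi>" by (intro tendsto_intros slim)
      then have "(\<lambda>n. gaussian (s n *\<^sub>R \<xi>)) \<longlonglongrightarrow> gaussian (0 *\<^sub>R \<xi>)"
        unfolding gaussian_def by (intro tendsto_intros slim) auto
      then show ?thesis by (intro tendsto_ennrealI tendsto_intros) simp
    qed
  qed auto
  moreover have "(\<lambda>n. ennreal (?c * (\<integral>z. gaussian z * A (s n *\<^sub>R z) \<partial>lborel))) \<longlonglongrightarrow> ennreal (?c * N)"
    using R by (rule tendsto_ennrealI)
  ultimately have "(\<integral>\<^sup>+\<xi>. ennreal ((norm (ft f \<xi>))\<^sup>2 * gaussian (0::'a)) \<partial>lborel) = ennreal (?c * N)"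
    unfolding nn by (rule LIMSEQ_unique)
  moreover have "(\<integral>\<^sup>+\<xi>. ennreal ((norm (ft f \<xi>))\<^sup>2 * gaussian (0::'a)) \<partial>lborel) = ennreal (gaussian (0::'a)) * sqn (ft f)"
    using gaussian_pos[of "0::'a"] by (simp add: sqn_def ennreal_mult nn_integral_cmult mult.commute less_imp_le)
  moreover have g0: "?c * gaussian (0::'a) = 1"
    by (simp add: gaussian_def power_divide)
  ultimately have *: "ennreal (gaussian (0::'a)) * sqn (ft f) = ennreal (?c * N)" by simp
  have cc: "?c * ?c = (2 * pi) ^ DIM('a)"
    unfolding power_mult_distrib[symmetric] by simp
  have "sqn (ft f) = ennreal (?c * gaussian (0::'a)) * sqn (ft f)" by (simp add: g0)
  also have "\<dots> = ennreal ?c * (ennreal (gaussian (0::'a)) * sqn (ft f))"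
    using gaussian_pos[of "0::'a"] by (simp add: ennreal_mult mult.assoc less_imp_le)
  also have "\<dots> = ennreal (?c * (?c * N))"
    unfolding * using N0 by (simp add: ennreal_mult[symmetric])
  also have "?c * (?c * N) = (2 * pi) ^ DIM('a) * N"
    unfolding mult.assoc[symmetric] cc ..
  finally show ?thesis using N0 by (simp add: sqnN ennreal_mult)
qed

section \<open>Completeness of \<open>L\<^sup>2\<close>\<close>

definition nrm :: "('a::euclidean_space \<Rightarrow> 'b::euclidean_space) \<Rightarrow> real" where
  "nrm f = sqrt (enn2real (sqn f))"

lemma sqn_eq_nrm: "sqn f < \<infinity> \<Longrightarrow> sqn f = ennreal ((nrm f)\<^sup>2)"
  by (simp add: nrm_def)

lemma nrm_nonneg [simp]: "nrm f \<ge> 0"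
  by (simp add: nrm_def)

text \<open>The right-hand side is minimal at e = b / a, where it equals (a + b)^2; the shift by t >
  0 keeps this quotient positive when a or b vanishes.\<close>

lemma le_add_of_quadratic:
  fixes a b c :: real
  assumes "a \<ge> 0" "b \<ge> 0" and *: "\<And>e. e > 0 \<Longrightarrow> c\<^sup>2 \<le> (1 + e) * a\<^sup>2 + (1 + 1 / e) * b\<^sup>2"
  shows "c \<le> a + b"
proof -
  have main: "c \<le> (a + t) + (b + t)" if "t > 0" for t
  proof -
    have pos: "a + t > 0" "b + t > 0" using assms that by auto
    have "c\<^sup>2 \<le> (1 + (b + t) / (a + t)) * a\<^sup>2 + (1 + 1 / ((b + t) / (a + t))) * b\<^sup>2"
      using pos by (intro *) auto
    also have "\<dots> \<le> (1 + (b + t) / (a + t)) * (a + t)\<^sup>2 + (1 + 1 / ((b + t) / (a + t))) * (b + t)\<^sup>2"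
      using assms pos that by (intro add_mono mult_left_mono power_mono) auto
    also have "\<dots> = ((a + t) + (b + t))\<^sup>2"
    proof -
      have "(1 + q / p) * p\<^sup>2 + (1 + 1 / (q / p)) * q\<^sup>2 = (p + q)\<^sup>2" if "p > 0" "q > 0" for p q :: real
        using that by (simp add: power2_eq_square field_simps)
      then show ?thesis using pos by blast
    qed
    finally show ?thesis using pos by (intro power2_le_imp_le[of c]) auto
  qed
  then have "c \<le> a + b + e" if "e > 0" for e
    using main[of "e / 2"] that by simp
  then show ?thesis by (rule field_le_epsilon)
qed

lemma sqn_add_finite:
  assumes "f \<in> borel_measurable borel" "g \<in> borel_measurable borel" "sqn f < \<infinity>" "sqn g < \<infinity>"
  shows "sqn (\<lambda>x. f x + g x) < \<infinity>"
proof -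
  have "sqn (\<lambda>x. f x + g x) \<le> 2 * sqn f + 2 * sqn g" using assms by (intro sqn_add_le2)
  also have "\<dots> < \<infinity>" using assms by (simp add: ennreal_mult_less_top)
  finally show ?thesis .
qed

lemma sqn_diff_finite:
  assumes "f \<in> borel_measurable borel" "g \<in> borel_measurable borel" "sqn f < \<infinity>" "sqn g < \<infinity>"
  shows "sqn (\<lambda>x. f x - g x) < \<infinity>"
  using sqn_add_finite[of f "\<lambda>x. - g x"] assms by (simp add: sqn_minus)

lemma nrm_triangle:
  assumes m: "f \<in> borel_measurable borel" "g \<in> borel_measurable borel" and fin: "sqn f < \<infinity>" "sqn g < \<infinity>"
  shows "nrm (\<lambda>x. f x + g x) \<le> nrm f + nrm g"
proof (rule le_add_of_quadratic)
  fix e :: real assume e: "e > 0"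
  have "ennreal ((nrm (\<lambda>x. f x + g x))\<^sup>2) \<le> ennreal (1 + e) * ennreal ((nrm f)\<^sup>2) + ennreal (1 + 1 / e) * ennreal ((nrm g)\<^sup>2)"
    using sqn_add_le[OF m e] fin sqn_add_finite[OF m fin] by (simp add: sqn_eq_nrm[symmetric])
  also have "\<dots> = ennreal ((1 + e) * (nrm f)\<^sup>2 + (1 + 1 / e) * (nrm g)\<^sup>2)"
    using e by (simp add: ennreal_mult)
  finally show "(nrm (\<lambda>x. f x + g x))\<^sup>2 \<le> (1 + e) * (nrm f)\<^sup>2 + (1 + 1 / e) * (nrm g)\<^sup>2"
    using e by (subst (asm) ennreal_le_iff) auto
qed simp_all

lemma nrm_commute: "nrm (\<lambda>x. f x - g x) = nrm (\<lambda>x. g x - f x)"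
  by (simp add: nrm_def sqn_commute[of f g])

lemma nrm_diff_abs:
  assumes m: "f \<in> borel_measurable borel" "g \<in> borel_measurable borel" and fin: "sqn f < \<infinity>" "sqn g < \<infinity>"
  shows "\<bar>nrm f - nrm g\<bar> \<le> nrm (\<lambda>x. f x - g x)"
proof -
  have "nrm f \<le> nrm (\<lambda>x. f x - g x) + nrm g"
    using nrm_triangle[of "\<lambda>x. f x - g x" g] m fin sqn_diff_finite[OF m fin] by simp
  moreover have "nrm g \<le> nrm (\<lambda>x. g x - f x) + nrm f"
    using nrm_triangle[of "\<lambda>x. g x - f x" f] m fin sqn_diff_finite[OF m(2,1) fin(2,1)] by simp
  ultimately show ?thesis by (simp add: nrm_commute[of g f])
qed

lemma nrm_tendsto_0: "((\<lambda>n. sqn (a n)) \<longlongrightarrow> 0) F \<Longrightarrow> ((\<lambda>n. nrm (a n)) \<longlongrightarrow> 0) F"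
proof -
  assume "((\<lambda>n. sqn (a n)) \<longlongrightarrow> 0) F"
  then have "((\<lambda>n. sqn (a n)) \<longlongrightarrow> ennreal 0) F" by simp
  then have "((\<lambda>n. enn2real (sqn (a n))) \<longlongrightarrow> 0) F" by (rule tendsto_enn2real) simp
  then have "((\<lambda>n. sqrt (enn2real (sqn (a n)))) \<longlongrightarrow> sqrt 0) F" by (rule tendsto_real_sqrt)
  then show ?thesis by (simp add: nrm_def)
qed

lemma sqn_tendsto:
  fixes a :: "'i \<Rightarrow> 'a::euclidean_space \<Rightarrow> 'b::euclidean_space"
  assumes [measurable]: "\<And>n. a n \<in> borel_measurable borel" "g \<in> borel_measurable borel"
    and fin: "\<And>n. sqn (a n) < \<infinity>" "sqn g < \<infinity>" and lim: "((\<lambda>n. sqn (\<lambda>x. a n x - g x)) \<longlongrightarrow> 0) F"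
  shows "((\<lambda>n. sqn (a n)) \<longlongrightarrow> sqn g) F"
proof -
  have "((\<lambda>n. nrm (a n) - nrm g) \<longlongrightarrow> 0) F"
    by (rule Lim_null_comparison[OF _ nrm_tendsto_0[OF lim]])
       (auto intro!: always_eventually nrm_diff_abs fin)
  then have "((\<lambda>n. nrm (a n)) \<longlongrightarrow> nrm g) F" by (simp add: LIM_zero_iff)
  then have "((\<lambda>n. ennreal ((nrm (a n))\<^sup>2)) \<longlongrightarrow> ennreal ((nrm g)\<^sup>2)) F"
    by (intro tendsto_ennrealI tendsto_intros)
  then show ?thesis by (simp only: sqn_eq_nrm[OF fin(1)] sqn_eq_nrm[OF fin(2)])
qed

lemma sqn_0_iff:
  assumes [measurable]: "f \<in> borel_measurable borel"
  shows "sqn f = 0 \<longleftrightarrow> (AE x in lborel. f x = 0)"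
  unfolding sqn_def by (subst nn_integral_0_iff_AE) (auto simp: ennreal_eq_0_iff)

lemma sqn_cong_AE: "AE x in lborel. f x = g x \<Longrightarrow> sqn f = sqn g"
  unfolding sqn_def by (intro nn_integral_cong_AE) auto

lemma sqn_limit_unique:
  fixes a :: "'i \<Rightarrow> 'a::euclidean_space \<Rightarrow> 'b::euclidean_space"
  assumes [measurable]: "\<And>n. a n \<in> borel_measurable borel" "g \<in> borel_measurable borel" "h \<in> borel_measurable borel"
    and lim: "((\<lambda>n. sqn (\<lambda>x. a n x - g x)) \<longlongrightarrow> 0) F" "((\<lambda>n. sqn (\<lambda>x. a n x - h x)) \<longlongrightarrow> 0) F" and F: "F \<noteq> bot"
  shows "AE x in lborel. g x = h x"
proof -
  have "((\<lambda>n. 2 * sqn (\<lambda>x. a n x - g x) + 2 * sqn (\<lambda>x. a n x - h x)) \<longlongrightarrow> 2 * 0 + 2 * 0) F"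
    by (intro tendsto_add ennreal_tendsto_cmult lim) auto
  moreover have "sqn (\<lambda>x. g x - h x) \<le> 2 * sqn (\<lambda>x. a n x - g x) + 2 * sqn (\<lambda>x. a n x - h x)" for n
  proof -
    have "sqn (\<lambda>x. (a n x - h x) - (a n x - g x)) \<le> 2 * sqn (\<lambda>x. a n x - h x) + 2 * sqn (\<lambda>x. a n x - g x)"
      by (intro sqn_diff_le2) auto
    then show ?thesis by (simp add: add.commute)
  qed
  ultimately have "sqn (\<lambda>x. g x - h x) \<le> 0"
    using F by (intro tendsto_lowerbound[of "\<lambda>n. 2 * sqn (\<lambda>x. a n x - g x) + 2 * sqn (\<lambda>x. a n x - h x)" _ F]) auto
  then have "sqn (\<lambda>x. g x - h x) = 0" by simp
  then show ?thesis by (subst (asm) sqn_0_iff) auto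
qed

text \<open>The rate 8^(-k) leaves room for a factor 2^k: the weighted squares of the increments
  still have a finite integral, so almost everywhere the increments decay like 2^(-k/2) and their
  series converges. Fatou's lemma then bounds the distance to the limit.\<close>

lemma riesz_fischer_geometric:
  fixes F :: "nat \<Rightarrow> 'a::euclidean_space \<Rightarrow> 'b::euclidean_space"
  assumes [measurable]: "\<And>n. F n \<in> borel_measurable borel"
    and cau: "\<And>k m. k \<le> m \<Longrightarrow> sqn (\<lambda>x. F m x - F k x) \<le> ennreal ((1 / 8) ^ k)"
  obtains G where "G \<in> borel_measurable borel" "\<And>k. sqn (\<lambda>x. F k x - G x) \<le> ennreal ((1 / 8) ^ k)"
proof -
  define G where "G x = lim (\<lambda>n. F n x)" for x
  have Gm[measurable]: "G \<in> borel_measurable borel" unfolding G_def by measurable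
  have AEconv: "AE x in lborel. (\<lambda>n. F n x) \<longlonglongrightarrow> G x"
  proof -
    define h where "h k x = ennreal (2 ^ k * (norm (F (Suc k) x - F k x))\<^sup>2)" for k x
    have [measurable]: "h k \<in> borel_measurable borel" for k unfolding h_def by measurable
    have "(\<integral>\<^sup>+x. (\<Sum>k. h k x) \<partial>lborel) = (\<Sum>k. \<integral>\<^sup>+x. h k x \<partial>lborel)"
      by (intro nn_integral_suminf) auto
    also have "\<dots> \<le> (\<Sum>k. ennreal ((1 / 4) ^ k))"
    proof (intro suminf_le summableI)
      fix k
      have "(\<integral>\<^sup>+x. h k x \<partial>lborel) = ennreal (2 ^ k) * sqn (\<lambda>x. F (Suc k) x - F k x)"
        by (simp add: h_def sqn_def ennreal_mult nn_integral_cmult)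
      also have "\<dots> \<le> ennreal (2 ^ k) * ennreal ((1 / 8) ^ k)"
        by (intro mult_left_mono cau) auto
      also have "\<dots> = ennreal (2 ^ k * (1 / 8) ^ k)" by (simp add: ennreal_mult)
      also have "(2::real) ^ k * (1 / 8) ^ k = (1 / 4) ^ k" by (simp flip: power_mult_distrib)
      finally show "(\<integral>\<^sup>+x. h k x \<partial>lborel) \<le> ennreal ((1 / 4) ^ k)" .
    qed
    also have "\<dots> = ennreal (\<Sum>k. (1 / 4) ^ k)"
      by (intro suminf_ennreal2) (auto intro: summable_geometric)
    also have "\<dots> < \<infinity>" by simp
    finally have "AE x in lborel. (\<Sum>k. h k x) \<noteq> \<infinity>"
      by (intro nn_integral_noteq_infinite) auto
    then show ?thesis
    proof eventually_elim
      case (elim x)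
      let ?d = "\<lambda>k. F (Suc k) x - F k x"
      obtain C where C: "C \<ge> 0" "(\<Sum>k. h k x) = ennreal C" using elim by (metis ennreal_cases infinity_ennreal_def)
      have "norm (?d k) \<le> sqrt C * (1 / sqrt 2) ^ k" for k
      proof -
        have "h k x \<le> (\<Sum>k. h k x)"
          using sum_le_suminf[of "\<lambda>k. h k x" "{k}"] by (simp add: summableI)
        then have "h k x \<le> ennreal C" by (simp only: C(2))
        then have "2 ^ k * (norm (?d k))\<^sup>2 \<le> C" using C(1) by (simp add: h_def)
        then have "(1 / 2) ^ k * (2 ^ k * (norm (?d k))\<^sup>2) \<le> (1 / 2) ^ k * C"
          by (intro mult_left_mono) auto
        moreover have "(1 / 2) ^ k * (2 ^ k * (norm (?d k))\<^sup>2) = (norm (?d k))\<^sup>2"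
          unfolding mult.assoc[symmetric] power_mult_distrib[symmetric] by simp
        ultimately have "(norm (?d k))\<^sup>2 \<le> C * (1 / 2) ^ k" by (simp add: mult.commute)
        then have "sqrt ((norm (?d k))\<^sup>2) \<le> sqrt (C * (1 / 2) ^ k)" by (rule real_sqrt_le_mono)
        also have "\<dots> = sqrt C * (1 / sqrt 2) ^ k"
          unfolding real_sqrt_mult real_sqrt_power real_sqrt_divide real_sqrt_one ..
        finally show ?thesis by simp
      qed
      moreover have "summable (\<lambda>k. sqrt C * (1 / sqrt 2) ^ k)"
        by (intro summable_mult summable_geometric) (simp only: norm_divide, simp)
      ultimately have "summable ?d" by (rule summable_comparison_test'[where N=0, rotated])
      then have "convergent (\<lambda>n. F 0 x + (\<Sum>k<n. ?d k))"
        by (intro convergent_add convergent_const) (simp only: summable_iff_convergent)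
      moreover have "F 0 x + (\<Sum>k<n. ?d k) = F n x" for n
        using sum_lessThan_telescope[of "\<lambda>k. F k x" n] by simp
      ultimately have "convergent (\<lambda>n. F n x)" by simp
      then show ?case unfolding G_def by (simp add: convergent_LIMSEQ_iff)
    qed
  qed
  have "sqn (\<lambda>x. F k x - G x) \<le> ennreal ((1 / 8) ^ k)" for k
  proof -
    have "sqn (\<lambda>x. F k x - G x) = (\<integral>\<^sup>+x. liminf (\<lambda>m. ennreal ((norm (F m x - F k x))\<^sup>2)) \<partial>lborel)"
      unfolding sqn_def
    proof (rule nn_integral_cong_AE)
      show "AE x in lborel. ennreal ((norm (F k x - G x))\<^sup>2) = liminf (\<lambda>m. ennreal ((norm (F m x - F k x))\<^sup>2))"
        using AEconv
      proof eventually_elim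
        case (elim x)
        have "(\<lambda>m. ennreal ((norm (F m x - F k x))\<^sup>2)) \<longlonglongrightarrow> ennreal ((norm (G x - F k x))\<^sup>2)"
          by (intro tendsto_ennrealI tendsto_intros elim)
        from lim_imp_Liminf[OF sequentially_bot this] show ?case by (simp only: norm_minus_commute[of "F k x" "G x"])
      qed
    qed
    also have "\<dots> \<le> liminf (\<lambda>m. sqn (\<lambda>x. F m x - F k x))"
      unfolding sqn_def by (intro nn_integral_liminf) auto
    also have "\<dots> \<le> ennreal ((1 / 8) ^ k)"
      by (rule Liminf_le) (auto simp: eventually_sequentially intro!: exI[of _ k] cau)
    finally show ?thesis .
  qed
  with Gm that show thesis by blast
qed

section \<open>The Fourier transform of vector-valued functions\<close>

lemma norm_vector_smult: "norm (c *s v) = cmod c * norm (v::complex^'n)"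
proof -
  have "norm (c *s v) = L2_set (\<lambda>i. cmod c * norm (v $ i)) UNIV"
    by (simp add: norm_vec_def norm_mult)
  then show ?thesis by (simp add: norm_vec_def L2_set_right_distrib)
qed

lemma bounded_bilinear_vector_smult: "bounded_bilinear ((*s) :: complex \<Rightarrow> complex^'n \<Rightarrow> complex^'n)"
proof
  show "\<exists>K. \<forall>a (b::complex^'n). norm (a *s b) \<le> norm a * norm b * K"
    by (intro exI[of _ 1]) (simp add: norm_vector_smult)
qed (simp_all add: vec_eq_iff algebra_simps)

lemma bounded_bilinear_matrix_vector_mult:
  "bounded_bilinear ((*v) :: complex^'n^'m \<Rightarrow> complex^'n \<Rightarrow> complex^'m)"
proof -
  have "bilinear ((*v) :: complex^'n^'m \<Rightarrow> complex^'n \<Rightarrow> complex^'m)"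
    unfolding bilinear_def
    by (auto intro!: linearI simp: vec_eq_iff matrix_vector_mult_def sum.distrib algebra_simps scaleR_sum_right)
  then show ?thesis by (simp add: bilinear_conv_bounded_bilinear)
qed

lemma borel_measurable_vector_smult [measurable (raw)]:
  fixes f :: "'a \<Rightarrow> complex" and g :: "'a \<Rightarrow> complex^'n"
  assumes "f \<in> borel_measurable M" "g \<in> borel_measurable M"
  shows "(\<lambda>x. f x *s g x) \<in> borel_measurable M"
  using assms
  by (rule borel_measurable_continuous_Pair)
     (intro bounded_bilinear.continuous_on[OF bounded_bilinear_vector_smult] continuous_intros)

lemma borel_measurable_matrix_vector_mult [measurable (raw)]:
  fixes f :: "'a \<Rightarrow> complex^'n^'m" and g :: "'a \<Rightarrow> complex^'n"
  assumes "f \<in> borel_measurable M" "g \<in> borel_measurable M"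
  shows "(\<lambda>x. f x *v g x) \<in> borel_measurable M"
  using assms
  by (rule borel_measurable_continuous_Pair)
     (intro bounded_bilinear.continuous_on[OF bounded_bilinear_matrix_vector_mult] continuous_intros)

lemma borel_measurable_vec_nth [measurable (raw)]:
  fixes f :: "'a \<Rightarrow> 'b::euclidean_space^'n"
  assumes "f \<in> borel_measurable M"
  shows "(\<lambda>x. f x $ i) \<in> borel_measurable M"
  by (rule measurable_compose[OF assms]) (intro borel_measurable_continuous_onI continuous_intros)

lemma norm_vec_power2: "(norm (v::complex^'n))\<^sup>2 = (\<Sum>i\<in>UNIV. (norm (v $ i))\<^sup>2)"
  by (simp add: norm_vec_def L2_set_def sum_nonneg)

lemma sqn_vec:
  fixes f :: "'a::euclidean_space \<Rightarrow> complex^'n"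
  assumes [measurable]: "f \<in> borel_measurable borel"
  shows "sqn f = (\<Sum>i\<in>UNIV. sqn (\<lambda>x. f x $ i))"
proof -
  have "sqn f = (\<integral>\<^sup>+x. (\<Sum>i\<in>UNIV. ennreal ((norm (f x $ i))\<^sup>2)) \<partial>lborel)"
    by (simp add: sqn_def norm_vec_power2)
  also have "\<dots> = (\<Sum>i\<in>UNIV. sqn (\<lambda>x. f x $ i))"
    unfolding sqn_def by (intro nn_integral_sum) auto
  finally show ?thesis .
qed

lemma L2_sqnorm_eq_sqn: "L2_sqnorm f = sqn f"
  by (simp add: L2_sqnorm_def sqn_def)

lemma L2_space_iff: "f \<in> L2_space \<longleftrightarrow> f \<in> borel_measurable borel \<and> sqn f < \<infinity>"
  by (simp add: L2_space_def L2_sqnorm_eq_sqn)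

lemma fourier_integrable:
  fixes f :: "real^'d \<Rightarrow> complex^'n"
  assumes "integrable lborel f"
  shows "integrable lborel (\<lambda>x. exp (- \<i> * of_real (x \<bullet> \<xi>)) *s f x)"
  by (rule Bochner_Integration.integrable_bound[OF assms]) (use assms in \<open>auto simp: norm_vector_smult\<close>)

lemma fourier_nth:
  fixes f :: "real^'d \<Rightarrow> complex^'n"
  assumes "integrable lborel f"
  shows "fourier f \<xi> $ i = ft (\<lambda>x. f x $ i) \<xi>"
  unfolding fourier_def ft_def
  by (subst integral_bounded_linear[OF bounded_linear_vec_nth, symmetric])
     (use fourier_integrable[OF assms] in simp_all)

lemma fourier_measurable [measurable]:
  fixes f :: "real^'d \<Rightarrow> complex^'n"
  assumes [measurable]: "f \<in> borel_measurable borel"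
  shows "fourier f \<in> borel_measurable borel"
  unfolding fourier_def by measurable

theorem plancherel:
  fixes f :: "real^'d \<Rightarrow> complex^'n"
  assumes f: "integrable lborel f" and fin: "sqn f < \<infinity>"
  shows "sqn (fourier f) = ennreal ((2 * pi) ^ CARD('d)) * sqn f"
proof -
  have [measurable]: "f \<in> borel_measurable borel" using f by auto
  have i: "integrable lborel (\<lambda>x. f x $ i)" for i
    using integrable_bounded_linear[OF bounded_linear_vec_nth f] .
  have "sqn (\<lambda>x. f x $ i) \<le> sqn f" for i
    unfolding sqn_def by (intro nn_integral_mono ennreal_leI power_mono) (auto simp: component_le_norm_cart Finite_Cartesian_Product.norm_nth_le)
  then have si: "sqn (\<lambda>x. f x $ i) < \<infinity>" for i using fin le_less_trans by blast
  have "sqn (fourier f) = (\<Sum>i\<in>UNIV. sqn (ft (\<lambda>x. f x $ i)))"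
    by (subst sqn_vec) (simp_all add: fourier_nth[OF f] fun_eq_iff[symmetric])
  also have "\<dots> = (\<Sum>i\<in>UNIV. ennreal ((2 * pi) ^ CARD('d)) * sqn (\<lambda>x. f x $ i))"
    using plancherel_complex[OF i si] by simp
  also have "\<dots> = ennreal ((2 * pi) ^ CARD('d)) * sqn f"
    by (simp add: sqn_vec sum_distrib_left)
  finally show ?thesis .
qed

lemma fourier_diff:
  fixes f g :: "real^'d \<Rightarrow> complex^'n"
  assumes "integrable lborel f" "integrable lborel g"
  shows "fourier (\<lambda>x. f x - g x) \<xi> = fourier f \<xi> - fourier g \<xi>"
proof -
  have "exp (- \<i> * of_real (x \<bullet> \<xi>)) *s (f x - g x) = exp (- \<i> * of_real (x \<bullet> \<xi>)) *s f x - exp (- \<i> * of_real (x \<bullet> \<xi>)) *s g x" for x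
    by (simp add: vec_eq_iff algebra_simps)
  then show ?thesis
    unfolding fourier_def using fourier_integrable[OF assms(1)] fourier_integrable[OF assms(2)] by simp
qed

text \<open>On a set of finite measure, |f| \<le> 1 + |f|^2 takes the place of Hoelder's
  inequality.\<close>

lemma bounded_support_integrable:
  fixes f :: "'a::euclidean_space \<Rightarrow> 'b::euclidean_space"
  assumes [measurable]: "f \<in> borel_measurable borel" and fin: "sqn f < \<infinity>"
    and B[measurable]: "B \<in> sets borel" and Bfin: "emeasure lborel B < \<infinity>" and supp: "AE x in lborel. x \<notin> B \<longrightarrow> f x = 0"
  shows "integrable lborel f"
proof (rule integrableI_bounded)
  have "(\<integral>\<^sup>+x. ennreal (norm (f x)) \<partial>lborel) \<le> (\<integral>\<^sup>+x. indicator B x + ennreal ((norm (f x))\<^sup>2) \<partial>lborel)"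
  proof (rule nn_integral_mono_AE)
    show "AE x in lborel. ennreal (norm (f x)) \<le> indicator B x + ennreal ((norm (f x))\<^sup>2)"
      using supp
    proof eventually_elim
      case (elim x)
      have "2 * norm (f x) \<le> 1 + (norm (f x))\<^sup>2"
        using sum_squares_bound[of "1::real" "norm (f x)"] by simp
      then have "norm (f x) \<le> 1 + (norm (f x))\<^sup>2"
        using norm_ge_zero[of "f x"] by linarith
      then have "ennreal (norm (f x)) \<le> 1 + ennreal ((norm (f x))\<^sup>2)"
        by (simp add: ennreal_plus[symmetric] flip: ennreal_1 del: ennreal_plus)
      then show ?case using elim by (cases "x \<in> B") auto
    qed
  qed
  also have "\<dots> = emeasure lborel B + sqn f" by (simp add: nn_integral_add sqn_def)
  also have "\<dots> < \<infinity>" using fin Bfin by simp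
  finally show "(\<integral>\<^sup>+x. ennreal (norm (f x)) \<partial>lborel) < \<infinity>" .
qed simp

section \<open>Truncations and the transform on L^2\<close>

abbreviation trunc :: "real \<Rightarrow> ('a::euclidean_space \<Rightarrow> 'b::euclidean_space) \<Rightarrow> 'a \<Rightarrow> 'b" where
  "trunc R f \<equiv> (\<lambda>x. indicator (ball 0 R) x *\<^sub>R f x)"

lemma ball_borel [measurable]: "ball (a::'a::metric_space) r \<in> sets borel" "cball a r \<in> sets borel"
  by auto

lemma sqn_indicator_le: "sqn (\<lambda>x. indicator A x *\<^sub>R f x) \<le> sqn f"
  unfolding sqn_def by (intro nn_integral_mono ennreal_leI) (auto split: split_indicator)

lemma trunc_integrable:
  fixes f :: "'a::euclidean_space \<Rightarrow> 'b::euclidean_space"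
  assumes [measurable]: "f \<in> borel_measurable borel" and fin: "sqn f < \<infinity>"
  shows "integrable lborel (trunc R f)"
proof (rule bounded_support_integrable[where B="ball 0 R"])
  show "sqn (trunc R f) < \<infinity>" using sqn_indicator_le fin by (rule le_less_trans)
  show "emeasure lborel (ball (0::'a) R) < \<infinity>" by (intro emeasure_bounded_finite bounded_ball)
qed auto

lemma trunc_tendsto:
  fixes f :: "'a::euclidean_space \<Rightarrow> 'b::euclidean_space"
  assumes [measurable]: "f \<in> borel_measurable borel" and fin: "sqn f < \<infinity>"
  shows "(\<lambda>n. sqn (\<lambda>x. trunc (real n) f x - f x)) \<longlonglongrightarrow> 0"
proof -
  have "(\<lambda>n. sqn (\<lambda>x. trunc (real n) f x - f x)) \<longlonglongrightarrow> (\<integral>\<^sup>+x. 0 \<partial>(lborel :: 'a measure))"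
    unfolding sqn_def
  proof (rule nn_integral_dominated_convergence[where w="\<lambda>x. ennreal ((norm (f x))\<^sup>2)"])
    show "AE x in lborel. (\<lambda>n. ennreal ((norm (trunc (real n) f x - f x))\<^sup>2)) \<longlonglongrightarrow> 0"
    proof (rule AE_I2)
      fix x :: 'a
      obtain N where "norm x < real N" using reals_Archimedean2 by blast
      then have "\<forall>\<^sub>F n in sequentially. ennreal ((norm (trunc (real n) f x - f x))\<^sup>2) = 0"
        by (intro eventually_sequentiallyI[of N]) (auto simp: indicator_def)
      then show "(\<lambda>n. ennreal ((norm (trunc (real n) f x - f x))\<^sup>2)) \<longlonglongrightarrow> 0" by (rule tendsto_eventually)
    qed
    show "AE x in lborel. ennreal ((norm (trunc (real j) f x - f x))\<^sup>2) \<le> ennreal ((norm (f x))\<^sup>2)" for j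
      by (auto split: split_indicator)
    show "(\<integral>\<^sup>+x. ennreal ((norm (f x))\<^sup>2) \<partial>lborel) < \<infinity>" using fin by (simp add: sqn_def)
  qed auto
  then show ?thesis by simp
qed

lemma trunc_diff_mono:
  assumes "S \<le> R" "S \<le> R'"
  shows "sqn (\<lambda>x. trunc R f x - trunc R' f x) \<le> sqn (\<lambda>x. trunc S f x - f x)"
  unfolding sqn_def using assms
  by (intro nn_integral_mono ennreal_leI) (auto simp: indicator_def)

text \<open>Plancherel turns the Cauchy property of the truncations of f into that of their
  transforms. Completeness along a fast sequence of radii gives the limit, and the Cauchy estimate,
  valid for all real radii, extends the convergence to \<open>at_top\<close>.\<close>

lemma L2_fourier_exists:
  fixes f :: "real^'d \<Rightarrow> complex^'n"
  assumes "f \<in> L2_space"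
  shows "\<exists>g. g \<in> L2_space \<and> ((\<lambda>R::real. L2_sqnorm (\<lambda>\<xi>. fourier (trunc R f) \<xi> - g \<xi>)) \<longlongrightarrow> 0) at_top"
proof -
  have [measurable]: "f \<in> borel_measurable borel" and fin: "sqn f < \<infinity>"
    using assms by (auto simp: L2_space_iff)
  let ?c = "(2 * pi) ^ CARD('d)"
  have cauchy: "sqn (\<lambda>\<xi>. fourier (trunc R f) \<xi> - fourier (trunc R' f) \<xi>) \<le> ennreal ?c * sqn (\<lambda>x. trunc S f x - f x)"
    if "S \<le> R" "S \<le> R'" for R R' S
  proof -
    let ?h = "\<lambda>x. trunc R f x - trunc R' f x"
    have "sqn ?h < \<infinity>"
      by (intro sqn_diff_finite le_less_trans[OF sqn_indicator_le fin]) auto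
    moreover have "integrable lborel ?h"
      by (intro Bochner_Integration.integrable_diff trunc_integrable fin) auto
    ultimately have "sqn (fourier ?h) = ennreal ?c * sqn ?h" by (intro plancherel)
    also have "\<dots> \<le> ennreal ?c * sqn (\<lambda>x. trunc S f x - f x)"
      by (intro mult_left_mono trunc_diff_mono that) auto
    also have "fourier ?h = (\<lambda>\<xi>. fourier (trunc R f) \<xi> - fourier (trunc R' f) \<xi>)"
      by (intro ext fourier_diff trunc_integrable fin) auto
    finally show ?thesis .
  qed
  have tail: "(\<lambda>n. ennreal ?c * sqn (\<lambda>x. trunc (real n) f x - f x)) \<longlonglongrightarrow> ennreal ?c * 0"
    by (intro ennreal_tendsto_cmult trunc_tendsto fin) auto
  have "\<exists>n. ennreal ?c * sqn (\<lambda>x. trunc (real n) f x - f x) \<le> ennreal ((1 / 8) ^ k)" for k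
  proof -
    have "\<forall>\<^sub>F n in sequentially. ennreal ?c * sqn (\<lambda>x. trunc (real n) f x - f x) < ennreal ((1 / 8) ^ k)"
      using tail by (intro order_tendstoD) auto
    then show ?thesis by (auto simp: eventually_sequentially intro: less_imp_le)
  qed
  then have "\<forall>k. \<exists>n. ennreal ?c * sqn (\<lambda>x. trunc (real n) f x - f x) \<le> ennreal ((1 / 8) ^ k)" by blast
  from choice[OF this] obtain r0 where
    "\<forall>k. ennreal ?c * sqn (\<lambda>x. trunc (real (r0 k)) f x - f x) \<le> ennreal ((1 / 8) ^ k)" ..
  then have r0: "ennreal ?c * sqn (\<lambda>x. trunc (real (r0 k)) f x - f x) \<le> ennreal ((1 / 8) ^ k)" for k ..
  \<comment> \<open>Taking maxima gives r m \<ge> r0 k for all m \<ge> k, so that both radii r k and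
    r m lie beyond the threshold belonging to k.\<close>
  define r where "r k = Max (r0 ` {..k})" for k
  have r_ge: "r0 k \<le> r m" if "k \<le> m" for k m
    unfolding r_def using that by (intro Max_ge) auto
  have cau: "sqn (\<lambda>\<xi>. fourier (trunc (real (r m)) f) \<xi> - fourier (trunc (real (r k)) f) \<xi>) \<le> ennreal ((1 / 8) ^ k)" if "k \<le> m" for k m
    using cauchy[of "real (r0 k)" "real (r m)" "real (r k)"] r_ge[OF that] r_ge[of k k] r0[of k] by (auto intro: order_trans)
  have meas: "fourier (trunc (real (r k)) f) \<in> borel_measurable borel" for k by measurable
  obtain G where G[measurable]: "G \<in> borel_measurable borel"
    and GF: "\<And>k. sqn (\<lambda>\<xi>. fourier (trunc (real (r k)) f) \<xi> - G \<xi>) \<le> ennreal ((1 / 8) ^ k)"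
    by (rule riesz_fischer_geometric[of "\<lambda>k. fourier (trunc (real (r k)) f)", OF meas cau]) blast+
  have "sqn (fourier (trunc (real (r 0)) f)) < \<infinity>"
    using le_less_trans[OF sqn_indicator_le fin, of "ball 0 (real (r 0))"]
    by (subst plancherel[OF trunc_integrable[OF _ fin]]) (auto simp: ennreal_mult_less_top)
  moreover have "sqn (\<lambda>\<xi>. fourier (trunc (real (r 0)) f) \<xi> - G \<xi>) < \<infinity>"
    using GF[of 0] by (rule le_less_trans) simp
  ultimately have "sqn (\<lambda>\<xi>. fourier (trunc (real (r 0)) f) \<xi> - (fourier (trunc (real (r 0)) f) \<xi> - G \<xi>)) < \<infinity>"
    by (rule sqn_diff_finite[rotated 2]) measurable
  then have "G \<in> L2_space" by (simp add: L2_space_iff)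
  moreover have "((\<lambda>R::real. sqn (\<lambda>\<xi>. fourier (trunc R f) \<xi> - G \<xi>)) \<longlongrightarrow> 0) at_top"
  proof (rule order_tendstoI)
    fix e :: ennreal assume "0 < e"
    have "(\<lambda>k. 4 * ennreal ((1 / 8) ^ k)) \<longlonglongrightarrow> 4 * ennreal 0"
      by (intro ennreal_tendsto_cmult tendsto_ennrealI LIMSEQ_realpow_zero) auto
    then have "\<forall>\<^sub>F k in sequentially. 4 * ennreal ((1 / 8) ^ k) < e"
      using \<open>0 < e\<close> by (intro order_tendstoD) auto
    then obtain k where k: "4 * ennreal ((1 / 8) ^ k) < e" by (auto simp: eventually_sequentially)
    have "sqn (\<lambda>\<xi>. fourier (trunc R f) \<xi> - G \<xi>) < e" if "R \<ge> real (r k)" for R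
    proof -
      let ?a = "\<lambda>\<xi>. fourier (trunc R f) \<xi> - fourier (trunc (real (r k)) f) \<xi>"
        and ?b = "\<lambda>\<xi>. fourier (trunc (real (r k)) f) \<xi> - G \<xi>"
      have "sqn (\<lambda>\<xi>. ?a \<xi> + ?b \<xi>) \<le> 2 * sqn ?a + 2 * sqn ?b" by (intro sqn_add_le2) auto
      also have "\<dots> \<le> 2 * ennreal ((1 / 8) ^ k) + 2 * ennreal ((1 / 8) ^ k)"
        using cauchy[of "real (r0 k)" R "real (r k)"] r_ge[of k k] that r0[of k] GF[of k]
        by (intro add_mono mult_left_mono) (auto intro: order_trans)
      also have "\<dots> = 4 * ennreal ((1 / 8) ^ k)" by (simp flip: distrib_right)
      finally show ?thesis using k by simp
    qed
    then show "\<forall>\<^sub>F R in at_top. sqn (\<lambda>\<xi>. fourier (trunc R f) \<xi> - G \<xi>) < e"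
      by (auto simp: eventually_at_top_linorder)
  qed simp
  ultimately show ?thesis by (auto simp: L2_sqnorm_eq_sqn)
qed

lemma L2_fourier_props:
  fixes f :: "real^'d \<Rightarrow> complex^'n"
  assumes "f \<in> L2_space"
  shows L2_fourier_measurable: "L2_fourier f \<in> borel_measurable borel"
    and L2_fourier_finite: "sqn (L2_fourier f) < \<infinity>"
    and L2_fourier_tendsto: "(\<lambda>n. sqn (\<lambda>\<xi>. fourier (trunc (real n) f) \<xi> - L2_fourier f \<xi>)) \<longlonglongrightarrow> 0"
proof -
  have *: "L2_fourier f \<in> L2_space \<and> ((\<lambda>R::real. L2_sqnorm (\<lambda>\<xi>. fourier (trunc R f) \<xi> - L2_fourier f \<xi>)) \<longlongrightarrow> 0) at_top"
    unfolding L2_fourier_def using L2_fourier_exists[OF assms] by (rule someI_ex)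
  then show "L2_fourier f \<in> borel_measurable borel" "sqn (L2_fourier f) < \<infinity>"
    by (auto simp: L2_space_iff)
  show "(\<lambda>n. sqn (\<lambda>\<xi>. fourier (trunc (real n) f) \<xi> - L2_fourier f \<xi>)) \<longlonglongrightarrow> 0"
    using * filterlim_compose[OF _ filterlim_real_sequentially] by (auto simp: L2_sqnorm_eq_sqn)
qed

text \<open>The transform is fixed by a choice, so it can be identified only almost everywhere.
  Integer radii suffice for this because two L^2-limits of one sequence agree almost
  everywhere.\<close>

lemma L2_fourier_unique:
  fixes f :: "real^'d \<Rightarrow> complex^'n"
  assumes f: "f \<in> L2_space" and g[measurable]: "g \<in> borel_measurable borel"
    and lim: "(\<lambda>n. sqn (\<lambda>\<xi>. fourier (trunc (real n) f) \<xi> - g \<xi>)) \<longlonglongrightarrow> 0"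
  shows "AE \<xi> in lborel. L2_fourier f \<xi> = g \<xi>"
proof -
  have [measurable]: "f \<in> borel_measurable borel" "L2_fourier f \<in> borel_measurable borel"
    using f L2_fourier_measurable[OF f] by (auto simp: L2_space_iff)
  show ?thesis
    by (rule sqn_limit_unique[OF _ _ _ L2_fourier_tendsto[OF f] lim]) auto
qed

lemma L2_fourier_isometry:
  fixes f :: "real^'d \<Rightarrow> complex^'n"
  assumes f: "f \<in> L2_space"
  shows "sqn (L2_fourier f) = ennreal ((2 * pi) ^ CARD('d)) * sqn f"
proof -
  have [measurable]: "f \<in> borel_measurable borel" and fin: "sqn f < \<infinity>"
    using f by (auto simp: L2_space_iff)
  have tfin: "sqn (trunc (real n) f) < \<infinity>" for n
    using sqn_indicator_le fin by (rule le_less_trans)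
  have pl: "sqn (fourier (trunc (real n) f)) = ennreal ((2 * pi) ^ CARD('d)) * sqn (trunc (real n) f)" for n
    using tfin trunc_integrable[OF _ fin] by (intro plancherel) auto
  have "(\<lambda>n. sqn (fourier (trunc (real n) f))) \<longlonglongrightarrow> sqn (L2_fourier f)"
    using tfin by (intro sqn_tendsto L2_fourier_props[OF f]) (auto simp: pl ennreal_mult_less_top)
  moreover have "(\<lambda>n. ennreal ((2 * pi) ^ CARD('d)) * sqn (trunc (real n) f)) \<longlonglongrightarrow> ennreal ((2 * pi) ^ CARD('d)) * sqn f"
    using tfin fin by (intro ennreal_tendsto_cmult sqn_tendsto trunc_tendsto) auto
  ultimately show ?thesis unfolding pl by (rule LIMSEQ_unique)
qed

lemma L2_space_diff:
  assumes "f \<in> L2_space" "g \<in> L2_space"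
  shows "(\<lambda>x. f x - g x) \<in> L2_space"
proof -
  have "sqn (\<lambda>x. f x - g x) < \<infinity>" using assms by (intro sqn_diff_finite) (simp_all add: L2_space_iff)
  then show ?thesis using assms by (simp add: L2_space_iff borel_measurable_diff)
qed

lemma L2_fourier_diff:
  fixes f g :: "real^'d \<Rightarrow> complex^'n"
  assumes f: "f \<in> L2_space" and g: "g \<in> L2_space"
  shows "AE \<xi> in lborel. L2_fourier (\<lambda>x. f x - g x) \<xi> = L2_fourier f \<xi> - L2_fourier g \<xi>"
proof (rule L2_fourier_unique[OF L2_space_diff[OF f g]])
  have [measurable]: "f \<in> borel_measurable borel" "L2_fourier f \<in> borel_measurable borel"
     "g \<in> borel_measurable borel" "L2_fourier g \<in> borel_measurable borel" and fin: "sqn f < \<infinity>" "sqn g < \<infinity>"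
    using f g L2_fourier_measurable[OF f] L2_fourier_measurable[OF g] by (auto simp: L2_space_iff)
  show "(\<lambda>\<xi>. L2_fourier f \<xi> - L2_fourier g \<xi>) \<in> borel_measurable borel" by measurable
  let ?a = "\<lambda>n \<xi>. fourier (trunc (real n) f) \<xi> - L2_fourier f \<xi>" and ?b = "\<lambda>n \<xi>. fourier (trunc (real n) g) \<xi> - L2_fourier g \<xi>"
  have lim: "(\<lambda>n. 2 * sqn (?a n) + 2 * sqn (?b n)) \<longlonglongrightarrow> 2 * 0 + 2 * 0"
    by (intro tendsto_add ennreal_tendsto_cmult L2_fourier_tendsto f g) auto
  have eq: "fourier (trunc (real n) (\<lambda>x. f x - g x)) \<xi> - (L2_fourier f \<xi> - L2_fourier g \<xi>) = ?a n \<xi> - ?b n \<xi>" for n \<xi>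
  proof -
    have "fourier (\<lambda>x. trunc (real n) f x - trunc (real n) g x) \<xi> = fourier (trunc (real n) f) \<xi> - fourier (trunc (real n) g) \<xi>"
      by (intro fourier_diff trunc_integrable fin) auto
    then show ?thesis by (simp add: scaleR_diff_right)
  qed
  show "(\<lambda>n. sqn (\<lambda>\<xi>. fourier (trunc (real n) (\<lambda>x. f x - g x)) \<xi> - (L2_fourier f \<xi> - L2_fourier g \<xi>))) \<longlonglongrightarrow> 0"
    unfolding eq
    by (rule tendsto_sandwich[OF _ _ tendsto_const, of _ _ _ "\<lambda>n. 2 * sqn (?a n) + 2 * sqn (?b n)"])
       (use lim in \<open>auto intro!: always_eventually sqn_diff_le2\<close>)
qed

section \<open>Fourier inversion in L^2\<close>

lemma inverse_fourier_eq:
  fixes g :: "real^'d \<Rightarrow> complex^'n"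
  shows "inverse_fourier g x = (1 / (2 * pi) ^ CARD('d)) *\<^sub>R fourier g (- x)"
  by (simp add: inverse_fourier_def fourier_def inner_commute)

lemma sqn_reflect:
  fixes f :: "'a::euclidean_space \<Rightarrow> 'b::euclidean_space"
  assumes [measurable]: "f \<in> borel_measurable borel"
  shows "sqn (\<lambda>x. f (- x)) = sqn f"
  unfolding sqn_def by (subst (2) lborel_affine_nn_integral[of _ "-1" 0]) auto

lemma inverse_fourier_measurable [measurable]:
  fixes g :: "real^'d \<Rightarrow> complex^'n"
  assumes [measurable]: "g \<in> borel_measurable borel"
  shows "inverse_fourier g \<in> borel_measurable borel"
  unfolding inverse_fourier_eq[abs_def] by measurable

lemma sqn_inverse_fourier:
  fixes g :: "real^'d \<Rightarrow> complex^'n"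
  assumes g: "integrable lborel g" and fin: "sqn g < \<infinity>"
  shows "sqn (inverse_fourier g) = ennreal (1 / (2 * pi) ^ CARD('d)) * sqn g"
proof -
  have [measurable]: "g \<in> borel_measurable borel" using g by auto
  let ?c = "1 / (2 * pi) ^ CARD('d)"
  have "sqn (inverse_fourier g) = ennreal (?c\<^sup>2) * sqn (\<lambda>x. fourier g (- x))"
    unfolding inverse_fourier_eq[abs_def] by (rule sqn_cmult) measurable
  also have "sqn (\<lambda>x. fourier g (- x)) = ennreal ((2 * pi) ^ CARD('d)) * sqn g"
    by (subst sqn_reflect) (simp_all add: plancherel[OF g fin])
  also have "ennreal (?c\<^sup>2) * (ennreal ((2 * pi) ^ CARD('d)) * sqn g) = ennreal (?c\<^sup>2 * (2 * pi) ^ CARD('d)) * sqn g"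
    by (simp add: ennreal_mult mult.assoc)
  also have "?c\<^sup>2 * (2 * pi) ^ CARD('d) = ?c" by (simp add: power2_eq_square)
  finally show ?thesis .
qed

lemma inverse_fourier_L2_space:
  fixes g :: "real^'d \<Rightarrow> complex^'n"
  assumes g: "integrable lborel g" and fin: "sqn g < \<infinity>"
  shows "inverse_fourier g \<in> L2_space"
proof -
  have [measurable]: "g \<in> borel_measurable borel" using g by auto
  show ?thesis using sqn_inverse_fourier[OF assms] fin
    by (auto simp: L2_space_iff ennreal_mult_less_top)
qed

lemma inner_vector_smult:
  fixes u v :: "complex^'n"
  shows "(c *s u) \<bullet> v = u \<bullet> (cnj c *s v)"
  by (simp add: inner_vec_def inner_complex_def algebra_simps)

text \<open>With respect to the real inner product, multiplication by a complex number has
  multiplication by its conjugate as adjoint; conjugating the exponential accounts for the reflected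
  argument -x.\<close>

lemma fourier_adjoint:
  fixes f g :: "real^'d \<Rightarrow> complex^'n"
  assumes f: "integrable lborel f" and g: "integrable lborel g"
  shows "(\<integral>\<xi>. fourier f \<xi> \<bullet> g \<xi> \<partial>lborel) = (\<integral>x. f x \<bullet> fourier g (- x) \<partial>lborel)"
proof -
  have [measurable]: "f \<in> borel_measurable borel" "g \<in> borel_measurable borel" using f g by auto
  let ?e = "\<lambda>x \<xi>. exp (- \<i> * of_real (x \<bullet> \<xi>))"
  have 1: "fourier f \<xi> \<bullet> g \<xi> = (\<integral>x. (?e x \<xi> *s f x) \<bullet> g \<xi> \<partial>lborel)" for \<xi>
    unfolding fourier_def using fourier_integrable[OF f] by (intro integral_inner_left[symmetric]) auto
  have 2: "f x \<bullet> fourier g (- x) = (\<integral>\<xi>. (?e x \<xi> *s f x) \<bullet> g \<xi> \<partial>lborel)" for x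
  proof -
    have "f x \<bullet> fourier g (- x) = (\<integral>\<xi>. f x \<bullet> (exp (- \<i> * of_real (\<xi> \<bullet> (- x))) *s g \<xi>) \<partial>lborel)"
      unfolding fourier_def by (rule integral_inner_right[symmetric], rule fourier_integrable[OF g])
    also have "\<dots> = (\<integral>\<xi>. (?e x \<xi> *s f x) \<bullet> g \<xi> \<partial>lborel)"
      by (simp only: inner_vector_smult) (simp add: exp_cnj inner_commute[of _ x])
    finally show ?thesis .
  qed
  have "integrable (lborel \<Otimes>\<^sub>M lborel) (\<lambda>(x, \<xi>). (?e x \<xi> *s f x) \<bullet> g \<xi>)"
  proof (rule Bochner_Integration.integrable_bound)
    show "integrable (lborel \<Otimes>\<^sub>M lborel) (\<lambda>p. norm (f (fst p)) * norm (g (snd p)))"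
      using f g by (intro lborel_pair_integrable_mult) auto
    show "(\<lambda>(x, \<xi>). (?e x \<xi> *s f x) \<bullet> g \<xi>) \<in> borel_measurable (lborel \<Otimes>\<^sub>M lborel)"
      unfolding split_beta' lborel_prod measurable_lborel2 borel_prod[symmetric] by measurable
    show "AE p in lborel \<Otimes>\<^sub>M lborel. norm (case p of (x, \<xi>) \<Rightarrow> (?e x \<xi> *s f x) \<bullet> g \<xi>) \<le> norm (norm (f (fst p)) * norm (g (snd p)))"
      by (auto intro!: AE_I2 Cauchy_Schwarz_ineq2[THEN order_trans] simp: norm_vector_smult split_beta')
  qed
  then show ?thesis unfolding 1 2 by (rule lborel_pair.Fubini_integral)
qed

lemma sqn_diff_expand:
  fixes f g :: "'a::euclidean_space \<Rightarrow> 'b::euclidean_space"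
  assumes [measurable]: "f \<in> borel_measurable borel" "g \<in> borel_measurable borel"
    and f: "sqn f < \<infinity>" and g: "sqn g < \<infinity>"
  shows "integrable lborel (\<lambda>x. f x \<bullet> g x)"
    and "sqn (\<lambda>x. f x - g x) = ennreal (enn2real (sqn f) - 2 * (\<integral>x. f x \<bullet> g x \<partial>lborel) + enn2real (sqn g))"
proof -
  note F = sqn_finite[OF _ f] and G = sqn_finite[OF _ g] and D = sqn_finite[OF _ sqn_diff_finite[OF _ _ f g]]
  show I: "integrable lborel (\<lambda>x. f x \<bullet> g x)"
  proof (rule Bochner_Integration.integrable_bound)
    show "integrable lborel (\<lambda>x. (norm (f x))\<^sup>2 + (norm (g x))\<^sup>2)" using F(1) G(1) by simp
    show "AE x in lborel. norm (f x \<bullet> g x) \<le> norm ((norm (f x))\<^sup>2 + (norm (g x))\<^sup>2)"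
    proof (rule AE_I2)
      fix x
      have "\<bar>f x \<bullet> g x\<bar> \<le> norm (f x) * norm (g x)" by (rule Cauchy_Schwarz_ineq2)
      then show "norm (f x \<bullet> g x) \<le> norm ((norm (f x))\<^sup>2 + (norm (g x))\<^sup>2)"
        using sum_squares_bound[of "norm (f x)" "norm (g x)"] mult_nonneg_nonneg[OF norm_ge_zero[of "f x"] norm_ge_zero[of "g x"]]
        unfolding real_norm_def by linarith
    qed
  qed measurable
  have "(\<integral>x. (norm (f x - g x))\<^sup>2 \<partial>lborel) = (\<integral>x. ((norm (f x))\<^sup>2 - 2 * (f x \<bullet> g x)) + (norm (g x))\<^sup>2 \<partial>lborel)"
    by (intro Bochner_Integration.integral_cong) (auto simp: power2_norm_eq_inner inner_diff_left inner_diff_right inner_commute)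
  also have "\<dots> = (\<integral>x. (norm (f x))\<^sup>2 \<partial>lborel) - 2 * (\<integral>x. f x \<bullet> g x \<partial>lborel) + (\<integral>x. (norm (g x))\<^sup>2 \<partial>lborel)"
    using F(1) G(1) I by simp
  finally show "sqn (\<lambda>x. f x - g x) = ennreal (enn2real (sqn f) - 2 * (\<integral>x. f x \<bullet> g x \<partial>lborel) + enn2real (sqn g))"
    using D(2) F(2) G(2) by simp
qed

text \<open>Inversion in norm, with no pointwise inversion formula. Let f be the inverse transform
  of g and c = (2 pi)^d. The adjoint identity shows that the inner product of g with the transform
  of a truncation of f is c times the squared norm of that truncation, and by Plancherel the squared
  norm of the transform has the same value. Expanding the square leaves c (|f|^2 - |trunc f|^2),
  which tends to 0.\<close>

theorem L2_fourier_inverse_fourier: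
  fixes g :: "real^'d \<Rightarrow> complex^'n"
  assumes g: "integrable lborel g" and fin: "sqn g < \<infinity>"
  shows "AE \<xi> in lborel. L2_fourier (inverse_fourier g) \<xi> = g \<xi>"
proof (rule L2_fourier_unique[OF inverse_fourier_L2_space[OF g fin]])
  show gm[measurable]: "g \<in> borel_measurable borel" using g by auto
  define f where "f = inverse_fourier g"
  let ?c = "(2 * pi) ^ CARD('d)"
  have [measurable]: "f \<in> borel_measurable borel" unfolding f_def by measurable
  have sf: "sqn g = ennreal ?c * sqn f"
    unfolding f_def sqn_inverse_fourier[OF g fin] by (simp add: mult.assoc[symmetric] flip: ennreal_mult)
  then have ffin: "sqn f < \<infinity>" using fin by (auto simp: ennreal_mult_less_top)
  define N where "N = enn2real (sqn f)"
  have tfin: "sqn (trunc (real n) f) < \<infinity>" for n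
    using sqn_indicator_le ffin by (rule le_less_trans)
  have ti: "integrable lborel (trunc (real n) f)" for n by (intro trunc_integrable ffin) auto
  have pl: "sqn (fourier (trunc (real n) f)) = ennreal ?c * sqn (trunc (real n) f)" for n
    by (intro plancherel ti tfin)
  have ip: "(\<integral>\<xi>. fourier (trunc (real n) f) \<xi> \<bullet> g \<xi> \<partial>lborel) = ?c * enn2real (sqn (trunc (real n) f))" for n
  proof -
    have "(\<integral>\<xi>. fourier (trunc (real n) f) \<xi> \<bullet> g \<xi> \<partial>lborel) = (\<integral>x. trunc (real n) f x \<bullet> fourier g (- x) \<partial>lborel)"
      by (rule fourier_adjoint[OF ti g])
    also have "\<dots> = (\<integral>x. ?c * (norm (trunc (real n) f x))\<^sup>2 \<partial>lborel)"
    proof (intro Bochner_Integration.integral_cong refl)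
      fix x :: "real^'d"
      have "fourier g (- x) = ?c *\<^sub>R f x" by (simp add: f_def inverse_fourier_eq)
      then show "trunc (real n) f x \<bullet> fourier g (- x) = ?c * (norm (trunc (real n) f x))\<^sup>2"
        by (auto simp: indicator_def power2_norm_eq_inner)
    qed
    also have "\<dots> = ?c * enn2real (sqn (trunc (real n) f))"
      using sqn_finite(2)[OF _ tfin] by simp
    finally show ?thesis .
  qed
  have eq: "sqn (\<lambda>\<xi>. fourier (trunc (real n) f) \<xi> - g \<xi>) = ennreal (?c * N - ?c * enn2real (sqn (trunc (real n) f)))" for n
  proof -
    have "sqn (fourier (trunc (real n) f)) < \<infinity>" using tfin by (simp add: pl ennreal_mult_less_top)
    then have "sqn (\<lambda>\<xi>. fourier (trunc (real n) f) \<xi> - g \<xi>) = ennreal (enn2real (sqn (fourier (trunc (real n) f)))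
       - 2 * (\<integral>\<xi>. fourier (trunc (real n) f) \<xi> \<bullet> g \<xi> \<partial>lborel) + enn2real (sqn g))"
      by (intro sqn_diff_expand(2) fin) auto
    also have "enn2real (sqn (fourier (trunc (real n) f))) = ?c * enn2real (sqn (trunc (real n) f))"
      by (simp add: pl enn2real_mult)
    also have "enn2real (sqn g) = ?c * N" by (simp add: sf N_def enn2real_mult)
    finally show ?thesis by (simp only: ip) (simp add: algebra_simps)
  qed
  have "(\<lambda>n. sqn (trunc (real n) f)) \<longlonglongrightarrow> ennreal N"
  proof -
    have "(\<lambda>n. sqn (trunc (real n) f)) \<longlonglongrightarrow> sqn f"
      using tfin ffin by (intro sqn_tendsto trunc_tendsto) auto
    then show ?thesis using ffin by (simp add: N_def)
  qed
  then have "(\<lambda>n. enn2real (sqn (trunc (real n) f))) \<longlonglongrightarrow> N"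
    by (rule tendsto_enn2real) (simp add: N_def)
  then have "(\<lambda>n. ennreal (?c * N - ?c * enn2real (sqn (trunc (real n) f)))) \<longlonglongrightarrow> ennreal (?c * N - ?c * N)"
    by (intro tendsto_ennrealI tendsto_diff tendsto_mult tendsto_const)
  then show "(\<lambda>n. sqn (\<lambda>\<xi>. fourier (trunc (real n) (inverse_fourier g)) \<xi> - g \<xi>)) \<longlonglongrightarrow> 0"
    unfolding f_def[symmetric] eq by simp
qed

section \<open>Trace inequalities\<close>

lemma ft_continuous:
  fixes f :: "'a::euclidean_space \<Rightarrow> complex"
  assumes f: "integrable lborel f"
  shows "continuous_on A (ft f)"
proof (rule continuous_at_imp_continuous_on, rule ballI)
  fix \<xi> :: 'a
  have [measurable]: "f \<in> borel_measurable borel" using f by auto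
  show "isCont (ft f) \<xi>"
  proof (subst continuous_at_sequentially, intro allI impI)
    fix X :: "nat \<Rightarrow> 'a" assume X: "X \<longlonglongrightarrow> \<xi>"
    have "(\<lambda>n. ft f (X n)) \<longlonglongrightarrow> ft f \<xi>"
      unfolding ft_def
    proof (rule integral_dominated_convergence[where w="\<lambda>x. norm (f x)"])
      show "AE x in lborel. (\<lambda>n. exp (- \<i> * of_real (x \<bullet> X n)) * f x) \<longlonglongrightarrow> exp (- \<i> * of_real (x \<bullet> \<xi>)) * f x"
        by (intro AE_I2 tendsto_intros X)
    qed (use f in \<open>auto simp: norm_mult\<close>)
    then show "(ft f \<circ> X) \<longlonglongrightarrow> ft f \<xi>" by (simp add: o_def)
  qed
qed

text \<open>A finite second moment along \<eta> controls the remainder, since |exp (i y) - 1 - i y|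
  \<le> y^2; the difference quotient then differs from the derivative by at most K |s - t|.\<close>

lemma ft_has_directional_derivative:
  fixes f :: "'a::euclidean_space \<Rightarrow> complex"
  assumes f: "integrable lborel f" and f1: "integrable lborel (\<lambda>x. of_real (x \<bullet> \<eta>) * f x)"
    and f2: "integrable lborel (\<lambda>x. (x \<bullet> \<eta>)\<^sup>2 * norm (f x))"
  shows "((\<lambda>t. ft f (p + t *\<^sub>R \<eta>)) has_vector_derivative
    - \<i> * ft (\<lambda>x. of_real (x \<bullet> \<eta>) * f x) (p + t *\<^sub>R \<eta>)) (at t)"
proof -
  define K where "K = (\<integral>x. (x \<bullet> \<eta>)\<^sup>2 * norm (f x) \<partial>lborel)"
  let ?u = "\<lambda>t. ft f (p + t *\<^sub>R \<eta>)"
  define D where "D = - \<i> * ft (\<lambda>x. of_real (x \<bullet> \<eta>) * f x) (p + t *\<^sub>R \<eta>)"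
  have bound: "norm (?u s - ?u t - (s - t) *\<^sub>R D) \<le> K * (s - t)\<^sup>2" for s
  proof -
    let ?e = "\<lambda>s x. exp (- \<i> * of_real (x \<bullet> (p + s *\<^sub>R \<eta>)))"
    let ?r = "\<lambda>x. ?e s x * f x - ?e t x * f x - ((s - t) *\<^sub>R (- \<i>)) * (?e t x * (of_real (x \<bullet> \<eta>) * f x))"
    note i1 = ft_integrable[OF f, of "p + s *\<^sub>R \<eta>"] ft_integrable[OF f, of "p + t *\<^sub>R \<eta>"] ft_integrable[OF f1, of "p + t *\<^sub>R \<eta>"]
    have i2: "integrable lborel ?r"
      by (intro Bochner_Integration.integrable_diff integrable_mult_right i1)
    have "(\<integral>x. ?r x \<partial>lborel) = ?u s - ?u t - (s - t) *\<^sub>R D"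
      unfolding ft_def D_def
      by (subst Bochner_Integration.integral_diff Bochner_Integration.integral_diff integral_mult_right_zero,
          (intro Bochner_Integration.integrable_diff integrable_mult_right i1)+)+
         (simp add: scaleR_conv_of_real)
    then have "norm (?u s - ?u t - (s - t) *\<^sub>R D) = norm (\<integral>x. ?r x \<partial>lborel)" by simp
    also have "\<dots> \<le> (\<integral>x. (s - t)\<^sup>2 * ((x \<bullet> \<eta>)\<^sup>2 * norm (f x)) \<partial>lborel)"
    proof (rule Bochner_Integration.integral_norm_bound_integral[OF i2])
      show "integrable lborel (\<lambda>x. (s - t)\<^sup>2 * ((x \<bullet> \<eta>)\<^sup>2 * norm (f x)))" using f2 by (rule integrable_mult_right)
      fix x
      define y where "y = - (s - t) * (x \<bullet> \<eta>)"
      have es: "?e s x = ?e t x * iexp y"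
        by (simp add: y_def exp_add[symmetric] inner_add_right inner_scaleR_right algebra_simps)
      have "?r x = ?e t x * f x * (iexp y - (1 + \<i> * y))"
        unfolding es by (simp add: y_def scaleR_conv_of_real algebra_simps)
      then have "norm (?r x) = norm (f x) * norm (iexp y - (1 + \<i> * y))"
        by (simp add: norm_mult)
      also have "\<dots> \<le> norm (f x) * y\<^sup>2"
      proof -
        have "cmod (iexp y - (\<Sum>k\<le>1. (\<i> * y) ^ k / fact k)) \<le> \<bar>y\<bar> ^ Suc 1 / fact (Suc 1)" by (rule iexp_approx1)
        moreover have "(\<Sum>k\<le>1. (\<i> * y) ^ k / fact k) = 1 + \<i> * y" by simp
        moreover have "\<bar>y\<bar> ^ Suc 1 / fact (Suc 1) \<le> y\<^sup>2" by (simp add: power2_eq_square[symmetric])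
        ultimately show ?thesis by (intro mult_left_mono) simp_all
      qed
      also have "\<dots> = (s - t)\<^sup>2 * ((x \<bullet> \<eta>)\<^sup>2 * norm (f x))"
        by (simp only: y_def power_mult_distrib power2_minus mult_ac)
      finally show "norm (?r x) \<le> (s - t)\<^sup>2 * ((x \<bullet> \<eta>)\<^sup>2 * norm (f x))"
        .
    qed
    also have "\<dots> = K * (s - t)\<^sup>2" by (simp add: K_def)
    finally show ?thesis .
  qed
  have "(?u has_vector_derivative D) (at t)"
    unfolding has_vector_derivative_def
  proof (rule has_derivativeI_sandwich[where e=1 and H="\<lambda>s. K * \<bar>s - t\<bar>"])
    show "((\<lambda>s. K * \<bar>s - t\<bar>) \<longlongrightarrow> 0) (at t)"
      by (auto intro!: tendsto_eq_intros)
    fix s assume "s \<noteq> t"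
    have "norm (?u s - ?u t - (s - t) *\<^sub>R D) / norm (s - t) \<le> K * (s - t)\<^sup>2 / norm (s - t)"
      by (intro divide_right_mono bound) simp
    also have "\<dots> = K * \<bar>s - t\<bar>"
    proof -
      have sq: "(s - t)\<^sup>2 = \<bar>s - t\<bar> * \<bar>s - t\<bar>" by (simp add: power2_eq_square)
      have *: "K * (a * a) / a = K * a" if "a \<noteq> 0" for a :: real using that by simp
      have "\<bar>s - t\<bar> \<noteq> 0" using \<open>s \<noteq> t\<close> by simp
      from *[OF this] show ?thesis unfolding sq real_norm_def .
    qed
    finally show "norm (?u s - ?u t - (s - t) *\<^sub>R D) / norm (s - t) \<le> K * \<bar>s - t\<bar>" .
  qed (auto intro: bounded_linear_scaleR_left)
  then show ?thesis by (simp only: D_def)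
qed

text \<open>The derivative of \<beta> \<rho>^n |v|^2 contains the mixed term 2 \<beta> (v \<bullet>
  v'), which |\<beta> v - v'|^2 \<ge> 0 bounds by \<beta>^2 |v|^2 + |v'|^2. The quadratic term of
  the Riccati inequality is the price of this completion of the square.\<close>

lemma radial_piece:
  fixes v v' :: "real \<Rightarrow> complex" and \<beta> \<beta>' :: "real \<Rightarrow> real"
  assumes ab: "0 < a" "a \<le> b" and n: "n \<ge> 1"
    and v: "\<And>\<rho>. \<rho> \<in> {a..b} \<Longrightarrow> (v has_vector_derivative v' \<rho>) (at \<rho>)"
    and v': "continuous_on {a..b} v'"
    and \<beta>: "\<And>\<rho>. \<rho> \<in> {a..b} \<Longrightarrow> (\<beta> has_real_derivative \<beta>' \<rho>) (at \<rho>)"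
    and riccati: "\<And>\<rho>. \<rho> \<in> {a..b} \<Longrightarrow> \<beta>' \<rho> + real n * \<beta> \<rho> / \<rho> + (\<beta> \<rho>)\<^sup>2 \<le> \<kappa>"
  shows "\<beta> b * b ^ n * (norm (v b))\<^sup>2 - \<beta> a * a ^ n * (norm (v a))\<^sup>2
    \<le> integral {a..b} (\<lambda>\<rho>. \<rho> ^ n * (\<kappa> * (norm (v \<rho>))\<^sup>2 + (norm (v' \<rho>))\<^sup>2))"
proof -
  let ?B = "\<lambda>\<rho>. \<beta> \<rho> * \<rho> ^ n * (norm (v \<rho>))\<^sup>2"
  let ?B' = "\<lambda>\<rho>. \<rho> ^ n * ((\<beta>' \<rho> + real n * \<beta> \<rho> / \<rho>) * (norm (v \<rho>))\<^sup>2 + 2 * \<beta> \<rho> * (v \<rho> \<bullet> v' \<rho>))"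
  let ?e = "\<lambda>\<rho>. \<rho> ^ n * (\<kappa> * (norm (v \<rho>))\<^sup>2 + (norm (v' \<rho>))\<^sup>2)"
  have vc: "continuous_on {a..b} v"
    using v by (intro continuous_at_imp_continuous_on ballI) (auto intro: has_vector_derivative_continuous)
  have dB: "(?B has_real_derivative ?B' \<rho>) (at \<rho>)" if "\<rho> \<in> {a..b}" for \<rho>
  proof -
    have r: "\<rho> > 0" using that ab by auto
    have "((\<lambda>\<rho>. v \<rho> \<bullet> v \<rho>) has_derivative (\<lambda>h. v \<rho> \<bullet> (h *\<^sub>R v' \<rho>) + (h *\<^sub>R v' \<rho>) \<bullet> v \<rho>)) (at \<rho>)"
      using v[OF that] unfolding has_vector_derivative_def by (rule has_derivative_inner[OF _ ]) (use v[OF that] in \<open>simp add: has_vector_derivative_def\<close>)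
    then have dv: "((\<lambda>\<rho>. (norm (v \<rho>))\<^sup>2) has_real_derivative 2 * (v \<rho> \<bullet> v' \<rho>)) (at \<rho>)"
      unfolding has_field_derivative_def power2_norm_eq_inner
      by (rule has_derivative_eq_rhs) (auto simp: inner_commute)
    have np: "real n * \<rho> ^ (n - Suc 0) = \<rho> ^ n * (real n / \<rho>)"
      using r n by (cases n) auto
    show ?thesis
      by (rule DERIV_cong[OF DERIV_mult[OF DERIV_mult[OF \<beta>[OF that] DERIV_pow] dv]])
         (simp only: np, simp add: algebra_simps)
  qed
  have le: "?B' \<rho> \<le> ?e \<rho>" if "\<rho> \<in> {a..b}" for \<rho>
  proof -
    have r: "\<rho> > 0" using that ab by auto
    have "2 * \<beta> \<rho> * (v \<rho> \<bullet> v' \<rho>) \<le> (\<beta> \<rho>)\<^sup>2 * (norm (v \<rho>))\<^sup>2 + (norm (v' \<rho>))\<^sup>2"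
    proof -
      have "0 \<le> (norm (\<beta> \<rho> *\<^sub>R v \<rho> - v' \<rho>))\<^sup>2" by simp
      also have "\<dots> = (\<beta> \<rho>)\<^sup>2 * (norm (v \<rho>))\<^sup>2 + (norm (v' \<rho>))\<^sup>2 - 2 * \<beta> \<rho> * (v \<rho> \<bullet> v' \<rho>)"
        unfolding power2_norm_eq_inner by (simp add: inner_diff_left inner_diff_right inner_commute power2_eq_square)
      finally show ?thesis by simp
    qed
    moreover have "(\<beta>' \<rho> + real n * \<beta> \<rho> / \<rho> + (\<beta> \<rho>)\<^sup>2) * (norm (v \<rho>))\<^sup>2 \<le> \<kappa> * (norm (v \<rho>))\<^sup>2"
      using riccati[OF that] by (intro mult_right_mono) auto
    ultimately have "(\<beta>' \<rho> + real n * \<beta> \<rho> / \<rho>) * (norm (v \<rho>))\<^sup>2 + 2 * \<beta> \<rho> * (v \<rho> \<bullet> v' \<rho>) \<le> \<kappa> * (norm (v \<rho>))\<^sup>2 + (norm (v' \<rho>))\<^sup>2"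
      by (simp add: algebra_simps)
    then show ?thesis using r by (intro mult_left_mono) auto
  qed
  have "(?B' has_integral (?B b - ?B a)) {a..b}"
    using ab dB by (intro fundamental_theorem_of_calculus) (auto intro: has_vector_derivative_at_within simp: has_real_derivative_iff_has_vector_derivative)
  moreover have "?e integrable_on {a..b}"
    by (intro integrable_continuous_interval continuous_intros vc v')
  then have "(?e has_integral integral {a..b} ?e) {a..b}" by (rule integrable_integral)
  ultimately show ?thesis by (rule has_integral_le) (rule le)
qed

lemma emeasure_lborel_atLeast_top: "emeasure lborel {a::real..} = \<top>"
proof (rule ccontr)
  assume "emeasure lborel {a..} \<noteq> \<top>"
  then obtain n where n: "emeasure lborel {a..} < of_nat n"
    using ennreal_Ex_less_of_nat by (metis less_top)
  have "of_nat n = emeasure lborel {a..a + real n}" by (simp add: ennreal_of_nat_eq_real_of_nat)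
  also have "\<dots> \<le> emeasure lborel {a..}" by (intro emeasure_mono) auto
  finally show False using n by simp
qed

text \<open>The estimate is applied on \<open>[\<epsilon>, 1]\<close> and \<open>[1, L]\<close>. The boundary term at \<open>\<epsilon>\<close> has the right sign; the
  one at \<open>L\<close> tends to \<open>0\<close> along a sequence, since otherwise the right-hand side is infinite.\<close>

lemma radial_trace:
  fixes v v' :: "real \<Rightarrow> complex"
  assumes n: "n \<ge> 1" and \<kappa>: "\<kappa> > 0"
    and v: "\<And>\<rho>. (v has_vector_derivative v' \<rho>) (at \<rho>)"
    and v': "continuous_on UNIV v'"
    and \<beta>: "\<And>\<rho>. 0 < \<rho> \<Longrightarrow> (\<beta> has_real_derivative \<beta>' \<rho>) (at \<rho>)"
    and riccati: "\<And>\<rho>. 0 < \<rho> \<Longrightarrow> \<beta>' \<rho> + real n * \<beta> \<rho> / \<rho> + (\<beta> \<rho>)\<^sup>2 \<le> \<kappa>"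
    and small: "\<And>\<rho>. 0 < \<rho> \<Longrightarrow> \<rho> \<le> \<epsilon> \<Longrightarrow> \<beta> \<rho> \<le> 0" "0 < \<epsilon>" "\<epsilon> \<le> 1"
    and \<gamma>: "\<And>\<rho>. 0 < \<rho> \<Longrightarrow> (\<gamma> has_real_derivative \<gamma>' \<rho>) (at \<rho>)"
    and riccati2: "\<And>\<rho>. 0 < \<rho> \<Longrightarrow> \<gamma>' \<rho> + real n * \<gamma> \<rho> / \<rho> + (\<gamma> \<rho>)\<^sup>2 \<le> \<kappa>"
    and large: "\<And>\<rho>. 1 \<le> \<rho> \<Longrightarrow> - \<gamma> \<rho> \<le> M" "0 < M"
  shows "ennreal ((\<beta> 1 - \<gamma> 1) * (norm (v 1))\<^sup>2) \<le>
    (\<integral>\<^sup>+\<rho>. ennreal (\<rho> ^ n * (\<kappa> * (norm (v \<rho>))\<^sup>2 + (norm (v' \<rho>))\<^sup>2)) * indicator {0<..} \<rho> \<partial>lborel)" (is "_ \<le> ?I")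
proof (cases "?I = \<infinity>")
  case False
  define e where "e \<rho> = \<rho> ^ n * (\<kappa> * (norm (v \<rho>))\<^sup>2 + (norm (v' \<rho>))\<^sup>2)" for \<rho>
  note e_fold = e_def[symmetric]
  have vc: "continuous_on A v" for A
    using v by (intro continuous_at_imp_continuous_on ballI) (auto intro: has_vector_derivative_continuous)
  have ec: "continuous_on A e" for A
    unfolding e_def by (intro continuous_intros vc continuous_on_subset[OF v']) auto
  have [measurable]: "e \<in> borel_measurable borel"
    using ec by (rule borel_measurable_continuous_onI)
  have e0: "e \<rho> \<ge> 0" if "\<rho> \<ge> 0" for \<rho> using that \<kappa> by (simp add: e_def)
  define I where "I = enn2real ?I"
  have "?I < \<top>" using False unfolding infinity_ennreal_def by (simp only: less_top)
  then have I: "?I = ennreal I" "I \<ge> 0"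
    unfolding I_def by (simp_all only: ennreal_enn2real enn2real_nonneg)
  have piece: "integral {a..b} e \<le> I" if "0 < a" for a b
  proof -
    have le: "(\<integral>\<^sup>+\<rho>\<in>{a..b}. ennreal (e \<rho>) \<partial>lborel) \<le> ?I"
      unfolding e_fold using that by (intro nn_integral_mono) (auto split: split_indicator)
    have "(\<integral>\<^sup>+\<rho>\<in>{a..b}. ennreal (e \<rho>) \<partial>lborel) = ennreal (integral {a..b} e)"
    proof (rule set_nn_integral_lborel_eq_integral)
      show "(\<integral>\<^sup>+\<rho>\<in>{a..b}. ennreal (e \<rho>) \<partial>lborel) < \<infinity>"
        using le I(1) by (simp only: infinity_ennreal_def) (rule le_less_trans, auto)
    qed (use that e0 in \<open>auto simp: set_borel_measurable_def\<close>)
    then have "ennreal (integral {a..b} e) \<le> ennreal I" using le by (simp only: I(1))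
    then show ?thesis using I(2) by (simp add: ennreal_le_iff)
  qed
  have decay: "\<exists>L\<ge>1. M * L ^ n * (norm (v L))\<^sup>2 \<le> \<delta>" if \<delta>: "\<delta> > 0" for \<delta>
  proof (rule ccontr)
    assume "\<not> ?thesis"
    then have big: "M * L ^ n * (norm (v L))\<^sup>2 > \<delta>" if "L \<ge> 1" for L using that by force
    have "\<infinity> = (\<integral>\<^sup>+\<rho>. ennreal (\<delta> * \<kappa> / M) * indicator {1..} \<rho> \<partial>(lborel::real measure))"
      using \<delta> \<kappa> large(2) by (simp add: nn_integral_cmult_indicator emeasure_lborel_atLeast_top ennreal_mult_top)
    also have "\<dots> \<le> ?I"
      unfolding e_fold
    proof (rule nn_integral_mono)
      fix \<rho> :: real
      show "ennreal (\<delta> * \<kappa> / M) * indicator {1..} \<rho> \<le> ennreal (e \<rho>) * indicator {0<..} \<rho>"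
      proof (cases "\<rho> \<ge> 1")
        case True
        have "\<delta> * \<kappa> / M \<le> (M * \<rho> ^ n * (norm (v \<rho>))\<^sup>2) * \<kappa> / M"
          using big[OF True] \<kappa> large(2) by (intro divide_right_mono mult_right_mono) auto
        also have "\<dots> = \<rho> ^ n * (\<kappa> * (norm (v \<rho>))\<^sup>2)" using large(2) by simp
        also have "\<dots> \<le> e \<rho>" unfolding e_def using True by (intro mult_left_mono) auto
        finally show ?thesis using True by (simp add: ennreal_leI)
      qed simp
    qed
    finally show False using False by (simp add: top_unique)
  qed
  have "(\<beta> 1 - \<gamma> 1) * (norm (v 1))\<^sup>2 \<le> I + \<delta>" if "\<delta> > 0" for \<delta>
  proof -
    obtain L where L: "L \<ge> 1" "M * L ^ n * (norm (v L))\<^sup>2 \<le> \<delta>" using decay[OF \<open>\<delta> > 0\<close>] by blast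
    have in': "\<beta> 1 * 1 ^ n * (norm (v 1))\<^sup>2 - \<beta> \<epsilon> * \<epsilon> ^ n * (norm (v \<epsilon>))\<^sup>2 \<le> integral {\<epsilon>..1} e"
      unfolding e_def using small n by (intro radial_piece[where \<beta>'=\<beta>'] v \<beta> riccati continuous_on_subset[OF v']) auto
    have "\<beta> \<epsilon> * \<epsilon> ^ n * (norm (v \<epsilon>))\<^sup>2 \<le> 0"
      using small(1)[of \<epsilon>] small(2) by (simp add: mult_nonpos_nonneg)
    with in' have 1: "\<beta> 1 * (norm (v 1))\<^sup>2 \<le> integral {\<epsilon>..1} e" by simp
    have out: "\<gamma> L * L ^ n * (norm (v L))\<^sup>2 - \<gamma> 1 * 1 ^ n * (norm (v 1))\<^sup>2 \<le> integral {1..L} e"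
      unfolding e_def using L n by (intro radial_piece[where \<beta>'=\<gamma>'] v \<gamma> riccati2 continuous_on_subset[OF v']) auto
    have "- \<gamma> L * (L ^ n * (norm (v L))\<^sup>2) \<le> M * (L ^ n * (norm (v L))\<^sup>2)"
      using large(1)[OF L(1)] L(1) by (intro mult_right_mono) auto
    with out L have 2: "- \<gamma> 1 * (norm (v 1))\<^sup>2 \<le> integral {1..L} e + \<delta>" by (simp add: mult.assoc)
    have "integral {\<epsilon>..1} e + integral {1..L} e = integral {\<epsilon>..L} e"
      using small L by (intro Henstock_Kurzweil_Integration.integral_combine integrable_continuous_interval ec) auto
    also have "\<dots> \<le> I" using small by (intro piece)
    finally show ?thesis using 1 2 by (simp add: algebra_simps)
  qed
  then have "(\<beta> 1 - \<gamma> 1) * (norm (v 1))\<^sup>2 \<le> I" by (rule field_le_epsilon)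
  then show ?thesis unfolding I by (rule ennreal_leI)
qed simp

text \<open>The substitution \<beta> = c - n / (2 \<rho>) removes the first-order term: the
  left-hand side of the Riccati inequality becomes c' + c^2 - n (n - 2) / (4 \<rho>^2). Both choices
  below are of this form, and the jump at 1 is the difference of the inner and the outer value of
  c.\<close>

lemma ray_trace:
  fixes v v' :: "real \<Rightarrow> complex"
  assumes n: "n \<ge> 2" and r: "r > 0"
    and v: "\<And>\<rho>. (v has_vector_derivative v' \<rho>) (at \<rho>)" and v': "continuous_on UNIV v'"
  shows "ennreal (sqrt (1 + r\<^sup>2) * (norm (v 1))\<^sup>2) \<le> ennreal (if n \<ge> 4 then 1 / 2 else 1) *
    (\<integral>\<^sup>+\<rho>. ennreal (\<rho> ^ n * (r\<^sup>2 * (norm (v \<rho>))\<^sup>2 + (norm (v' \<rho>))\<^sup>2)) * indicator {0<..} \<rho> \<partial>lborel)" (is "_ \<le> _ * ?I")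
proof (cases "n \<ge> 4")
  case False
  define a where "a = real n"
  have a: "a \<ge> 2" using n by (simp add: a_def)
  \<comment> \<open>Inside, c = 1 / \<rho> solves c' + c^2 = 0; outside, c = -r is constant with c^2
    = r^2. The jump 1 + r is at least (1 + r^2)^(1/2).\<close>
  define \<beta> \<beta>' \<gamma> \<gamma>' where "\<beta> \<rho> = - (a - 2) / (2 * \<rho>)" and "\<beta>' \<rho> = (a - 2) / (2 * \<rho>\<^sup>2)"
    and "\<gamma> \<rho> = - r - a / (2 * \<rho>)" and "\<gamma>' \<rho> = a / (2 * \<rho>\<^sup>2)" for \<rho> :: real
  have "ennreal ((\<beta> 1 - \<gamma> 1) * (norm (v 1))\<^sup>2) \<le> ?I"
  proof (rule radial_trace[where \<beta>'=\<beta>' and \<gamma>'=\<gamma>' and \<epsilon>=1 and M="r + a / 2"])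
    fix \<rho> :: real assume \<rho>: "0 < \<rho>"
    show "(\<beta> has_real_derivative \<beta>' \<rho>) (at \<rho>)" "(\<gamma> has_real_derivative \<gamma>' \<rho>) (at \<rho>)"
      unfolding \<beta>_def[abs_def] \<beta>'_def \<gamma>_def[abs_def] \<gamma>'_def using \<rho>
      by (auto intro!: derivative_eq_intros simp: field_simps power2_eq_square)
    have "\<beta>' \<rho> + a * \<beta> \<rho> / \<rho> + (\<beta> \<rho>)\<^sup>2 = - ((a - 2) * a) / (4 * \<rho>\<^sup>2)"
      unfolding \<beta>_def \<beta>'_def using \<rho> by (simp add: field_simps power2_eq_square)
    also have "\<dots> \<le> 0" using a by (simp add: divide_nonpos_nonneg)
    also have "0 \<le> r\<^sup>2" by simp
    finally show "\<beta>' \<rho> + real n * \<beta> \<rho> / \<rho> + (\<beta> \<rho>)\<^sup>2 \<le> r\<^sup>2" by (simp add: a_def)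
    have "\<gamma>' \<rho> + a * \<gamma> \<rho> / \<rho> + (\<gamma> \<rho>)\<^sup>2 = r\<^sup>2 - ((a - 2) * a) / (4 * \<rho>\<^sup>2)"
      unfolding \<gamma>_def \<gamma>'_def using \<rho> by (simp add: field_simps power2_eq_square)
    also have "\<dots> \<le> r\<^sup>2" using a by simp
    finally show "\<gamma>' \<rho> + real n * \<gamma> \<rho> / \<rho> + (\<gamma> \<rho>)\<^sup>2 \<le> r\<^sup>2" by (simp add: a_def)
    show "\<beta> \<rho> \<le> 0" unfolding \<beta>_def using a \<rho> by (simp add: divide_nonpos_pos)
  next
    fix \<rho> :: real assume "1 \<le> \<rho>"
    then show "- \<gamma> \<rho> \<le> r + a / 2" unfolding \<gamma>_def using a by (simp add: field_simps)
  qed (use n r a v v' in auto)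
  note main = this
  have "\<beta> 1 - \<gamma> 1 = 1 + r" by (simp add: \<beta>_def \<gamma>_def field_simps)
  moreover have "sqrt (1 + r\<^sup>2) \<le> 1 + r"
    using r by (intro real_le_lsqrt) (auto simp: power2_eq_square algebra_simps)
  ultimately have "sqrt (1 + r\<^sup>2) * (norm (v 1))\<^sup>2 \<le> (\<beta> 1 - \<gamma> 1) * (norm (v 1))\<^sup>2"
    by (intro mult_right_mono) simp_all
  from order_trans[OF ennreal_leI[OF this] main] show ?thesis
    unfolding if_not_P[OF False] ennreal_1 mult_1_left .
next
  case True
  define a where "a = real n"
  have a: "a \<ge> 4" using True by (simp add: a_def)
  \<comment> \<open>Here c = s inside and c = -s outside with s^2 = r^2 + 1 / \<rho>^2, so that the
    jump at 1 is exactly 2 (1 + r^2)^(1/2). The term n (n - 2) / (4 \<rho>^2) has to absorb the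
    excess 1 / \<rho>^2 of s^2 and, outside, also |s'| \<le> 1 / \<rho>^2.\<close>
  define s s' where "s \<rho> = sqrt (r\<^sup>2 + 1 / \<rho>\<^sup>2)" and "s' \<rho> = - 1 / (\<rho> ^ 3 * sqrt (r\<^sup>2 + 1 / \<rho>\<^sup>2))" for \<rho> :: real
  define \<beta> \<beta>' \<gamma> \<gamma>' where "\<beta> \<rho> = - a / (2 * \<rho>) + s \<rho>" and "\<beta>' \<rho> = a / (2 * \<rho>\<^sup>2) + s' \<rho>"
    and "\<gamma> \<rho> = - a / (2 * \<rho>) - s \<rho>" and "\<gamma>' \<rho> = a / (2 * \<rho>\<^sup>2) - s' \<rho>" for \<rho> :: real
  have ds: "(s has_real_derivative s' \<rho>) (at \<rho>)" if "\<rho> > 0" for \<rho>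
  proof -
    have "r\<^sup>2 + 1 / \<rho>\<^sup>2 > 0" using r that by (simp add: add_pos_pos)
    then show ?thesis
      unfolding s_def[abs_def] s'_def using that
      by (auto intro!: derivative_eq_intros simp: field_simps power2_eq_square power3_eq_cube)
  qed
  have s2: "(s \<rho>)\<^sup>2 = r\<^sup>2 + 1 / \<rho>\<^sup>2" for \<rho> by (simp add: s_def)
  have s_ge: "s \<rho> \<ge> 1 / \<rho>" if "\<rho> > 0" for \<rho>
    unfolding s_def using that by (intro real_le_rsqrt) (simp add: power_divide)
  have s_le: "s \<rho> \<le> r + 1 / \<rho>" if "\<rho> > 0" for \<rho>
    unfolding s_def using that r by (intro real_le_lsqrt) (auto simp: power2_sum power_divide)
  have s'0: "s' \<rho> \<le> 0" and s'1: "- s' \<rho> \<le> 1 / \<rho>\<^sup>2" if "\<rho> > 0" for \<rho>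
  proof -
    have "0 < 1 / \<rho>" using that by simp
    then have sp: "s \<rho> > 0" using s_ge[OF that] by linarith
    have s'eq: "- s' \<rho> = 1 / \<rho>\<^sup>2 * (1 / \<rho> / s \<rho>)"
      by (simp add: s'_def s_def power2_eq_square power3_eq_cube)
    have "1 / \<rho> / s \<rho> \<le> 1" using s_ge[OF that] unfolding pos_divide_le_eq[OF sp] mult_1_left .
    then have "1 / \<rho>\<^sup>2 * (1 / \<rho> / s \<rho>) \<le> 1 / \<rho>\<^sup>2 * 1" by (intro mult_left_mono) auto
    then show "- s' \<rho> \<le> 1 / \<rho>\<^sup>2" by (simp only: s'eq mult_1_right)
    show "s' \<rho> \<le> 0" using that sp by (simp add: s'_def s_def[symmetric] divide_nonpos_pos)
  qed
  have "ennreal ((\<beta> 1 - \<gamma> 1) * (norm (v 1))\<^sup>2) \<le> ?I"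
  proof (rule radial_trace[where \<beta>'=\<beta>' and \<gamma>'=\<gamma>' and \<epsilon>="min 1 (1 / r)" and M="a / 2 + r + 1"])
    fix \<rho> :: real assume \<rho>: "0 < \<rho>"
    have d: "((\<lambda>\<rho>. - a / (2 * \<rho>)) has_real_derivative a / (2 * \<rho>\<^sup>2)) (at \<rho>)"
      using \<rho> by (auto intro!: derivative_eq_intros simp: field_simps power2_eq_square)
    show "(\<beta> has_real_derivative \<beta>' \<rho>) (at \<rho>)" "(\<gamma> has_real_derivative \<gamma>' \<rho>) (at \<rho>)"
      unfolding \<beta>_def[abs_def] \<beta>'_def \<gamma>_def[abs_def] \<gamma>'_def
      by (intro DERIV_add DERIV_diff d ds \<rho>)+
    \<comment> \<open>The condition a (a - 2) \<ge> 8 is (a - 4)(a + 2) \<ge> 0; with a = d - 1 this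
      is the threshold d \<ge> 5.\<close>
    have aa: "2 * a - a * a + 8 \<le> 0" using mult_nonneg_nonneg[of "a - 4" "a + 2"] a by (simp add: algebra_simps)
    have "\<beta>' \<rho> + a * \<beta> \<rho> / \<rho> + (\<beta> \<rho>)\<^sup>2 = (s \<rho>)\<^sup>2 + s' \<rho> + (2 * a - a * a) / (4 * \<rho>\<^sup>2)"
      unfolding \<beta>_def \<beta>'_def using \<rho> by (simp add: field_simps power2_eq_square)
    also have "\<dots> \<le> r\<^sup>2 + 1 / \<rho>\<^sup>2 + 0 + (- 8) / (4 * \<rho>\<^sup>2)"
      unfolding s2 using s'0[OF \<rho>] aa by (intro add_mono divide_right_mono) auto
    also have "\<dots> \<le> r\<^sup>2" by (simp add: field_simps)
    finally show "\<beta>' \<rho> + real n * \<beta> \<rho> / \<rho> + (\<beta> \<rho>)\<^sup>2 \<le> r\<^sup>2" by (simp add: a_def)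
    have "\<gamma>' \<rho> + a * \<gamma> \<rho> / \<rho> + (\<gamma> \<rho>)\<^sup>2 = (s \<rho>)\<^sup>2 + (- s' \<rho>) + (2 * a - a * a) / (4 * \<rho>\<^sup>2)"
      unfolding \<gamma>_def \<gamma>'_def using \<rho> by (simp add: field_simps power2_eq_square)
    also have "\<dots> \<le> r\<^sup>2 + 1 / \<rho>\<^sup>2 + 1 / \<rho>\<^sup>2 + (- 8) / (4 * \<rho>\<^sup>2)"
      unfolding s2 using s'1[OF \<rho>] aa by (intro add_mono divide_right_mono) auto
    also have "\<dots> = r\<^sup>2" using \<rho> by (simp add: field_simps)
    finally show "\<gamma>' \<rho> + real n * \<gamma> \<rho> / \<rho> + (\<gamma> \<rho>)\<^sup>2 \<le> r\<^sup>2" by (simp add: a_def)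
  next
    \<comment> \<open>Near the origin r \<le> 1 / \<rho>, hence s \<le> 2 / \<rho> \<le> a / (2
      \<rho>) because a \<ge> 4; this is where \<epsilon> = min 1 (1 / r) comes from.\<close>
    fix \<rho> :: real assume \<rho>: "0 < \<rho>" "\<rho> \<le> min 1 (1 / r)"
    have "r \<le> 1 / \<rho>" using \<rho> r by (simp add: field_simps)
    moreover have "4 / (2 * \<rho>) \<le> a / (2 * \<rho>)" using a \<rho> by (intro divide_right_mono) auto
    ultimately show "\<beta> \<rho> \<le> 0" unfolding \<beta>_def using s_le[OF \<rho>(1)] by simp
  next
    fix \<rho> :: real assume \<rho>: "1 \<le> \<rho>"
    have "1 / \<rho> \<le> 1" "a / (2 * \<rho>) \<le> a / 2" using \<rho> a by (auto simp: field_simps)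
    moreover have "\<gamma> \<rho> = - (a / (2 * \<rho>)) - s \<rho>" by (simp add: \<gamma>_def)
    moreover have "s \<rho> \<le> r + 1 / \<rho>" using \<rho> by (intro s_le) simp
    ultimately show "- \<gamma> \<rho> \<le> a / 2 + r + 1" by linarith
  qed (use n r a v v' in auto)
  note main = this
  have J: "\<beta> 1 - \<gamma> 1 = 2 * sqrt (1 + r\<^sup>2)" by (simp add: \<beta>_def \<gamma>_def s_def add.commute)
  have "ennreal (1 / 2) * ennreal (2 * sqrt (1 + r\<^sup>2) * (norm (v 1))\<^sup>2) \<le> ennreal (1 / 2) * ?I"
    using main unfolding J by (intro mult_left_mono) simp_all
  moreover have "ennreal (1 / 2) * ennreal (2 * sqrt (1 + r\<^sup>2) * (norm (v 1))\<^sup>2) = ennreal (sqrt (1 + r\<^sup>2) * (norm (v 1))\<^sup>2)"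
    by (subst ennreal_mult[symmetric]) simp_all
  ultimately show ?thesis unfolding if_P[OF True] by (simp only:)
qed

section \<open>The dispersion relation and its change of variables\<close>

lemma dirac_dispersion_eq_sqrt: "dirac_dispersion m r = sqrt (r\<^sup>2 + m\<^sup>2)"
  by (simp add: dirac_dispersion_def powr_half_sqrt)

lemma dirac_dispersion_pos: "r \<noteq> 0 \<Longrightarrow> dirac_dispersion m r > 0"
  by (simp add: dirac_dispersion_eq_sqrt add_pos_nonneg)

lemma dirac_dispersion_nonneg [simp]: "dirac_dispersion m r \<ge> 0"
  by (simp add: dirac_dispersion_eq_sqrt)

lemma dirac_dispersion_measurable [measurable]: "dirac_dispersion m \<in> borel_measurable borel"
  unfolding dirac_dispersion_eq_sqrt[abs_def] by measurable

lemma bracket_smoothing_sq: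
  assumes "r \<noteq> 0"
  shows "(bracket_smoothing m r)\<^sup>2 = sqrt (1 + r\<^sup>2) / dirac_dispersion m r"
proof -
  have p: "dirac_dispersion m r > 0" by (rule dirac_dispersion_pos[OF assms])
  have "(dirac_dispersion m r powr (- 1 / 2))\<^sup>2 = 1 / dirac_dispersion m r"
    using p by (simp add: powr_minus_divide powr_half_sqrt power_divide)
  moreover have "((1 + r\<^sup>2) powr (1 / 4))\<^sup>2 = sqrt (1 + r\<^sup>2)"
  proof -
    have "(x powr (1 / 4))\<^sup>2 = sqrt x" if "x \<ge> 0" for x :: real
      using that by (simp add: power2_eq_square powr_half_sqrt flip: powr_add)
    then show ?thesis by simp
  qed
  ultimately show ?thesis by (simp add: bracket_smoothing_def power_mult_distrib)
qed

lemma bracket_smoothing_measurable [measurable]: "bracket_smoothing m \<in> borel_measurable borel"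
  unfolding bracket_smoothing_def[abs_def] by measurable

text \<open>The substitution \<open>\<tau> = \<phi>(\<rho> / \<mu>)\<close>; its image is only \<open>\<tau> > m\<close>, hence the inequality.\<close>

lemma dispersion_substitution:
  fixes h :: "real \<Rightarrow> real"
  assumes h[measurable]: "h \<in> borel_measurable borel" and h0: "\<And>x. h x \<ge> 0" and \<rho>: "\<rho> > 0"
  shows "(\<integral>\<^sup>+\<mu>. ennreal (h (dirac_dispersion m (\<rho> / \<mu>)) * (\<rho>\<^sup>2 / \<mu> ^ 3 / dirac_dispersion m (\<rho> / \<mu>))) * indicator {0<..} \<mu> \<partial>lborel)
    \<le> (\<integral>\<^sup>+\<tau>. ennreal (h \<tau>) * indicator {0<..} \<tau> \<partial>lborel)" (is "_ \<le> ?R")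
proof -
  \<comment> \<open>The sign makes the substitution increasing, as the substitution rule requires; a
    reflection of \<tau> undoes it afterwards.\<close>
  let ?g = "\<lambda>\<mu>. - sqrt ((\<rho> / \<mu>)\<^sup>2 + m\<^sup>2)"
  define g' where "g' \<mu> = \<rho>\<^sup>2 / \<mu> ^ 3 / sqrt ((\<rho> / \<mu>)\<^sup>2 + m\<^sup>2)" for \<mu>
  define k where "k \<mu> = h (- ?g \<mu>) * g' \<mu>" for \<mu>
  have [measurable]: "g' \<in> borel_measurable borel" "k \<in> borel_measurable borel"
    unfolding g'_def[abs_def] k_def[abs_def] by measurable
  define a b where "a n = 1 / real (Suc n)" and "b n = real (Suc n)" for n
  have ab: "0 < a n" "a n \<le> b n" for n by (auto simp: a_def b_def field_simps)
  have piece: "(\<integral>\<^sup>+\<mu>. ennreal (k \<mu>) * indicator {a n..b n} \<mu> \<partial>lborel) \<le> ?R" for n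
  proof -
    have pos: "(\<rho> / \<mu>)\<^sup>2 + m\<^sup>2 > 0" if "\<mu> > 0" for \<mu> using that \<rho> by (simp add: add_pos_nonneg)
    have AB: "(\<integral>\<^sup>+x. ennreal (h (- x) * indicator {?g (a n)..?g (b n)} x) \<partial>lborel) =
      (\<integral>\<^sup>+x. ennreal (h (- ?g x) * g' x * indicator {a n..b n} x) \<partial>lborel)"
    proof (rule nn_integral_substitution)
      show "set_borel_measurable borel {?g (a n)..?g (b n)} (\<lambda>x. h (- x))"
        unfolding set_borel_measurable_def by measurable
      show "a n \<le> b n" by (rule ab)
      fix x assume x: "x \<in> {a n..b n}"
      then have x0: "x > 0" using ab(1)[of n] by auto
      show "(?g has_real_derivative g' x) (at x)"
        unfolding g'_def using pos[OF x0] x0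
        by (auto intro!: derivative_eq_intros simp: field_simps power2_eq_square power3_eq_cube)
      show "0 \<le> g' x" unfolding g'_def using x0 by simp
    next
      have "x \<noteq> 0 \<and> sqrt ((\<rho> / x)\<^sup>2 + m\<^sup>2) \<noteq> 0" if "x \<in> {a n..b n}" for x
        using that ab(1)[of n] pos[of x] by auto
      then show "continuous_on {a n..b n} g'"
        unfolding g'_def by (intro continuous_intros) auto
    qed
    have "(\<integral>\<^sup>+x. ennreal (h (- x) * indicator {?g (a n)..?g (b n)} x) \<partial>lborel) \<le> (\<integral>\<^sup>+x. ennreal (h (- x)) * indicator {..<0} x \<partial>lborel)"
    proof (rule nn_integral_mono)
      fix x
      have "sqrt ((\<rho> / b n)\<^sup>2 + m\<^sup>2) > 0" using ab[of n] by (intro real_sqrt_gt_zero pos) linarith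
      then have "x \<le> ?g (b n) \<Longrightarrow> x < 0" by linarith
      then show "ennreal (h (- x) * indicator {?g (a n)..?g (b n)} x) \<le> ennreal (h (- x)) * indicator {..<0} x"
        by (auto split: split_indicator)
    qed
    also have "\<dots> = ?R"
      using nn_integral_real_affine[of "\<lambda>\<tau>. ennreal (h \<tau>) * indicator {0<..} \<tau>" "-1" 0]
      by (simp add: indicator_def)
    finally have "(\<integral>\<^sup>+x. ennreal (h (- ?g x) * g' x * indicator {a n..b n} x) \<partial>lborel) \<le> ?R"
      unfolding AB .
    moreover have "(\<integral>\<^sup>+\<mu>. ennreal (k \<mu>) * indicator {a n..b n} \<mu> \<partial>lborel) =
      (\<integral>\<^sup>+x. ennreal (h (- ?g x) * g' x * indicator {a n..b n} x) \<partial>lborel)"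
      by (intro nn_integral_cong) (simp add: k_def indicator_def)
    ultimately show ?thesis by (simp only:)
  qed
  have "(\<lambda>n. \<integral>\<^sup>+\<mu>. ennreal (k \<mu>) * indicator {a n..b n} \<mu> \<partial>lborel) \<longlonglongrightarrow> (\<integral>\<^sup>+\<mu>. ennreal (k \<mu>) * indicator {0<..} \<mu> \<partial>lborel)"
  proof (rule nn_integral_LIMSEQ)
    show "incseq (\<lambda>n \<mu>. ennreal (k \<mu>) * indicator {a n..b n} \<mu>)"
    proof (intro incseq_SucI le_funI mult_left_mono)
      fix n and \<mu> :: real
      have "a (Suc n) \<le> a n" "b n \<le> b (Suc n)" by (auto simp: a_def b_def field_simps)
      then show "indicator {a n..b n} \<mu> \<le> (indicator {a (Suc n)..b (Suc n)} \<mu> :: ennreal)"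
        by (auto split: split_indicator)
    qed simp
    fix \<mu> :: real
    show "(\<lambda>n. ennreal (k \<mu>) * indicator {a n..b n} \<mu>) \<longlonglongrightarrow> ennreal (k \<mu>) * indicator {0<..} \<mu>"
    proof (cases "\<mu> > 0")
      case True
      obtain N where N: "max \<mu> (1 / \<mu>) < real N" using reals_Archimedean2 by blast
      have "\<mu> \<in> {a n..b n}" if "n \<ge> N" for n
      proof -
        have "1 / \<mu> \<le> real (Suc n)" "\<mu> \<le> real (Suc n)" using N that by auto
        then show ?thesis using True by (auto simp: a_def b_def field_simps)
      qed
      then show ?thesis using True
        by (intro tendsto_eventually eventually_sequentiallyI[of N]) (auto simp: indicator_def)
    next
      case False
      then have "\<mu> \<notin> {a n..b n}" for n using ab(1)[of n] by auto
      then show ?thesis using False by simp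
    qed
  qed measurable
  then have "(\<integral>\<^sup>+\<mu>. ennreal (k \<mu>) * indicator {0<..} \<mu> \<partial>lborel) \<le> ?R"
    by (rule LIMSEQ_le_const2) (use piece in blast)
  then show ?thesis by (simp add: k_def g'_def dirac_dispersion_eq_sqrt)
qed

section \<open>Trace estimates for space-time functions of bounded support\<close>

lemma bounded_support_moments:
  fixes F :: "'a::euclidean_space \<Rightarrow> complex"
  assumes [measurable]: "F \<in> borel_measurable borel"
    and bound: "\<And>p. norm (F p) \<le> M * indicator (cball 0 R) p"
  shows "integrable lborel F" and "sqn F < \<infinity>"
proof -
  have fin: "emeasure lborel (cball (0::'a) R) < \<infinity>"
    by (intro emeasure_bounded_finite bounded_cball)
  have "(\<integral>\<^sup>+p. ennreal (norm (F p)) \<partial>lborel) \<le> (\<integral>\<^sup>+p. ennreal M * indicator (cball (0::'a) R) p \<partial>lborel)"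
  proof (rule nn_integral_mono)
    fix p
    have "ennreal (norm (F p)) \<le> ennreal (M * indicator (cball 0 R) p)" by (rule ennreal_leI[OF bound])
    then show "ennreal (norm (F p)) \<le> ennreal M * indicator (cball 0 R) p" by (cases "p \<in> cball 0 R") simp_all
  qed
  also have "\<dots> < \<infinity>" using fin by (simp add: nn_integral_cmult_indicator ennreal_mult_less_top)
  finally show "integrable lborel F" by (simp add: integrable_iff_bounded)
  have "sqn F \<le> (\<integral>\<^sup>+p. ennreal (M\<^sup>2) * indicator (cball (0::'a) R) p \<partial>lborel)"
    unfolding sqn_def
  proof (rule nn_integral_mono)
    fix p
    have "(norm (F p))\<^sup>2 \<le> (M * indicator (cball 0 R) p)\<^sup>2" using bound[of p] by (intro power_mono) auto
    then have "ennreal ((norm (F p))\<^sup>2) \<le> ennreal ((M * indicator (cball 0 R) p)\<^sup>2)" by (rule ennreal_leI)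
    then show "ennreal ((norm (F p))\<^sup>2) \<le> ennreal (M\<^sup>2) * indicator (cball 0 R) p"
      by (cases "p \<in> cball 0 R") simp_all
  qed
  also have "\<dots> < \<infinity>" using fin by (simp add: nn_integral_cmult_indicator ennreal_mult_less_top)
  finally show "sqn F < \<infinity>" .
qed

lemma bounded_support_mult:
  fixes F :: "'a::euclidean_space \<Rightarrow> complex"
  assumes [measurable]: "F \<in> borel_measurable borel"
    and bound: "\<And>p. norm (F p) \<le> M * indicator (cball 0 R) p" and g: "\<And>p. \<bar>g p\<bar> \<le> K * norm p" "K \<ge> 0"
  shows "norm (complex_of_real (g p) * F p) \<le> (K * R * M) * indicator (cball 0 R) p"
proof (cases "p \<in> cball 0 R")
  case True
  have "\<bar>g p\<bar> * norm (F p) \<le> (K * R) * (M * indicator (cball 0 R) p)"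
  proof (rule mult_mono[OF _ bound])
    have "K * norm p \<le> K * R" using True g(2) by (intro mult_left_mono) auto
    then show "\<bar>g p\<bar> \<le> K * R" using g(1)[of p] by simp
    then show "0 \<le> K * R" by simp
  qed simp
  then show ?thesis using True by (simp add: norm_mult)
next
  case False
  then have "F p = 0" using bound[of p] by simp
  then show ?thesis using False by simp
qed

text \<open>\<open>|F^|\<^sup>2 + |\<nabla>\<^sub>\<xi> F^|\<^sup>2\<close>, where multiplication by \<open>x\<^sub>j\<close> stands for the derivative.\<close>

definition xi_energy :: "(real \<times> (real^'d) \<Rightarrow> complex) \<Rightarrow> real \<times> (real^'d) \<Rightarrow> real" where
  "xi_energy F p = (norm (ft F p))\<^sup>2 + (\<Sum>j\<in>UNIV. (norm (ft (\<lambda>q. of_real (snd q $ j) * F q) p))\<^sup>2)"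

lemma xi_energy_nonneg: "xi_energy F p \<ge> 0"
  by (simp add: xi_energy_def sum_nonneg)

context
  fixes F :: "real \<times> (real^'d) \<Rightarrow> complex" and M R :: real
  assumes F[measurable]: "F \<in> borel_measurable borel"
    and bound: "\<And>p. norm (F p) \<le> M * indicator (cball 0 R) p"
begin

lemma snd_component_bound: "norm (complex_of_real (snd p $ j) * F p) \<le> (1 * R * M) * indicator (cball 0 R) p"
proof (rule bounded_support_mult[OF F bound])
  fix q :: "real \<times> (real^'d)"
  have "\<bar>snd q $ j\<bar> \<le> norm (snd q)" by (rule component_le_norm_cart)
  also have "\<dots> \<le> norm q" by (cases q) (simp add: norm_snd_le)
  finally show "\<bar>snd q $ j\<bar> \<le> 1 * norm q" by simp
qed simp

lemma snd_component_measurable: "(\<lambda>p. complex_of_real (snd p $ j) * F p) \<in> borel_measurable borel"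
proof -
  have "(\<lambda>p::real \<times> (real^'d). snd p $ j) \<in> borel_measurable borel"
    by (intro borel_measurable_continuous_onI continuous_intros)
  then show ?thesis by measurable
qed

lemmas F_int = bounded_support_moments[OF F bound]
lemmas xF_int = bounded_support_moments[OF snd_component_measurable snd_component_bound]

lemma xi_energy_continuous: "continuous_on A (xi_energy F)"
  unfolding xi_energy_def[abs_def] by (intro continuous_intros ft_continuous F_int xF_int)

lemma xi_energy_measurable: "xi_energy F \<in> borel_measurable borel"
  by (rule borel_measurable_continuous_onI[OF xi_energy_continuous])

lemma xi_energy_Pair_measurable [measurable (raw)]:
  "a \<in> borel_measurable N \<Longrightarrow> b \<in> borel_measurable N \<Longrightarrow> (\<lambda>x. xi_energy F (a x, b x)) \<in> borel_measurable N"
  by (rule measurable_compose[OF borel_measurable_Pair xi_energy_measurable])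

lemma ft_Pair_measurable [measurable (raw)]:
  "a \<in> borel_measurable N \<Longrightarrow> b \<in> borel_measurable N \<Longrightarrow> (\<lambda>x. ft F (a x, b x)) \<in> borel_measurable N"
  by (rule measurable_compose[OF borel_measurable_Pair ft_measurable[OF F]])

text \<open>Plancherel on R x R^d, applied to F and to each x_j F; this is how differentiation in
  \<xi> turns into the spatial weight 1 + |x|^2.\<close>

lemma xi_energy_integral:
  "(\<integral>\<^sup>+p. ennreal (xi_energy F p) \<partial>lborel) =
    ennreal ((2 * pi) ^ (CARD('d) + 1)) * (\<integral>\<^sup>+p. ennreal ((1 + (norm (snd p))\<^sup>2) * (norm (F p))\<^sup>2) \<partial>lborel)"
proof -
  let ?c = "ennreal ((2 * pi) ^ (CARD('d) + 1))"
  note [measurable] = snd_component_measurable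
  have D: "DIM(real \<times> (real^'d)) = CARD('d) + 1" by simp
  have "(\<integral>\<^sup>+p. ennreal (xi_energy F p) \<partial>lborel) = (\<integral>\<^sup>+p. ennreal ((norm (ft F p))\<^sup>2) + (\<Sum>j\<in>UNIV. ennreal ((norm (ft (\<lambda>q. of_real (snd q $ j) * F q) p))\<^sup>2)) \<partial>lborel)"
    by (simp add: xi_energy_def sum_nonneg)
  also have "\<dots> = sqn (ft F) + (\<Sum>j\<in>UNIV. sqn (ft (\<lambda>q. of_real (snd q $ j) * F q)))"
    unfolding sqn_def by (subst nn_integral_add, simp, simp, subst nn_integral_sum) simp_all
  also have "\<dots> = ?c * sqn F + (\<Sum>j\<in>UNIV. ?c * sqn (\<lambda>q. of_real (snd q $ j) * F q))"
    by (simp only: plancherel_complex[OF F_int] plancherel_complex[OF xF_int] D)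
  also have "\<dots> = ?c * (sqn F + (\<Sum>j\<in>UNIV. sqn (\<lambda>q. of_real (snd q $ j) * F q)))"
    by (simp only: sum_distrib_left distrib_left)
  also have "sqn F + (\<Sum>j\<in>UNIV. sqn (\<lambda>q. of_real (snd q $ j) * F q)) =
     (\<integral>\<^sup>+p. ennreal ((norm (F p))\<^sup>2) + (\<Sum>j\<in>UNIV. ennreal ((norm (of_real (snd p $ j) * F p))\<^sup>2)) \<partial>lborel)"
    unfolding sqn_def by (subst nn_integral_add, simp, simp, subst nn_integral_sum) simp_all
  also have "\<dots> = (\<integral>\<^sup>+p. ennreal ((1 + (norm (snd p))\<^sup>2) * (norm (F p))\<^sup>2) \<partial>lborel)"
  proof (rule nn_integral_cong)
    fix p :: "real \<times> (real^'d)"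
    have "(norm (snd p))\<^sup>2 = (\<Sum>j\<in>UNIV. (snd p $ j)\<^sup>2)"
      by (simp add: norm_vec_def L2_set_def sum_nonneg)
    then have "(norm (F p))\<^sup>2 + (\<Sum>j\<in>UNIV. (norm (of_real (snd p $ j) * F p))\<^sup>2) = (1 + (norm (snd p))\<^sup>2) * (norm (F p))\<^sup>2"
      by (simp add: norm_mult power_mult_distrib sum_distrib_right distrib_right)
    then show "ennreal ((norm (F p))\<^sup>2) + (\<Sum>j\<in>UNIV. ennreal ((norm (of_real (snd p $ j) * F p))\<^sup>2)) = ennreal ((1 + (norm (snd p))\<^sup>2) * (norm (F p))\<^sup>2)"
      by (simp add: sum_nonneg flip: ennreal_plus)
  qed
  finally show ?thesis .
qed

text \<open>At a fixed time frequency, v(\<mu>) is the value of the transform at (\<tau>, \<mu>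
  \<xi>). By Cauchy-Schwarz |v'|^2 is at most |\<xi>|^2 times the squared gradient, so with the
  Riccati constant |\<xi>|^2 both terms of the ray integral carry the same factor |\<xi>|^2.\<close>

lemma ray_energy:
  fixes \<xi> :: "real^'d"
  assumes d: "CARD('d) \<ge> 3" and \<xi>: "\<xi> \<noteq> 0"
  shows "ennreal (sqrt (1 + (norm \<xi>)\<^sup>2) * (norm (ft F (\<tau>, \<xi>)))\<^sup>2) \<le> ennreal (if CARD('d) \<ge> 5 then 1 / 2 else 1) *
    (\<integral>\<^sup>+\<mu>. ennreal (\<mu> ^ (CARD('d) - 1) * ((norm \<xi>)\<^sup>2 * xi_energy F (\<tau>, \<mu> *\<^sub>R \<xi>))) * indicator {0<..} \<mu> \<partial>lborel)"
proof -
  let ?\<eta> = "(0::real, \<xi>)"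
  let ?p = "(\<tau>, 0::real^'d)"
  define v where "v \<mu> = ft F (?p + \<mu> *\<^sub>R ?\<eta>)" for \<mu>
  define v' where "v' \<mu> = - \<i> * ft (\<lambda>q. of_real (q \<bullet> ?\<eta>) * F q) (?p + \<mu> *\<^sub>R ?\<eta>)" for \<mu>
  have pt: "?p + \<mu> *\<^sub>R ?\<eta> = (\<tau>, \<mu> *\<^sub>R \<xi>)" for \<mu> by simp
  have g: "\<bar>q \<bullet> ?\<eta>\<bar> \<le> norm \<xi> * norm q" for q
    using Cauchy_Schwarz_ineq2[of q ?\<eta>] by (simp add: mult.commute)
  have m1: "(\<lambda>q. complex_of_real (q \<bullet> ?\<eta>) * F q) \<in> borel_measurable borel" by measurable
  have b1: "norm (complex_of_real (q \<bullet> ?\<eta>) * F q) \<le> (norm \<xi> * R * M) * indicator (cball 0 R) q" for q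
    by (rule bounded_support_mult[OF F bound g]) simp
  note i1 = bounded_support_moments(1)[OF m1 b1]
  have m2: "(\<lambda>q. complex_of_real (q \<bullet> ?\<eta>) * (complex_of_real (q \<bullet> ?\<eta>) * F q)) \<in> borel_measurable borel" by measurable
  have b2: "norm (complex_of_real (q \<bullet> ?\<eta>) * (complex_of_real (q \<bullet> ?\<eta>) * F q)) \<le> (norm \<xi> * R * (norm \<xi> * R * M)) * indicator (cball 0 R) q" for q
    by (rule bounded_support_mult[OF m1 b1 g]) simp
  have i2: "integrable lborel (\<lambda>q. (q \<bullet> ?\<eta>)\<^sup>2 * norm (F q))"
    using integrable_norm[OF bounded_support_moments(1)[OF m2 b2]]
    by (simp add: norm_mult power2_eq_square mult.assoc abs_mult_self_eq flip: mult.assoc)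
  have dv: "(v has_vector_derivative v' \<mu>) (at \<mu>)" for \<mu>
    unfolding v_def[abs_def] v'_def by (rule ft_has_directional_derivative[OF F_int(1) i1 i2])
  have cv': "continuous_on UNIV v'"
    unfolding v'_def by (intro continuous_intros continuous_on_compose2[OF ft_continuous[OF i1, of UNIV]]) auto
  have grad: "(norm (v' \<mu>))\<^sup>2 \<le> (norm \<xi>)\<^sup>2 * (\<Sum>j\<in>UNIV. (norm (ft (\<lambda>q. of_real (snd q $ j) * F q) (\<tau>, \<mu> *\<^sub>R \<xi>)))\<^sup>2)" for \<mu>
  proof -
    let ?G = "\<lambda>j. ft (\<lambda>q. of_real (snd q $ j) * F q) (\<tau>, \<mu> *\<^sub>R \<xi>)"
    have "ft (\<lambda>q. of_real (q \<bullet> ?\<eta>) * F q) (\<tau>, \<mu> *\<^sub>R \<xi>) = (\<Sum>j\<in>UNIV. of_real (\<xi> $ j) * ?G j)"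
    proof -
      have "ft (\<lambda>q. of_real (q \<bullet> ?\<eta>) * F q) (\<tau>, \<mu> *\<^sub>R \<xi>) =
        (\<integral>q. (\<Sum>j\<in>UNIV. of_real (\<xi> $ j) * (exp (- \<i> * of_real (q \<bullet> (\<tau>, \<mu> *\<^sub>R \<xi>))) * (of_real (snd q $ j) * F q))) \<partial>lborel)"
        unfolding ft_def
      proof (intro Bochner_Integration.integral_cong refl)
        fix q :: "real \<times> (real^'d)"
        have "q \<bullet> ?\<eta> = (\<Sum>j\<in>UNIV. \<xi> $ j * snd q $ j)"
          by (cases q) (simp add: inner_vec_def mult.commute)
        then show "exp (- \<i> * of_real (q \<bullet> (\<tau>, \<mu> *\<^sub>R \<xi>))) * (of_real (q \<bullet> ?\<eta>) * F q) =
          (\<Sum>j\<in>UNIV. of_real (\<xi> $ j) * (exp (- \<i> * of_real (q \<bullet> (\<tau>, \<mu> *\<^sub>R \<xi>))) * (of_real (snd q $ j) * F q)))"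
          by (simp only: of_real_sum of_real_mult sum_distrib_left sum_distrib_right) (simp only: mult_ac)
      qed
      also have "\<dots> = (\<Sum>j\<in>UNIV. of_real (\<xi> $ j) * ?G j)"
        unfolding ft_def
        by (subst Bochner_Integration.integral_sum) (intro integrable_mult_right ft_integrable xF_int, simp)
      finally show ?thesis .
    qed
    then have "norm (v' \<mu>) \<le> (\<Sum>j\<in>UNIV. \<bar>\<xi> $ j\<bar> * norm (?G j))"
      unfolding v'_def pt by (simp only: norm_mult norm_minus_cancel norm_ii mult_1_left)
        (rule norm_sum[THEN order_trans], simp add: norm_mult)
    then have "(norm (v' \<mu>))\<^sup>2 \<le> (\<Sum>j\<in>UNIV. \<bar>\<xi> $ j\<bar> * norm (?G j))\<^sup>2" by (intro power_mono) auto
    also have "\<dots> \<le> (\<Sum>j\<in>UNIV. \<bar>\<xi> $ j\<bar>\<^sup>2) * (\<Sum>j\<in>UNIV. (norm (?G j))\<^sup>2)"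
      by (rule Cauchy_Schwarz_ineq_sum)
    also have "(\<Sum>j\<in>UNIV. \<bar>\<xi> $ j\<bar>\<^sup>2) = (norm \<xi>)\<^sup>2"
      by (simp add: norm_vec_def L2_set_def sum_nonneg)
    finally show ?thesis .
  qed
  have v1: "v 1 = ft F (\<tau>, \<xi>)" by (simp add: v_def)
  have c: "(if CARD('d) - 1 \<ge> 4 then 1 / 2 else 1 :: real) = (if CARD('d) \<ge> 5 then 1 / 2 else 1)" by auto
  have "ennreal (sqrt (1 + (norm \<xi>)\<^sup>2) * (norm (v 1))\<^sup>2) \<le> ennreal (if CARD('d) - 1 \<ge> 4 then 1 / 2 else 1) *
    (\<integral>\<^sup>+\<mu>. ennreal (\<mu> ^ (CARD('d) - 1) * ((norm \<xi>)\<^sup>2 * (norm (v \<mu>))\<^sup>2 + (norm (v' \<mu>))\<^sup>2)) * indicator {0<..} \<mu> \<partial>lborel)"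
    using d \<xi> by (intro ray_trace dv cv') auto
  also have "\<dots> \<le> ennreal (if CARD('d) - 1 \<ge> 4 then 1 / 2 else 1) *
    (\<integral>\<^sup>+\<mu>. ennreal (\<mu> ^ (CARD('d) - 1) * ((norm \<xi>)\<^sup>2 * xi_energy F (\<tau>, \<mu> *\<^sub>R \<xi>))) * indicator {0<..} \<mu> \<partial>lborel)"
  proof (intro mult_left_mono nn_integral_mono)
    fix \<mu> :: real
    have "(norm \<xi>)\<^sup>2 * (norm (v \<mu>))\<^sup>2 + (norm (v' \<mu>))\<^sup>2 \<le> (norm \<xi>)\<^sup>2 * xi_energy F (\<tau>, \<mu> *\<^sub>R \<xi>)"
      using grad[of \<mu>] by (simp only: xi_energy_def v_def pt distrib_left)
    then show "ennreal (\<mu> ^ (CARD('d) - 1) * ((norm \<xi>)\<^sup>2 * (norm (v \<mu>))\<^sup>2 + (norm (v' \<mu>))\<^sup>2)) * indicator {0<..} \<mu>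
      \<le> ennreal (\<mu> ^ (CARD('d) - 1) * ((norm \<xi>)\<^sup>2 * xi_energy F (\<tau>, \<mu> *\<^sub>R \<xi>))) * indicator {0<..} \<mu>"
      by (cases "\<mu> > 0") (auto intro!: ennreal_leI mult_left_mono)
  qed simp
  finally show ?thesis unfolding v1 c .
qed

theorem trace_spacetime:
  assumes d: "CARD('d) \<ge> 3" and \<sigma>: "\<sigma> = 1 \<or> \<sigma> = - 1"
  shows "(\<integral>\<^sup>+\<xi>. ennreal ((bracket_smoothing m (norm \<xi>))\<^sup>2 * (norm (ft F (\<sigma> * dirac_dispersion m (norm \<xi>), \<xi>)))\<^sup>2) \<partial>lborel)
    \<le> ennreal (if CARD('d) \<ge> 5 then 1 / 2 else 1) *
      (\<integral>\<^sup>+\<eta>. (\<integral>\<^sup>+\<tau>. ennreal (xi_energy F (\<sigma> * \<tau>, \<eta>)) * indicator {0<..} \<tau> \<partial>lborel) \<partial>lborel)"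
proof -
  let ?\<phi> = "dirac_dispersion m" and ?c = "ennreal (if CARD('d) \<ge> 5 then 1 / 2 else 1)" and ?d = "CARD('d)"
  \<comment> \<open>\<open>K\<close> is the integrand in (\<xi>, \<mu>) and \<open>L\<close> its
    form after \<eta> = \<mu> \<xi>. The Jacobian \<mu>^(-d) turns \<mu>^(d - 1) into 1 / \<mu>, and
    |\<xi>|^2 = |\<eta>|^2 / \<mu>^2. The resulting factor |\<eta>|^2 / (\<mu>^3 \<phi>) is, up to
    sign, exactly the derivative of \<phi>(|\<eta>| / \<mu>) with respect to \<mu>.\<close>
  define K where "K \<xi> \<mu> = ennreal (\<mu> ^ (?d - 1) * ((norm \<xi>)\<^sup>2 / ?\<phi> (norm \<xi>)) * xi_energy F (\<sigma> * ?\<phi> (norm \<xi>), \<mu> *\<^sub>R \<xi>)) * indicator {0<..} \<mu>"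
    for \<xi> :: "real^'d" and \<mu>
  define L where "L \<eta> \<mu> = ennreal (xi_energy F (\<sigma> * ?\<phi> (norm \<eta> / \<mu>), \<eta>) * ((norm \<eta>)\<^sup>2 / \<mu> ^ 3 / ?\<phi> (norm \<eta> / \<mu>))) * indicator {0<..} \<mu>"
    for \<eta> :: "real^'d" and \<mu>
  have Km: "case_prod K \<in> borel_measurable (lborel \<Otimes>\<^sub>M lborel)" and Lm: "case_prod L \<in> borel_measurable (lborel \<Otimes>\<^sub>M lborel)"
    unfolding K_def L_def split_beta' lborel_prod measurable_lborel2 borel_prod[symmetric]
    by measurable
  have K1: "(\<lambda>\<xi>. K \<xi> \<mu>) \<in> borel_measurable borel" and K2: "(\<lambda>\<mu>. K \<xi> \<mu>) \<in> borel_measurable borel" for \<xi> \<mu>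
    using Km by (auto dest: measurable_Pair1' measurable_Pair2')
  have 1: "ennreal ((bracket_smoothing m (norm \<xi>))\<^sup>2 * (norm (ft F (\<sigma> * ?\<phi> (norm \<xi>), \<xi>)))\<^sup>2) \<le> ?c * (\<integral>\<^sup>+\<mu>. K \<xi> \<mu> \<partial>lborel)"
    if "\<xi> \<noteq> 0" for \<xi>
  proof -
    define P where "P = ?\<phi> (norm \<xi>)"
    have P: "P > 0" unfolding P_def using that by (intro dirac_dispersion_pos) simp
    have "ennreal ((bracket_smoothing m (norm \<xi>))\<^sup>2 * (norm (ft F (\<sigma> * P, \<xi>)))\<^sup>2)
      = ennreal (1 / P) * ennreal (sqrt (1 + (norm \<xi>)\<^sup>2) * (norm (ft F (\<sigma> * P, \<xi>)))\<^sup>2)"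
      using that P by (subst bracket_smoothing_sq) (simp_all add: P_def[symmetric] flip: ennreal_mult)
    also have "\<dots> \<le> ennreal (1 / P) * (?c *
       (\<integral>\<^sup>+\<mu>. ennreal (\<mu> ^ (?d - 1) * ((norm \<xi>)\<^sup>2 * xi_energy F (\<sigma> * P, \<mu> *\<^sub>R \<xi>))) * indicator {0<..} \<mu> \<partial>lborel))"
      by (intro mult_left_mono ray_energy d that) simp
    also have "\<dots> = ?c * (\<integral>\<^sup>+\<mu>. ennreal (1 / P) * (ennreal (\<mu> ^ (?d - 1) * ((norm \<xi>)\<^sup>2 * xi_energy F (\<sigma> * P, \<mu> *\<^sub>R \<xi>))) * indicator {0<..} \<mu>) \<partial>lborel)"
      by (subst nn_integral_cmult) (measurable, simp add: mult_ac)
    also have "(\<integral>\<^sup>+\<mu>. ennreal (1 / P) * (ennreal (\<mu> ^ (?d - 1) * ((norm \<xi>)\<^sup>2 * xi_energy F (\<sigma> * P, \<mu> *\<^sub>R \<xi>))) * indicator {0<..} \<mu>) \<partial>lborel)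
      = (\<integral>\<^sup>+\<mu>. K \<xi> \<mu> \<partial>lborel)"
    proof (rule nn_integral_cong)
      fix \<mu> :: real
      show "ennreal (1 / P) * (ennreal (\<mu> ^ (?d - 1) * ((norm \<xi>)\<^sup>2 * xi_energy F (\<sigma> * P, \<mu> *\<^sub>R \<xi>))) * indicator {0<..} \<mu>) = K \<xi> \<mu>"
      proof (cases "\<mu> > 0")
        case True
        then show ?thesis
          using P xi_energy_nonneg[of F "(\<sigma> * P, \<mu> *\<^sub>R \<xi>)"]
          unfolding K_def P_def[symmetric] by (simp add: ennreal_mult[symmetric] mult_ac divide_inverse)
      qed (simp add: K_def)
    qed
    finally show ?thesis unfolding P_def .
  qed
  have 2: "(\<integral>\<^sup>+\<xi>. K \<xi> \<mu> \<partial>lborel) = (\<integral>\<^sup>+\<eta>. L \<eta> \<mu> \<partial>lborel)" for \<mu>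
  proof (cases "\<mu> > 0")
    case True
    have "(\<integral>\<^sup>+\<xi>. K \<xi> \<mu> \<partial>lborel) = ennreal (\<bar>1 / \<mu>\<bar> ^ DIM(real^'d)) * (\<integral>\<^sup>+\<eta>. K (0 + (1 / \<mu>) *\<^sub>R \<eta>) \<mu> \<partial>lborel)"
      using True by (intro lborel_affine_nn_integral K1) simp
    also have "\<dots> = (\<integral>\<^sup>+\<eta>. ennreal (\<bar>1 / \<mu>\<bar> ^ DIM(real^'d)) * K (0 + (1 / \<mu>) *\<^sub>R \<eta>) \<mu> \<partial>lborel)"
      by (rule nn_integral_cmult[symmetric]) (use K1[of \<mu>] in measurable)
    also have "\<dots> = (\<integral>\<^sup>+\<eta>. L \<eta> \<mu> \<partial>lborel)"
    proof (rule nn_integral_cong)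
      fix \<eta> :: "real^'d"
      define P where "P = ?\<phi> (norm \<eta> / \<mu>)"
      define E where "E = xi_energy F (\<sigma> * P, \<eta>)"
      have E: "E \<ge> 0" by (simp add: E_def xi_energy_nonneg)
      have P: "P \<ge> 0" by (simp add: P_def)
      have nrm: "norm ((1 / \<mu>) *\<^sub>R \<eta>) = norm \<eta> / \<mu>" using True by simp
      have pw: "\<mu> ^ ?d = \<mu> ^ (?d - 1) * \<mu>" by (cases ?d) (use d in simp_all)
      have e: "K (0 + (1 / \<mu>) *\<^sub>R \<eta>) \<mu> = ennreal (\<mu> ^ (?d - 1) * ((norm \<eta> / \<mu>)\<^sup>2 / P) * E)"
        using True unfolding K_def E_def P_def add_0 nrm by simp
      have l: "L \<eta> \<mu> = ennreal (E * ((norm \<eta>)\<^sup>2 / \<mu> ^ 3 / P))"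
        using True unfolding L_def E_def P_def by simp
      have "\<bar>1 / \<mu>\<bar> ^ DIM(real^'d) * (\<mu> ^ (?d - 1) * ((norm \<eta> / \<mu>)\<^sup>2 / P) * E) = E * ((norm \<eta>)\<^sup>2 / \<mu> ^ 3 / P)"
      proof -
        have "\<bar>1 / \<mu>\<bar> ^ DIM(real^'d) = 1 / \<mu> ^ ?d" using True by (simp add: power_one_over)
        then have "\<bar>1 / \<mu>\<bar> ^ DIM(real^'d) = 1 / (\<mu> ^ (?d - 1) * \<mu>)" unfolding pw .
        then show ?thesis using True by (simp add: power_divide power2_eq_square power3_eq_cube mult_ac)
      qed
      then show "ennreal (\<bar>1 / \<mu>\<bar> ^ DIM(real^'d)) * K (0 + (1 / \<mu>) *\<^sub>R \<eta>) \<mu> = L \<eta> \<mu>"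
        unfolding e l by (subst ennreal_mult[symmetric]) (use True E P in simp_all)
    qed
    finally show ?thesis .
  qed (simp add: K_def L_def)
  have 3: "(\<integral>\<^sup>+\<mu>. L \<eta> \<mu> \<partial>lborel) \<le> (\<integral>\<^sup>+\<tau>. ennreal (xi_energy F (\<sigma> * \<tau>, \<eta>)) * indicator {0<..} \<tau> \<partial>lborel)" for \<eta>
  proof (cases "\<eta> = 0")
    case False
    have "(\<lambda>\<tau>. xi_energy F (\<sigma> * \<tau>, \<eta>)) \<in> borel_measurable borel" by measurable
    then show ?thesis unfolding L_def
      using False by (intro dispersion_substitution[where h="\<lambda>\<tau>. xi_energy F (\<sigma> * \<tau>, \<eta>)"] xi_energy_nonneg) auto
  qed (simp add: L_def)
  have "AE \<xi> in lborel. (\<xi>::real^'d) \<noteq> 0" by (rule AE_lborel_singleton)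
  then have "(\<integral>\<^sup>+\<xi>. ennreal ((bracket_smoothing m (norm \<xi>))\<^sup>2 * (norm (ft F (\<sigma> * ?\<phi> (norm \<xi>), \<xi>)))\<^sup>2) \<partial>lborel)
    \<le> (\<integral>\<^sup>+\<xi>. ?c * (\<integral>\<^sup>+\<mu>. K \<xi> \<mu> \<partial>lborel) \<partial>lborel)"
    by (intro nn_integral_mono_AE) (erule eventually_mono, rule 1)
  also have "\<dots> = ?c * (\<integral>\<^sup>+\<xi>. (\<integral>\<^sup>+\<mu>. K \<xi> \<mu> \<partial>lborel) \<partial>lborel)"
    by (rule nn_integral_cmult) (use lborel.borel_measurable_nn_integral[OF Km] in simp)
  also have "(\<integral>\<^sup>+\<xi>. (\<integral>\<^sup>+\<mu>. K \<xi> \<mu> \<partial>lborel) \<partial>lborel) = (\<integral>\<^sup>+\<mu>. (\<integral>\<^sup>+\<xi>. K \<xi> \<mu> \<partial>lborel) \<partial>lborel)"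
    using lborel_pair.Fubini'[OF Km] by simp
  also have "\<dots> = (\<integral>\<^sup>+\<mu>. (\<integral>\<^sup>+\<eta>. L \<eta> \<mu> \<partial>lborel) \<partial>lborel)" by (simp only: 2)
  also have "\<dots> = (\<integral>\<^sup>+\<eta>. (\<integral>\<^sup>+\<mu>. L \<eta> \<mu> \<partial>lborel) \<partial>lborel)"
    using lborel_pair.Fubini'[OF Lm] by simp
  also have "\<dots> \<le> (\<integral>\<^sup>+\<eta>. (\<integral>\<^sup>+\<tau>. ennreal (xi_energy F (\<sigma> * \<tau>, \<eta>)) * indicator {0<..} \<tau> \<partial>lborel) \<partial>lborel)"
    by (intro nn_integral_mono 3)
  finally show ?thesis by (simp add: mult_left_mono)
qed

text \<open>The positive and the negative branch are estimated by integrals over \<tau> > 0 and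
  \<tau> < 0. These regions are disjoint, so both branches together cost no more than one full
  space-time integral.\<close>

corollary trace_both_branches:
  assumes d: "CARD('d) \<ge> 3"
  shows "(\<integral>\<^sup>+\<xi>. ennreal ((bracket_smoothing m (norm \<xi>))\<^sup>2 *
      ((norm (ft F (- dirac_dispersion m (norm \<xi>), \<xi>)))\<^sup>2 + (norm (ft F (dirac_dispersion m (norm \<xi>), \<xi>)))\<^sup>2)) \<partial>lborel)
    \<le> ennreal ((if CARD('d) \<ge> 5 then 1 / 2 else 1) * (2 * pi) ^ (CARD('d) + 1)) *
      (\<integral>\<^sup>+p. ennreal ((1 + (norm (snd p))\<^sup>2) * (norm (F p))\<^sup>2) \<partial>lborel)"
proof -
  let ?c = "if CARD('d) \<ge> 5 then 1 / 2 else 1 :: real"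
  let ?A = "\<lambda>\<sigma>. \<integral>\<^sup>+\<xi>. ennreal ((bracket_smoothing m (norm \<xi>))\<^sup>2 * (norm (ft F (\<sigma> * dirac_dispersion m (norm \<xi>), \<xi>)))\<^sup>2) \<partial>lborel"
  let ?B = "\<lambda>\<sigma> \<eta>. \<integral>\<^sup>+\<tau>. ennreal (xi_energy F (\<sigma> * \<tau>, \<eta>)) * indicator {0<..} \<tau> \<partial>lborel"
  have Em: "(\<lambda>(\<tau>, \<eta>). ennreal (xi_energy F (\<tau>, \<eta>))) \<in> borel_measurable (lborel \<Otimes>\<^sub>M lborel)"
    unfolding split_beta' lborel_prod measurable_lborel2 borel_prod[symmetric] by measurable
  have "(\<integral>\<^sup>+\<xi>. ennreal ((bracket_smoothing m (norm \<xi>))\<^sup>2 *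
      ((norm (ft F (- dirac_dispersion m (norm \<xi>), \<xi>)))\<^sup>2 + (norm (ft F (dirac_dispersion m (norm \<xi>), \<xi>)))\<^sup>2)) \<partial>lborel)
    = ?A (- 1) + ?A 1"
    by (subst nn_integral_add[symmetric]) (measurable, simp add: distrib_left)
  also have "\<dots> \<le> ennreal ?c * (\<integral>\<^sup>+\<eta>. ?B (- 1) \<eta> \<partial>lborel) + ennreal ?c * (\<integral>\<^sup>+\<eta>. ?B 1 \<eta> \<partial>lborel)"
    by (intro add_mono trace_spacetime d) auto
  also have "\<dots> = ennreal ?c * (\<integral>\<^sup>+\<eta>. ?B (- 1) \<eta> + ?B 1 \<eta> \<partial>lborel)"
    by (subst nn_integral_add) (measurable, simp add: distrib_left)
  also have "(\<integral>\<^sup>+\<eta>. ?B (- 1) \<eta> + ?B 1 \<eta> \<partial>lborel) \<le> (\<integral>\<^sup>+\<eta>. (\<integral>\<^sup>+\<tau>. ennreal (xi_energy F (\<tau>, \<eta>)) \<partial>lborel) \<partial>lborel)"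
  proof (rule nn_integral_mono)
    fix \<eta> :: "real^'d"
    have "?B (- 1) \<eta> = (\<integral>\<^sup>+\<tau>. ennreal (xi_energy F (\<tau>, \<eta>)) * indicator {..<0} \<tau> \<partial>lborel)"
      by (subst (2) nn_integral_real_affine[of _ "-1" 0]) (measurable, auto intro!: nn_integral_cong simp: indicator_def)
    then have "?B (- 1) \<eta> + ?B 1 \<eta> = (\<integral>\<^sup>+\<tau>. ennreal (xi_energy F (\<tau>, \<eta>)) * indicator {..<0} \<tau> + ennreal (xi_energy F (\<tau>, \<eta>)) * indicator {0<..} \<tau> \<partial>lborel)"
      by (subst nn_integral_add) simp_all
    also have "\<dots> \<le> (\<integral>\<^sup>+\<tau>. ennreal (xi_energy F (\<tau>, \<eta>)) \<partial>lborel)"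
      by (intro nn_integral_mono) (auto simp: indicator_def)
    finally show "?B (- 1) \<eta> + ?B 1 \<eta> \<le> (\<integral>\<^sup>+\<tau>. ennreal (xi_energy F (\<tau>, \<eta>)) \<partial>lborel)" .
  qed
  also have "(\<integral>\<^sup>+\<eta>. (\<integral>\<^sup>+\<tau>. ennreal (xi_energy F (\<tau>, \<eta>)) \<partial>lborel) \<partial>lborel) = (\<integral>\<^sup>+p. ennreal (xi_energy F p) \<partial>lborel)"
    using lborel_pair.nn_integral_snd[OF Em] by (simp add: lborel_prod split_beta')
  also have "\<dots> = ennreal ((2 * pi) ^ (CARD('d) + 1)) * (\<integral>\<^sup>+p. ennreal ((1 + (norm (snd p))\<^sup>2) * (norm (F p))\<^sup>2) \<partial>lborel)"
    by (rule xi_energy_integral)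
  finally show ?thesis by (simp only: ennreal_mult[symmetric] mult.assoc[symmetric]) (simp add: mult_left_mono ennreal_mult mult.assoc)
qed

end

section \<open>The Dirac symbol and its exponential\<close>

lemma bounded_bilinear_matrix_mult:
  "bounded_bilinear ((**) :: complex^'n^'m \<Rightarrow> complex^'p^'n \<Rightarrow> complex^'p^'m)"
proof -
  have "bilinear ((**) :: complex^'n^'m \<Rightarrow> complex^'p^'n \<Rightarrow> complex^'p^'m)"
    unfolding bilinear_def
    by (auto intro!: linearI simp: vec_eq_iff matrix_matrix_mult_def sum.distrib algebra_simps scaleR_sum_right)
  then show ?thesis by (simp add: bilinear_conv_bounded_bilinear)
qed

lemma mat_of_real: "mat (complex_of_real c) = c *\<^sub>R (mat 1 :: complex^'n^'n)"
  by (simp add: vec_eq_iff mat_def of_real_def)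

lemma hermitian_matrix_inner:
  fixes A :: "complex^'n^'n"
  assumes "hermitian_matrix A"
  shows "(A *v u) \<bullet> v = u \<bullet> (A *v v)"
proof -
  have A: "A $ i $ j = cnj (A $ j $ i)" for i j
    using assms unfolding hermitian_matrix_def by blast
  have c: "(a * x) \<bullet> y = x \<bullet> (cnj a * y)" for a x y :: complex
    by (simp add: inner_complex_def algebra_simps)
  have "(A *v u) \<bullet> v = (\<Sum>i\<in>UNIV. \<Sum>j\<in>UNIV. (A $ i $ j * u $ j) \<bullet> v $ i)"
    by (simp add: inner_vec_def matrix_vector_mult_def inner_sum_left)
  also have "\<dots> = (\<Sum>i\<in>UNIV. \<Sum>j\<in>UNIV. u $ j \<bullet> (A $ j $ i * v $ i))"
  proof (intro sum.cong refl)
    fix i j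
    show "(A $ i $ j * u $ j) \<bullet> v $ i = u $ j \<bullet> (A $ j $ i * v $ i)"
      unfolding c by (subst A[of j i]) (rule refl)
  qed
  also have "\<dots> = (\<Sum>j\<in>UNIV. \<Sum>i\<in>UNIV. u $ j \<bullet> (A $ j $ i * v $ i))" by (rule sum.swap)
  also have "\<dots> = u \<bullet> (A *v v)"
    by (simp add: inner_vec_def matrix_vector_mult_def inner_sum_right)
  finally show ?thesis .
qed

lemma matrix_vector_mult_smult:
  fixes A :: "complex^'n^'m"
  shows "A *v (c *s u) = c *s (A *v u)"
  by (simp add: vec_eq_iff matrix_vector_mult_def sum_distrib_left mult_ac)

text \<open>As C squares to -1, its powers alternate up to sign between 1 and C, and the exponential
  series splits into the cosine series and the sine series.\<close>

lemma matrix_exp_unit: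
  fixes C :: "complex^'n^'n"
  assumes C: "C ** C = - mat 1"
  shows "matrix_exp (\<theta> *\<^sub>R C) = cos \<theta> *\<^sub>R mat 1 + sin \<theta> *\<^sub>R C"
proof -
  interpret M: bounded_bilinear "(**) :: complex^'n^'n \<Rightarrow> complex^'n^'n \<Rightarrow> complex^'n^'n"
    by (rule bounded_bilinear_matrix_mult)
  have pow: "(((**) (\<theta> *\<^sub>R C)) ^^ k) (mat 1) = fact k *\<^sub>R ((cos_coeff k * \<theta> ^ k) *\<^sub>R mat 1 + (sin_coeff k * \<theta> ^ k) *\<^sub>R C)" for k
  proof (induction k)
    case 0
    show ?case by (simp add: cos_coeff_def sin_coeff_def)
  next
    case (Suc k)
    have "(((**) (\<theta> *\<^sub>R C)) ^^ Suc k) (mat 1) = (\<theta> *\<^sub>R C) ** (fact k *\<^sub>R ((cos_coeff k * \<theta> ^ k) *\<^sub>R mat 1 + (sin_coeff k * \<theta> ^ k) *\<^sub>R C))"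
      by (simp only: funpow.simps o_def Suc)
    also have "\<dots> = (fact k * cos_coeff k * \<theta> ^ Suc k) *\<^sub>R C + (- (fact k * sin_coeff k * \<theta> ^ Suc k)) *\<^sub>R mat 1"
      by (simp add: M.add_right M.scaleR_left M.scaleR_right C scaleR_add_right mult_ac)
    also have "fact k * cos_coeff k = fact (Suc k) * sin_coeff (Suc k)"
      by (simp add: sin_coeff_Suc)
    also have "fact k * sin_coeff k = - (fact (Suc k) * cos_coeff (Suc k))"
      by (simp add: cos_coeff_Suc)
    finally show ?case by (simp add: scaleR_add_right mult_ac add.commute)
  qed
  have "(\<lambda>k. (cos_coeff k * \<theta> ^ k) *\<^sub>R (mat 1 :: complex^'n^'n) + (sin_coeff k * \<theta> ^ k) *\<^sub>R C) sums (cos \<theta> *\<^sub>R mat 1 + sin \<theta> *\<^sub>R C)"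
    using cos_converges[of \<theta>] sin_converges[of \<theta>]
    by (intro sums_add bounded_linear.sums[OF bounded_linear_scaleR_left]) simp_all
  then show ?thesis
    unfolding matrix_exp_def pow by (simp add: sums_unique[symmetric])
qed

text \<open>Real orthogonality and antisymmetry of \<open>i H / \<phi>\<close> replace the spectral projections of the
  Dirac symbol throughout.\<close>

definition dirac_J ::
  "('d::finite \<Rightarrow> complex^'n^'n) \<Rightarrow> complex^'n^'n \<Rightarrow> real \<Rightarrow> real^'d \<Rightarrow> complex^'n \<Rightarrow> complex^'n" where
  "dirac_J \<alpha> \<beta> m \<xi> u = (1 / dirac_dispersion m (norm \<xi>)) *\<^sub>R (\<i> *s (dirac_symbol \<alpha> \<beta> m \<xi> *v u))"

lemma bounded_linear_dirac_J: "bounded_linear (dirac_J \<alpha> \<beta> m \<xi>)"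
  unfolding dirac_J_def[abs_def]
  by (intro bounded_linear_intros
     bounded_linear_compose[OF bounded_bilinear.bounded_linear_right[OF bounded_bilinear_vector_smult]]
     bounded_bilinear.bounded_linear_right[OF bounded_bilinear_matrix_vector_mult])

lemma dirac_J_smult: "dirac_J \<alpha> \<beta> m \<xi> (c *s u) = c *s dirac_J \<alpha> \<beta> m \<xi> u"
  unfolding dirac_J_def by (simp add: vec_eq_iff matrix_vector_mult_smult)

section \<open>Consequences of the Clifford relations\<close>

context
  fixes \<alpha> :: "'d::finite \<Rightarrow> complex^'n^'n" and \<beta> :: "complex^'n^'n" and m :: real
  assumes dirac: "dirac_matrices \<alpha> \<beta>"
begin

lemma dirac_symbol_hermitian: "hermitian_matrix (dirac_symbol \<alpha> \<beta> m \<xi>)"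
proof -
  have a: "\<alpha> j $ i $ k = cnj (\<alpha> j $ k $ i)" and b: "\<beta> $ i $ k = cnj (\<beta> $ k $ i)" for i j k
    using dirac unfolding dirac_matrices_def hermitian_matrix_def by blast+
  show ?thesis
    unfolding hermitian_matrix_def dirac_symbol_def
    by (auto simp: sum_component cnj_sum a[symmetric] b[symmetric])
qed

lemma dirac_beta_sq: "\<beta> ** \<beta> = mat 1"
proof -
  have "\<beta> ** \<beta> + \<beta> ** \<beta> = mat (of_real 2)" using dirac by (simp add: dirac_matrices_def)
  then have "2 *\<^sub>R (\<beta> ** \<beta>) = 2 *\<^sub>R mat 1" unfolding mat_of_real by (simp add: scaleR_2)
  then show ?thesis by simp
qed

lemma dirac_alpha_sq: "\<alpha> j ** \<alpha> j = mat 1"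
proof -
  have "\<alpha> j ** \<alpha> j + \<alpha> j ** \<alpha> j = mat (of_real 2)" using dirac by (simp add: dirac_matrices_def)
  then have "2 *\<^sub>R (\<alpha> j ** \<alpha> j) = 2 *\<^sub>R mat 1" unfolding mat_of_real by (simp add: scaleR_2)
  then show ?thesis by simp
qed

lemma dirac_anticomm: "\<alpha> j ** \<beta> = - (\<beta> ** \<alpha> j)"
  using dirac by (simp add: dirac_matrices_def eq_neg_iff_add_eq_0)

text \<open>Symmetrising the double sum over j and k leaves only anticommutators, of which just the
  diagonal ones survive; the mixed terms with \<beta> cancel in the same way.\<close>

lemma dirac_symbol_sq:
  "dirac_symbol \<alpha> \<beta> m \<xi> ** dirac_symbol \<alpha> \<beta> m \<xi> = (dirac_dispersion m (norm \<xi>))\<^sup>2 *\<^sub>R mat 1"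
proof -
  interpret M: bounded_bilinear "(**) :: complex^'n^'n \<Rightarrow> complex^'n^'n \<Rightarrow> complex^'n^'n"
    by (rule bounded_bilinear_matrix_mult)
  let ?A = "\<Sum>j\<in>UNIV. (\<xi> $ j) *\<^sub>R \<alpha> j"
  have AA: "?A ** ?A = (norm \<xi>)\<^sup>2 *\<^sub>R mat 1"
  proof -
    have e: "?A ** ?A = (\<Sum>j\<in>UNIV. \<Sum>k\<in>UNIV. (\<xi> $ j * \<xi> $ k) *\<^sub>R (\<alpha> j ** \<alpha> k))"
      by (simp add: M.sum_left M.sum_right M.scaleR_left M.scaleR_right scaleR_sum_right)
         (subst sum.swap, simp add: mult.commute)
    also have "\<dots> = (\<Sum>j\<in>UNIV. \<Sum>k\<in>UNIV. (\<xi> $ j * \<xi> $ k) *\<^sub>R (\<alpha> k ** \<alpha> j))"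
      by (subst sum.swap) (simp add: mult.commute)
    finally have "?A ** ?A + ?A ** ?A = (\<Sum>j\<in>UNIV. \<Sum>k\<in>UNIV. (\<xi> $ j * \<xi> $ k) *\<^sub>R (\<alpha> j ** \<alpha> k + \<alpha> k ** \<alpha> j))"
      using e by (simp add: sum.distrib scaleR_add_right)
    also have "\<dots> = (\<Sum>j\<in>UNIV. \<Sum>k\<in>UNIV. if k = j then (2 * (\<xi> $ j)\<^sup>2) *\<^sub>R mat 1 else 0)"
      using dirac mat_of_real[of 2, where 'n='n]
      by (intro sum.cong refl) (auto simp: dirac_matrices_def power2_eq_square)
    also have "\<dots> = (2 * (norm \<xi>)\<^sup>2) *\<^sub>R mat 1"
      by (simp add: norm_vec_def L2_set_def sum_nonneg sum_distrib_left scaleR_sum_left)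
    finally have "(1 / 2) *\<^sub>R (?A ** ?A + ?A ** ?A) = (1 / 2) *\<^sub>R ((2 * (norm \<xi>)\<^sup>2) *\<^sub>R mat 1)" by (simp only:)
    then show ?thesis by (simp add: scaleR_2[symmetric])
  qed
  have AB: "?A ** \<beta> = - (\<beta> ** ?A)"
    by (simp add: M.sum_left M.sum_right M.scaleR_left M.scaleR_right dirac_anticomm sum_negf)
  have "dirac_symbol \<alpha> \<beta> m \<xi> ** dirac_symbol \<alpha> \<beta> m \<xi> = ?A ** ?A + (m * m) *\<^sub>R (\<beta> ** \<beta>)"
  proof -
    have "(A + m *\<^sub>R \<beta>) ** (A + m *\<^sub>R \<beta>) = A ** A + m *\<^sub>R (A ** \<beta> + \<beta> ** A) + (m * m) *\<^sub>R (\<beta> ** \<beta>)" for A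
      by (simp add: M.add_left M.add_right M.scaleR_left M.scaleR_right scaleR_add_right)
    from this[of ?A] show ?thesis unfolding dirac_symbol_def AB by simp
  qed
  also have "\<dots> = ((norm \<xi>)\<^sup>2 + m\<^sup>2) *\<^sub>R mat 1"
    by (simp add: AA dirac_beta_sq scaleR_add_left power2_eq_square)
  finally show ?thesis by (simp add: dirac_dispersion_eq_sqrt)
qed

lemma dirac_J_antisym: "dirac_J \<alpha> \<beta> m \<xi> u \<bullet> v = - (u \<bullet> dirac_J \<alpha> \<beta> m \<xi> v)"
proof -
  have e: "dirac_symbol \<alpha> \<beta> m \<xi> *v (cnj \<i> *s v) = - (\<i> *s (dirac_symbol \<alpha> \<beta> m \<xi> *v v))"
    unfolding matrix_vector_mult_smult by (simp add: vec_eq_iff)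
  show ?thesis
    unfolding dirac_J_def
    by (simp only: inner_scaleR_left inner_scaleR_right inner_vector_smult
        hermitian_matrix_inner[OF dirac_symbol_hermitian] e inner_minus_right mult_minus_right)
qed

lemma norm_dirac_J:
  assumes "\<xi> \<noteq> 0"
  shows "norm (dirac_J \<alpha> \<beta> m \<xi> u) = norm u"
proof -
  let ?H = "dirac_symbol \<alpha> \<beta> m \<xi>" and ?\<phi> = "dirac_dispersion m (norm \<xi>)"
  have \<phi>: "?\<phi> > 0" using assms by (intro dirac_dispersion_pos) simp
  have "(norm (?H *v u))\<^sup>2 = u \<bullet> (?H *v (?H *v u))"
    by (simp add: power2_norm_eq_inner hermitian_matrix_inner[OF dirac_symbol_hermitian])
  also have "?H *v (?H *v u) = ?\<phi>\<^sup>2 *\<^sub>R u"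
    unfolding matrix_vector_mul_assoc dirac_symbol_sq
    by (simp add: bounded_bilinear.scaleR_left[OF bounded_bilinear_matrix_vector_mult])
  finally have "(norm (?H *v u))\<^sup>2 = (?\<phi> * norm u)\<^sup>2"
    by (simp add: power_mult_distrib power2_norm_eq_inner)
  then have "norm (?H *v u) = ?\<phi> * norm u"
    using \<phi> by (simp add: power2_eq_iff_nonneg)
  then show ?thesis using \<phi> by (simp add: dirac_J_def norm_vector_smult)
qed

lemma matrix_exp_dirac:
  assumes "\<xi> \<noteq> 0"
  shows "matrix_exp (mat (- \<i> * of_real t) ** dirac_symbol \<alpha> \<beta> m \<xi>) *v u =
    cos (t * dirac_dispersion m (norm \<xi>)) *\<^sub>R u - sin (t * dirac_dispersion m (norm \<xi>)) *\<^sub>R dirac_J \<alpha> \<beta> m \<xi> u"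
proof -
  interpret M: bounded_bilinear "(**) :: complex^'n^'n \<Rightarrow> complex^'n^'n \<Rightarrow> complex^'n^'n"
    by (rule bounded_bilinear_matrix_mult)
  interpret S: bounded_bilinear "(*s) :: complex \<Rightarrow> complex^'n \<Rightarrow> complex^'n"
    by (rule bounded_bilinear_vector_smult)
  interpret V: bounded_bilinear "(*v) :: complex^'n^'n \<Rightarrow> complex^'n \<Rightarrow> complex^'n"
    by (rule bounded_bilinear_matrix_vector_mult)
  let ?H = "dirac_symbol \<alpha> \<beta> m \<xi>" and ?\<phi> = "dirac_dispersion m (norm \<xi>)"
  have \<phi>: "?\<phi> > 0" using assms by (intro dirac_dispersion_pos) simp
  \<comment> \<open>C is the matrix of -J, so that -i t H = (t \<phi>) C. Dividing by \<phi> makes C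
    a square root of -1, and \<xi> \<noteq> 0 permits this even for m = 0.\<close>
  define C where "C = (1 / ?\<phi>) *\<^sub>R (mat (- \<i>) ** ?H)"
  have "(mat c :: complex^'n^'n) *v w = c *s w" for c w
  proof -
    have "(\<Sum>j\<in>UNIV. (if i = j then c else 0) * w $ j) = (\<Sum>j\<in>UNIV. if i = j then c * w $ j else 0)" for i
      by (intro sum.cong) auto
    then show ?thesis by (simp add: vec_eq_iff matrix_vector_mult_def mat_def)
  qed
  then have mat_v: "(mat c ** A) *v u = c *s (A *v u)" for c and A :: "complex^'n^'n" and u
    by (simp add: matrix_vector_mul_assoc[symmetric])
  have Cv: "C *v u = - dirac_J \<alpha> \<beta> m \<xi> u" for u
    unfolding C_def dirac_J_def V.scaleR_left mat_v by (simp add: vec_eq_iff)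
  have "(C ** C) *v u = (- mat 1) *v u" for u
  proof -
    have "(C ** C) *v u = dirac_J \<alpha> \<beta> m \<xi> (dirac_J \<alpha> \<beta> m \<xi> u)"
      by (simp add: matrix_vector_mul_assoc[symmetric] Cv V.minus_right)
    also have "\<dots> = - u"
    proof -
      have "?H *v (?H *v u) = ?\<phi>\<^sup>2 *\<^sub>R u"
        unfolding matrix_vector_mul_assoc dirac_symbol_sq by (simp add: V.scaleR_left)
      moreover have "\<i> *s (\<i> *s w) = - w" for w :: "complex^'n"
        by (simp add: vec_eq_iff mult.assoc[symmetric])
      ultimately show ?thesis using \<phi>
        unfolding dirac_J_def
        by (simp add: V.scaleR_right matrix_vector_mult_smult S.scaleR_right power2_eq_square)
    qed
    finally show ?thesis by (simp add: V.minus_left)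
  qed
  then have CC: "C ** C = - mat 1" by (simp add: matrix_eq)
  have "mat (- \<i> * of_real t) ** ?H = (t * ?\<phi>) *\<^sub>R C"
  proof -
    have sm: "(- \<i> * of_real t) *s w = - (t *\<^sub>R (\<i> *s w))" for w :: "complex^'n"
      by (simp add: vec_eq_iff scaleR_conv_of_real[where 'a=complex] mult_ac)
    have "(mat (- \<i> * of_real t) ** ?H) *v u = ((t * ?\<phi>) *\<^sub>R C) *v u" for u
      using \<phi> unfolding mat_v sm V.scaleR_left Cv dirac_J_def by simp
    then show ?thesis by (simp add: matrix_eq)
  qed
  then show ?thesis
    by (simp add: matrix_exp_unit[OF CC] V.add_left V.scaleR_left Cv)
qed

end

section \<open>Duality\<close>

text \<open>The transform of \<psi>(|D|) exp (-i t H) f when g is the transform of f, with the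
  matrix exponential in closed form. In this form joint measurability in t and \<xi> is evident and
  additivity in g holds at every point.\<close>

definition flow_density ::
  "('d::finite \<Rightarrow> complex^'n^'n) \<Rightarrow> complex^'n^'n \<Rightarrow> real \<Rightarrow> (real^'d \<Rightarrow> complex^'n) \<Rightarrow> real \<Rightarrow> real^'d \<Rightarrow> complex^'n" where
  "flow_density \<alpha> \<beta> m g t \<xi> = bracket_smoothing m (norm \<xi>) *\<^sub>R
     (cos (t * dirac_dispersion m (norm \<xi>)) *\<^sub>R g \<xi> - sin (t * dirac_dispersion m (norm \<xi>)) *\<^sub>R dirac_J \<alpha> \<beta> m \<xi> (g \<xi>))"

lemma dirac_symbol_measurable [measurable]: "dirac_symbol \<alpha> \<beta> m \<in> borel_measurable borel"
  unfolding dirac_symbol_def[abs_def]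
  by (intro borel_measurable_continuous_onI continuous_intros)

lemma dirac_J_measurable [measurable (raw)]:
  fixes \<alpha> :: "'d::finite \<Rightarrow> complex^'n^'n"
  assumes [measurable]: "a \<in> borel_measurable N" "b \<in> borel_measurable N"
  shows "(\<lambda>x. dirac_J \<alpha> \<beta> m (a x) (b x)) \<in> borel_measurable N"
  unfolding dirac_J_def by measurable

lemma flow_density_measurable [measurable (raw)]:
  fixes \<alpha> :: "'d::finite \<Rightarrow> complex^'n^'n"
  assumes [measurable]: "g \<in> borel_measurable borel" "a \<in> borel_measurable N" "b \<in> borel_measurable N"
  shows "(\<lambda>x. flow_density \<alpha> \<beta> m g (a x) (b x)) \<in> borel_measurable N"
  unfolding flow_density_def by measurable

lemma inverse_fourier_cong_AE:
  fixes g h :: "real^'d \<Rightarrow> complex^'n"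
  assumes [measurable]: "g \<in> borel_measurable borel" "h \<in> borel_measurable borel" and "AE \<xi> in lborel. g \<xi> = h \<xi>"
  shows "inverse_fourier g x = inverse_fourier h x"
  unfolding inverse_fourier_def using assms(3)
  by (intro arg_cong[where f="\<lambda>v. _ *\<^sub>R v"] integral_cong_AE) (auto elim!: eventually_mono)

text \<open>Any g that agrees almost everywhere with the chosen representative
  \<open>L2_fourier f\<close> may be used; this admits explicit data for the lower bounds.\<close>

lemma smoothed_dirac_flow_eq:
  fixes \<alpha> :: "'d::finite \<Rightarrow> complex^'n^'n" and f g :: "real^'d \<Rightarrow> complex^'n"
  assumes dirac: "dirac_matrices \<alpha> \<beta>" and f: "f \<in> L2_space" and g[measurable]: "g \<in> borel_measurable borel"
    and fg: "AE \<xi> in lborel. L2_fourier f \<xi> = g \<xi>"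
  shows "smoothed_dirac_flow \<alpha> \<beta> (bracket_smoothing m) m t f x = inverse_fourier (flow_density \<alpha> \<beta> m g t) x"
proof -
  have [measurable]: "L2_fourier f \<in> borel_measurable borel" by (rule L2_fourier_measurable[OF f])
  let ?S = "\<lambda>\<xi>. (bracket_smoothing m (norm \<xi>) *\<^sub>R matrix_exp (mat (- \<i> * of_real t) ** dirac_symbol \<alpha> \<beta> m \<xi>)) *v L2_fourier f \<xi>"
  have S: "?S \<xi> = flow_density \<alpha> \<beta> m (L2_fourier f) t \<xi>" if "\<xi> \<noteq> 0" for \<xi>
    unfolding flow_density_def
    by (simp only: bounded_bilinear.scaleR_left[OF bounded_bilinear_matrix_vector_mult] matrix_exp_dirac[OF dirac that])
  \<comment> \<open>The closed formula holds off the origin; isolating the single value at 0 yields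
    measurability of \<open>?S\<close> with no statement about \<open>matrix_exp\<close> as a
    function of the matrix.\<close>
  have "?S = (\<lambda>\<xi>. if \<xi> = 0 then ?S 0 else flow_density \<alpha> \<beta> m (L2_fourier f) t \<xi>)"
    using S by (intro ext) simp
  then have Sm: "?S \<in> borel_measurable borel" by (rule ssubst) measurable
  have "AE \<xi> in lborel. (\<xi>::real^'d) \<noteq> 0" by (rule AE_lborel_singleton)
  with fg have "AE \<xi> in lborel. ?S \<xi> = flow_density \<alpha> \<beta> m g t \<xi>"
  proof eventually_elim
    case (elim \<xi>)
    show ?case using S[OF elim(2)] elim(1) by (simp only: flow_density_def)
  qed
  then have "inverse_fourier ?S x = inverse_fourier (flow_density \<alpha> \<beta> m g t) x"
    by (intro inverse_fourier_cong_AE Sm) measurable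
  then show ?thesis
    by (simp only: smoothed_dirac_flow_def fourier_multiplier_def)
qed

lemma inverse_fourier_flow_measurable [measurable (raw)]:
  fixes \<alpha> :: "'d::finite \<Rightarrow> complex^'n^'n"
  assumes [measurable]: "g \<in> borel_measurable borel" "a \<in> borel_measurable N" "b \<in> borel_measurable N"
  shows "(\<lambda>x. inverse_fourier (flow_density \<alpha> \<beta> m g (a x)) (b x)) \<in> borel_measurable N"
  unfolding inverse_fourier_def by measurable

lemma flow_density_norm_le:
  fixes \<alpha> :: "'d::finite \<Rightarrow> complex^'n^'n"
  assumes dirac: "dirac_matrices \<alpha> \<beta>" and "\<xi> \<noteq> 0"
  shows "norm (flow_density \<alpha> \<beta> m g t \<xi>) \<le> 2 * \<bar>bracket_smoothing m (norm \<xi>)\<bar> * norm (g \<xi>)"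
proof -
  have key: "norm (cos s *\<^sub>R g \<xi> - sin s *\<^sub>R dirac_J \<alpha> \<beta> m \<xi> (g \<xi>)) \<le> norm (g \<xi>) + norm (g \<xi>)" for s
    by (rule norm_triangle_le_diff) (intro add_mono, simp_all add: norm_dirac_J[OF dirac assms(2)] mult_left_le_one_le abs_cos_le_one abs_sin_le_one)
  have "norm (flow_density \<alpha> \<beta> m g t \<xi>) \<le> \<bar>bracket_smoothing m (norm \<xi>)\<bar> * (norm (g \<xi>) + norm (g \<xi>))"
    unfolding flow_density_def norm_scaleR by (intro mult_left_mono key) simp
  then show ?thesis by (simp add: mult_2[symmetric])
qed

text \<open>For m = 0 the function \<psi> is unbounded near the origin, so boundedness is obtained
  by compactness away from it. This is the reason for working with annular data.\<close>

lemma bracket_smoothing_bounded: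
  fixes K :: "(real^'d) set"
  assumes K: "compact K" "0 \<notin> K"
  obtains B where "B \<ge> 0" "\<And>\<xi>. \<xi> \<in> K \<Longrightarrow> \<bar>bracket_smoothing m (norm \<xi>)\<bar> \<le> B"
proof -
  have nz: "norm \<xi> \<noteq> 0" if "\<xi> \<in> K" for \<xi> using that K by auto
  have "dirac_dispersion m (norm \<xi>) \<noteq> 0" if "\<xi> \<in> K" for \<xi>
    using dirac_dispersion_pos[OF nz[OF that], of m] by simp
  then have "continuous_on K (\<lambda>\<xi>. bracket_smoothing m (norm \<xi>))"
    unfolding bracket_smoothing_def dirac_dispersion_eq_sqrt
    by (intro continuous_intros) (auto simp: add_nonneg_eq_0_iff)
  then have "bounded ((\<lambda>\<xi>. bracket_smoothing m (norm \<xi>)) ` K)"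
    using K(1) by (intro compact_imp_bounded compact_continuous_image)
  then obtain B where "\<forall>y\<in>(\<lambda>\<xi>. bracket_smoothing m (norm \<xi>)) ` K. norm y \<le> B" by (auto simp: bounded_iff)
  then show thesis by (intro that[of "max B 0"]) (auto simp: le_max_iff_disj)
qed

text \<open>With \<open>a\<close>, \<open>b\<close> the values of \<open>F^\<close> at \<open>(\<minusplus>\<phi>, \<xi>)\<close>, the left-hand side is the norm of
  \<open>(a + b) / 2 + J ((a - b) / (2 i))\<close>. As \<open>J\<close> is isometric, the parallelogram law applies.\<close>

lemma dual_density_bound:
  fixes \<alpha> :: "'d::finite \<Rightarrow> complex^'n^'n" and F :: "real \<times> (real^'d) \<Rightarrow> complex^'n" and m :: real
  assumes dirac: "dirac_matrices \<alpha> \<beta>" and F: "integrable lborel F" and \<xi>: "\<xi> \<noteq> 0"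
  defines "\<phi> \<equiv> dirac_dispersion m (norm \<xi>)"
  shows "(norm (\<integral>p. exp (- \<i> * of_real (snd p \<bullet> \<xi>)) *s (cos (fst p * \<phi>) *\<^sub>R F p + sin (fst p * \<phi>) *\<^sub>R dirac_J \<alpha> \<beta> m \<xi> (F p)) \<partial>lborel))\<^sup>2
    \<le> (\<Sum>i\<in>UNIV. (norm (ft (\<lambda>p. F p $ i) (- \<phi>, \<xi>)))\<^sup>2 + (norm (ft (\<lambda>p. F p $ i) (\<phi>, \<xi>)))\<^sup>2)" (is "(norm ?\<Phi>)\<^sup>2 \<le> _")
proof -
  interpret S: bounded_bilinear "(*s) :: complex \<Rightarrow> complex^'n \<Rightarrow> complex^'n"
    by (rule bounded_bilinear_vector_smult)
  interpret J: bounded_linear "dirac_J \<alpha> \<beta> m \<xi>" by (rule bounded_linear_dirac_J)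
  have [measurable]: "F \<in> borel_measurable borel" using F by auto
  define e where "e s p = exp (- \<i> * of_real (p \<bullet> (s * \<phi>, \<xi>)))" for s and p :: "real \<times> (real^'d)"
  define A where "A s = (\<integral>p. e s p *s F p \<partial>lborel)" for s
  have ne: "norm (e s p) = 1" for s p by (simp add: e_def)
  have eF: "integrable lborel (\<lambda>p. e s p *s F p)" for s
  proof (rule Bochner_Integration.integrable_bound[OF F])
    show "(\<lambda>p. e s p *s F p) \<in> borel_measurable lborel" unfolding e_def by measurable
  qed (simp add: norm_vector_smult ne)
  have Ai: "A s $ i = ft (\<lambda>p. F p $ i) (s * \<phi>, \<xi>)" for s i
    unfolding A_def ft_def e_def
    by (subst integral_bounded_linear[OF bounded_linear_vec_nth, symmetric]) (use eF[of s, unfolded e_def] in simp_all)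
  have split: "exp (- \<i> * of_real (snd p \<bullet> \<xi>)) *s (cos (fst p * \<phi>) *\<^sub>R F p + sin (fst p * \<phi>) *\<^sub>R dirac_J \<alpha> \<beta> m \<xi> (F p))
     = (1 / 2) *\<^sub>R (e (- 1) p *s F p + e 1 p *s F p) + dirac_J \<alpha> \<beta> m \<xi> ((1 / (2 * \<i>)) *s (e (- 1) p *s F p - e 1 p *s F p))" for p
  proof -
    let ?x = "exp (- \<i> * of_real (snd p \<bullet> \<xi>))" and ?\<theta> = "fst p * \<phi>"
    have em: "e (- 1) p = ?x * exp (\<i> * of_real ?\<theta>)" and ep: "e 1 p = ?x * exp (- \<i> * of_real ?\<theta>)"
      by (cases p; simp add: e_def exp_add[symmetric] algebra_simps)+
    have c: "?x * of_real (cos ?\<theta>) = (e (- 1) p + e 1 p) / 2"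
      unfolding em ep by (simp add: cos_of_real[symmetric] cos_exp_eq distrib_left)
    have s: "?x * of_real (sin ?\<theta>) = (1 / (2 * \<i>)) * (e (- 1) p - e 1 p)"
      unfolding em ep by (simp add: sin_of_real[symmetric] sin_exp_eq right_diff_distrib)
    have 1: "?x *s (r *\<^sub>R v) = (?x * of_real r) *s v" for r and v :: "complex^'n"
      by (simp add: vec_eq_iff scaleR_conv_of_real[where 'a=complex] mult_ac)
    have 2: "((a + b) / 2) *s v = (1 / 2) *\<^sub>R (a *s v + b *s v)" for a b and v :: "complex^'n"
      by (simp add: vec_eq_iff scaleR_conv_of_real[where 'a=complex] field_simps)
    have 3: "(a * b) *s v = a *s (b *s v)" for a b and v :: "complex^'n"
      by (simp add: vec_eq_iff mult.assoc)
    show ?thesis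
      unfolding S.add_right 1 c s 2 3 dirac_J_smult[symmetric] S.diff_left J.diff ..
  qed
  have "?\<Phi> = (1 / 2) *\<^sub>R (A (- 1) + A 1) + dirac_J \<alpha> \<beta> m \<xi> ((1 / (2 * \<i>)) *s (A (- 1) - A 1))"
  proof -
    have i1: "integrable lborel (\<lambda>p. (1 / 2) *\<^sub>R (e (- 1) p *s F p + e 1 p *s F p))"
      by (intro integrable_scaleR_right Bochner_Integration.integrable_add eF)
    have i2: "integrable lborel (\<lambda>p. (1 / (2 * \<i>)) *s (e (- 1) p *s F p - e 1 p *s F p))"
      by (intro integrable_bounded_linear[OF S.bounded_linear_right] Bochner_Integration.integrable_diff eF)
    have i3: "integrable lborel (\<lambda>p. dirac_J \<alpha> \<beta> m \<xi> ((1 / (2 * \<i>)) *s (e (- 1) p *s F p - e 1 p *s F p)))"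
      by (intro integrable_bounded_linear[OF J.bounded_linear_axioms] i2)
    have "?\<Phi> = (\<integral>p. (1 / 2) *\<^sub>R (e (- 1) p *s F p + e 1 p *s F p) \<partial>lborel) +
       (\<integral>p. dirac_J \<alpha> \<beta> m \<xi> ((1 / (2 * \<i>)) *s (e (- 1) p *s F p - e 1 p *s F p)) \<partial>lborel)"
      unfolding split by (rule Bochner_Integration.integral_add[OF i1 i3])
    also have "(\<integral>p. (1 / 2) *\<^sub>R (e (- 1) p *s F p + e 1 p *s F p) \<partial>lborel) = (1 / 2) *\<^sub>R (A (- 1) + A 1)"
      unfolding A_def by (subst integral_scaleR_right, simp) (subst Bochner_Integration.integral_add[OF eF eF], simp)
    also have "(\<integral>p. dirac_J \<alpha> \<beta> m \<xi> ((1 / (2 * \<i>)) *s (e (- 1) p *s F p - e 1 p *s F p)) \<partial>lborel)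
       = dirac_J \<alpha> \<beta> m \<xi> ((1 / (2 * \<i>)) *s (A (- 1) - A 1))"
      unfolding A_def integral_bounded_linear[OF J.bounded_linear_axioms i2]
        integral_bounded_linear[OF S.bounded_linear_right Bochner_Integration.integrable_diff[OF eF eF]]
        Bochner_Integration.integral_diff[OF eF eF] ..
    finally show ?thesis .
  qed
  then have "norm ?\<Phi> \<le> norm ((1 / 2) *\<^sub>R (A (- 1) + A 1)) + norm (dirac_J \<alpha> \<beta> m \<xi> ((1 / (2 * \<i>)) *s (A (- 1) - A 1)))"
    by (simp only: norm_triangle_ineq)
  also have "\<dots> = norm (A (- 1) + A 1) / 2 + norm (A (- 1) - A 1) / 2"
    by (simp only: norm_dirac_J[OF dirac \<xi>] norm_vector_smult norm_scaleR) (simp add: norm_divide norm_mult)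
  finally have "(norm ?\<Phi>)\<^sup>2 \<le> (norm (A (- 1) + A 1) / 2 + norm (A (- 1) - A 1) / 2)\<^sup>2"
    by (intro power_mono) auto
  also have "\<dots> \<le> ((norm (A (- 1) + A 1))\<^sup>2 + (norm (A (- 1) - A 1))\<^sup>2) / 2"
    using sum_squares_bound[of "norm (A (- 1) + A 1)" "norm (A (- 1) - A 1)"]
    by (simp add: power2_sum power_divide field_simps)
  also have "\<dots> = (norm (A (- 1)))\<^sup>2 + (norm (A 1))\<^sup>2"
    by (simp add: power2_norm_eq_inner inner_add_left inner_add_right inner_diff_left inner_diff_right)
  also have "\<dots> = (\<Sum>i\<in>UNIV. (norm (ft (\<lambda>p. F p $ i) (- \<phi>, \<xi>)))\<^sup>2 + (norm (ft (\<lambda>p. F p $ i) (\<phi>, \<xi>)))\<^sup>2)"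
    unfolding norm_vec_power2 Ai by (simp add: sum.distrib)
  finally show ?thesis .
qed

lemma fst_borel: "(fst :: 'a::topological_space \<times> 'b::topological_space \<Rightarrow> 'a) \<in> borel_measurable borel"
  and snd_borel: "(snd :: 'a \<times> 'b \<Rightarrow> 'b) \<in> borel_measurable borel"
  by (intro borel_measurable_continuous_onI continuous_intros)+

lemma dual_kernel_measurable:
  fixes \<alpha> :: "'d::finite \<Rightarrow> complex^'n^'n"
  assumes [measurable]: "t \<in> borel_measurable N" "x \<in> borel_measurable N" "a \<in> borel_measurable N" "v \<in> borel_measurable N"
  shows "(\<lambda>z. exp (- \<i> * of_real (x z \<bullet> a z)) *s (cos (t z * dirac_dispersion m (norm (a z))) *\<^sub>R v z
      + sin (t z * dirac_dispersion m (norm (a z))) *\<^sub>R dirac_J \<alpha> \<beta> m (a z) (v z))) \<in> borel_measurable N"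
  by measurable

lemma dual_kernel_integrable:
  fixes \<alpha> :: "'d::finite \<Rightarrow> complex^'n^'n" and F :: "real \<times> (real^'d) \<Rightarrow> complex^'n"
  assumes F: "integrable lborel F"
  shows "integrable lborel (\<lambda>p. exp (- \<i> * of_real (snd p \<bullet> \<xi>)) *s (cos (fst p * dirac_dispersion m (norm \<xi>)) *\<^sub>R F p
      + sin (fst p * dirac_dispersion m (norm \<xi>)) *\<^sub>R dirac_J \<alpha> \<beta> m \<xi> (F p)))" (is "integrable lborel ?k")
proof (rule Bochner_Integration.integrable_bound)
  have Fm: "F \<in> borel_measurable borel" using F by auto
  show "integrable lborel (\<lambda>p. norm (F p) + norm (dirac_J \<alpha> \<beta> m \<xi> (F p)))"
    by (intro Bochner_Integration.integrable_add integrable_norm F integrable_bounded_linear[OF bounded_linear_dirac_J F])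
  show "?k \<in> borel_measurable lborel"
    unfolding measurable_lborel2 by (rule dual_kernel_measurable[OF fst_borel snd_borel _ Fm]) simp
  show "AE p in lborel. norm (?k p) \<le> norm (norm (F p) + norm (dirac_J \<alpha> \<beta> m \<xi> (F p)))"
  proof (rule AE_I2)
    fix p
    have "norm (?k p) \<le> \<bar>cos (fst p * dirac_dispersion m (norm \<xi>))\<bar> * norm (F p) + \<bar>sin (fst p * dirac_dispersion m (norm \<xi>))\<bar> * norm (dirac_J \<alpha> \<beta> m \<xi> (F p))"
      unfolding norm_vector_smult by (simp add: norm_triangle_le)
    also have "\<dots> \<le> 1 * norm (F p) + 1 * norm (dirac_J \<alpha> \<beta> m \<xi> (F p))"
      by (intro add_mono mult_right_mono abs_cos_le_one abs_sin_le_one) auto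
    finally show "norm (?k p) \<le> norm (norm (F p) + norm (dirac_J \<alpha> \<beta> m \<xi> (F p)))" by simp
  qed
qed

text \<open>The adjoint of the flow for the real inner product: antisymmetry of J changes the sign
  of the sine term, and the scalar z is conjugated.\<close>

lemma flow_density_inner:
  fixes \<alpha> :: "'d::finite \<Rightarrow> complex^'n^'n" and m :: real
  assumes dirac: "dirac_matrices \<alpha> \<beta>"
  defines "\<phi> \<equiv> \<lambda>\<xi>. dirac_dispersion m (norm \<xi>)"
  shows "(z *s flow_density \<alpha> \<beta> m g t \<xi>) \<bullet> v =
    (bracket_smoothing m (norm \<xi>) *\<^sub>R g \<xi>) \<bullet> (cnj z *s (cos (t * \<phi> \<xi>) *\<^sub>R v + sin (t * \<phi> \<xi>) *\<^sub>R dirac_J \<alpha> \<beta> m \<xi> v))"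
proof -
  interpret S: bounded_bilinear "(*s) :: complex \<Rightarrow> complex^'n \<Rightarrow> complex^'n"
    by (rule bounded_bilinear_vector_smult)
  have J: "dirac_J \<alpha> \<beta> m \<xi> (g \<xi>) \<bullet> (cnj z *s v) = - (g \<xi> \<bullet> (cnj z *s dirac_J \<alpha> \<beta> m \<xi> v))"
    by (simp only: dirac_J_antisym[OF dirac] dirac_J_smult)
  show ?thesis
    unfolding inner_vector_smult flow_density_def \<phi>_def
    by (simp add: inner_diff_left inner_add_right J S.add_right S.scaleR_right algebra_simps)
qed

text \<open>The pointwise bound is a sum over the components of F, and each component is a scalar
  space-time function to which the two-branch estimate applies. Summing the components restores
  |F|^2, so no factor depending on their number appears.\<close>

lemma dual_density_integral:
  fixes \<alpha> :: "'d::finite \<Rightarrow> complex^'n^'n" and F :: "real \<times> (real^'d) \<Rightarrow> complex^'n" and m :: real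
  assumes dirac: "dirac_matrices \<alpha> \<beta>" and d: "CARD('d) \<ge> 3"
    and F[measurable]: "F \<in> borel_measurable borel" and bound: "\<And>p. norm (F p) \<le> M * indicator (cball 0 R) p"
  defines "\<Phi> \<equiv> \<lambda>\<xi>. \<integral>p. exp (- \<i> * of_real (snd p \<bullet> \<xi>)) *s (cos (fst p * dirac_dispersion m (norm \<xi>)) *\<^sub>R F p
      + sin (fst p * dirac_dispersion m (norm \<xi>)) *\<^sub>R dirac_J \<alpha> \<beta> m \<xi> (F p)) \<partial>lborel"
  shows "(\<integral>\<^sup>+\<xi>. ennreal ((bracket_smoothing m (norm \<xi>))\<^sup>2 * (norm (\<Phi> \<xi>))\<^sup>2) \<partial>lborel)
    \<le> ennreal ((if CARD('d) \<ge> 5 then 1 / 2 else 1) * (2 * pi) ^ (CARD('d) + 1)) *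
      (\<integral>\<^sup>+p. ennreal ((1 + (norm (snd p))\<^sup>2) * (norm (F p))\<^sup>2) \<partial>lborel)"
proof -
  let ?C = "ennreal ((if CARD('d) \<ge> 5 then 1 / 2 else 1) * (2 * pi) ^ (CARD('d) + 1))"
  let ?A = "\<lambda>i \<xi>. (bracket_smoothing m (norm \<xi>))\<^sup>2 * ((norm (ft (\<lambda>p. F p $ i) (- dirac_dispersion m (norm \<xi>), \<xi>)))\<^sup>2 + (norm (ft (\<lambda>p. F p $ i) (dirac_dispersion m (norm \<xi>), \<xi>)))\<^sup>2)"
  have bi: "norm (F p $ i) \<le> M * indicator (cball 0 R) p" for p i
    using Finite_Cartesian_Product.norm_nth_le[of "F p" i] bound[of p] by (rule order_trans)
  have Fi[measurable]: "(\<lambda>p. F p $ i) \<in> borel_measurable borel" for i by measurable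
  have Fint: "integrable lborel F"
  proof (rule Bochner_Integration.integrable_bound)
    have "emeasure lborel (cball (0::real \<times> (real^'d)) R) < \<infinity>"
      by (intro emeasure_bounded_finite bounded_cball)
    then show "integrable lborel (\<lambda>p::real \<times> (real^'d). M * indicator (cball 0 R) p)"
      by (intro integrable_mult_right integrable_real_indicator) auto
    show "AE p in lborel. norm (F p) \<le> norm (M * indicator (cball 0 R) p)"
      using bound by (intro AE_I2) (auto intro: order_trans[OF _ abs_ge_self])
  qed simp
  have ftm: "(\<lambda>\<xi>. ft (\<lambda>p. F p $ i) (a \<xi>, \<xi>)) \<in> borel_measurable borel" if "a \<in> borel_measurable borel" for i a
    by (rule measurable_compose[OF borel_measurable_Pair[OF that] ft_measurable[OF Fi]]) measurable
  have Am: "?A i \<in> borel_measurable borel" for i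
    using ftm[of "\<lambda>\<xi>. - dirac_dispersion m (norm \<xi>)" i] ftm[of "\<lambda>\<xi>. dirac_dispersion m (norm \<xi>)" i] by measurable
  have "AE \<xi> in lborel. (\<xi>::real^'d) \<noteq> 0" by (rule AE_lborel_singleton)
  then have "AE \<xi> in lborel. ennreal ((bracket_smoothing m (norm \<xi>))\<^sup>2 * (norm (\<Phi> \<xi>))\<^sup>2) \<le> (\<Sum>i\<in>UNIV. ennreal (?A i \<xi>))"
  proof eventually_elim
    case (elim \<xi>)
    have "(bracket_smoothing m (norm \<xi>))\<^sup>2 * (norm (\<Phi> \<xi>))\<^sup>2 \<le> (\<Sum>i\<in>UNIV. ?A i \<xi>)"
      unfolding sum_distrib_left[symmetric] \<Phi>_def by (intro mult_left_mono dual_density_bound[OF dirac Fint elim]) simp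
    then have "ennreal ((bracket_smoothing m (norm \<xi>))\<^sup>2 * (norm (\<Phi> \<xi>))\<^sup>2) \<le> ennreal (\<Sum>i\<in>UNIV. ?A i \<xi>)" by (rule ennreal_leI)
    also have "\<dots> = (\<Sum>i\<in>UNIV. ennreal (?A i \<xi>))" by (rule sum_ennreal[symmetric]) simp
    finally show ?case .
  qed
  then have "(\<integral>\<^sup>+\<xi>. ennreal ((bracket_smoothing m (norm \<xi>))\<^sup>2 * (norm (\<Phi> \<xi>))\<^sup>2) \<partial>lborel) \<le> (\<integral>\<^sup>+\<xi>. (\<Sum>i\<in>UNIV. ennreal (?A i \<xi>)) \<partial>lborel)"
    by (rule nn_integral_mono_AE)
  also have "\<dots> = (\<Sum>i\<in>UNIV. \<integral>\<^sup>+\<xi>. ennreal (?A i \<xi>) \<partial>lborel)"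
    using Am by (intro nn_integral_sum) simp
  also have "\<dots> \<le> (\<Sum>i\<in>UNIV. ?C * (\<integral>\<^sup>+p. ennreal ((1 + (norm (snd p))\<^sup>2) * (norm (F p $ i))\<^sup>2) \<partial>lborel))"
    by (intro sum_mono trace_both_branches[OF Fi bi d])
  also have "\<dots> = ?C * (\<integral>\<^sup>+p. (\<Sum>i\<in>UNIV. ennreal ((1 + (norm (snd p))\<^sup>2) * (norm (F p $ i))\<^sup>2)) \<partial>lborel)"
  proof -
    have wm: "(\<lambda>p :: real \<times> (real^'d). 1 + (norm (snd p))\<^sup>2) \<in> borel_measurable borel"
      by (intro borel_measurable_continuous_onI continuous_intros)
    have "(\<lambda>p. (norm (F p $ i))\<^sup>2) \<in> borel_measurable borel" for i by measurable
    from borel_measurable_times[OF wm this] show ?thesis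
      unfolding sum_distrib_left[symmetric] by (subst nn_integral_sum) simp_all
  qed
  also have "(\<integral>\<^sup>+p. (\<Sum>i\<in>UNIV. ennreal ((1 + (norm (snd p))\<^sup>2) * (norm (F p $ i))\<^sup>2)) \<partial>lborel) = (\<integral>\<^sup>+p. ennreal ((1 + (norm (snd p))\<^sup>2) * (norm (F p))\<^sup>2) \<partial>lborel)"
    unfolding norm_vec_power2 sum_distrib_left by (intro nn_integral_cong sum_ennreal) simp
  finally show ?thesis .
qed

lemma annular_integrable:
  fixes g :: "real^'d \<Rightarrow> complex^'n"
  assumes "g \<in> borel_measurable borel" "sqn g < \<infinity>" "compact K" "AE \<xi> in lborel. \<xi> \<notin> K \<longrightarrow> g \<xi> = 0"
  shows "integrable lborel g"
  using assms by (intro bounded_support_integrable[of g K] emeasure_bounded_finite compact_imp_bounded borel_compact)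

text \<open>The solution u itself, multiplied by the weight and cut off to a ball, serves as the
  dual function F. Then both the pairing of u with F and the squared dual norm of F equal the
  truncated left-hand side N, and the duality estimate closes on N.\<close>

theorem flow_upper_bound:
  fixes \<alpha> :: "'d::finite \<Rightarrow> complex^'n^'n" and g :: "real^'d \<Rightarrow> complex^'n" and m :: real
  assumes dirac: "dirac_matrices \<alpha> \<beta>" and d: "CARD('d) \<ge> 3"
    and g[measurable]: "g \<in> borel_measurable borel" and fin: "sqn g < \<infinity>"
    and K: "compact K" "0 \<notin> K" and supp: "AE \<xi> in lborel. \<xi> \<notin> K \<longrightarrow> g \<xi> = 0"
  defines "u \<equiv> \<lambda>p. inverse_fourier (flow_density \<alpha> \<beta> m g (fst p)) (snd p)"
  shows "(\<integral>\<^sup>+p. ennreal ((norm (u p))\<^sup>2 * inverse (1 + (norm (snd p))\<^sup>2)) \<partial>lborel)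
    \<le> ennreal (2 * pi * (if CARD('d) \<ge> 5 then 1 / 2 else 1) / (2 * pi) ^ CARD('d)) * sqn g"
proof -
  define c :: real where "c = (if CARD('d) \<ge> 5 then 1 / 2 else 1)"
  have c: "c > 0" by (simp add: c_def)
  define c0 where "c0 = 1 / (2 * pi) ^ CARD('d)"
  have c0: "c0 > 0" by (simp add: c0_def)
  let ?\<psi> = "\<lambda>\<xi>::real^'d. bracket_smoothing m (norm \<xi>)"
  define W where "W = flow_density \<alpha> \<beta> m g"
  define w where "w p = inverse (1 + (norm (snd p))\<^sup>2)" for p :: "real \<times> (real^'d)"
  have w: "0 < w p" "w p \<le> 1" "(1 + (norm (snd p))\<^sup>2) * w p = 1" for p
    by (auto simp: w_def inverse_le_1_iff add_pos_nonneg add_nonneg_eq_0_iff)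
  have [measurable]: "w \<in> borel_measurable borel"
    unfolding w_def[abs_def]
    by (intro borel_measurable_continuous_onI continuous_intros) (auto simp: add_nonneg_eq_0_iff)
  have [measurable]: "u \<in> borel_measurable borel"
    unfolding u_def by (rule inverse_fourier_flow_measurable[OF g fst_borel snd_borel])
  have Wm[measurable (raw)]: "a \<in> borel_measurable N \<Longrightarrow> b \<in> borel_measurable N \<Longrightarrow> (\<lambda>x. W (a x) (b x)) \<in> borel_measurable N" for a b and N :: "'z measure"
    unfolding W_def by measurable
  obtain B where B: "B \<ge> 0" "\<And>\<xi>. \<xi> \<in> K \<Longrightarrow> \<bar>?\<psi> \<xi>\<bar> \<le> B" using bracket_smoothing_bounded[OF K] by blast
  have gi: "integrable lborel g" by (rule annular_integrable[OF g fin K(1) supp])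
  define V where "V \<xi> = 2 * \<bar>?\<psi> \<xi>\<bar> * norm (g \<xi>)" for \<xi>
  have Vi: "integrable lborel V"
  proof (rule Bochner_Integration.integrable_bound)
    show "integrable lborel (\<lambda>\<xi>. 2 * B * norm (g \<xi>))" using gi by simp
    show "V \<in> borel_measurable lborel" unfolding V_def[abs_def] by measurable
    show "AE \<xi> in lborel. norm (V \<xi>) \<le> norm (2 * B * norm (g \<xi>))"
      using supp
    proof eventually_elim
      case (elim \<xi>)
      then show ?case using B by (cases "\<xi> \<in> K") (auto simp: V_def abs_mult mult_right_mono)
    qed
  qed
  have V0: "V \<xi> \<ge> 0" for \<xi> by (simp add: V_def)
  have nz: "AE \<xi> in lborel. (\<xi>::real^'d) \<noteq> 0" by (rule AE_lborel_singleton)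
  have WV: "norm (W t \<xi>) \<le> V \<xi>" if "\<xi> \<noteq> 0" for t \<xi>
    unfolding W_def V_def by (rule flow_density_norm_le[OF dirac that])
  have eW: "integrable lborel (\<lambda>\<xi>. exp (\<i> * of_real (x \<bullet> \<xi>)) *s W t \<xi>)" for x t
  proof (rule Bochner_Integration.integrable_bound[OF Vi])
    show "AE \<xi> in lborel. norm (exp (\<i> * of_real (x \<bullet> \<xi>)) *s W t \<xi>) \<le> norm (V \<xi>)"
      using nz by eventually_elim (simp add: norm_vector_smult abs_of_nonneg[OF V0] WV)
  qed measurable
  \<comment> \<open>A uniform bound for u makes F bounded with bounded support. This keeps N finite,
    which the absorption of N / 2 on the left requires.\<close>
  define U where "U = c0 * (\<integral>\<xi>. V \<xi> \<partial>lborel)"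
  have ueq: "u p = c0 *\<^sub>R (\<integral>\<xi>. exp (\<i> * of_real (snd p \<bullet> \<xi>)) *s W (fst p) \<xi> \<partial>lborel)" for p
    by (simp add: u_def inverse_fourier_def c0_def W_def)
  have uU: "norm (u p) \<le> U" for p
  proof -
    have "norm (\<integral>\<xi>. exp (\<i> * of_real (snd p \<bullet> \<xi>)) *s W (fst p) \<xi> \<partial>lborel) \<le> (\<integral>\<xi>. norm (exp (\<i> * of_real (snd p \<bullet> \<xi>)) *s W (fst p) \<xi>) \<partial>lborel)"
      by (rule integral_norm_bound)
    also have "\<dots> \<le> (\<integral>\<xi>. V \<xi> \<partial>lborel)"
    proof (rule integral_mono_AE[OF integrable_norm[OF eW] Vi])
      show "AE \<xi> in lborel. norm (exp (\<i> * of_real (snd p \<bullet> \<xi>)) *s W (fst p) \<xi>) \<le> V \<xi>"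
        using nz by eventually_elim (simp add: norm_vector_smult WV)
    qed
    finally show ?thesis unfolding ueq U_def using c0 by (simp add: mult_left_mono)
  qed
  have piece: "(\<integral>\<^sup>+p. ennreal (indicator (cball 0 R) p * ((norm (u p))\<^sup>2 * w p)) \<partial>lborel) \<le> ennreal (2 * pi * c * c0) * sqn g" for R :: real
  proof -
    define F where "F p = indicator (cball 0 R) p *\<^sub>R (w p *\<^sub>R u p)" for p
    have Fm[measurable]: "F \<in> borel_measurable borel" unfolding F_def[abs_def] by measurable
    have Fb: "norm (F p) \<le> U * indicator (cball 0 R) p" for p
    proof -
      have "w p * norm (u p) \<le> 1 * U" using w[of p] by (intro mult_mono uU) auto
      then show ?thesis using w[of p] by (simp add: F_def indicator_def)
    qed
    have fincb: "emeasure lborel (cball (0::real \<times> (real^'d)) R) < \<infinity>"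
      by (intro emeasure_bounded_finite bounded_cball)
    have ind: "integrable lborel (\<lambda>p::real \<times> (real^'d). U * indicator (cball 0 R) p)"
      using fincb by (intro integrable_mult_right integrable_real_indicator) auto
    have Fi: "integrable lborel F"
      by (rule Bochner_Integration.integrable_bound[OF ind]) (auto intro!: order_trans[OF Fb abs_ge_self])
    define N where "N = (\<integral>p. u p \<bullet> F p \<partial>lborel)"
    have uF: "u p \<bullet> F p = indicator (cball 0 R) p * ((norm (u p))\<^sup>2 * w p)" for p
      by (simp add: F_def power2_norm_eq_inner)
    have uFi: "integrable lborel (\<lambda>p. u p \<bullet> F p)"
    proof (rule Bochner_Integration.integrable_bound)
      show "integrable lborel (\<lambda>p. U * norm (F p))" using Fi by simp
      show "AE p in lborel. norm (u p \<bullet> F p) \<le> norm (U * norm (F p))"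
      proof (rule AE_I2)
        fix p
        have "\<bar>u p \<bullet> F p\<bar> \<le> norm (u p) * norm (F p)" by (rule Cauchy_Schwarz_ineq2)
        also have "\<dots> \<le> U * norm (F p)" by (intro mult_right_mono uU) simp
        finally show "norm (u p \<bullet> F p) \<le> norm (U * norm (F p))" by simp
      qed
    qed measurable
    have NN: "(\<integral>\<^sup>+p. ennreal (indicator (cball 0 R) p * ((norm (u p))\<^sup>2 * w p)) \<partial>lborel) = ennreal N"
      unfolding N_def uF[symmetric] using uFi w(1) by (intro nn_integral_eq_integral) (auto simp: uF less_imp_le)
    have N0: "N \<ge> 0" unfolding N_def uF using w(1) by (intro Bochner_Integration.integral_nonneg) (simp add: less_imp_le)
    let ?\<Phi> = "\<lambda>\<xi>. \<integral>p. exp (- \<i> * of_real (snd p \<bullet> \<xi>)) *s (cos (fst p * dirac_dispersion m (norm \<xi>)) *\<^sub>R F p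
      + sin (fst p * dirac_dispersion m (norm \<xi>)) *\<^sub>R dirac_J \<alpha> \<beta> m \<xi> (F p)) \<partial>lborel"
    define h where "h \<xi> = (\<integral>p. (exp (\<i> * of_real (snd p \<bullet> \<xi>)) *s W (fst p) \<xi>) \<bullet> F p \<partial>lborel)" for \<xi>
    have fub: "integrable (lborel \<Otimes>\<^sub>M lborel) (\<lambda>(p, \<xi>). (exp (\<i> * of_real (snd p \<bullet> \<xi>)) *s W (fst p) \<xi>) \<bullet> F p)"
    proof (rule Bochner_Integration.integrable_bound)
      show "integrable (lborel \<Otimes>\<^sub>M lborel) (\<lambda>q. norm (F (fst q)) * V (snd q))"
        using Fi Vi by (intro lborel_pair_integrable_mult) auto
      show "(\<lambda>(p, \<xi>). (exp (\<i> * of_real (snd p \<bullet> \<xi>)) *s W (fst p) \<xi>) \<bullet> F p) \<in> borel_measurable (lborel \<Otimes>\<^sub>M lborel)"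
        unfolding split_beta' lborel_prod measurable_lborel2
        by (intro borel_measurable_inner borel_measurable_vector_smult Wm measurable_compose[OF fst_borel fst_borel]
            snd_borel measurable_compose[OF fst_borel Fm] borel_measurable_continuous_onI continuous_intros)
      have "AE q in lborel \<Otimes>\<^sub>M lborel. snd (q :: (real \<times> (real^'d)) \<times> (real^'d)) \<noteq> 0"
      proof (rule lborel_pair.AE_pair_measure)
        have "open {q :: (real \<times> (real^'d)) \<times> (real^'d). snd q \<noteq> 0}"
          by (intro open_Collect_neq continuous_intros)
        then show "{q \<in> space (lborel \<Otimes>\<^sub>M lborel). snd (q :: (real \<times> (real^'d)) \<times> (real^'d)) \<noteq> 0} \<in> sets (lborel \<Otimes>\<^sub>M lborel)"
          unfolding lborel_prod by (simp add: borel_open)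
      qed (use nz in simp)
      then show "AE q in lborel \<Otimes>\<^sub>M lborel. norm (case q of (p, \<xi>) \<Rightarrow> (exp (\<i> * of_real (snd p \<bullet> \<xi>)) *s W (fst p) \<xi>) \<bullet> F p) \<le> norm (norm (F (fst q)) * V (snd q))"
      proof eventually_elim
        case (elim q)
        have "\<bar>(exp (\<i> * of_real (snd (fst q) \<bullet> snd q)) *s W (fst (fst q)) (snd q)) \<bullet> F (fst q)\<bar> \<le> norm (W (fst (fst q)) (snd q)) * norm (F (fst q))"
          by (rule Cauchy_Schwarz_ineq2[THEN order_trans]) (simp add: norm_vector_smult)
        also have "\<dots> \<le> V (snd q) * norm (F (fst q))" by (intro mult_right_mono WV elim) simp
        finally show ?case using V0 by (simp add: split_beta' abs_mult mult.commute)
      qed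
    qed
    have hi: "integrable lborel h" unfolding h_def using lborel_pair.integrable_snd[OF fub] by simp
    have Nh: "N = c0 * (\<integral>\<xi>. h \<xi> \<partial>lborel)"
    proof -
      have "u p \<bullet> F p = c0 * (\<integral>\<xi>. (exp (\<i> * of_real (snd p \<bullet> \<xi>)) *s W (fst p) \<xi>) \<bullet> F p \<partial>lborel)" for p
        unfolding ueq inner_scaleR_left by (subst integral_inner_left) (use eW in simp_all)
      then have "N = c0 * (\<integral>p. (\<integral>\<xi>. (exp (\<i> * of_real (snd p \<bullet> \<xi>)) *s W (fst p) \<xi>) \<bullet> F p \<partial>lborel) \<partial>lborel)"
        unfolding N_def by simp
      then show ?thesis unfolding h_def lborel_pair.Fubini_integral[OF fub] .
    qed
    have h\<Phi>: "h \<xi> = (?\<psi> \<xi> *\<^sub>R g \<xi>) \<bullet> ?\<Phi> \<xi>" for \<xi>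
    proof -
      have "h \<xi> = (\<integral>p. (?\<psi> \<xi> *\<^sub>R g \<xi>) \<bullet> (exp (- \<i> * of_real (snd p \<bullet> \<xi>)) *s (cos (fst p * dirac_dispersion m (norm \<xi>)) *\<^sub>R F p
          + sin (fst p * dirac_dispersion m (norm \<xi>)) *\<^sub>R dirac_J \<alpha> \<beta> m \<xi> (F p))) \<partial>lborel)"
        unfolding h_def W_def flow_density_inner[OF dirac] by (simp add: exp_cnj)
      also have "\<dots> = (?\<psi> \<xi> *\<^sub>R g \<xi>) \<bullet> ?\<Phi> \<xi>"
        by (rule integral_inner_right) (rule dual_kernel_integrable[OF Fi])
      finally show ?thesis .
    qed
    define Q where "Q = (\<integral>\<xi>. (?\<psi> \<xi>)\<^sup>2 * (norm (?\<Phi> \<xi>))\<^sup>2 \<partial>lborel)"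
    have \<Phi>m: "?\<Phi> \<in> borel_measurable borel"
    proof (rule lborel.borel_measurable_lebesgue_integral)
      have sm: "snd \<in> borel_measurable (borel \<Otimes>\<^sub>M lborel)" and fm: "fst \<in> borel_measurable (borel \<Otimes>\<^sub>M lborel)"
        using measurable_snd[of borel lborel] by (simp_all only: measurable_lborel1 measurable_fst)
      show "(\<lambda>(\<xi>, p). exp (- \<i> * of_real (snd p \<bullet> \<xi>)) *s (cos (fst p * dirac_dispersion m (norm \<xi>)) *\<^sub>R F p
        + sin (fst p * dirac_dispersion m (norm \<xi>)) *\<^sub>R dirac_J \<alpha> \<beta> m \<xi> (F p))) \<in> borel_measurable (borel \<Otimes>\<^sub>M lborel)"
        unfolding split_beta'
        by (rule dual_kernel_measurable[OF measurable_compose[OF sm fst_borel] measurable_compose[OF sm snd_borel] fm measurable_compose[OF sm Fm]])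
    qed
    \<comment> \<open>Since (1 + |x|^2) w = 1, the weight of the dual norm cancels one of the two
      factors w in |F|^2, and the right-hand side becomes a multiple of N.\<close>
    have Qle: "(\<integral>\<^sup>+\<xi>. ennreal ((?\<psi> \<xi>)\<^sup>2 * (norm (?\<Phi> \<xi>))\<^sup>2) \<partial>lborel) \<le> ennreal (c * (2 * pi) ^ (CARD('d) + 1) * N)"
    proof -
      have "(\<integral>\<^sup>+p. ennreal ((1 + (norm (snd p))\<^sup>2) * (norm (F p))\<^sup>2) \<partial>lborel) = (\<integral>\<^sup>+p. ennreal (indicator (cball 0 R) p * ((norm (u p))\<^sup>2 * w p)) \<partial>lborel)"
      proof (intro nn_integral_cong arg_cong[where f=ennreal])
        fix p
        have "(1 + (norm (snd p))\<^sup>2) * (norm (F p))\<^sup>2 = ((1 + (norm (snd p))\<^sup>2) * w p) * (indicator (cball 0 R) p * ((norm (u p))\<^sup>2 * w p))"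
          by (simp add: F_def power_mult_distrib power2_eq_square indicator_def)
        then show "(1 + (norm (snd p))\<^sup>2) * (norm (F p))\<^sup>2 = indicator (cball 0 R) p * ((norm (u p))\<^sup>2 * w p)"
          by (simp only: w(3) mult_1_left)
      qed
      then show ?thesis
        using dual_density_integral[OF dirac d Fm Fb, of m] N0 c unfolding NN c_def[symmetric]
        by (simp add: ennreal_mult)
    qed
    have Qi: "integrable lborel (\<lambda>\<xi>. (?\<psi> \<xi>)\<^sup>2 * (norm (?\<Phi> \<xi>))\<^sup>2)"
    proof (rule integrableI_bounded)
      show "(\<lambda>\<xi>. (?\<psi> \<xi>)\<^sup>2 * (norm (?\<Phi> \<xi>))\<^sup>2) \<in> borel_measurable lborel" using \<Phi>m by measurable
      show "(\<integral>\<^sup>+\<xi>. ennreal (norm ((?\<psi> \<xi>)\<^sup>2 * (norm (?\<Phi> \<xi>))\<^sup>2)) \<partial>lborel) < \<infinity>"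
        using Qle by (simp only: real_norm_def abs_mult abs_power2) (rule le_less_trans, auto)
    qed
    have Q: "Q \<le> c * (2 * pi) ^ (CARD('d) + 1) * N"
    proof -
      have "ennreal Q \<le> ennreal (c * (2 * pi) ^ (CARD('d) + 1) * N)"
        using Qle unfolding Q_def by (subst nn_integral_eq_integral[symmetric, OF Qi]) auto
      then show ?thesis using N0 c by (subst (asm) ennreal_le_iff) auto
    qed
    define G where "G = (\<integral>\<xi>. (norm (g \<xi>))\<^sup>2 \<partial>lborel)"
    \<comment> \<open>The parameter of Young's inequality: as c0 c (2 pi)^(d + 1) = 2 pi c =
      \<kappa>, the term with Q contributes at most N / 2. Absorbing it leaves the constant \<kappa>
      c0.\<close>
    define \<kappa> where "\<kappa> = 2 * pi * c"
    have \<kappa>: "\<kappa> > 0" using c by (simp add: \<kappa>_def)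
    have "(\<integral>\<xi>. h \<xi> \<partial>lborel) \<le> (\<integral>\<xi>. \<kappa> / 2 * (norm (g \<xi>))\<^sup>2 + 1 / (2 * \<kappa>) * ((?\<psi> \<xi>)\<^sup>2 * (norm (?\<Phi> \<xi>))\<^sup>2) \<partial>lborel)"
    proof (intro integral_mono hi Bochner_Integration.integrable_add integrable_mult_right Qi sqn_finite(1)[OF g fin])
      fix \<xi>
      have "h \<xi> = g \<xi> \<bullet> (?\<psi> \<xi> *\<^sub>R ?\<Phi> \<xi>)" unfolding h\<Phi> by simp
      also have "\<dots> \<le> norm (g \<xi>) * norm (?\<psi> \<xi> *\<^sub>R ?\<Phi> \<xi>)" by (rule norm_cauchy_schwarz)
      also have "\<dots> \<le> \<kappa> / 2 * (norm (g \<xi>))\<^sup>2 + 1 / (2 * \<kappa>) * (norm (?\<psi> \<xi> *\<^sub>R ?\<Phi> \<xi>))\<^sup>2"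
      proof -
        have "a * b \<le> \<kappa> / 2 * a\<^sup>2 + 1 / (2 * \<kappa>) * b\<^sup>2" for a b :: real
        proof -
          have "0 \<le> (\<kappa> * a - b)\<^sup>2 / (2 * \<kappa>)" using \<kappa> by simp
          also have "\<dots> = \<kappa> / 2 * a\<^sup>2 + 1 / (2 * \<kappa>) * b\<^sup>2 - a * b"
            using \<kappa> by (simp add: power2_eq_square field_simps)
          finally show ?thesis by simp
        qed
        then show ?thesis .
      qed
      finally show "h \<xi> \<le> \<kappa> / 2 * (norm (g \<xi>))\<^sup>2 + 1 / (2 * \<kappa>) * ((?\<psi> \<xi>)\<^sup>2 * (norm (?\<Phi> \<xi>))\<^sup>2)"
        by (simp add: power_mult_distrib)
    qed
    also have "\<dots> = \<kappa> / 2 * G + 1 / (2 * \<kappa>) * Q"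
      unfolding G_def Q_def using Qi sqn_finite(1)[OF g fin] by simp
    finally have "N \<le> c0 * (\<kappa> / 2 * G + 1 / (2 * \<kappa>) * Q)"
      unfolding Nh using c0 by (intro mult_left_mono) auto
    also have "\<dots> \<le> c0 * (\<kappa> / 2 * G + 1 / (2 * \<kappa>) * (c * (2 * pi) ^ (CARD('d) + 1) * N))"
      using Q c0 \<kappa> by (intro mult_left_mono add_left_mono) auto
    also have "\<dots> = c0 * \<kappa> / 2 * G + N / 2"
      using c by (simp add: c0_def \<kappa>_def field_simps)
    finally have "N \<le> \<kappa> * c0 * G" by (simp add: field_simps)
    then have "ennreal N \<le> ennreal (2 * pi * c * c0) * ennreal G"
      using c c0 by (subst ennreal_mult[symmetric]) (auto simp: G_def \<kappa>_def intro!: ennreal_leI)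
    then show ?thesis unfolding NN sqn_finite(2)[OF g fin] G_def .
  qed
  have "(\<lambda>n. \<integral>\<^sup>+p. ennreal (indicator (cball 0 (real n)) p * ((norm (u p))\<^sup>2 * w p)) \<partial>lborel) \<longlonglongrightarrow> (\<integral>\<^sup>+p. ennreal ((norm (u p))\<^sup>2 * w p) \<partial>lborel)"
  proof (rule nn_integral_LIMSEQ)
    show "incseq (\<lambda>n p. ennreal (indicator (cball 0 (real n)) p * ((norm (u p))\<^sup>2 * w p)))"
      using w(1) by (intro incseq_SucI le_funI ennreal_leI mult_right_mono) (auto simp: indicator_def less_imp_le)
    show "(\<lambda>n. ennreal (indicator (cball 0 (real n)) p * ((norm (u p))\<^sup>2 * w p))) \<longlonglongrightarrow> ennreal ((norm (u p))\<^sup>2 * w p)" for p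
    proof -
      obtain n0 where "norm p < real n0" using reals_Archimedean2 by blast
      then show ?thesis
        by (intro tendsto_eventually eventually_sequentiallyI[of n0]) (auto simp: indicator_def)
    qed
  qed measurable
  then have "(\<integral>\<^sup>+p. ennreal ((norm (u p))\<^sup>2 * w p) \<partial>lborel) \<le> ennreal (2 * pi * c * c0) * sqn g"
    by (rule LIMSEQ_le_const2) (use piece in blast)
  then show ?thesis by (simp add: w_def c_def c0_def)
qed

section \<open>Extension to \<open>L\<^sup>2\<close>\<close>

lemma flow_density_integrable:
  fixes \<alpha> :: "'d::finite \<Rightarrow> complex^'n^'n" and g :: "real^'d \<Rightarrow> complex^'n"
  assumes dirac: "dirac_matrices \<alpha> \<beta>" and g[measurable]: "g \<in> borel_measurable borel" and fin: "sqn g < \<infinity>"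
    and K: "compact K" "0 \<notin> K" and supp: "AE \<xi> in lborel. \<xi> \<notin> K \<longrightarrow> g \<xi> = 0"
  shows "integrable lborel (flow_density \<alpha> \<beta> m g t)"
proof -
  obtain B where B: "B \<ge> 0" "\<And>\<xi>. \<xi> \<in> K \<Longrightarrow> \<bar>bracket_smoothing m (norm \<xi>)\<bar> \<le> B"
    using bracket_smoothing_bounded[OF K] by blast
  show ?thesis
  proof (rule Bochner_Integration.integrable_bound)
    show "integrable lborel (\<lambda>\<xi>. 2 * B * norm (g \<xi>))" using annular_integrable[OF g fin K(1) supp] by simp
    have "AE \<xi> in lborel. (\<xi>::real^'d) \<noteq> 0" by (rule AE_lborel_singleton)
    with supp show "AE \<xi> in lborel. norm (flow_density \<alpha> \<beta> m g t \<xi>) \<le> norm (2 * B * norm (g \<xi>))"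
    proof eventually_elim
      case (elim \<xi>)
      have "norm (flow_density \<alpha> \<beta> m g t \<xi>) \<le> 2 * \<bar>bracket_smoothing m (norm \<xi>)\<bar> * norm (g \<xi>)"
        by (rule flow_density_norm_le[OF dirac elim(2)])
      also have "\<dots> \<le> 2 * B * norm (g \<xi>)"
        using B elim(1) by (cases "\<xi> \<in> K") (auto intro!: mult_right_mono)
      finally show ?case using B by simp
    qed
  qed measurable
qed

lemma inverse_fourier_diff:
  fixes f g :: "real^'d \<Rightarrow> complex^'n"
  assumes "integrable lborel f" "integrable lborel g"
  shows "inverse_fourier (\<lambda>x. f x - g x) \<xi> = inverse_fourier f \<xi> - inverse_fourier g \<xi>"
  unfolding inverse_fourier_eq fourier_diff[OF assms] by (rule scaleR_diff_right)

lemma flow_density_diff: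
  "flow_density \<alpha> \<beta> m (\<lambda>\<xi>. f \<xi> - g \<xi>) t \<xi> = flow_density \<alpha> \<beta> m f t \<xi> - flow_density \<alpha> \<beta> m g t \<xi>"
  unfolding flow_density_def linear_diff[OF bounded_linear.linear[OF bounded_linear_dirac_J]]
  by (simp add: algebra_simps)

text \<open>The weight enters through its square root, so that the left-hand side of the smoothing
  estimate is an L^2 norm on space-time and obeys the triangle inequality.\<close>

definition weighted_flow ::
  "('d::finite \<Rightarrow> complex^'n^'n) \<Rightarrow> complex^'n^'n \<Rightarrow> (real \<Rightarrow> real) \<Rightarrow> real \<Rightarrow> (real^'d \<Rightarrow> complex^'n)
     \<Rightarrow> real \<times> (real^'d) \<Rightarrow> complex^'n" where
  "weighted_flow \<alpha> \<beta> w m g p = sqrt (w (norm (snd p))) *\<^sub>R inverse_fourier (flow_density \<alpha> \<beta> m g (fst p)) (snd p)"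

lemma weighted_flow_measurable [measurable]:
  fixes \<alpha> :: "'d::finite \<Rightarrow> complex^'n^'n"
  assumes g: "g \<in> borel_measurable borel" and w[measurable]: "w \<in> borel_measurable borel"
  shows "weighted_flow \<alpha> \<beta> w m g \<in> borel_measurable borel"
proof -
  have "(\<lambda>p::real \<times> (real^'d). sqrt (w (norm (snd p)))) \<in> borel_measurable borel"
    by (rule measurable_compose[OF snd_borel]) measurable
  then show ?thesis
    unfolding weighted_flow_def[abs_def]
    by (intro borel_measurable_scaleR inverse_fourier_flow_measurable g fst_borel snd_borel)
qed

lemma smoothing_lhs_direct_eq:
  fixes \<alpha> :: "'d::finite \<Rightarrow> complex^'n^'n" and f g :: "real^'d \<Rightarrow> complex^'n"
  assumes dirac: "dirac_matrices \<alpha> \<beta>" and f: "f \<in> L2_space" and g: "g \<in> borel_measurable borel"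
    and fg: "AE \<xi> in lborel. L2_fourier f \<xi> = g \<xi>"
    and w[measurable]: "w \<in> borel_measurable borel" and w0: "\<And>r. w r \<ge> 0"
  shows "smoothing_lhs_direct \<alpha> \<beta> w (bracket_smoothing m) m f = sqn (weighted_flow \<alpha> \<beta> w m g)"
proof -
  let ?h = "\<lambda>p. ennreal ((norm (weighted_flow \<alpha> \<beta> w m g p))\<^sup>2)"
  have hm: "?h \<in> borel_measurable (lborel \<Otimes>\<^sub>M lborel)"
    unfolding lborel_prod using weighted_flow_measurable[OF g w] by measurable
  have "smoothing_lhs_direct \<alpha> \<beta> w (bracket_smoothing m) m f = (\<integral>\<^sup>+t. (\<integral>\<^sup>+x. ?h (t, x) \<partial>lborel) \<partial>lborel)"
    unfolding smoothing_lhs_direct_def smoothed_dirac_flow_eq[OF dirac f g fg]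
    by (simp add: weighted_flow_def power_mult_distrib w0 mult.commute)
  also have "\<dots> = (\<integral>\<^sup>+p. ?h p \<partial>(lborel \<Otimes>\<^sub>M lborel))" by (rule lborel.nn_integral_fst[OF hm])
  finally show ?thesis by (simp add: sqn_def lborel_prod)
qed

lemma L2_annularD:
  assumes "f \<in> L2_annular"
  shows "f \<in> L2_space" and "\<exists>K. compact K \<and> 0 \<notin> K \<and> (AE \<xi> in lborel. \<xi> \<notin> K \<longrightarrow> L2_fourier f \<xi> = 0)"
  using assms by (auto simp: L2_annular_def)

lemma L2_annular_diff:
  fixes f h :: "real^'d \<Rightarrow> complex^'n"
  assumes f: "f \<in> L2_annular" and h: "h \<in> L2_annular"
  shows "(\<lambda>x. f x - h x) \<in> L2_annular"
proof -
  note fh = L2_annularD(1)[OF f] L2_annularD(1)[OF h]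
  obtain K L where K: "compact K" "0 \<notin> K" "AE \<xi> in lborel. \<xi> \<notin> K \<longrightarrow> L2_fourier f \<xi> = 0"
    and L: "compact L" "0 \<notin> L" "AE \<xi> in lborel. \<xi> \<notin> L \<longrightarrow> L2_fourier h \<xi> = 0"
    using L2_annularD(2)[OF f] L2_annularD(2)[OF h] by blast
  have "AE \<xi> in lborel. \<xi> \<notin> K \<union> L \<longrightarrow> L2_fourier (\<lambda>x. f x - h x) \<xi> = 0"
    using K(3) L(3) L2_fourier_diff[OF fh] by eventually_elim simp
  then show ?thesis using K L L2_space_diff[OF fh]
    by (auto simp: L2_annular_def intro!: exI[of _ "K \<union> L"])
qed

lemma inverse_fourier_annular:
  fixes g :: "real^'d \<Rightarrow> complex^'n"
  assumes g: "g \<in> borel_measurable borel" and fin: "sqn g < \<infinity>"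
    and K: "compact K" "0 \<notin> K" and supp: "AE \<xi> in lborel. \<xi> \<notin> K \<longrightarrow> g \<xi> = 0"
  shows "inverse_fourier g \<in> L2_annular"
proof -
  have gi: "integrable lborel g" by (rule annular_integrable[OF g fin K(1) supp])
  have "AE \<xi> in lborel. \<xi> \<notin> K \<longrightarrow> L2_fourier (inverse_fourier g) \<xi> = 0"
    using supp L2_fourier_inverse_fourier[OF gi fin] by eventually_elim simp
  then show ?thesis using inverse_fourier_L2_space[OF gi fin] K by (auto simp: L2_annular_def)
qed

lemma smoothing_lhs_inverse_fourier:
  fixes \<alpha> :: "'d::finite \<Rightarrow> complex^'n^'n" and g :: "real^'d \<Rightarrow> complex^'n"
  assumes dirac: "dirac_matrices \<alpha> \<beta>" and g: "g \<in> borel_measurable borel" and fin: "sqn g < \<infinity>"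
    and K: "compact K" "0 \<notin> K" and supp: "AE \<xi> in lborel. \<xi> \<notin> K \<longrightarrow> g \<xi> = 0"
    and w: "w \<in> borel_measurable borel" "\<And>r. w r \<ge> 0"
  shows "smoothing_lhs \<alpha> \<beta> w (bracket_smoothing m) m (inverse_fourier g) = sqn (weighted_flow \<alpha> \<beta> w m g)"
proof -
  have gi: "integrable lborel g" by (rule annular_integrable[OF g fin K(1) supp])
  show ?thesis
    using inverse_fourier_annular[OF g fin K supp]
      smoothing_lhs_direct_eq[OF dirac inverse_fourier_L2_space[OF gi fin] g L2_fourier_inverse_fourier[OF gi fin] w]
    by (simp add: smoothing_lhs_def)
qed

text \<open>Lower bounds are tested with explicit data on the Fourier side; squared norm (2 pi)^d
  there means norm 1 in physical space.\<close>

lemma smoothing_const_ge: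
  fixes \<alpha> :: "'d::finite \<Rightarrow> complex^'n^'n" and g :: "real^'d \<Rightarrow> complex^'n"
  assumes dirac: "dirac_matrices \<alpha> \<beta>" and g: "g \<in> borel_measurable borel" and one: "sqn g = ennreal ((2 * pi) ^ CARD('d))"
    and K: "compact K" "0 \<notin> K" and supp: "AE \<xi> in lborel. \<xi> \<notin> K \<longrightarrow> g \<xi> = 0"
    and w: "w \<in> borel_measurable borel" "\<And>r. w r \<ge> 0"
  shows "sqn (weighted_flow \<alpha> \<beta> w m g) \<le> smoothing_const \<alpha> \<beta> w (bracket_smoothing m) m"
proof -
  have fin: "sqn g < \<infinity>" by (simp add: one)
  have gi: "integrable lborel g" by (rule annular_integrable[OF g fin K(1) supp])
  have "L2_sqnorm (inverse_fourier g) = 1"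
    unfolding L2_sqnorm_eq_sqn sqn_inverse_fourier[OF gi fin] one by (simp flip: ennreal_mult)
  then show ?thesis
    unfolding smoothing_const_def smoothing_lhs_inverse_fourier[OF dirac g fin K supp w, symmetric]
    using inverse_fourier_L2_space[OF gi fin] by (intro SUP_upper) simp
qed

lemma smoothing_estimate_imp_const_finite:
  fixes \<alpha> :: "'d::finite \<Rightarrow> complex^'n^'n"
  assumes "smoothing_estimate \<alpha> \<beta> w \<psi> m"
  shows "smoothing_const \<alpha> \<beta> w \<psi> m < \<infinity>"
proof -
  obtain C :: real where C: "\<And>f :: real^'d \<Rightarrow> complex^'n. f \<in> L2_space \<Longrightarrow> smoothing_lhs \<alpha> \<beta> w \<psi> m f \<le> ennreal C * L2_sqnorm f"
    using assms by (auto simp: smoothing_estimate_def)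
  have "smoothing_const \<alpha> \<beta> w \<psi> m \<le> ennreal C"
    unfolding smoothing_const_def
  proof (rule SUP_least)
    fix f :: "real^'d \<Rightarrow> complex^'n" assume "f \<in> {f \<in> L2_space. L2_sqnorm f = 1}"
    then show "smoothing_lhs \<alpha> \<beta> w \<psi> m f \<le> ennreal C" using C[of f] by simp
  qed
  then show ?thesis by (rule le_less_trans) simp
qed

text \<open>The transform is cut off to annuli that exhaust the complement of the origin; by the
  isometry the distance to f can be measured on the Fourier side.\<close>

lemma L2_annular_dense:
  fixes f :: "real^'d \<Rightarrow> complex^'n"
  assumes f: "f \<in> L2_space"
  obtains h where "\<And>n. h n \<in> L2_annular" "(\<lambda>n. sqn (\<lambda>x. h n x - f x)) \<longlonglongrightarrow> 0"
proof -
  define G where "G = L2_fourier f"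
  have Gm[measurable]: "G \<in> borel_measurable borel" and Gfin: "sqn G < \<infinity>"
    using L2_fourier_measurable[OF f] L2_fourier_finite[OF f] by (auto simp: G_def)
  define K where "K n = cball 0 (real (Suc n)) - ball (0::real^'d) (1 / real (Suc n))" for n
  have K: "compact (K n)" "0 \<notin> K n" for n
    unfolding K_def by (auto intro: compact_diff)
  have Kb[measurable]: "K n \<in> sets borel" for n by (rule borel_compact[OF K(1)])
  define g where "g n \<xi> = indicator (K n) \<xi> *\<^sub>R G \<xi>" for n \<xi>
  have gm[measurable]: "g n \<in> borel_measurable borel" for n unfolding g_def[abs_def] by measurable
  have gfin: "sqn (g n) < \<infinity>" for n
    unfolding g_def[abs_def] using sqn_indicator_le Gfin by (rule le_less_trans)
  have supp: "AE \<xi> in lborel. \<xi> \<notin> K n \<longrightarrow> g n \<xi> = 0" for n by (simp add: g_def)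
  define h where "h n = inverse_fourier (g n)" for n
  have ha: "h n \<in> L2_annular" for n unfolding h_def by (rule inverse_fourier_annular[OF gm gfin K supp])
  have gi: "integrable lborel (g n)" for n by (rule annular_integrable[OF gm gfin K(1) supp])
  have lim: "(\<lambda>n. sqn (\<lambda>\<xi>. g n \<xi> - G \<xi>)) \<longlonglongrightarrow> 0"
  proof -
    have "(\<lambda>n. sqn (\<lambda>\<xi>. g n \<xi> - G \<xi>)) \<longlonglongrightarrow> (\<integral>\<^sup>+x. 0 \<partial>(lborel :: (real^'d) measure))"
      unfolding sqn_def
    proof (rule nn_integral_dominated_convergence[where w="\<lambda>x. ennreal ((norm (G x))\<^sup>2)"])
      have "AE \<xi> in lborel. (\<xi>::real^'d) \<noteq> 0" by (rule AE_lborel_singleton)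
      then show "AE \<xi> in lborel. (\<lambda>n. ennreal ((norm (g n \<xi> - G \<xi>))\<^sup>2)) \<longlonglongrightarrow> 0"
      proof eventually_elim
        case (elim \<xi>)
        obtain N where N: "max (norm \<xi>) (1 / norm \<xi>) < real N" using reals_Archimedean2 by blast
        have "\<xi> \<in> K n" if "n \<ge> N" for n
        proof -
          have "norm \<xi> \<le> real (Suc n)" "1 / norm \<xi> \<le> real (Suc n)" using N that by auto
          then show ?thesis using elim by (auto simp: K_def field_simps)
        qed
        then show ?case
          by (intro tendsto_eventually eventually_sequentiallyI[of N]) (auto simp: g_def)
      qed
      show "AE \<xi> in lborel. ennreal ((norm (g j \<xi> - G \<xi>))\<^sup>2) \<le> ennreal ((norm (G \<xi>))\<^sup>2)" for j
        by (auto simp: g_def indicator_def)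
      show "(\<integral>\<^sup>+x. ennreal ((norm (G x))\<^sup>2) \<partial>lborel) < \<infinity>" using Gfin by (simp add: sqn_def)
    qed measurable
    then show ?thesis by simp
  qed
  let ?c = "(2 * pi) ^ CARD('d)"
  have eq: "sqn (\<lambda>x. h n x - f x) = ennreal (1 / ?c) * sqn (\<lambda>\<xi>. g n \<xi> - G \<xi>)" for n
  proof -
    have hL: "h n \<in> L2_space" using ha by (rule L2_annularD)
    have "AE \<xi> in lborel. L2_fourier (\<lambda>x. h n x - f x) \<xi> = g n \<xi> - G \<xi>"
      using L2_fourier_diff[OF hL f] L2_fourier_inverse_fourier[OF gi[of n] gfin]
      unfolding h_def G_def by eventually_elim simp
    then have "sqn (\<lambda>\<xi>. g n \<xi> - G \<xi>) = sqn (L2_fourier (\<lambda>x. h n x - f x))"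
      by (intro sqn_cong_AE) (auto elim: eventually_mono)
    also have "\<dots> = ennreal ?c * sqn (\<lambda>x. h n x - f x)" by (rule L2_fourier_isometry[OF L2_space_diff[OF hL f]])
    finally show ?thesis by (simp add: mult.assoc[symmetric] flip: ennreal_mult)
  qed
  have "(\<lambda>n. sqn (\<lambda>x. h n x - f x)) \<longlonglongrightarrow> ennreal (1 / ?c) * 0"
    unfolding eq by (intro ennreal_tendsto_cmult lim) simp
  then show thesis by (intro that[OF ha]) simp
qed

section \<open>The uniform bound for weights below (1 + r^2)^(-1) and its extension by
  continuity\<close>

context
  fixes \<alpha> :: "'d::finite \<Rightarrow> complex^'n^'n" and \<beta> :: "complex^'n^'n" and m C :: real and w :: "real \<Rightarrow> real"
  assumes C: "C = 2 * pi * (if CARD('d) \<ge> 5 then 1 / 2 else 1)" and dirac: "dirac_matrices \<alpha> \<beta>" and d: "CARD('d) \<ge> 3"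
    and w[measurable]: "w \<in> borel_measurable borel" and w0: "\<And>r. w r \<ge> 0" and w1: "\<And>r. w r \<le> inverse (1 + r\<^sup>2)"
begin

lemma weighted_flow_bound:
  fixes g :: "real^'d \<Rightarrow> complex^'n"
  assumes g: "g \<in> borel_measurable borel" and fin: "sqn g < \<infinity>"
    and K: "compact K" "0 \<notin> K" and supp: "AE \<xi> in lborel. \<xi> \<notin> K \<longrightarrow> g \<xi> = 0"
  shows "sqn (weighted_flow \<alpha> \<beta> w m g) \<le> ennreal (C / (2 * pi) ^ CARD('d)) * sqn g"
proof -
  have "sqn (weighted_flow \<alpha> \<beta> w m g) \<le> (\<integral>\<^sup>+p. ennreal ((norm (inverse_fourier (flow_density \<alpha> \<beta> m g (fst p)) (snd p)))\<^sup>2 * inverse (1 + (norm (snd p))\<^sup>2)) \<partial>lborel)"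
    unfolding sqn_def
  proof (intro nn_integral_mono ennreal_leI)
    fix p :: "real \<times> (real^'d)"
    have "(norm (weighted_flow \<alpha> \<beta> w m g p))\<^sup>2 = (norm (inverse_fourier (flow_density \<alpha> \<beta> m g (fst p)) (snd p)))\<^sup>2 * w (norm (snd p))"
      by (simp add: weighted_flow_def power_mult_distrib w0)
    also have "\<dots> \<le> (norm (inverse_fourier (flow_density \<alpha> \<beta> m g (fst p)) (snd p)))\<^sup>2 * inverse (1 + (norm (snd p))\<^sup>2)"
      by (intro mult_left_mono w1) simp
    finally show "(norm (weighted_flow \<alpha> \<beta> w m g p))\<^sup>2 \<le> (norm (inverse_fourier (flow_density \<alpha> \<beta> m g (fst p)) (snd p)))\<^sup>2 * inverse (1 + (norm (snd p))\<^sup>2)" .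
  qed
  also have "\<dots> \<le> ennreal (C / (2 * pi) ^ CARD('d)) * sqn g"
    unfolding C by (rule flow_upper_bound[OF dirac d g fin K supp])
  finally show ?thesis .
qed

abbreviation (input) flow_of :: "(real^'d \<Rightarrow> complex^'n) \<Rightarrow> real \<times> (real^'d) \<Rightarrow> complex^'n" where
  "flow_of f \<equiv> weighted_flow \<alpha> \<beta> w m (L2_fourier f)"

lemma C_pos: "C > 0"
  by (simp add: C)

lemma annular_bound:
  fixes f :: "real^'d \<Rightarrow> complex^'n"
  assumes f: "f \<in> L2_annular"
  shows "sqn (flow_of f) \<le> ennreal C * sqn f"
proof -
  note fL = L2_annularD(1)[OF f]
  obtain K where K: "compact K" "0 \<notin> K" "AE \<xi> in lborel. \<xi> \<notin> K \<longrightarrow> L2_fourier f \<xi> = 0"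
    using L2_annularD(2)[OF f] by blast
  have "sqn (flow_of f) \<le> ennreal (C / (2 * pi) ^ CARD('d)) * sqn (L2_fourier f)"
    by (rule weighted_flow_bound[OF L2_fourier_measurable[OF fL] L2_fourier_finite[OF fL] K])
  also have "\<dots> = ennreal C * sqn f"
    unfolding L2_fourier_isometry[OF fL] using C_pos by (simp add: mult.assoc[symmetric] flip: ennreal_mult)
  finally show ?thesis .
qed

lemma annular_lhs:
  fixes f :: "real^'d \<Rightarrow> complex^'n"
  assumes f: "f \<in> L2_annular"
  shows "smoothing_lhs_direct \<alpha> \<beta> w (bracket_smoothing m) m f = sqn (flow_of f)"
  using L2_annularD(1)[OF f] by (intro smoothing_lhs_direct_eq[OF dirac] L2_fourier_measurable w w0) auto

lemma annular_finite:
  fixes f :: "real^'d \<Rightarrow> complex^'n"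
  assumes f: "f \<in> L2_annular"
  shows "sqn (flow_of f) < \<infinity>" and "nrm (flow_of f) \<le> sqrt C * nrm f"
proof -
  have ff: "sqn f < \<infinity>" using L2_annularD(1)[OF f] by (simp add: L2_space_iff)
  then show fin: "sqn (flow_of f) < \<infinity>"
    using annular_bound[OF f] by (auto intro: le_less_trans simp: ennreal_mult_less_top)
  have "ennreal ((nrm (flow_of f))\<^sup>2) \<le> ennreal C * ennreal ((nrm f)\<^sup>2)"
    using annular_bound[OF f] unfolding sqn_eq_nrm[OF fin] sqn_eq_nrm[OF ff] .
  then have "(nrm (flow_of f))\<^sup>2 \<le> C * (nrm f)\<^sup>2"
    using C_pos by (simp add: ennreal_mult[symmetric])
  then have "sqrt ((nrm (flow_of f))\<^sup>2) \<le> sqrt (C * (nrm f)\<^sup>2)" by (rule real_sqrt_le_mono)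
  then show "nrm (flow_of f) \<le> sqrt C * nrm f" by (simp add: real_sqrt_mult)
qed

text \<open>The transform of f - h and the difference of the transforms agree almost everywhere, and
  inverse Fourier integrals do not see null sets. Hence the flow of f - h is the difference of the
  flows at every point, and the norm bound for f - h is a Lipschitz bound.\<close>

lemma annular_lipschitz:
  fixes f h :: "real^'d \<Rightarrow> complex^'n"
  assumes f: "f \<in> L2_annular" and h: "h \<in> L2_annular"
  shows "\<bar>nrm (flow_of f) - nrm (flow_of h)\<bar> \<le> sqrt C * nrm (\<lambda>x. f x - h x)"
proof -
  note fL = L2_annularD(1)[OF f] and hL = L2_annularD(1)[OF h] and fh = L2_annular_diff[OF f h]
  note fm = L2_fourier_measurable[OF fL] and hm = L2_fourier_measurable[OF hL]
    and fhm = L2_fourier_measurable[OF L2_annularD(1)[OF fh]]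
  obtain K where K: "compact K" "0 \<notin> K" "AE \<xi> in lborel. \<xi> \<notin> K \<longrightarrow> L2_fourier f \<xi> = 0"
    using L2_annularD(2)[OF f] by blast
  obtain L where L: "compact L" "0 \<notin> L" "AE \<xi> in lborel. \<xi> \<notin> L \<longrightarrow> L2_fourier h \<xi> = 0"
    using L2_annularD(2)[OF h] by blast
  have "inverse_fourier (flow_density \<alpha> \<beta> m (L2_fourier (\<lambda>x. f x - h x)) t) x =
    inverse_fourier (flow_density \<alpha> \<beta> m (L2_fourier f) t) x - inverse_fourier (flow_density \<alpha> \<beta> m (L2_fourier h) t) x" for t x
  proof -
    have "inverse_fourier (flow_density \<alpha> \<beta> m (L2_fourier (\<lambda>x. f x - h x)) t) x =
      inverse_fourier (flow_density \<alpha> \<beta> m (\<lambda>\<xi>. L2_fourier f \<xi> - L2_fourier h \<xi>) t) x"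
    proof (rule inverse_fourier_cong_AE)
      show "AE \<xi> in lborel. flow_density \<alpha> \<beta> m (L2_fourier (\<lambda>x. f x - h x)) t \<xi> = flow_density \<alpha> \<beta> m (\<lambda>\<xi>. L2_fourier f \<xi> - L2_fourier h \<xi>) t \<xi>"
        using L2_fourier_diff[OF fL hL] by eventually_elim (simp only: flow_density_def)
    qed (use fm hm fhm in measurable)
    then show ?thesis
      unfolding flow_density_diff[abs_def]
      by (simp only: inverse_fourier_diff[OF flow_density_integrable[OF dirac fm L2_fourier_finite[OF fL] K] flow_density_integrable[OF dirac hm L2_fourier_finite[OF hL] L]])
  qed
  then have eq: "flow_of (\<lambda>x. f x - h x) = (\<lambda>p. flow_of f p - flow_of h p)"
    unfolding weighted_flow_def by (simp add: scaleR_diff_right)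
  have "\<bar>nrm (flow_of f) - nrm (flow_of h)\<bar> \<le> nrm (\<lambda>p. flow_of f p - flow_of h p)"
    by (intro nrm_diff_abs weighted_flow_measurable fm hm w annular_finite f h)
  also have "\<dots> \<le> sqrt C * nrm (\<lambda>x. f x - h x)"
    unfolding eq[symmetric] by (rule annular_finite(2)[OF fh])
  finally show ?thesis .
qed

text \<open>Outside \<open>L2_annular\<close> the left-hand side is a \<open>Lim\<close> along a
  filter, so convergence must be shown before any bound. The norms along one approximating sequence
  form a Cauchy sequence with limit l, and the Lipschitz estimate carries the convergence to l over
  to the whole filter.\<close>

theorem smoothing_lhs_le:
  fixes f :: "real^'d \<Rightarrow> complex^'n"
  assumes f: "f \<in> L2_space"
  shows "smoothing_lhs \<alpha> \<beta> w (bracket_smoothing m) m f \<le> ennreal C * sqn f"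
proof (cases "f \<in> L2_annular")
  case True
  then show ?thesis by (simp add: smoothing_lhs_def annular_lhs annular_bound)
next
  case False
  have fm: "f \<in> borel_measurable borel" and ffin: "sqn f < \<infinity>" using f by (auto simp: L2_space_iff)
  let ?F = "inf (filtercomap (\<lambda>g. L2_sqnorm (\<lambda>x. g x - f x)) (nhds 0)) (principal L2_annular)"
  obtain h where h: "\<And>n. h n \<in> L2_annular" and hf: "(\<lambda>n. sqn (\<lambda>x. h n x - f x)) \<longlonglongrightarrow> 0"
    using L2_annular_dense[OF f] by blast
  have am: "g \<in> borel_measurable borel" and afin: "sqn g < \<infinity>" if "g \<in> L2_annular" for g :: "real^'d \<Rightarrow> complex^'n"
    using L2_annularD(1)[OF that] by (auto simp: L2_space_iff)
  have tri: "nrm (\<lambda>x. g x - k x) \<le> nrm (\<lambda>x. g x - f x) + nrm (\<lambda>x. k x - f x)" if "g \<in> L2_annular" "k \<in> L2_annular" for g k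
  proof -
    have "nrm (\<lambda>x. (g x - f x) + (f x - k x)) \<le> nrm (\<lambda>x. g x - f x) + nrm (\<lambda>x. f x - k x)"
      by (rule nrm_triangle[OF borel_measurable_diff[OF am[OF that(1)] fm] borel_measurable_diff[OF fm am[OF that(2)]]
          sqn_diff_finite[OF am[OF that(1)] fm afin[OF that(1)] ffin] sqn_diff_finite[OF fm am[OF that(2)] ffin afin[OF that(2)]]])
    then show ?thesis by (simp add: nrm_commute[of f k])
  qed
  have nhf: "(\<lambda>n. nrm (\<lambda>x. h n x - f x)) \<longlonglongrightarrow> 0" by (rule nrm_tendsto_0[OF hf])
  define X where "X n = nrm (flow_of (h n))" for n
  have Xbound: "\<bar>nrm (flow_of g) - X n\<bar> \<le> sqrt C * (nrm (\<lambda>x. g x - f x) + nrm (\<lambda>x. h n x - f x))" if "g \<in> L2_annular" for g n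
    unfolding X_def using annular_lipschitz[OF that h[of n]] tri[OF that h[of n]] C_pos
    by (auto intro: order_trans mult_left_mono)
  have "Cauchy X"
  proof (rule metric_CauchyI)
    fix e :: real assume e: "e > 0"
    have "\<forall>\<^sub>F n in sequentially. nrm (\<lambda>x. h n x - f x) < e / (2 * sqrt C)"
      using nhf e C_pos by (intro order_tendstoD) auto
    then obtain N where N: "\<And>n. n \<ge> N \<Longrightarrow> nrm (\<lambda>x. h n x - f x) < e / (2 * sqrt C)"
      by (auto simp: eventually_sequentially)
    have "dist (X p) (X q) < e" if "p \<ge> N" "q \<ge> N" for p q
    proof -
      have "dist (X p) (X q) \<le> sqrt C * (nrm (\<lambda>x. h p x - f x) + nrm (\<lambda>x. h q x - f x))"
        using Xbound[OF h[of p], of q] by (simp add: dist_real_def X_def)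
      also have "\<dots> < sqrt C * (e / (2 * sqrt C) + e / (2 * sqrt C))"
        using C_pos by (intro mult_strict_left_mono add_strict_mono N that) simp
      also have "\<dots> = e" using C_pos by (simp add: field_simps)
      finally show ?thesis .
    qed
    then show "\<exists>M. \<forall>m\<ge>M. \<forall>n\<ge>M. dist (X m) (X n) < e" by blast
  qed
  then obtain l where l: "X \<longlonglongrightarrow> l" unfolding Cauchy_convergent_iff convergent_def by blast
  have lip: "\<bar>nrm (flow_of g) - l\<bar> \<le> sqrt C * nrm (\<lambda>x. g x - f x)" if "g \<in> L2_annular" for g
  proof -
    have "(\<lambda>n. \<bar>nrm (flow_of g) - X n\<bar>) \<longlonglongrightarrow> \<bar>nrm (flow_of g) - l\<bar>" by (intro tendsto_intros l)
    moreover have "(\<lambda>n. sqrt C * (nrm (\<lambda>x. g x - f x) + nrm (\<lambda>x. h n x - f x))) \<longlonglongrightarrow> sqrt C * (nrm (\<lambda>x. g x - f x) + 0)"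
      by (intro tendsto_intros nhf)
    ultimately have "\<bar>nrm (flow_of g) - l\<bar> \<le> sqrt C * (nrm (\<lambda>x. g x - f x) + 0)"
      by (rule LIMSEQ_le) (use Xbound[OF that] in blast)
    then show ?thesis by simp
  qed
  have l_le: "l \<le> sqrt C * nrm f"
  proof -
    have "(\<lambda>n. sqn (h n)) \<longlonglongrightarrow> sqn f"
      by (intro sqn_tendsto am afin h fm ffin hf)
    then have "(\<lambda>n. nrm (h n)) \<longlonglongrightarrow> nrm f"
      unfolding nrm_def using ffin
      by (intro tendsto_real_sqrt tendsto_enn2real) (simp_all add: ennreal_enn2real)
    then have "(\<lambda>n. sqrt C * nrm (h n)) \<longlonglongrightarrow> sqrt C * nrm f" by (intro tendsto_intros)
    from LIMSEQ_le[OF l this] show ?thesis by (simp add: X_def annular_finite(2)[OF h])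
  qed
  have l0: "l \<ge> 0" using l by (rule LIMSEQ_le_const) (simp add: X_def)
  have sq: "((\<lambda>g. sqn (\<lambda>x. g x - f x)) \<longlongrightarrow> 0) ?F"
    unfolding L2_sqnorm_eq_sqn by (rule filterlim_mono[OF filterlim_filtercomap order_refl inf_le1])
  have ev: "\<forall>\<^sub>F g in ?F. g \<in> L2_annular"
    by (rule filter_leD[OF inf_le2]) (simp add: eventually_principal)
  have bd: "\<forall>\<^sub>F g in ?F. norm (nrm (flow_of g) - l) \<le> sqrt C * nrm (\<lambda>x. g x - f x)"
    using ev by eventually_elim (simp add: lip)
  have "((\<lambda>g. sqrt C * nrm (\<lambda>x. g x - f x)) \<longlongrightarrow> sqrt C * 0) ?F"
    by (intro tendsto_intros nrm_tendsto_0 sq)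
  then have "((\<lambda>g. sqrt C * nrm (\<lambda>x. g x - f x)) \<longlongrightarrow> 0) ?F"
    unfolding mult_zero_right .
  with bd have "((\<lambda>g. nrm (flow_of g) - l) \<longlongrightarrow> 0) ?F"
    by (rule Lim_null_comparison)
  then have "((\<lambda>g. nrm (flow_of g)) \<longlongrightarrow> l) ?F" by (rule LIM_zero_cancel)
  then have "((\<lambda>g. ennreal ((nrm (flow_of g))\<^sup>2)) \<longlongrightarrow> ennreal (l\<^sup>2)) ?F"
    by (intro tendsto_ennrealI tendsto_power)
  moreover have "\<forall>\<^sub>F g in ?F. ennreal ((nrm (flow_of g))\<^sup>2) = smoothing_lhs_direct \<alpha> \<beta> w (bracket_smoothing m) m g"
    using ev by eventually_elim (simp only: annular_lhs sqn_eq_nrm[OF annular_finite(1)])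
  ultimately have lim: "(smoothing_lhs_direct \<alpha> \<beta> w (bracket_smoothing m) m \<longlongrightarrow> ennreal (l\<^sup>2)) ?F"
    by (rule Lim_transform_eventually)
  \<comment> \<open>\<open>Lim\<close> is determined by a limit only along a proper filter.
    Properness here is the density of \<open>L2_annular\<close>: the sequence h runs along the
    filter.\<close>
  have nontriv: "?F \<noteq> bot"
  proof
    assume F: "?F = bot"
    have "filterlim h ?F sequentially"
      unfolding filterlim_inf using hf h
      by (simp add: filterlim_filtercomap_iff filterlim_principal L2_sqnorm_eq_sqn o_def)
    then have "filterlim h bot sequentially" unfolding F .
    then show False by (simp add: filterlim_def bot_unique filtermap_bot_iff)
  qed
  have "smoothing_lhs \<alpha> \<beta> w (bracket_smoothing m) m f = ennreal (l\<^sup>2)"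
    unfolding smoothing_lhs_def using False tendsto_Lim[OF nontriv lim] by simp
  also have "\<dots> \<le> ennreal (C * (nrm f)\<^sup>2)"
  proof (rule ennreal_leI)
    have "l\<^sup>2 \<le> (sqrt C * nrm f)\<^sup>2" using l_le l0 by (rule power_mono)
    then show "l\<^sup>2 \<le> C * (nrm f)\<^sup>2" using C_pos by (simp add: power_mult_distrib)
  qed
  also have "\<dots> = ennreal C * sqn f" using C_pos by (simp add: sqn_eq_nrm[OF ffin] ennreal_mult)
  finally show ?thesis .
qed

corollary smoothing_estimate_holds:
  shows "smoothing_estimate \<alpha> \<beta> w (bracket_smoothing m) m"
    and "smoothing_const \<alpha> \<beta> w (bracket_smoothing m) m \<le> ennreal C"
proof -
  show "smoothing_estimate \<alpha> \<beta> w (bracket_smoothing m) m"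
    unfolding smoothing_estimate_def using smoothing_lhs_le by (auto simp: L2_sqnorm_eq_sqn)
  show "smoothing_const \<alpha> \<beta> w (bracket_smoothing m) m \<le> ennreal C"
    unfolding smoothing_const_def
  proof (rule SUP_least)
    fix f :: "real^'d \<Rightarrow> complex^'n" assume "f \<in> {f \<in> L2_space. L2_sqnorm f = 1}"
    then show "smoothing_lhs \<alpha> \<beta> w (bracket_smoothing m) m f \<le> ennreal C"
      using smoothing_lhs_le[of f] by (simp add: L2_sqnorm_eq_sqn)
  qed
qed

end

section \<open>Low frequencies\<close>

text \<open>As A squares to 1, the vector x + A x is fixed by A. If it vanishes, x lies in the -1
  eigenspace, which B maps injectively into the +1 eigenspace.\<close>

lemma anticommuting_involutions_eigenvector:
  fixes A B :: "complex^'n^'n"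
  assumes A: "A ** A = mat 1" and B: "B ** B = mat 1" and AB: "A ** B = - (B ** A)"
  obtains v where "v \<noteq> 0" "A *v v = v"
proof -
  interpret V: bounded_bilinear "(*v) :: complex^'n^'n \<Rightarrow> complex^'n \<Rightarrow> complex^'n"
    by (rule bounded_bilinear_matrix_vector_mult)
  define x :: "complex^'n" where "x = 1"
  have x0: "x \<noteq> 0" by (simp add: x_def)
  have AA: "A *v (A *v y) = y" and BB: "B *v (B *v y) = y" and ABv: "A *v (B *v y) = - (B *v (A *v y))" for y
    unfolding matrix_vector_mul_assoc A B AB by (simp_all add: V.minus_left)
  show thesis
  proof (cases "x + A *v x = 0")
    case False
    have "A *v (x + A *v x) = x + A *v x" by (simp add: V.add_right AA add.commute)
    then show thesis using False that by blast
  next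
    case True
    then have "A *v x = - x" by (simp add: eq_neg_iff_add_eq_0 add.commute)
    then have "A *v (B *v x) = B *v x" by (simp add: ABv V.minus_right)
    moreover have "B *v x \<noteq> 0" using BB[of x] x0 by (metis V.zero_right)
    ultimately show thesis using that by blast
  qed
qed

text \<open>Anticommutation puts B v into the -1 eigenspace of A, which is orthogonal to the fixed
  vector v because A is Hermitian.\<close>

lemma anticommuting_inner_zero:
  fixes A B :: "complex^'n^'n"
  assumes A: "hermitian_matrix A" and v: "A *v v = v" and AB: "A ** B = - (B ** A)"
  shows "(z *s (B *v v)) \<bullet> v = 0"
proof -
  interpret V: bounded_bilinear "(*v) :: complex^'n^'n \<Rightarrow> complex^'n \<Rightarrow> complex^'n"
    by (rule bounded_bilinear_matrix_vector_mult)
  have "(z *s (B *v v)) \<bullet> v = (z *s (B *v v)) \<bullet> (A *v v)" by (simp only: v)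
  also have "\<dots> = (A *v (z *s (B *v v))) \<bullet> v" by (rule hermitian_matrix_inner[OF A, symmetric])
  also have "A *v (z *s (B *v v)) = z *s ((A ** B) *v v)"
    by (simp add: matrix_vector_mult_smult matrix_vector_mul_assoc)
  also have "(A ** B) *v v = - (B *v (A *v v))" by (simp add: AB V.minus_left matrix_vector_mul_assoc)
  also have "(z *s - (B *v (A *v v))) \<bullet> v = - ((z *s (B *v v)) \<bullet> v)"
    unfolding v by (simp add: inner_vector_smult)
  finally show ?thesis by simp
qed

lemma smult_inner_self: "(z *s v) \<bullet> v = Re z * (norm (v::complex^'n))\<^sup>2"
  unfolding norm_vec_power2 inner_vec_def inner_complex_def cmod_power2 sum_distrib_left
  by (intro sum.cong refl) (simp add: algebra_simps power2_eq_square)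

lemma cos_ge_one_minus_abs: "cos x \<ge> 1 - \<bar>x::real\<bar>"
proof -
  have "1 - cos x = 2 * (sin (x / 2))\<^sup>2" using cos_double_sin[of "x / 2"] by simp
  also have "\<dots> \<le> 2 * \<bar>sin (x / 2)\<bar>"
  proof -
    have "\<bar>sin (x / 2)\<bar> * \<bar>sin (x / 2)\<bar> \<le> 1 * \<bar>sin (x / 2)\<bar>" by (intro mult_right_mono abs_sin_le_one) simp
    then show ?thesis by (simp add: power2_eq_square)
  qed
  also have "\<dots> \<le> 2 * \<bar>x / 2\<bar>" by (intro mult_left_mono abs_sin_x_le_abs_x) simp
  finally show ?thesis by simp
qed

text \<open>The second bound comes from (\<phi> - m)(\<phi> + m) = r^2. Dividing by \<phi> rather
  than by m keeps it valid in the massless case.\<close>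

lemma dirac_dispersion_bounds:
  assumes m: "m \<ge> 0" and r: "r > 0"
  shows "m \<le> dirac_dispersion m r" "dirac_dispersion m r - m \<le> r\<^sup>2 / dirac_dispersion m r"
proof -
  let ?\<phi> = "dirac_dispersion m r"
  have p: "?\<phi> > 0" using r by (intro dirac_dispersion_pos) simp
  show le: "m \<le> ?\<phi>" unfolding dirac_dispersion_eq_sqrt using m by (intro real_le_rsqrt) simp
  have "(?\<phi> - m) * (?\<phi> + m) = r\<^sup>2" by (simp add: dirac_dispersion_eq_sqrt algebra_simps power2_eq_square[symmetric])
  moreover have "(?\<phi> - m) * ?\<phi> \<le> (?\<phi> - m) * (?\<phi> + m)" using m le by (intro mult_left_mono) auto
  ultimately show "?\<phi> - m \<le> r\<^sup>2 / ?\<phi>" using p by (simp add: pos_le_divide_eq)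
qed

lemma dirac_dispersion_mono: "0 \<le> r \<Longrightarrow> r \<le> r' \<Longrightarrow> dirac_dispersion m r \<le> dirac_dispersion m r'"
  unfolding dirac_dispersion_eq_sqrt by (intro real_sqrt_le_mono add_right_mono power_mono)

lemma bracket_smoothing_nonneg: "bracket_smoothing m r \<ge> 0"
  by (simp add: bracket_smoothing_def)

text \<open>With z = m t + y the expression is cos (t \<phi> - z) - (1 - m / \<phi>) sin (t \<phi>)
  sin z. The first term is at least 5/8. In the second, |sin (t \<phi>)| \<le> |t| \<phi> cancels
  the denominator and leaves |t| (\<phi> - m) \<le> 1/8, uniformly down to m = 0.\<close>

lemma low_frequency_phase:
  fixes t \<phi> m y :: real
  assumes m: "0 \<le> m" "m \<le> \<phi>" "0 < \<phi>" and t: "\<bar>t\<bar> * (\<phi> - m) \<le> 1 / 8" and y: "\<bar>y\<bar> \<le> 1 / 4"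
  shows "1 / 2 \<le> cos (t * \<phi>) * cos (m * t + y) + m / \<phi> * (sin (t * \<phi>) * sin (m * t + y))"
proof -
  let ?z = "m * t + y"
  have "\<bar>t * \<phi> - ?z\<bar> \<le> \<bar>t * (\<phi> - m)\<bar> + \<bar>y\<bar>" by (simp add: algebra_simps)
  also have "\<bar>t * (\<phi> - m)\<bar> = \<bar>t\<bar> * (\<phi> - m)" using m by (simp add: abs_mult)
  finally have "\<bar>t * \<phi> - ?z\<bar> \<le> 3 / 8" using t y by linarith
  then have 1: "cos (t * \<phi> - ?z) \<ge> 5 / 8" using cos_ge_one_minus_abs[of "t * \<phi> - ?z"] by linarith
  have "\<bar>(1 - m / \<phi>) * (sin (t * \<phi>) * sin ?z)\<bar> \<le> (1 - m / \<phi>) * (\<bar>t * \<phi>\<bar> * 1)"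
    unfolding abs_mult[of "1 - m / \<phi>"] abs_mult[of "sin (t * \<phi>)"] using m by (intro mult_mono abs_sin_x_le_abs_x abs_sin_le_one) auto
  also have "\<dots> = \<bar>t\<bar> * (\<phi> - m)" using m by (simp add: abs_mult field_simps)
  finally have 2: "\<bar>(1 - m / \<phi>) * (sin (t * \<phi>) * sin ?z)\<bar> \<le> 1 / 8" using t by linarith
  have "cos (t * \<phi>) * cos ?z + m / \<phi> * (sin (t * \<phi>) * sin ?z) = cos (t * \<phi> - ?z) - (1 - m / \<phi>) * (sin (t * \<phi>) * sin ?z)"
    by (simp add: cos_diff algebra_simps)
  then show ?thesis using 1 2 by linarith
qed

lemma sqn_indicator_vec:
  fixes v :: "complex^'n"
  assumes [measurable]: "A \<in> sets borel"
  shows "sqn (\<lambda>x::'a::euclidean_space. indicator A x *\<^sub>R v) = ennreal ((norm v)\<^sup>2) * emeasure lborel A"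
proof -
  have "sqn (\<lambda>x::'a. indicator A x *\<^sub>R v) = (\<integral>\<^sup>+x. ennreal ((norm v)\<^sup>2) * indicator A x \<partial>lborel)"
    unfolding sqn_def by (intro nn_integral_cong) (simp add: indicator_def)
  then show ?thesis by (simp add: nn_integral_cmult_indicator)
qed

section \<open>Concentration of low-frequency data\<close>

context
  fixes \<alpha> :: "'d::finite \<Rightarrow> complex^'n^'n" and \<beta> :: "complex^'n^'n" and m :: real
  assumes dirac: "dirac_matrices \<alpha> \<beta>" and m: "m \<ge> 0"
begin

lemma dirac_hermitian: "hermitian_matrix (\<alpha> j)" "hermitian_matrix \<beta>"
  using dirac by (auto simp: dirac_matrices_def)

lemma dirac_symbol_vec: "dirac_symbol \<alpha> \<beta> m \<xi> *v v = (\<Sum>j\<in>UNIV. (\<xi> $ j) *\<^sub>R (\<alpha> j *v v)) + m *\<^sub>R (\<beta> *v v)"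
proof -
  interpret V: bounded_bilinear "(*v) :: complex^'n^'n \<Rightarrow> complex^'n \<Rightarrow> complex^'n"
    by (rule bounded_bilinear_matrix_vector_mult)
  show ?thesis unfolding dirac_symbol_def by (simp add: V.add_left V.sum_left V.scaleR_left)
qed

lemma dirac_J_inner:
  "(z *s dirac_J \<alpha> \<beta> m \<xi> v) \<bullet> v = 1 / dirac_dispersion m (norm \<xi>) *
    ((\<Sum>j\<in>UNIV. \<xi> $ j * (((z * \<i>) *s (\<alpha> j *v v)) \<bullet> v)) + m * (((z * \<i>) *s (\<beta> *v v)) \<bullet> v))"
proof -
  interpret S: bounded_bilinear "(*s) :: complex \<Rightarrow> complex^'n \<Rightarrow> complex^'n"
    by (rule bounded_bilinear_vector_smult)
  have "z *s dirac_J \<alpha> \<beta> m \<xi> v = (1 / dirac_dispersion m (norm \<xi>)) *\<^sub>R ((z * \<i>) *s (dirac_symbol \<alpha> \<beta> m \<xi> *v v))"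
    unfolding dirac_J_def S.scaleR_right by (simp add: vec_eq_iff mult.assoc)
  then show ?thesis
    unfolding dirac_symbol_vec by (simp add: S.add_right S.sum_right S.scaleR_right inner_add_left inner_sum_left)
qed

text \<open>On a +1 eigenvector of \<beta> every \<alpha> matrix produces a vector orthogonal to v,
  so only the mass term of the symbol is visible in the component along v.\<close>

lemma dirac_J_inner_beta:
  assumes v: "\<beta> *v v = v"
  shows "(z *s dirac_J \<alpha> \<beta> m \<xi> v) \<bullet> v = - (m / dirac_dispersion m (norm \<xi>) * Im z * (norm v)\<^sup>2)"
proof -
  have "\<beta> ** \<alpha> j = - (\<alpha> j ** \<beta>)" for j using dirac_anticomm[OF dirac, of j] by simp
  then have "(y *s (\<alpha> j *v v)) \<bullet> v = 0" for y j
    by (intro anticommuting_inner_zero[OF dirac_hermitian(2) v])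
  then show ?thesis unfolding dirac_J_inner v smult_inner_self by simp
qed

text \<open>The same cancellation with the roles exchanged: on a +1 eigenvector of
  \<open>\<alpha> k\<close> only the frequency in direction k remains visible.\<close>

lemma dirac_J_inner_alpha:
  assumes v: "\<alpha> k *v v = v"
  shows "(z *s dirac_J \<alpha> \<beta> m \<xi> v) \<bullet> v = - (\<xi> $ k / dirac_dispersion m (norm \<xi>) * Im z * (norm v)\<^sup>2)"
proof -
  have b: "(y *s (\<beta> *v v)) \<bullet> v = 0" for y
    by (rule anticommuting_inner_zero[OF dirac_hermitian(1) v dirac_anticomm[OF dirac]])
  have a: "(y *s (\<alpha> j *v v)) \<bullet> v = (if j = k then Re y * (norm v)\<^sup>2 else 0)" for y j
  proof (cases "j = k")
    case True
    then show ?thesis by (simp add: v smult_inner_self)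
  next
    case False
    then have "\<alpha> k ** \<alpha> j + \<alpha> j ** \<alpha> k = 0" using dirac by (auto simp: dirac_matrices_def)
    then have "\<alpha> k ** \<alpha> j = - (\<alpha> j ** \<alpha> k)" by (simp add: eq_neg_iff_add_eq_0)
    from anticommuting_inner_zero[OF dirac_hermitian(1) v this] show ?thesis using False by simp
  qed
  have "(\<Sum>j\<in>UNIV. \<xi> $ j * (((z * \<i>) *s (\<alpha> j *v v)) \<bullet> v)) = (\<Sum>j\<in>UNIV. if j = k then \<xi> $ k * (Re (z * \<i>) * (norm v)\<^sup>2) else 0)"
    unfolding a by (intro sum.cong) auto
  also have "\<dots> = \<xi> $ k * (Re (z * \<i>) * (norm v)\<^sup>2)" by simp
  finally show ?thesis unfolding dirac_J_inner b by simp
qed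

text \<open>Once the common phase exp (-i m t) is removed, the component along v has a positive
  lower bound at every frequency in A, so the integral over A cannot cancel. The denominators are
  tuned to this: |\<xi>|^2 \<le> 9 \<delta>^2 and 72 = 8 * 9 give |t| (\<phi> - m) \<le> 1/8, and 12
  = 3 * 4 gives |x \<bullet> \<xi>| \<le> 1/4.\<close>

lemma low_frequency_pointwise:
  fixes v :: "complex^'n" and \<delta> t :: real and x :: "real^'d"
  assumes v: "\<beta> *v v = v" "v \<noteq> 0" and \<delta>: "\<delta> > 0"
    and A: "A \<in> sets borel" "emeasure lborel A < \<infinity>" "compact A" "\<And>\<xi>. \<xi> \<in> A \<Longrightarrow> \<delta> \<le> norm \<xi> \<and> norm \<xi> \<le> 3 * \<delta>"
    and t: "\<bar>t\<bar> \<le> dirac_dispersion m \<delta> / (72 * \<delta>\<^sup>2)" and x: "norm x \<le> 1 / (12 * \<delta>)"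
  shows "(measure lborel A * norm v)\<^sup>2 / ((2 * pi) ^ (2 * CARD('d)) * (12 * dirac_dispersion m \<delta>))
    \<le> (norm (inverse_fourier (flow_density \<alpha> \<beta> m (\<lambda>\<xi>. indicator A \<xi> *\<^sub>R v) t) x))\<^sup>2"
proof -
  define g where "g \<xi> = indicator A \<xi> *\<^sub>R v" for \<xi>
  define P where "P = dirac_dispersion m \<delta>"
  have P: "P > 0" unfolding P_def using \<delta> by (intro dirac_dispersion_pos) simp
  have gm: "g \<in> borel_measurable borel" unfolding g_def[abs_def] using A(1) by measurable
  have gfin: "sqn g < \<infinity>" unfolding g_def[abs_def] sqn_indicator_vec[OF A(1)] using A(2) by (simp add: ennreal_mult_less_top)
  have supp: "AE \<xi> in lborel. \<xi> \<notin> A \<longrightarrow> g \<xi> = 0" by (simp add: g_def)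
  have A0: "0 \<notin> A" using A(4)[of 0] \<delta> by auto
  have fi: "integrable lborel (flow_density \<alpha> \<beta> m g t)"
    by (rule flow_density_integrable[OF dirac gm gfin A(3) A0 supp])
  let ?z = "\<lambda>\<xi>. exp (\<i> * of_real (m * t + x \<bullet> \<xi>))"
  let ?c = "1 / (2 * pi) ^ CARD('d)"
  define u where "u = inverse_fourier (flow_density \<alpha> \<beta> m g t) x"
  have zi: "integrable lborel (\<lambda>\<xi>. ?z \<xi> *s flow_density \<alpha> \<beta> m g t \<xi>)"
  proof (rule Bochner_Integration.integrable_bound[OF fi])
    have [measurable]: "flow_density \<alpha> \<beta> m g t \<in> borel_measurable borel" using fi by auto
    show "(\<lambda>\<xi>. ?z \<xi> *s flow_density \<alpha> \<beta> m g t \<xi>) \<in> borel_measurable lborel" by measurable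
  qed (simp add: norm_vector_smult)
  have ei: "integrable lborel (\<lambda>\<xi>. exp (\<i> * of_real (x \<bullet> \<xi>)) *s flow_density \<alpha> \<beta> m g t \<xi>)"
  proof (rule Bochner_Integration.integrable_bound[OF fi])
    have [measurable]: "flow_density \<alpha> \<beta> m g t \<in> borel_measurable borel" using fi by auto
    show "(\<lambda>\<xi>. exp (\<i> * of_real (x \<bullet> \<xi>)) *s flow_density \<alpha> \<beta> m g t \<xi>) \<in> borel_measurable lborel" by measurable
  qed (simp add: norm_vector_smult)
  have phase: "exp (\<i> * of_real (m * t)) *s u = ?c *\<^sub>R (\<integral>\<xi>. ?z \<xi> *s flow_density \<alpha> \<beta> m g t \<xi> \<partial>lborel)"
  proof -
    interpret S: bounded_bilinear "(*s) :: complex \<Rightarrow> complex^'n \<Rightarrow> complex^'n"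
      by (rule bounded_bilinear_vector_smult)
    have "?z \<xi> *s w = exp (\<i> * of_real (m * t)) *s (exp (\<i> * of_real (x \<bullet> \<xi>)) *s w)" for \<xi> and w :: "complex^'n"
      by (simp add: vec_eq_iff exp_add[symmetric] mult.assoc[symmetric] distrib_left)
    then show ?thesis unfolding u_def inverse_fourier_def S.scaleR_right
      by (simp only: integral_bounded_linear[OF S.bounded_linear_right ei])
  qed
  have "?c * (measure lborel A * (sqrt (1 / (3 * P)) * (norm v)\<^sup>2 / 2)) \<le> (exp (\<i> * of_real (m * t)) *s u) \<bullet> v"
  proof -
    have Ai: "integrable lborel (\<lambda>\<xi>. indicator A \<xi> * (sqrt (1 / (3 * P)) * (norm v)\<^sup>2 / 2) :: real)"
      using A by (intro integrable_mult_left integrable_real_indicator) auto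
    have "measure lborel A * (sqrt (1 / (3 * P)) * (norm v)\<^sup>2 / 2) = (\<integral>\<xi>. indicator A \<xi> * (sqrt (1 / (3 * P)) * (norm v)\<^sup>2 / 2) \<partial>lborel)"
      using A by simp
    also have "\<dots> \<le> (\<integral>\<xi>. (?z \<xi> *s flow_density \<alpha> \<beta> m g t \<xi>) \<bullet> v \<partial>lborel)"
    proof (rule integral_mono[OF Ai integrable_inner_left])
      show "integrable lborel (\<lambda>\<xi>. ?z \<xi> *s flow_density \<alpha> \<beta> m g t \<xi>)" by (rule zi)
      fix \<xi> :: "real^'d"
      show "indicator A \<xi> * (sqrt (1 / (3 * P)) * (norm v)\<^sup>2 / 2) \<le> (?z \<xi> *s flow_density \<alpha> \<beta> m g t \<xi>) \<bullet> v"
      proof (cases "\<xi> \<in> A")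
        case False
        have "flow_density \<alpha> \<beta> m g t \<xi> = 0"
          using False linear_0[OF bounded_linear.linear[OF bounded_linear_dirac_J[of \<alpha> \<beta> m \<xi>]]] by (simp add: flow_density_def g_def)
        then show ?thesis using False by simp
      next
        case True
        define \<phi> where "\<phi> = dirac_dispersion m (norm \<xi>)"
        define \<psi> where "\<psi> = bracket_smoothing m (norm \<xi>)"
        have r: "\<delta> \<le> norm \<xi>" "norm \<xi> \<le> 3 * \<delta>" "norm \<xi> > 0" using A(4)[OF True] \<delta> by auto
        have \<phi>P: "P \<le> \<phi>" unfolding P_def \<phi>_def using r \<delta> by (intro dirac_dispersion_mono) auto
        have \<phi>3: "\<phi> \<le> 3 * P"
        proof -
          have "\<phi> \<le> dirac_dispersion m (3 * \<delta>)" unfolding \<phi>_def using r by (intro dirac_dispersion_mono) auto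
          also have "\<dots> \<le> 3 * P" unfolding P_def dirac_dispersion_eq_sqrt
            by (intro real_le_lsqrt) (auto simp: power_mult_distrib)
          finally show ?thesis .
        qed
        note bd = dirac_dispersion_bounds[OF m r(3), folded \<phi>_def]
        have "\<phi> - m \<le> 9 * \<delta>\<^sup>2 / P"
        proof -
          have "(norm \<xi>)\<^sup>2 \<le> (3 * \<delta>)\<^sup>2" using r by (intro power_mono) auto
          then have "(norm \<xi>)\<^sup>2 / \<phi> \<le> 9 * \<delta>\<^sup>2 / P" using \<phi>P P by (intro frac_le) (auto simp: power_mult_distrib)
          then show ?thesis using bd by linarith
        qed
        then have "\<bar>t\<bar> * (\<phi> - m) \<le> P / (72 * \<delta>\<^sup>2) * (9 * \<delta>\<^sup>2 / P)"
          using t bd(1) P unfolding P_def[symmetric] by (intro mult_mono) auto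
        also have "\<dots> = 1 / 8" using P \<delta> by simp
        finally have tt: "\<bar>t\<bar> * (\<phi> - m) \<le> 1 / 8" .
        have "\<bar>x \<bullet> \<xi>\<bar> \<le> norm x * norm \<xi>" by (rule Cauchy_Schwarz_ineq2)
        also have "\<dots> \<le> 1 / (12 * \<delta>) * (3 * \<delta>)" using x r \<delta> by (intro mult_mono) auto
        also have "\<dots> = 1 / 4" using \<delta> by simp
        finally have xx: "\<bar>x \<bullet> \<xi>\<bar> \<le> 1 / 4" .
        have ph: "1 / 2 \<le> cos (t * \<phi>) * cos (m * t + x \<bullet> \<xi>) + m / \<phi> * (sin (t * \<phi>) * sin (m * t + x \<bullet> \<xi>))"
          using \<phi>P P by (intro low_frequency_phase m bd(1) tt xx) linarith
        \<comment> \<open>This is where 12 P = 4 * 3 P in the conclusion comes from: 3 P bounds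
          \<phi>, and the 4 is the square of the lower bound 1/2 for the phase.\<close>
        have \<psi>: "sqrt (1 / (3 * P)) \<le> \<psi>"
        proof (rule real_le_lsqrt[THEN order_trans[OF _ order_refl]])
          show "0 \<le> \<psi>" by (simp add: \<psi>_def bracket_smoothing_nonneg)
          have "1 / (3 * P) \<le> 1 / \<phi>" using \<phi>3 \<phi>P P by (intro divide_left_mono) auto
          also have "\<dots> \<le> sqrt (1 + (norm \<xi>)\<^sup>2) / \<phi>" using \<phi>P P by (intro divide_right_mono) auto
          also have "\<dots> = \<psi>\<^sup>2" unfolding \<psi>_def \<phi>_def using r by (intro bracket_smoothing_sq[symmetric]) simp
          finally show "1 / (3 * P) \<le> \<psi>\<^sup>2" .
        qed
        have e: "Re (?z \<xi>) = cos (m * t + x \<bullet> \<xi>)" "Im (?z \<xi>) = sin (m * t + x \<bullet> \<xi>)"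
          by (simp_all only: Re_exp Im_exp) simp_all
        have "(?z \<xi> *s flow_density \<alpha> \<beta> m g t \<xi>) \<bullet> v = \<psi> * (cos (t * \<phi>) * ((?z \<xi> *s v) \<bullet> v) - sin (t * \<phi>) * ((?z \<xi> *s dirac_J \<alpha> \<beta> m \<xi> v) \<bullet> v))"
        proof -
          interpret S: bounded_bilinear "(*s) :: complex \<Rightarrow> complex^'n \<Rightarrow> complex^'n"
            by (rule bounded_bilinear_vector_smult)
          show ?thesis
            using True unfolding flow_density_def \<psi>_def \<phi>_def g_def
            by (simp add: S.scaleR_right S.diff_right inner_diff_left)
        qed
        also have "\<dots> = \<psi> * ((cos (t * \<phi>) * cos (m * t + x \<bullet> \<xi>) + m / \<phi> * (sin (t * \<phi>) * sin (m * t + x \<bullet> \<xi>))) * (norm v)\<^sup>2)"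
          unfolding smult_inner_self dirac_J_inner_beta[OF v(1)] e \<phi>_def[symmetric] by (simp add: algebra_simps)
        also have "\<dots> \<ge> sqrt (1 / (3 * P)) * (1 / 2 * (norm v)\<^sup>2)"
          using P by (intro mult_mono \<psi> mult_right_mono ph) (auto simp: \<psi>_def bracket_smoothing_nonneg)
        finally show ?thesis using True by simp
      qed
    qed
    also have "\<dots> = (\<integral>\<xi>. ?z \<xi> *s flow_density \<alpha> \<beta> m g t \<xi> \<partial>lborel) \<bullet> v"
      by (rule integral_inner_left) (rule zi)
    finally show ?thesis unfolding phase inner_scaleR_left by (intro mult_left_mono) auto
  qed
  also have "\<dots> \<le> norm (exp (\<i> * of_real (m * t)) *s u) * norm v" by (rule norm_cauchy_schwarz)
  also have "\<dots> = norm u * norm v" by (simp add: norm_vector_smult)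
  finally have "?c * (measure lborel A * (sqrt (1 / (3 * P)) * (norm v / 2))) * norm v \<le> norm u * norm v"
    by (simp add: power2_eq_square mult_ac)
  then have "?c * (measure lborel A * (sqrt (1 / (3 * P)) * (norm v / 2))) \<le> norm u"
    by (rule mult_right_le_imp_le) (use v(2) in simp)
  then have "(?c * (measure lborel A * (sqrt (1 / (3 * P)) * (norm v / 2))))\<^sup>2 \<le> (norm u)\<^sup>2"
    using P by (intro power_mono) auto
  also have "(?c * (measure lborel A * (sqrt (1 / (3 * P)) * (norm v / 2))))\<^sup>2 = (measure lborel A * norm v)\<^sup>2 / ((2 * pi) ^ (2 * CARD('d)) * (12 * P))"
    using P by (simp add: power_mult_distrib power_divide power_mult[symmetric] mult.commute)
  finally show ?thesis unfolding u_def g_def[abs_def] P_def .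
qed

text \<open>Count powers of \<delta>: the normalised data contribute |A|, of order \<delta>^d, the
  spatial ball \<delta>^(-d), the time interval \<phi>(\<delta>) / \<delta>^2 and the weight
  \<delta>^s for s \<ge> 0. The factor \<phi>(\<delta>) cancels against \<psi>^2, and \<delta>^(s -
  2) remains. With \<open>max s 0\<close> one formula also covers s < 0, where the weight is at
  least 1.\<close>

lemma smoothing_const_low_frequency:
  fixes \<delta> s :: real
  assumes \<delta>: "0 < \<delta>" "\<delta> \<le> 1 / 12"
  shows "ennreal ((unit_ball_vol CARD('d))\<^sup>2 / (12 ^ CARD('d) * (2 * pi) ^ CARD('d) * 432) * (1 / \<delta>\<^sup>2) powr (1 - max s 0 / 2))
    \<le> smoothing_const \<alpha> \<beta> (bracket_weight s) (bracket_smoothing m) m"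
proof -
  interpret V: bounded_bilinear "(*v) :: complex^'n^'n \<Rightarrow> complex^'n \<Rightarrow> complex^'n"
    by (rule bounded_bilinear_matrix_vector_mult)
  obtain j :: 'd where True by blast
  have "\<beta> ** \<alpha> j = - (\<alpha> j ** \<beta>)" using dirac_anticomm[OF dirac, of j] by simp
  then obtain v0 where v0: "v0 \<noteq> 0" "\<beta> *v v0 = v0"
    using anticommuting_involutions_eigenvector[OF dirac_beta_sq[OF dirac] dirac_alpha_sq[OF dirac]] by blast
  define e :: "real^'d" where "e = axis j 1"
  have e: "norm e = 1" by (simp add: e_def)
  \<comment> \<open>A ball off the origin inside the annulus \<delta> \<le> |\<xi>| \<le> 3
    \<delta>, so that the data are annular.\<close>
  define A where "A = cball ((2 * \<delta>) *\<^sub>R e) \<delta>"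
  let ?V = "unit_ball_vol (real CARD('d))"
  have V: "?V > 0" by simp
  define P where "P = dirac_dispersion m \<delta>"
  have P: "P > 0" unfolding P_def using \<delta> by (intro dirac_dispersion_pos) simp
  have eA: "emeasure lborel A = ennreal (?V * \<delta> ^ CARD('d))"
    unfolding A_def using \<delta> by (subst emeasure_cball) auto
  then have mA: "measure lborel A = ?V * \<delta> ^ CARD('d)" using \<delta> by (simp add: measure_def)
  define M where "M = measure lborel A"
  have M: "M > 0" unfolding M_def mA using \<delta> V by simp
  have normA: "\<delta> \<le> norm \<xi> \<and> norm \<xi> \<le> 3 * \<delta>" if "\<xi> \<in> A" for \<xi>
  proof -
    have "norm ((2 * \<delta>) *\<^sub>R e - \<xi>) \<le> \<delta>" using that by (simp add: A_def dist_norm)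
    then show ?thesis
      using norm_triangle_ineq2[of "(2 * \<delta>) *\<^sub>R e" \<xi>] norm_triangle_ineq2[of \<xi> "(2 * \<delta>) *\<^sub>R e"] e \<delta>
      by (simp add: norm_minus_commute)
  qed
  define v where "v = (sqrt ((2 * pi) ^ CARD('d) / M) / norm v0) *\<^sub>R v0"
  have vn: "(norm v)\<^sup>2 = (2 * pi) ^ CARD('d) / M"
    using v0 M by (simp add: v_def power_mult_distrib power_divide)
  have v: "\<beta> *v v = v" "v \<noteq> 0" using v0 M by (auto simp: v_def V.scaleR_right)
  have AA: "A \<in> sets borel" "emeasure lborel A < \<infinity>" "compact A"
    unfolding eA by (auto simp: A_def)
  define g where "g \<xi> = indicator A \<xi> *\<^sub>R v" for \<xi>
  have gm: "g \<in> borel_measurable borel" unfolding g_def[abs_def] using AA(1) by measurable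
  have eM: "emeasure lborel A = ennreal M" by (simp add: eA M_def mA)
  have g1: "sqn g = ennreal ((2 * pi) ^ CARD('d))"
    unfolding g_def[abs_def] sqn_indicator_vec[OF AA(1)] eM vn using M by (simp flip: ennreal_mult)
  have A0: "0 \<notin> A" using normA[of 0] \<delta> by auto
  define T where "T = P / (72 * \<delta>\<^sup>2)"
  define \<rho> where "\<rho> = 1 / (12 * \<delta>)"
  define \<omega> where "\<omega> = (1 / \<delta>\<^sup>2) powr (- (max s 0) / 2)"
  have T: "T > 0" and \<rho>: "\<rho> \<ge> 1" using P \<delta> by (auto simp: T_def \<rho>_def field_simps)
  have wt: "\<omega> \<le> bracket_weight s r" if "0 \<le> r" "r \<le> \<rho>" for r
  proof -
    have "r\<^sup>2 \<le> \<rho>\<^sup>2" using that by (intro power_mono)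
    moreover have "1 \<le> \<rho>\<^sup>2" using \<rho> by (simp add: one_le_power)
    moreover have "2 * \<rho>\<^sup>2 \<le> 1 / \<delta>\<^sup>2" using \<delta> by (simp add: \<rho>_def field_simps power2_eq_square)
    ultimately have le: "1 + r\<^sup>2 \<le> 1 / \<delta>\<^sup>2" by linarith
    have "\<omega> \<le> (1 + r\<^sup>2) powr (- (max s 0) / 2)"
      unfolding \<omega>_def using le by (intro powr_mono2') (auto simp: add_pos_nonneg)
    also have "\<dots> \<le> (1 + r\<^sup>2) powr (- s / 2)" by (intro powr_mono) auto
    finally show ?thesis by (simp add: bracket_weight_def)
  qed
  define k where "k = M / ((2 * pi) ^ CARD('d) * (12 * P)) * \<omega>"
  have k0: "k \<ge> 0" using M P by (simp add: k_def \<omega>_def)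
  let ?S = "{- T..T} \<times> cball (0::real^'d) \<rho>"
  have eS: "emeasure lborel ?S = ennreal (2 * T * (?V * \<rho> ^ CARD('d)))"
  proof -
    have "emeasure lborel ?S = emeasure (lborel \<Otimes>\<^sub>M lborel) ?S" by (simp only: lborel_prod)
    also have "\<dots> = emeasure lborel {- T..T} * emeasure lborel (cball (0::real^'d) \<rho>)"
      by (rule lborel.emeasure_pair_measure_Times) auto
    also have "\<dots> = ennreal (2 * T * (?V * \<rho> ^ CARD('d)))"
      using T \<rho> by (subst emeasure_cball) (auto simp: ennreal_mult[symmetric])
    finally show ?thesis .
  qed
  have "ennreal (?V\<^sup>2 / (12 ^ CARD('d) * (2 * pi) ^ CARD('d) * 432) * (1 / \<delta>\<^sup>2) powr (1 - max s 0 / 2)) = ennreal k * emeasure lborel ?S"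
  proof -
    have "(1 / \<delta>\<^sup>2) powr (1 - max s 0 / 2) = (1 / \<delta>\<^sup>2) * \<omega>"
      unfolding \<omega>_def using \<delta> by (simp add: powr_diff powr_minus_divide)
    \<comment> \<open>The 12 of the pointwise bound and the 36 of 2 T = P / (36 \<delta>^2) combine
      to 432; P itself cancels.\<close>
    moreover have "k * (2 * T * (?V * \<rho> ^ CARD('d))) = ?V\<^sup>2 / (12 ^ CARD('d) * (2 * pi) ^ CARD('d) * 432) * ((1 / \<delta>\<^sup>2) * \<omega>)"
      using P \<delta> by (simp add: k_def T_def \<rho>_def M_def mA power_divide power_mult_distrib power2_eq_square field_simps)
    ultimately show ?thesis unfolding eS using k0 by (simp add: ennreal_mult'[symmetric])
  qed
  also have "\<dots> = (\<integral>\<^sup>+p. ennreal k * indicator ?S p \<partial>lborel)"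
    by (rule nn_integral_cmult_indicator[symmetric]) (simp add: borel_closed closed_Times)
  also have "\<dots> \<le> sqn (weighted_flow \<alpha> \<beta> (bracket_weight s) m g)"
    unfolding sqn_def
  proof (rule nn_integral_mono)
    fix p :: "real \<times> (real^'d)"
    show "ennreal k * indicator ?S p \<le> ennreal ((norm (weighted_flow \<alpha> \<beta> (bracket_weight s) m g p))\<^sup>2)"
    proof (cases "p \<in> ?S")
      case True
      then have t: "\<bar>fst p\<bar> \<le> T" and x: "norm (snd p) \<le> \<rho>" by (cases p; auto)+
      define u where "u = inverse_fourier (flow_density \<alpha> \<beta> m g (fst p)) (snd p)"
      have "(M * norm v)\<^sup>2 / ((2 * pi) ^ (2 * CARD('d)) * (12 * P)) \<le> (norm u)\<^sup>2"
        unfolding M_def P_def u_def g_def[abs_def]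
        by (rule low_frequency_pointwise[OF v \<delta>(1) AA(1) AA(2) AA(3) normA t[unfolded T_def P_def] x[unfolded \<rho>_def]])
      also have "(M * norm v)\<^sup>2 / ((2 * pi) ^ (2 * CARD('d)) * (12 * P)) = M / ((2 * pi) ^ CARD('d) * (12 * P))"
      proof -
        have "(2 * pi) ^ (2 * CARD('d)) = (2 * pi) ^ CARD('d) * (2 * pi) ^ CARD('d)"
          by (simp only: power_even_eq power2_eq_square)
        then show ?thesis using M by (simp only: power_mult_distrib[of M] vn) (simp add: power2_eq_square)
      qed
      finally have "k \<le> (norm u)\<^sup>2 * bracket_weight s (norm (snd p))"
        unfolding k_def using x M P by (intro mult_mono wt) (auto simp: \<omega>_def)
      also have "\<dots> = (norm (weighted_flow \<alpha> \<beta> (bracket_weight s) m g p))\<^sup>2"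
        by (simp add: weighted_flow_def u_def power_mult_distrib bracket_weight_def)
      finally show ?thesis using True by (simp add: ennreal_leI)
    qed simp
  qed
  also have "\<dots> \<le> smoothing_const \<alpha> \<beta> (bracket_weight s) (bracket_smoothing m) m"
  proof (rule smoothing_const_ge[OF dirac gm g1 AA(3) A0])
    show "bracket_weight s \<in> borel_measurable borel" unfolding bracket_weight_def[abs_def] by measurable
  qed (auto simp: g_def bracket_weight_def)
  finally show ?thesis .
qed

theorem smoothing_const_infinite:
  assumes s: "s < 2"
  shows "smoothing_const \<alpha> \<beta> (bracket_weight s) (bracket_smoothing m) m = \<infinity>"
proof (rule ccontr)
  let ?C = "smoothing_const \<alpha> \<beta> (bracket_weight s) (bracket_smoothing m) m"
  assume "?C \<noteq> \<infinity>"
  then obtain B where B: "?C = ennreal B" "B \<ge> 0" by (cases ?C) auto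
  define c where "c = (unit_ball_vol CARD('d))\<^sup>2 / (12 ^ CARD('d) * (2 * pi) ^ CARD('d) * 432)"
  have "unit_ball_vol (real CARD('d)) > 0" by simp
  then have c: "c > 0" unfolding c_def by (intro divide_pos_pos mult_pos_pos zero_less_power) auto
  define q where "q = 1 - max s 0 / 2"
  have q: "q > 0" using s by (simp add: q_def)
  \<comment> \<open>y plays the role of 1 / \<delta>^2: the second entry of the maximum forces c y^q
    \<ge> B + 1, the first one \<delta> \<le> 1/12.\<close>
  define y where "y = max 144 (((B + 1) / c) powr (1 / q))"
  have y: "y \<ge> 144" by (simp add: y_def)
  define \<delta> where "\<delta> = 1 / sqrt y"
  have sy: "sqrt y \<ge> 12" using y by (intro real_le_rsqrt) simp
  have \<delta>: "0 < \<delta>" unfolding \<delta>_def using y by simp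
  have \<delta>': "\<delta> \<le> 1 / 12" unfolding \<delta>_def using sy y by (intro divide_left_mono) auto
  have dy: "1 / \<delta>\<^sup>2 = y" using y by (simp add: \<delta>_def power_divide)
  have "(B + 1) / c = (((B + 1) / c) powr (1 / q)) powr q"
    using B c q by (simp add: powr_powr)
  also have "\<dots> \<le> y powr q" using q by (intro powr_mono2) (auto simp: y_def)
  finally have "B + 1 \<le> c * y powr q" using c by (simp add: field_simps)
  moreover have "ennreal (c * y powr q) \<le> ennreal B"
    using smoothing_const_low_frequency[OF \<delta> \<delta>', of s] unfolding dy B(1) c_def q_def .
  then have "c * y powr q \<le> B" using B(2) by (subst (asm) ennreal_le_iff) auto
  ultimately show False by simp
qed

end

section \<open>Wave packets\<close>

text \<open>The nested roots come from \<psi>^4 = (1 + r^2) / (r^2 + m^2) = 1 + (1 - m^2) / (m^2 +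
  r^2).\<close>

lemma bracket_smoothing_tendsto_1:
  assumes r: "filterlim r at_top F"
  shows "((\<lambda>n. bracket_smoothing m (r n)) \<longlongrightarrow> 1) F"
proof -
  have "filterlim (\<lambda>n. m\<^sup>2 + (r n)\<^sup>2) at_top F"
    by (intro filterlim_tendsto_add_at_top[OF tendsto_const] filterlim_pow_at_top r) simp
  then have "((\<lambda>n. (1 - m\<^sup>2) / (m\<^sup>2 + (r n)\<^sup>2)) \<longlongrightarrow> 0) F"
    by (intro tendsto_divide_0[OF tendsto_const] filterlim_at_top_imp_at_infinity)
  then have "((\<lambda>n. sqrt (sqrt (1 + (1 - m\<^sup>2) / (m\<^sup>2 + (r n)\<^sup>2)))) \<longlongrightarrow> sqrt (sqrt (1 + 0))) F"
    by (intro tendsto_intros)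
  moreover have "\<forall>\<^sub>F n in F. sqrt (sqrt (1 + (1 - m\<^sup>2) / (m\<^sup>2 + (r n)\<^sup>2))) = bracket_smoothing m (r n)"
  proof -
    have "\<forall>\<^sub>F n in F. r n > 0" using r by (simp add: filterlim_at_top_dense)
    then show ?thesis
    proof eventually_elim
      case (elim n)
      have p: "m\<^sup>2 + (r n)\<^sup>2 > 0" using elim by (simp add: add_nonneg_pos)
      have "1 + (1 - m\<^sup>2) / D = (1 + (D - m\<^sup>2)) / D" if "D > 0" for D :: real
        using that by (simp add: field_simps)
      from this[OF p] have "1 + (1 - m\<^sup>2) / (m\<^sup>2 + (r n)\<^sup>2) = (1 + (r n)\<^sup>2) / ((r n)\<^sup>2 + m\<^sup>2)"
        by (simp add: add.commute)
      then have "sqrt (1 + (1 - m\<^sup>2) / (m\<^sup>2 + (r n)\<^sup>2)) = (bracket_smoothing m (r n))\<^sup>2"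
        using elim by (simp add: bracket_smoothing_sq dirac_dispersion_eq_sqrt real_sqrt_divide)
      then show ?case by (simp add: bracket_smoothing_nonneg)
    qed
  qed
  ultimately show ?thesis by (simp add: tendsto_cong)
qed

text \<open>A crude bound, uniform in m, that supplies the dominating function for the
  packets.\<close>

lemma bracket_smoothing_le_2:
  assumes "r \<ge> 1"
  shows "bracket_smoothing m r \<le> 2"
proof -
  have r2: "r\<^sup>2 \<ge> 1" using assms by (simp add: one_le_power)
  have "sqrt (1 + r\<^sup>2) \<le> 4 * dirac_dispersion m r"
    unfolding dirac_dispersion_eq_sqrt using r2
    by (intro real_le_lsqrt) (auto simp: power_mult_distrib intro!: add_increasing2)
  then have "(bracket_smoothing m r)\<^sup>2 \<le> 2\<^sup>2"
    using assms dirac_dispersion_pos[of r m] by (simp add: bracket_smoothing_sq divide_le_eq)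
  then show ?thesis by (rule power2_le_imp_le) simp
qed

lemma nn_integral_inverse_1_plus_square:
  "(\<integral>\<^sup>+t. ennreal (inverse (1 + t\<^sup>2)) \<partial>lborel) = ennreal pi"
proof -
  have i: "integrable lborel (\<lambda>t::real. inverse (1 + t\<^sup>2))"
    using integrable_inverse_1_plus_square by (simp add: set_integrable_def)
  have "(\<integral>(t::real). inverse (1 + t\<^sup>2) \<partial>lborel) = pi"
    using LBINT_inverse_1_plus_square
    by (simp add: interval_lebesgue_integral_def set_lebesgue_integral_def)
  then show ?thesis using nn_integral_eq_integral[OF i] by simp
qed

text \<open>The centre \<open>N\<^sup>3\<close> is chosen so that on a ball of radius \<open>N\<close> the dispersion relation is linear up to
  \<open>O(N\<^sup>2 / N\<^sup>3)\<close>.\<close>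

lemma high_frequency_dispersion:
  fixes \<zeta> :: "real^'d"
  assumes N: "N \<ge> 2" and \<zeta>: "norm \<zeta> \<le> 1" and \<xi>: "\<xi> = N ^ 3 *\<^sub>R axis k 1 + N *\<^sub>R \<zeta>"
  shows "N \<le> norm \<xi>" "0 \<le> dirac_dispersion m (norm \<xi>) - \<xi> $ k" "1 \<le> dirac_dispersion m (norm \<xi>)"
    "dirac_dispersion m (norm \<xi>) - \<xi> $ k \<le> (2 + 2 * m\<^sup>2) / N"
proof -
  define \<phi> where "\<phi> = dirac_dispersion m (norm \<xi>)"
  define a where "a = \<xi> $ k"
  have \<zeta>k: "\<bar>\<zeta> $ k\<bar> \<le> 1" using component_le_norm_cart[of \<zeta> k] \<zeta> by linarith
  have a: "a = N ^ 3 + N * \<zeta> $ k" by (simp add: a_def \<xi>)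
  have "4 * N \<le> N ^ 3"
    using N mult_mono[of 2 N 2 N] by (simp add: power3_eq_cube mult_right_mono)
  moreover have "\<bar>N * \<zeta> $ k\<bar> \<le> N" using \<zeta>k N by (simp add: abs_mult mult_left_le)
  ultimately have aN: "a \<ge> N ^ 3 / 2" "a \<ge> N" unfolding a using N by linarith+
  have na: "a \<le> norm \<xi>" using component_le_norm_cart[of \<xi> k] by (simp add: a_def)
  show "N \<le> norm \<xi>" using na aN by linarith
  have n2: "(norm \<xi>)\<^sup>2 = (N ^ 3)\<^sup>2 + 2 * N ^ 3 * (N * \<zeta> $ k) + N\<^sup>2 * (norm \<zeta>)\<^sup>2"
    unfolding power2_norm_eq_inner \<xi>
    by (simp add: inner_add_left inner_add_right inner_axis' inner_axis power2_eq_square algebra_simps)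
  have \<phi>2: "\<phi>\<^sup>2 = (norm \<xi>)\<^sup>2 + m\<^sup>2" by (simp add: \<phi>_def dirac_dispersion_eq_sqrt)
  have \<phi>0: "\<phi> \<ge> 0" by (simp add: \<phi>_def)
  have "norm \<xi> \<le> \<phi>" by (rule power2_le_imp_le) (simp_all add: \<phi>2 \<phi>0)
  then have \<phi>a: "a \<le> \<phi>" using na by linarith
  then show "0 \<le> dirac_dispersion m (norm \<xi>) - \<xi> $ k" "1 \<le> dirac_dispersion m (norm \<xi>)"
    using aN N unfolding a_def[symmetric] \<phi>_def[symmetric] by linarith+
  \<comment> \<open>In \<phi>^2 - a^2 all terms containing the centre N^3 cancel; N^2 times the
    transversal part of |\<zeta>|^2 and m^2 remain, while \<phi> + a is at least N^3 / 2.\<close>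
  have "(\<phi> - a) * (N ^ 3 / 2) \<le> (\<phi> - a) * (\<phi> + a)" using \<phi>a aN N by (intro mult_left_mono) auto
  also have "\<dots> = N\<^sup>2 * (norm \<zeta>)\<^sup>2 - N\<^sup>2 * (\<zeta> $ k)\<^sup>2 + m\<^sup>2"
  proof -
    have "(\<phi> - a) * (\<phi> + a) = \<phi>\<^sup>2 - a\<^sup>2" by (simp add: algebra_simps power2_eq_square)
    then show ?thesis unfolding \<phi>2 n2 a by (simp add: power2_eq_square algebra_simps)
  qed
  also have "\<dots> \<le> N\<^sup>2 * 1 + N\<^sup>2 * m\<^sup>2"
  proof -
    have "(norm \<zeta>)\<^sup>2 \<le> 1" using \<zeta> by (simp add: power_le_one)
    then have "N\<^sup>2 * (norm \<zeta>)\<^sup>2 \<le> N\<^sup>2 * 1" by (intro mult_left_mono) auto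
    moreover have "1 * m\<^sup>2 \<le> N\<^sup>2 * m\<^sup>2" using N by (intro mult_right_mono) (auto simp: one_le_power)
    moreover have "0 \<le> N\<^sup>2 * (\<zeta> $ k)\<^sup>2" by simp
    ultimately show ?thesis by linarith
  qed
  finally have "(\<phi> - a) * N ^ 3 \<le> (2 + 2 * m\<^sup>2) * N\<^sup>2" by (simp add: algebra_simps)
  then have "((\<phi> - a) * N) * N\<^sup>2 \<le> (2 + 2 * m\<^sup>2) * N\<^sup>2" by (simp add: power3_eq_cube power2_eq_square mult.assoc)
  then have "(\<phi> - a) * N \<le> 2 + 2 * m\<^sup>2" using N by (simp only: mult_le_cancel_right) auto
  then show "dirac_dispersion m (norm \<xi>) - \<xi> $ k \<le> (2 + 2 * m\<^sup>2) / N"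
    unfolding a_def[symmetric] \<phi>_def[symmetric] using N by (simp add: pos_le_divide_eq)
qed

section \<open>Packets moving along a coordinate axis\<close>

context
  fixes \<alpha> :: "'d::finite \<Rightarrow> complex^'n^'n" and \<beta> :: "complex^'n^'n" and m :: real
  assumes dirac: "dirac_matrices \<alpha> \<beta>" and m: "m \<ge> 0"
begin

text \<open>On a +1 eigenvector of \<open>\<alpha> k\<close>, J acts nearly as i when \<xi> points
  nearly along axis k: |J v - i v|^2 = 2 (1 - a / \<phi>) |v|^2 with a the k-th component of \<xi>.
  The flow is then nearly the scalar exp (-i t \<phi>), and replacing \<phi> by a, which is
  translation at speed one, costs |t| \<epsilon>.\<close>

lemma wave_packet_phase_error:
  assumes v: "\<alpha> k *v v = v" and \<xi>: "\<xi> \<noteq> 0"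
    and \<epsilon>: "0 \<le> dirac_dispersion m (norm \<xi>) - \<xi> $ k" "dirac_dispersion m (norm \<xi>) - \<xi> $ k \<le> \<epsilon>" "1 \<le> dirac_dispersion m (norm \<xi>)"
  shows "norm (exp (\<i> * of_real (t * \<xi> $ k)) *s (cos (t * dirac_dispersion m (norm \<xi>)) *\<^sub>R v
      - sin (t * dirac_dispersion m (norm \<xi>)) *\<^sub>R dirac_J \<alpha> \<beta> m \<xi> v) - v)
    \<le> (\<bar>t\<bar> * \<epsilon> + sqrt (2 * \<epsilon>)) * norm v"
proof -
  interpret S: bounded_bilinear "(*s) :: complex \<Rightarrow> complex^'n \<Rightarrow> complex^'n"
    by (rule bounded_bilinear_vector_smult)
  define \<phi> where "\<phi> = dirac_dispersion m (norm \<xi>)"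
  define a where "a = \<xi> $ k"
  define J where "J = dirac_J \<alpha> \<beta> m \<xi> v"
  note \<epsilon>' = \<epsilon>[folded \<phi>_def a_def]
  have nJ: "norm J = norm v" unfolding J_def by (rule norm_dirac_J[OF dirac \<xi>])
  have Jv: "(norm (J - \<i> *s v))\<^sup>2 \<le> 2 * \<epsilon> * (norm v)\<^sup>2"
  proof -
    have "J \<bullet> (\<i> *s v) = a / \<phi> * (norm v)\<^sup>2"
    proof -
      have "J \<bullet> (\<i> *s v) = (cnj \<i> *s J) \<bullet> v" by (metis inner_vector_smult inner_commute)
      then show ?thesis unfolding J_def a_def \<phi>_def by (simp only: dirac_J_inner_alpha[OF dirac m v]) simp
    qed
    moreover have "(norm (J - \<i> *s v))\<^sup>2 = (norm J)\<^sup>2 - 2 * (J \<bullet> (\<i> *s v)) + (norm (\<i> *s v))\<^sup>2"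
      unfolding power2_norm_eq_inner by (simp add: inner_diff_left inner_diff_right inner_commute)
    ultimately have eq: "(norm (J - \<i> *s v))\<^sup>2 = 2 * (1 - a / \<phi>) * (norm v)\<^sup>2"
      by (simp add: nJ norm_vector_smult algebra_simps)
    have "1 - a / \<phi> = (\<phi> - a) / \<phi>" using \<epsilon>' by (simp add: field_simps)
    moreover have "(\<phi> - a) / \<phi> \<le> \<epsilon> / 1" using \<epsilon>' by (intro frac_le) auto
    ultimately have le: "1 - a / \<phi> \<le> \<epsilon>" by simp
    show ?thesis unfolding eq using le by (intro mult_right_mono mult_left_mono) auto
  qed
  have "norm (J - \<i> *s v) \<le> sqrt (2 * \<epsilon>) * norm v"
    using real_sqrt_le_mono[OF Jv] by (simp add: real_sqrt_mult)
  moreover have "exp (\<i> * of_real (t * a)) *s (cos (t * \<phi>) *\<^sub>R v - sin (t * \<phi>) *\<^sub>R J) - v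
      = (exp (\<i> * of_real (t * (a - \<phi>))) - 1) *s v - sin (t * \<phi>) *\<^sub>R (exp (\<i> * of_real (t * a)) *s (J - \<i> *s v))"
  proof -
    have e: "exp (\<i> * of_real (t * (a - \<phi>))) = exp (\<i> * of_real (t * a)) * (of_real (cos (t * \<phi>)) - \<i> * of_real (sin (t * \<phi>)))"
    proof -
      have "exp (\<i> * of_real (t * (a - \<phi>))) = exp (\<i> * of_real (t * a)) * exp (\<i> * of_real (- (t * \<phi>)))"
        by (simp add: exp_add[symmetric] algebra_simps)
      also have "exp (\<i> * of_real (- (t * \<phi>))) = of_real (cos (t * \<phi>)) - \<i> * of_real (sin (t * \<phi>))"
        by (simp add: complex_eq_iff Re_exp Im_exp)
      finally show ?thesis .
    qed
    show ?thesis unfolding e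
      by (simp add: vec_eq_iff) (simp add: scaleR_conv_of_real[where 'a=complex] algebra_simps)
  qed
  moreover have "norm ((exp (\<i> * of_real (t * (a - \<phi>))) - 1) *s v) \<le> \<bar>t\<bar> * \<epsilon> * norm v"
  proof -
    have "cmod (exp (\<i> * of_real (t * (a - \<phi>))) - 1) \<le> \<bar>t * (a - \<phi>)\<bar>"
      using iexp_approx1[of "t * (a - \<phi>)" 0] by simp
    also have "\<dots> \<le> \<bar>t\<bar> * \<epsilon>" unfolding abs_mult using \<epsilon>' by (intro mult_left_mono) auto
    finally show ?thesis unfolding norm_vector_smult by (intro mult_right_mono) auto
  qed
  moreover have "norm (sin (t * \<phi>) *\<^sub>R (exp (\<i> * of_real (t * a)) *s (J - \<i> *s v))) \<le> 1 * norm (J - \<i> *s v)"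
    unfolding norm_scaleR norm_vector_smult by (intro mult_mono) (auto simp: abs_sin_le_one)
  ultimately show ?thesis
    unfolding a_def[symmetric] \<phi>_def[symmetric] J_def[symmetric]
    by (simp only: distrib_right) (rule norm_triangle_le_diff, linarith)
qed

text \<open>For fixed t the phase error |t| \<epsilon> + sqrt (2 \<epsilon>) tends to 0 and \<psi>
  tends to 1, so in rescaled variables moving with the packet the profile converges to a function
  independent of t. The shift n + 2 ensures that the scale is at least 2.\<close>

lemma wave_packet_tendsto:
  fixes v :: "complex^'n" and t :: real and z :: "real^'d" and k :: 'd
  assumes v: "\<alpha> k *v v = v"
  defines "\<xi> \<equiv> \<lambda>n (\<zeta>::real^'d). real (n + 2) ^ 3 *\<^sub>R axis k 1 + real (n + 2) *\<^sub>R \<zeta>"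
  shows "(\<lambda>n. inverse_fourier (\<lambda>\<zeta>. indicator (cball 0 1) \<zeta> *\<^sub>R (bracket_smoothing m (norm (\<xi> n \<zeta>)) *\<^sub>R
        (exp (\<i> * of_real (t * \<xi> n \<zeta> $ k)) *s (cos (t * dirac_dispersion m (norm (\<xi> n \<zeta>))) *\<^sub>R v
      - sin (t * dirac_dispersion m (norm (\<xi> n \<zeta>))) *\<^sub>R dirac_J \<alpha> \<beta> m (\<xi> n \<zeta>) v)))) z)
    \<longlonglongrightarrow> inverse_fourier (\<lambda>\<zeta>. indicator (cball 0 1) \<zeta> *\<^sub>R v) z"
proof -
  interpret S: bounded_bilinear "(*s) :: complex \<Rightarrow> complex^'n \<Rightarrow> complex^'n"
    by (rule bounded_bilinear_vector_smult)
  define y where "y n \<zeta> = exp (\<i> * of_real (t * \<xi> n \<zeta> $ k)) *s (cos (t * dirac_dispersion m (norm (\<xi> n \<zeta>))) *\<^sub>R v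
      - sin (t * dirac_dispersion m (norm (\<xi> n \<zeta>))) *\<^sub>R dirac_J \<alpha> \<beta> m (\<xi> n \<zeta>) v)" for n \<zeta>
  define F where "F n \<zeta> = indicator (cball 0 1) \<zeta> *\<^sub>R (bracket_smoothing m (norm (\<xi> n \<zeta>)) *\<^sub>R y n \<zeta>)" for n \<zeta>
  define \<epsilon> where "\<epsilon> n = (2 + 2 * m\<^sup>2) / real (n + 2)" for n
  have \<epsilon>0: "\<epsilon> \<longlonglongrightarrow> 0"
    unfolding \<epsilon>_def[abs_def] by (rule LIMSEQ_ignore_initial_segment[OF lim_const_over_n])
  have [measurable]: "(\<lambda>\<zeta>. \<xi> n \<zeta>) \<in> borel_measurable borel" for n unfolding \<xi>_def by measurable
  have [measurable]: "F n \<in> borel_measurable borel" for n unfolding F_def[abs_def] y_def by measurable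
  have hf: "real (n + 2) \<le> norm (\<xi> n \<zeta>)" "0 \<le> dirac_dispersion m (norm (\<xi> n \<zeta>)) - \<xi> n \<zeta> $ k"
      "1 \<le> dirac_dispersion m (norm (\<xi> n \<zeta>))" "dirac_dispersion m (norm (\<xi> n \<zeta>)) - \<xi> n \<zeta> $ k \<le> \<epsilon> n"
    if "norm \<zeta> \<le> 1" for n \<zeta>
    unfolding \<epsilon>_def by (rule high_frequency_dispersion[OF _ that]; simp add: \<xi>_def)+
  have yv: "norm (y n \<zeta> - v) \<le> (\<bar>t\<bar> * \<epsilon> n + sqrt (2 * \<epsilon> n)) * norm v" if "norm \<zeta> \<le> 1" for n \<zeta>
  proof -
    have "\<xi> n \<zeta> \<noteq> 0" using hf(1)[OF that, of n] by auto
    then show ?thesis unfolding y_def using hf[OF that, of n] by (intro wave_packet_phase_error v)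
  qed
  have yn: "norm (y n \<zeta>) \<le> 2 * norm v" if "norm \<zeta> \<le> 1" for n \<zeta>
  proof -
    have "\<xi> n \<zeta> \<noteq> 0" using hf(1)[OF that, of n] by auto
    then have "norm (y n \<zeta>) \<le> norm v + norm v"
      unfolding y_def norm_vector_smult norm_exp_i_times mult_1
      by (intro norm_triangle_le_diff add_mono)
        (simp_all add: norm_dirac_J[OF dirac] mult_left_le_one_le abs_cos_le_one abs_sin_le_one)
    then show ?thesis by simp
  qed
  have "(\<lambda>n. \<integral>\<zeta>. exp (\<i> * of_real (z \<bullet> \<zeta>)) *s F n \<zeta> \<partial>lborel)
      \<longlonglongrightarrow> (\<integral>\<zeta>. exp (\<i> * of_real (z \<bullet> \<zeta>)) *s (indicator (cball 0 1) \<zeta> *\<^sub>R v) \<partial>lborel)"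
  proof (rule integral_dominated_convergence[where w = "\<lambda>\<zeta>. indicator (cball 0 1) \<zeta> *\<^sub>R (4 * norm v)"])
    show "integrable lborel (\<lambda>\<zeta>::real^'d. indicator (cball 0 1) \<zeta> *\<^sub>R (4 * norm v))"
      by (intro integrable_scaleR_left integrable_real_indicator) (auto simp: emeasure_cball)
    show "AE \<zeta> in lborel. (\<lambda>n. exp (\<i> * of_real (z \<bullet> \<zeta>)) *s F n \<zeta>) \<longlonglongrightarrow> exp (\<i> * of_real (z \<bullet> \<zeta>)) *s (indicator (cball 0 1) \<zeta> *\<^sub>R v)"
    proof (intro AE_I2 S.tendsto tendsto_const)
      fix \<zeta> :: "real^'d"
      show "(\<lambda>n. F n \<zeta>) \<longlonglongrightarrow> indicator (cball 0 1) \<zeta> *\<^sub>R v"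
      proof (cases "norm \<zeta> \<le> 1")
        case True
        have "(\<lambda>n. (\<bar>t\<bar> * \<epsilon> n + sqrt (2 * \<epsilon> n)) * norm v) \<longlonglongrightarrow> (\<bar>t\<bar> * 0 + sqrt (2 * 0)) * norm v"
          by (intro tendsto_intros \<epsilon>0)
        then have "(\<lambda>n. (\<bar>t\<bar> * \<epsilon> n + sqrt (2 * \<epsilon> n)) * norm v) \<longlonglongrightarrow> 0" by simp
        then have "(\<lambda>n. y n \<zeta> - v) \<longlonglongrightarrow> 0"
          by (rule Lim_null_comparison[rotated]) (simp add: yv True)
        then have y: "(\<lambda>n. y n \<zeta>) \<longlonglongrightarrow> v" by (simp add: LIM_zero_iff)
        have "filterlim (\<lambda>n. real (n + 2)) at_top sequentially"
          by (rule filterlim_compose[OF filterlim_real_sequentially filterlim_add_const_nat_at_top])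
        then have "filterlim (\<lambda>n. norm (\<xi> n \<zeta>)) at_top sequentially"
          by (rule filterlim_at_top_mono) (intro always_eventually allI hf(1) True)
        then have "(\<lambda>n. F n \<zeta>) \<longlonglongrightarrow> indicator (cball 0 1) \<zeta> *\<^sub>R (1 *\<^sub>R v)"
          unfolding F_def by (intro tendsto_intros bracket_smoothing_tendsto_1 y)
        then show ?thesis by simp
      qed (simp add: F_def)
    qed
    show "AE \<zeta> in lborel. norm (exp (\<i> * of_real (z \<bullet> \<zeta>)) *s F n \<zeta>) \<le> indicator (cball 0 1) \<zeta> *\<^sub>R (4 * norm v)" for n
    proof (intro AE_I2)
      fix \<zeta> :: "real^'d"
      show "norm (exp (\<i> * of_real (z \<bullet> \<zeta>)) *s F n \<zeta>) \<le> indicator (cball 0 1) \<zeta> *\<^sub>R (4 * norm v)"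
      proof (cases "norm \<zeta> \<le> 1")
        case True
        have "bracket_smoothing m (norm (\<xi> n \<zeta>)) * norm (y n \<zeta>) \<le> 2 * (2 * norm v)"
          using hf(1)[OF True, of n] by (intro mult_mono bracket_smoothing_le_2 yn True) auto
        then show ?thesis using True
          unfolding norm_vector_smult norm_exp_i_times F_def norm_scaleR by (simp add: bracket_smoothing_nonneg)
      qed (simp add: F_def)
    qed
  qed measurable
  then show ?thesis unfolding inverse_fourier_def F_def y_def by (intro tendsto_intros)
qed

text \<open>For \<xi> = N^3 e + N \<zeta> and x = t e + z / N the phase x \<bullet> \<xi> equals z
  \<bullet> \<zeta> plus t times the k-th component of \<xi>, plus a quantity independent of \<zeta>
  that disappears in the norm. The Jacobian N^d and the normalisation N^(-d/2) leave N^d after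
  squaring: the packet is concentrated at scale 1 / N.\<close>

lemma wave_packet_rescaled:
  fixes v :: "complex^'n" and t N :: real and z :: "real^'d" and k :: 'd
  assumes N: "N \<ge> 2"
  defines "g \<equiv> \<lambda>\<xi>::real^'d. indicator (cball (N ^ 3 *\<^sub>R axis k 1) N) \<xi> *\<^sub>R ((1 / sqrt (N ^ CARD('d))) *\<^sub>R v)"
    and "\<xi> \<equiv> \<lambda>(\<zeta>::real^'d). N ^ 3 *\<^sub>R axis k 1 + N *\<^sub>R \<zeta>"
  shows "(norm (inverse_fourier (flow_density \<alpha> \<beta> m g t) (t *\<^sub>R axis k 1 + (1 / N) *\<^sub>R z)))\<^sup>2 = N ^ CARD('d) *
    (norm (inverse_fourier (\<lambda>\<zeta>. indicator (cball 0 1) \<zeta> *\<^sub>R (bracket_smoothing m (norm (\<xi> \<zeta>)) *\<^sub>R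
        (exp (\<i> * of_real (t * \<xi> \<zeta> $ k)) *s (cos (t * dirac_dispersion m (norm (\<xi> \<zeta>))) *\<^sub>R v
      - sin (t * dirac_dispersion m (norm (\<xi> \<zeta>))) *\<^sub>R dirac_J \<alpha> \<beta> m (\<xi> \<zeta>) v)))) z))\<^sup>2"
proof -
  interpret S: bounded_bilinear "(*s) :: complex \<Rightarrow> complex^'n \<Rightarrow> complex^'n"
    by (rule bounded_bilinear_vector_smult)
  interpret J: bounded_linear "dirac_J \<alpha> \<beta> m \<eta>" for \<eta> by (rule bounded_linear_dirac_J)
  define e :: "real^'d" where "e = axis k 1"
  define c where "c = 1 / sqrt (N ^ CARD('d))"
  define x where "x = t *\<^sub>R e + (1 / N) *\<^sub>R z"
  define Y where "Y \<eta> = bracket_smoothing m (norm \<eta>) *\<^sub>R (cos (t * dirac_dispersion m (norm \<eta>)) *\<^sub>R v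
      - sin (t * dirac_dispersion m (norm \<eta>)) *\<^sub>R dirac_J \<alpha> \<beta> m \<eta> v)" for \<eta>
  define b where "b = exp (\<i> * of_real (N\<^sup>2 * (z \<bullet> e)))"
  have [measurable]: "g \<in> borel_measurable borel" unfolding g_def by measurable
  have ge: "g = (\<lambda>\<xi>. indicator (cball (N ^ 3 *\<^sub>R e) N) \<xi> *\<^sub>R (c *\<^sub>R v))" by (simp add: g_def e_def c_def)
  have fd: "flow_density \<alpha> \<beta> m g t \<eta> = indicator (cball (N ^ 3 *\<^sub>R e) N) \<eta> *\<^sub>R (c *\<^sub>R Y \<eta>)" for \<eta>
    unfolding flow_density_def ge Y_def J.scaleR by (simp add: algebra_simps)
  have ind: "indicator (cball (N ^ 3 *\<^sub>R e) N) (\<xi> \<zeta>) = (indicator (cball 0 1) \<zeta> :: real)" for \<zeta>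
  proof -
    have "dist (N ^ 3 *\<^sub>R e) (\<xi> \<zeta>) = N * norm \<zeta>" using N by (simp add: \<xi>_def e_def dist_norm)
    then show ?thesis using N by (simp add: indicator_def)
  qed
  have ph: "exp (\<i> * of_real (x \<bullet> \<xi> \<zeta>)) = b * (exp (\<i> * of_real (z \<bullet> \<zeta>)) * exp (\<i> * of_real (t * \<xi> \<zeta> $ k)))" for \<zeta>
  proof -
    have "e \<bullet> \<xi> \<zeta> = \<xi> \<zeta> $ k" by (simp add: e_def inner_axis')
    moreover have "(1 / N) * (z \<bullet> \<xi> \<zeta>) = N\<^sup>2 * (z \<bullet> e) + z \<bullet> \<zeta>"
      using N by (simp add: \<xi>_def e_def inner_add_right field_simps power3_eq_cube power2_eq_square)
    ultimately have "x \<bullet> \<xi> \<zeta> = N\<^sup>2 * (z \<bullet> e) + z \<bullet> \<zeta> + t * \<xi> \<zeta> $ k"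
      by (simp only: x_def inner_add_left inner_scaleR_left)
    then show ?thesis by (simp add: b_def exp_add[symmetric] algebra_simps)
  qed
  define F where "F \<zeta> = indicator (cball 0 1) \<zeta> *\<^sub>R (exp (\<i> * of_real (t * \<xi> \<zeta> $ k)) *s Y (\<xi> \<zeta>))" for \<zeta> :: "real^'d"
  have "(\<integral>\<eta>. exp (\<i> * of_real (x \<bullet> \<eta>)) *s flow_density \<alpha> \<beta> m g t \<eta> \<partial>lborel)
      = \<bar>N\<bar> ^ DIM(real^'d) *\<^sub>R (\<integral>\<zeta>. exp (\<i> * of_real (x \<bullet> \<xi> \<zeta>)) *s flow_density \<alpha> \<beta> m g t (\<xi> \<zeta>) \<partial>lborel)"
    unfolding \<xi>_def using N by (intro lborel_affine_integral; simp)
  also have "(\<integral>\<zeta>. exp (\<i> * of_real (x \<bullet> \<xi> \<zeta>)) *s flow_density \<alpha> \<beta> m g t (\<xi> \<zeta>) \<partial>lborel)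
      = (\<integral>\<zeta>. b *s (c *\<^sub>R (exp (\<i> * of_real (z \<bullet> \<zeta>)) *s F \<zeta>)) \<partial>lborel)"
  proof (intro Bochner_Integration.integral_cong refl)
    fix \<zeta> :: "real^'d"
    show "exp (\<i> * of_real (x \<bullet> \<xi> \<zeta>)) *s flow_density \<alpha> \<beta> m g t (\<xi> \<zeta>) = b *s (c *\<^sub>R (exp (\<i> * of_real (z \<bullet> \<zeta>)) *s F \<zeta>))"
      unfolding ph fd ind F_def vector_smult_assoc[symmetric] S.scaleR_right by (rule scaleR_left_commute)
  qed
  also have "\<dots> = b *s (c *\<^sub>R (\<integral>\<zeta>. exp (\<i> * of_real (z \<bullet> \<zeta>)) *s F \<zeta> \<partial>lborel))"
  proof -
    have "b \<noteq> 0" "c \<noteq> 0" using N by (auto simp: b_def c_def)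
    define B where "B = (\<lambda>u::complex^'n. b *s (c *\<^sub>R u))"
    \<comment> \<open>A bounded left inverse lets B commute with the integral irrespective of
      integrability.\<close>
    define B' where "B' = (\<lambda>u::complex^'n. inverse b *s (inverse c *\<^sub>R u))"
    have "bounded_linear B" "bounded_linear B'" unfolding B_def B'_def
      by (intro bounded_linear_compose[OF S.bounded_linear_right] bounded_linear_scaleR_right)+
    moreover have "B' (B u) = u" for u
      unfolding B_def B'_def S.scaleR_right vector_smult_assoc scaleR_scaleR using \<open>b \<noteq> 0\<close> \<open>c \<noteq> 0\<close> by simp
    ultimately show ?thesis unfolding B_def[symmetric]
      using integral_bounded_linear'[of B B' lborel "\<lambda>\<zeta>. exp (\<i> * of_real (z \<bullet> \<zeta>)) *s F \<zeta>"] by (simp add: B_def)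
  qed
  finally have "inverse_fourier (flow_density \<alpha> \<beta> m g t) x = (N ^ CARD('d) * c) *\<^sub>R (b *s inverse_fourier F z)"
    unfolding inverse_fourier_def using N by (simp add: S.scaleR_right mult_ac)
  then have "norm (inverse_fourier (flow_density \<alpha> \<beta> m g t) x) = N ^ CARD('d) * c * norm (inverse_fourier F z)"
    using N by (simp add: norm_vector_smult b_def c_def)
  moreover have "(N ^ CARD('d) * c)\<^sup>2 = N ^ CARD('d)"
    using N by (simp add: c_def power_mult_distrib power_divide power2_eq_square)
  ultimately have "(norm (inverse_fourier (flow_density \<alpha> \<beta> m g t) x))\<^sup>2 = N ^ CARD('d) * (norm (inverse_fourier F z))\<^sup>2"
    by (simp only: power_mult_distrib)
  then show ?thesis unfolding F_def[abs_def] Y_def x_def e_def S.scaleR_right .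
qed

text \<open>Fatou's lemma in coordinates that travel with the packet: at time t the packet sits at t
  e, so the weight tends to 1 / (1 + t^2), while the limiting profile H has norm 1.\<close>

theorem smoothing_const_lower_bound:
  "ennreal pi \<le> smoothing_const \<alpha> \<beta> (\<lambda>r. inverse (1 + r\<^sup>2)) (bracket_smoothing m) m"
proof -
  interpret V: bounded_bilinear "(*v) :: complex^'n^'n \<Rightarrow> complex^'n \<Rightarrow> complex^'n"
    by (rule bounded_bilinear_matrix_vector_mult)
  obtain k :: 'd where True by blast
  obtain v0 where v0: "v0 \<noteq> 0" "\<alpha> k *v v0 = v0"
    using anticommuting_involutions_eigenvector[OF dirac_alpha_sq[OF dirac] dirac_beta_sq[OF dirac] dirac_anticomm[OF dirac]] by blast
  define e :: "real^'d" where "e = axis k 1"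
  have e: "norm e = 1" by (simp add: e_def)
  define V where "V = unit_ball_vol (real CARD('d))"
  have V: "V > 0" by (simp add: V_def)
  define v where "v = (sqrt ((2 * pi) ^ CARD('d) / V) / norm v0) *\<^sub>R v0"
  have vn: "(norm v)\<^sup>2 = (2 * pi) ^ CARD('d) / V"
    using v0 V by (simp add: v_def power_mult_distrib power_divide)
  have v: "\<alpha> k *v v = v" using v0 by (simp add: v_def V.scaleR_right)
  define w :: "real \<Rightarrow> real" where "w = (\<lambda>r. inverse (1 + r\<^sup>2))"
  have w[measurable]: "w \<in> borel_measurable borel" and w0: "w r \<ge> 0" for r by (auto simp: w_def)
  define N where "N n = real (n + 2)" for n
  have N: "N n \<ge> 2" for n by (simp add: N_def)
  define g where "g n = (\<lambda>\<xi>::real^'d. indicator (cball (N n ^ 3 *\<^sub>R e) (N n)) \<xi> *\<^sub>R ((1 / sqrt (N n ^ CARD('d))) *\<^sub>R v))" for n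
  have gm: "g n \<in> borel_measurable borel" for n unfolding g_def by measurable
  define H where "H = inverse_fourier (\<lambda>\<zeta>::real^'d. indicator (cball 0 1) \<zeta> *\<^sub>R v)"
  have Hm[measurable]: "H \<in> borel_measurable borel" unfolding H_def by measurable
  have H1: "sqn H = 1"
  proof -
    have s: "sqn (\<lambda>\<zeta>::real^'d. indicator (cball 0 1) \<zeta> *\<^sub>R v) = ennreal ((2 * pi) ^ CARD('d))"
      using V vn by (subst sqn_indicator_vec) (auto simp: emeasure_cball V_def[symmetric] simp flip: ennreal_mult)
    have "integrable lborel (\<lambda>\<zeta>::real^'d. indicator (cball 0 1) \<zeta> *\<^sub>R v)"
      by (intro integrable_scaleR_left integrable_real_indicator) (auto simp: emeasure_cball)
    from sqn_inverse_fourier[OF this] show ?thesis unfolding H_def s by (simp flip: ennreal_mult)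
  qed
  have upper: "sqn (weighted_flow \<alpha> \<beta> w m (g n)) \<le> smoothing_const \<alpha> \<beta> w (bracket_smoothing m) m" for n
  proof (rule smoothing_const_ge[OF dirac gm])
    have "sqn (g n) = ennreal ((norm ((1 / sqrt (N n ^ CARD('d))) *\<^sub>R v))\<^sup>2) * ennreal (V * N n ^ CARD('d))"
      unfolding g_def using N[of n] by (subst sqn_indicator_vec) (auto simp: emeasure_cball V_def)
    also have "\<dots> = ennreal ((2 * pi) ^ CARD('d))"
      using N[of n] V by (simp add: power_mult_distrib power_divide vn flip: ennreal_mult)
    finally show "sqn (g n) = ennreal ((2 * pi) ^ CARD('d))" .
    have "N n < N n ^ 3" using N[of n] power_strict_increasing[of 1 3 "N n"] by simp
    then show "0 \<notin> cball (N n ^ 3 *\<^sub>R e) (N n)" using N[of n] e by (simp add: dist_norm)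
  qed (use w w0 in \<open>auto simp: g_def\<close>)
  \<comment> \<open>The density in the moving coordinates; the division by N^d is the Jacobian of z
    -> t e + z / N.\<close>
  define q where "q n p = ennreal ((norm (weighted_flow \<alpha> \<beta> w m (g n) (fst p, fst p *\<^sub>R e + (1 / N n) *\<^sub>R snd p)))\<^sup>2 / N n ^ CARD('d))"
    for n and p :: "real \<times> (real^'d)"
  have qm: "q n \<in> borel_measurable borel" for n
  proof -
    have "(\<lambda>p::real \<times> (real^'d). (fst p, fst p *\<^sub>R e + (1 / N n) *\<^sub>R snd p)) \<in> borel_measurable borel"
      by (intro borel_measurable_continuous_onI continuous_intros)
    from measurable_compose[OF this weighted_flow_measurable[OF gm w]] show ?thesis
      unfolding q_def[abs_def] by measurable
  qed
  have qint: "(\<integral>\<^sup>+p. q n p \<partial>lborel) = sqn (weighted_flow \<alpha> \<beta> w m (g n))" for n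
  proof -
    define f where "f p = ennreal ((norm (weighted_flow \<alpha> \<beta> w m (g n) p))\<^sup>2)" for p
    have fm: "f \<in> borel_measurable borel"
      unfolding f_def[abs_def] using weighted_flow_measurable[OF gm w, of \<alpha> \<beta> m n] by measurable
    have ft: "(\<lambda>x. f (t, x)) \<in> borel_measurable borel" for t
      by (rule measurable_compose[OF _ fm]) (intro borel_measurable_continuous_onI continuous_intros)
    have qf: "q n (t, z) = ennreal ((1 / N n) ^ CARD('d)) * f (t, t *\<^sub>R e + (1 / N n) *\<^sub>R z)" for t z
      using N[of n] by (simp add: q_def f_def power_divide flip: ennreal_mult)
    have "(\<integral>\<^sup>+p. q n p \<partial>lborel) = (\<integral>\<^sup>+t. \<integral>\<^sup>+z. q n (t, z) \<partial>lborel \<partial>lborel)"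
      using qm[of n] unfolding lborel_prod[symmetric]
      by (intro lborel.nn_integral_fst[symmetric]) (simp only: lborel_prod measurable_lborel2)
    also have "\<dots> = (\<integral>\<^sup>+t. \<integral>\<^sup>+x. f (t, x) \<partial>lborel \<partial>lborel)"
    proof (rule nn_integral_cong)
      fix t :: real
      have "(\<integral>\<^sup>+x. f (t, x) \<partial>lborel) = ennreal (\<bar>1 / N n\<bar> ^ DIM(real^'d)) * (\<integral>\<^sup>+z. f (t, t *\<^sub>R e + (1 / N n) *\<^sub>R z) \<partial>lborel)"
        using N[of n] by (intro lborel_affine_nn_integral ft) simp
      also have "\<dots> = (\<integral>\<^sup>+z. q n (t, z) \<partial>lborel)"
      proof -
        have "(\<lambda>z. f (t, t *\<^sub>R e + (1 / N n) *\<^sub>R z)) \<in> borel_measurable lborel"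
          by (rule measurable_compose[OF _ ft]) simp
        then show ?thesis unfolding qf using N[of n] by (simp add: nn_integral_cmult)
      qed
      finally show "(\<integral>\<^sup>+z. q n (t, z) \<partial>lborel) = (\<integral>\<^sup>+x. f (t, x) \<partial>lborel)" ..
    qed
    also have "\<dots> = (\<integral>\<^sup>+p. f p \<partial>lborel)"
      using fm unfolding lborel_prod[symmetric]
      by (intro lborel.nn_integral_fst) (simp only: lborel_prod measurable_lborel2)
    finally show ?thesis by (simp add: sqn_def f_def)
  qed
  have lim: "(\<lambda>n. q n (t, z)) \<longlonglongrightarrow> ennreal (inverse (1 + t\<^sup>2)) * ennreal ((norm (H z))\<^sup>2)" for t z
  proof -
    define G where "G n = inverse_fourier (\<lambda>\<zeta>::real^'d. indicator (cball 0 1) \<zeta> *\<^sub>R (bracket_smoothing m (norm (N n ^ 3 *\<^sub>R axis k 1 + N n *\<^sub>R \<zeta>)) *\<^sub>R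
        (exp (\<i> * of_real (t * (N n ^ 3 *\<^sub>R axis k 1 + N n *\<^sub>R \<zeta>) $ k)) *s (cos (t * dirac_dispersion m (norm (N n ^ 3 *\<^sub>R axis k 1 + N n *\<^sub>R \<zeta>))) *\<^sub>R v
      - sin (t * dirac_dispersion m (norm (N n ^ 3 *\<^sub>R axis k 1 + N n *\<^sub>R \<zeta>))) *\<^sub>R dirac_J \<alpha> \<beta> m (N n ^ 3 *\<^sub>R axis k 1 + N n *\<^sub>R \<zeta>) v)))) z" for n
    have G: "G \<longlonglongrightarrow> H z"
      unfolding G_def[abs_def] H_def N_def by (rule wave_packet_tendsto[where k = k, OF v])
    have qG: "q n (t, z) = ennreal (w (norm (t *\<^sub>R e + (1 / N n) *\<^sub>R z)) * (norm (G n))\<^sup>2)" for n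
    proof -
      have "(norm (inverse_fourier (flow_density \<alpha> \<beta> m (g n) t) (t *\<^sub>R e + (1 / N n) *\<^sub>R z)))\<^sup>2 = N n ^ CARD('d) * (norm (G n))\<^sup>2"
        unfolding G_def g_def e_def by (rule wave_packet_rescaled[OF N])
      then show ?thesis using N[of n]
        by (simp add: q_def weighted_flow_def power_mult_distrib w0)
    qed
    have nz: "1 + r\<^sup>2 \<noteq> 0" for r :: real using zero_le_power2[of r] by linarith
    have "(\<lambda>n. 1 / N n) \<longlonglongrightarrow> 0"
      unfolding N_def by (rule LIMSEQ_ignore_initial_segment[OF lim_const_over_n])
    then have "(\<lambda>n. inverse (1 + (norm (t *\<^sub>R e + (1 / N n) *\<^sub>R z))\<^sup>2) * (norm (G n))\<^sup>2)
        \<longlonglongrightarrow> inverse (1 + (norm (t *\<^sub>R e + 0 *\<^sub>R z))\<^sup>2) * (norm (H z))\<^sup>2"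
      by (intro tendsto_intros G nz)
    then have "(\<lambda>n. w (norm (t *\<^sub>R e + (1 / N n) *\<^sub>R z)) * (norm (G n))\<^sup>2) \<longlonglongrightarrow> inverse (1 + t\<^sup>2) * (norm (H z))\<^sup>2"
      by (simp add: w_def e)
    from tendsto_ennrealI[OF this] show ?thesis unfolding qG by (simp add: ennreal_mult)
  qed
  have "ennreal pi = (\<integral>\<^sup>+t. ennreal (inverse (1 + t\<^sup>2)) * sqn H \<partial>lborel)"
    by (simp add: H1 nn_integral_inverse_1_plus_square)
  also have "\<dots> = (\<integral>\<^sup>+t. \<integral>\<^sup>+z. ennreal (inverse (1 + t\<^sup>2)) * ennreal ((norm (H z))\<^sup>2) \<partial>lborel \<partial>lborel)"
    unfolding sqn_def by (intro nn_integral_cong nn_integral_cmult[symmetric]) measurable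
  also have "\<dots> = (\<integral>\<^sup>+t. \<integral>\<^sup>+z. liminf (\<lambda>n. q n (t, z)) \<partial>lborel \<partial>lborel)"
    using lim by (intro nn_integral_cong lim_imp_Liminf[symmetric]) auto
  also have "\<dots> = (\<integral>\<^sup>+p. liminf (\<lambda>n. q n p) \<partial>lborel)"
  proof -
    have "(\<lambda>p. liminf (\<lambda>n. q n p)) \<in> borel_measurable borel" using qm by measurable
    then show ?thesis unfolding lborel_prod[symmetric]
      by (intro lborel.nn_integral_fst) (simp only: lborel_prod measurable_lborel2)
  qed
  also have "\<dots> \<le> liminf (\<lambda>n. \<integral>\<^sup>+p. q n p \<partial>lborel)"
    by (rule nn_integral_liminf) (simp add: qm)
  also have "\<dots> \<le> liminf (\<lambda>n::nat. smoothing_const \<alpha> \<beta> w (bracket_smoothing m) m)"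
    unfolding qint by (intro Liminf_mono always_eventually allI upper)
  also have "\<dots> = smoothing_const \<alpha> \<beta> w (bracket_smoothing m) m"
    by (rule Liminf_const) simp
  finally show ?thesis unfolding w_def .
qed

end

theorem corollary1p8:
  fixes \<alpha> :: "'d::finite \<Rightarrow> complex^'n^'n" and \<beta> :: "complex^'n^'n" and m :: real
  assumes "CARD('d) \<ge> 3"
    and "CARD('n) = 2 ^ ((CARD('d) + 1) div 2)"
    and "dirac_matrices \<alpha> \<beta>"
    and "m \<ge> 0"
  shows "(\<forall>s\<ge>2. smoothing_estimate \<alpha> \<beta> (bracket_weight s) (bracket_smoothing m) m \<and>
            smoothing_const \<alpha> \<beta> (bracket_weight s) (bracket_smoothing m) m < \<infinity>) \<and>
         (\<forall>s<2. \<not> smoothing_estimate \<alpha> \<beta> (bracket_weight s) (bracket_smoothing m) m \<and>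
            smoothing_const \<alpha> \<beta> (bracket_weight s) (bracket_smoothing m) m = \<infinity>) \<and>
         (CARD('d) = 3 \<longrightarrow>
            ennreal pi \<le> smoothing_const \<alpha> \<beta> (\<lambda>r. inverse (1 + r\<^sup>2)) (bracket_smoothing m) m \<and>
            smoothing_const \<alpha> \<beta> (\<lambda>r. inverse (1 + r\<^sup>2)) (bracket_smoothing m) m \<le> ennreal (2 * pi)) \<and>
         (CARD('d) \<ge> 5 \<longrightarrow>
            smoothing_const \<alpha> \<beta> (\<lambda>r. inverse (1 + r\<^sup>2)) (bracket_smoothing m) m \<le> ennreal pi)"
proof (intro conjI allI impI)
  note upper = smoothing_estimate_holds[OF refl assms(3) assms(1)]
  fix s :: real assume s: "2 \<le> s"
  have w: "bracket_weight s \<in> borel_measurable borel" "\<And>r. bracket_weight s r \<ge> 0"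
    unfolding bracket_weight_def[abs_def] by simp_all
  \<comment> \<open>For s \<ge> 2 the weight lies below the one for s = 2, so a single bound covers
    the whole range.\<close>
  have le: "bracket_weight s r \<le> inverse (1 + r\<^sup>2)" for r
  proof -
    have "(1 + r\<^sup>2) powr (- s / 2) \<le> (1 + r\<^sup>2) powr (- 1)" using s by (intro powr_mono) auto
    then show ?thesis by (simp add: bracket_weight_def powr_minus add_nonneg_pos)
  qed
  show est: "smoothing_estimate \<alpha> \<beta> (bracket_weight s) (bracket_smoothing m) m"
    by (rule upper(1)[OF w le])
  then show "smoothing_const \<alpha> \<beta> (bracket_weight s) (bracket_smoothing m) m < \<infinity>"
    by (rule smoothing_estimate_imp_const_finite)
next
  fix s :: real assume "s < 2"
  then show inf: "smoothing_const \<alpha> \<beta> (bracket_weight s) (bracket_smoothing m) m = \<infinity>"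
    by (rule smoothing_const_infinite[OF assms(3,4)])
  then show "\<not> smoothing_estimate \<alpha> \<beta> (bracket_weight s) (bracket_smoothing m) m"
    using smoothing_estimate_imp_const_finite[of \<alpha> \<beta> "bracket_weight s" "bracket_smoothing m" m] by auto
next
  show "ennreal pi \<le> smoothing_const \<alpha> \<beta> (\<lambda>r. inverse (1 + r\<^sup>2)) (bracket_smoothing m) m"
    by (rule smoothing_const_lower_bound[OF assms(3,4)])
next
  have w: "(\<lambda>r::real. inverse (1 + r\<^sup>2)) \<in> borel_measurable borel" by measurable
  note upper = smoothing_estimate_holds(2)[OF refl assms(3) assms(1) w]
  show "smoothing_const \<alpha> \<beta> (\<lambda>r. inverse (1 + r\<^sup>2)) (bracket_smoothing m) m \<le> ennreal (2 * pi)" if "CARD('d) = 3"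
    using upper that by simp
  show "smoothing_const \<alpha> \<beta> (\<lambda>r. inverse (1 + r\<^sup>2)) (bracket_smoothing m) m \<le> ennreal pi" if "CARD('d) \<ge> 5"
    using upper that by simp
qed

end
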